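(* Let $M=S^3/I^*$ be the Poincaré dodecahedral space with its spherical metric $g_0$ and $E=E_{168}(g_0)$. There exist arbitrarily small nonzero parameters $(\varepsilon_2,\varepsilon_3,\varepsilon_5)\in\mathbb R^3$ such that the function \[ \Psi_{\varepsilon_2,\varepsilon_3,\varepsilon_5}=F_0+\varepsilon_2\operatorname{Re}(F_4)+\varepsilon_3\operatorname{Re}(F_3)+\varepsilon_5\operatorname{Re}(F_1) \] is Morse with exactly six critical points on $M$. Equivalently, its projective line $[\Psi_{\varepsilon_2,\varepsilon_3,\varepsilon_5}]$ is a minimal-Morse line in $E$, and such lines may be chosen arbitrarily close to the seed line $[F_0]\in\mathbb P(E)$.
   Context: Let $I_{12}(x,y)=x^{11}y+11x^6y^6-xy^{11}$ and let $I^*\subset SU(2)$ be the binary icosahedral group (order $120$) fixing $I_{12}$, acting linearly on the unit sphere $S^3\subset\mathbb C^2$; $M=S^3/I^*$ carries the induced metric $g_0$ of constant curvature $1$. $E=E_{168}(g_0)$ is the real eigenspace of the nonnegative Laplacian of $g_0$ for its first positive eigenvalue $168$; $\dim E=13$; $E_{\mathbb C}=E\otimes_{\mathbb R}\mathbb C$. For $z=(\alpha,\beta)\in S^3$ write \[ I_{12}(\alpha x-\overline\beta y,\ \beta x+\overline\alpha y)=\sum_{j=0}^{12}A_j(z)\,x^{12-j}y^j . \] Each $A_j$ is $I^*$-invariant and descends to a smooth complex-valued function on $M$ belonging to $E_{\mathbb C}$. Set $F_1=A_1$, $F_3=A_3$, $F_4=A_4$; their real parts belong to $E$. The Hopf map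 $\mathfrak h:S^3\to S^2$, $\mathfrak h(\alpha,\beta)=(2\operatorname{Re}(\alpha\overline\beta),2\operatorname{Im}(\alpha\overline\beta),|\alpha|^2-|\beta|^2)$, is equivariant for $SU(2)\to SO(3)$; let $A_5\subset SO(3)$ be the image of $I^*$. There is a unique line of $A_5$-invariant spherical harmonics of degree $6$ on $S^2$; let $Y$ be a nonzero real generator. The seed $F_0\in E$ is the function on $M$ whose lift to $S^3$ is $Y\circ\mathfrak h$. A Morse function on $M$ is minimal if its number of critical points is the least possible among Morse functions on $M$ (for this $M$: exactly six critical points). A minimal-Morse line in $E$ is a line spanned by a minimal Morse function. *)

theory Defs
  imports "HOL-Analysis.Analysis" "HOL-Computational_Algebra.Polynomial"
begin

section \<open>Calculus on Euclidean spaces\<close>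

primrec Ck_on :: "nat \<Rightarrow> 'a::euclidean_space set \<Rightarrow> ('a \<Rightarrow> real) \<Rightarrow> bool" where
  "Ck_on 0 S f \<longleftrightarrow> continuous_on S f"
| "Ck_on (Suc k) S f \<longleftrightarrow> (\<forall>x\<in>S. f differentiable at x) \<and>
     (\<forall>v. Ck_on k S (\<lambda>x. frechet_derivative f (at x) v))"

text \<open>Only used for open sets.\<close>
definition smooth_on :: "'a::euclidean_space set \<Rightarrow> ('a \<Rightarrow> real) \<Rightarrow> bool" where
  "smooth_on S f \<longleftrightarrow> (\<forall>k. Ck_on k S f)"

definition second_deriv :: "('a::euclidean_space \<Rightarrow> real) \<Rightarrow> 'a \<Rightarrow> 'a \<Rightarrow> 'a \<Rightarrow> real" where
  "second_deriv f x v w =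
     frechet_derivative (\<lambda>y. frechet_derivative f (at y) w) (at x) v"

definition laplacian :: "('a::euclidean_space \<Rightarrow> real) \<Rightarrow> 'a \<Rightarrow> real" where
  "laplacian f x = (\<Sum>b\<in>Basis. second_deriv f x b b)"

definition spherical_harmonic :: "nat \<Rightarrow> ('a::euclidean_space \<Rightarrow> real) \<Rightarrow> bool" where
  "spherical_harmonic k Y \<longleftrightarrow>
     (\<exists>P. real_polynomial_function P \<and> (\<forall>c x. P (c *\<^sub>R x) = c ^ k * P x) \<and>
          (\<forall>x. laplacian P x = 0) \<and> (\<forall>x\<in>sphere 0 1. Y x = P x))"


section \<open>The binary icosahedral group and the quotient $M$\<close>

definition I12 :: "'a::comm_ring_1 \<Rightarrow> 'a \<Rightarrow> 'a" where
  "I12 x y = x ^ 11 * y + 11 * x ^ 6 * y ^ 6 - x * y ^ 11"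

definition conj_transpose :: "complex^'n^'m \<Rightarrow> complex^'m^'n" where
  "conj_transpose A = (\<chi> i j. cnj (A $ j $ i))"

definition SU2 :: "(complex^2^2) set" where
  "SU2 = {A. A ** conj_transpose A = mat 1 \<and> det A = 1}"

definition I_star :: "(complex^2^2) set" where
  "I_star = {A \<in> SU2. \<forall>w. I12 ((A *v w) $ 1) ((A *v w) $ 2) = I12 (w $ 1) (w $ 2)}"

abbreviation S3 :: "(complex^2) set" where
  "S3 \<equiv> sphere 0 1"

definition orbit :: "complex^2 \<Rightarrow> (complex^2) set" where
  "orbit z = (\<lambda>A. A *v z) ` I_star"

typedef dodec = "orbit ` S3"
  morphisms fibre Abs_dodec
  by (auto intro!: exI[of _ "axis 1 1"] simp: norm_axis_1)

definition proj :: "complex^2 \<Rightarrow> dodec" where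
  "proj z = Abs_dodec (orbit z)"

text \<open>The function on \<open>M\<close> whose lift to \<open>S3\<close> is \<open>u\<close>; meaningful if \<open>u\<close> is constant
  on \<open>I_star\<close>-orbits, see \<open>descend_proj\<close> below.\<close>
definition descend :: "(complex^2 \<Rightarrow> 'b) \<Rightarrow> dodec \<Rightarrow> 'b" where
  "descend u p = the_elem (u ` fibre p)"


section \<open>Differential geometry of $M$\<close>

text \<open>The projection \<open>S3 \<rightarrow> M\<close> is a smooth covering and a local isometry, so the notions
  below are read off from the lift \<open>u\<close> of \<open>f\<close>. The lift is extended to \<open>U x = u (x / |x|)\<close>
  on the punctured space. Let \<open>|z| = 1\<close>. As \<open>DU(z) z = 0\<close>, differentiating \<open>U\<close> along the
  unit speed geodesic \<open>c t = cos t z + sin t v\<close> gives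
  \<open>(u \<circ> c)' 0 = DU(z) v\<close> and \<open>(u \<circ> c)'' 0 = D2U(z)(v, v) + DU(z)(- z) = D2U(z)(v, v)\<close>:
  on tangent vectors, \<open>DU(z)\<close> and \<open>D2U(z)\<close> are the differential and the Riemannian Hessian
  of \<open>u\<close>. Since \<open>D2U(z)(z, z) = 0\<close>, the trace of this Hessian is the Euclidean Laplacian
  of \<open>U\<close> at \<open>z\<close>.\<close>
definition radial_lift :: "(dodec \<Rightarrow> real) \<Rightarrow> complex^2 \<Rightarrow> real" where
  "radial_lift f x = f (proj (x /\<^sub>R norm x))"

definition smooth_M :: "(dodec \<Rightarrow> real) \<Rightarrow> bool" where
  "smooth_M f \<longleftrightarrow> smooth_on (- {0}) (radial_lift f)"

definition tangent :: "complex^2 \<Rightarrow> (complex^2) set" where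
  "tangent z = {v. v \<bullet> z = 0}"

definition critical_points :: "(dodec \<Rightarrow> real) \<Rightarrow> dodec set" where
  "critical_points f =
     {p. \<forall>z\<in>fibre p. \<forall>v\<in>tangent z. frechet_derivative (radial_lift f) (at z) v = 0}"

definition nondegenerate_at :: "(dodec \<Rightarrow> real) \<Rightarrow> dodec \<Rightarrow> bool" where
  "nondegenerate_at f p \<longleftrightarrow>
     (\<forall>z\<in>fibre p. \<forall>v\<in>tangent z.
        (\<forall>w\<in>tangent z. second_deriv (radial_lift f) z v w = 0) \<longrightarrow> v = 0)"

definition morse :: "(dodec \<Rightarrow> real) \<Rightarrow> bool" where
  "morse f \<longleftrightarrow> smooth_M f \<and> (\<forall>p\<in>critical_points f. nondegenerate_at f p)"

text \<open>The finiteness clauses only guard against \<open>card\<close> being \<open>0\<close> on infinite sets.\<close>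
definition minimal_morse :: "(dodec \<Rightarrow> real) \<Rightarrow> bool" where
  "minimal_morse f \<longleftrightarrow> morse f \<and> finite (critical_points f) \<and>
     (\<forall>g. morse g \<and> finite (critical_points g) \<longrightarrow>
        card (critical_points f) \<le> card (critical_points g))"

text \<open>The sign makes the Laplacian of \<open>M\<close> nonnegative.\<close>
definition eigenspace :: "real \<Rightarrow> (dodec \<Rightarrow> real) set" where
  "eigenspace l =
     {f. smooth_M f \<and> (\<forall>z\<in>S3. - laplacian (radial_lift f) z = l * f (proj z))}"

abbreviation E168 :: "(dodec \<Rightarrow> real) set" where
  "E168 \<equiv> eigenspace 168"


section \<open>The projective space of $E$\<close>

definition line :: "(dodec \<Rightarrow> real) \<Rightarrow> (dodec \<Rightarrow> real) set" where
  "line f = range (\<lambda>c p. c * f p)"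

definition nonzero_E :: "(dodec \<Rightarrow> real) set" where
  "nonzero_E = E168 - {\<lambda>p. 0}"

text \<open>Quotient topology; see \<open>quotient_map_line\<close> below. As \<open>E168\<close> is
  finite-dimensional, the library topology on functions (pointwise convergence)
  restricts to its unique Hausdorff vector space topology.\<close>
definition proj_E :: "(dodec \<Rightarrow> real) set topology" where
  "proj_E = topology (\<lambda>U. U \<subseteq> line ` nonzero_E \<and>
     openin (top_of_set nonzero_E) {f \<in> nonzero_E. line f \<in> U})"

definition minimal_morse_line :: "(dodec \<Rightarrow> real) set \<Rightarrow> bool" where
  "minimal_morse_line L \<longleftrightarrow> (\<exists>f\<in>E168. minimal_morse f \<and> L = line f)"


section \<open>The functions $F_j$, the seed and the family\<close>

text \<open>The coefficients are read off after setting \<open>x = 1\<close>; the polynomial variable is \<open>y\<close>.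
  See \<open>A_fun_expansion\<close> below.\<close>
definition A_fun :: "nat \<Rightarrow> complex^2 \<Rightarrow> complex" where
  "A_fun j z = coeff (I12 [: z $ 1, - cnj (z $ 2) :] [: z $ 2, cnj (z $ 1) :]) j"

definition F_fun :: "nat \<Rightarrow> dodec \<Rightarrow> complex" where
  "F_fun j = descend (A_fun j)"

definition hopf :: "complex^2 \<Rightarrow> real^3" where
  "hopf z = vector [2 * Re (z $ 1 * cnj (z $ 2)), 2 * Im (z $ 1 * cnj (z $ 2)),
                    (cmod (z $ 1))\<^sup>2 - (cmod (z $ 2))\<^sup>2]"

text \<open>The image of \<open>I_star\<close> under the homomorphism from \<open>SU(2)\<close> to \<open>SO(3)\<close> for which
  \<open>hopf\<close> is equivariant.\<close>
definition A5 :: "(real^3^3) set" where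
  "A5 = {R. rotation_matrix R \<and> (\<exists>B\<in>I_star. \<forall>z\<in>S3. hopf (B *v z) = R *v hopf z)}"

definition seed :: "(real^3 \<Rightarrow> real) \<Rightarrow> dodec \<Rightarrow> real" where
  "seed Y = descend (Y \<circ> hopf)"

definition Psi :: "(real^3 \<Rightarrow> real) \<Rightarrow> real \<Rightarrow> real \<Rightarrow> real \<Rightarrow> dodec \<Rightarrow> real" where
  "Psi Y e2 e3 e5 p = seed Y p + e2 * Re (F_fun 4 p) + e3 * Re (F_fun 3 p) + e5 * Re (F_fun 1 p)"


section \<open>Well-definedness\<close>

lemma SU2_entries:
  assumes "B \<in> SU2"
  shows "B $ 2 $ 2 = cnj (B $ 1 $ 1)" "B $ 1 $ 2 = - cnj (B $ 2 $ 1)"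
    "B $ 1 $ 1 * cnj (B $ 1 $ 1) + B $ 2 $ 1 * cnj (B $ 2 $ 1) = 1"
proof -
  define a b c d where "a = B $ 1 $ 1" and "b = B $ 1 $ 2" and "c = B $ 2 $ 1" and "d = B $ 2 $ 2"
  have *: "B ** conj_transpose B = mat 1" and D: "det B = 1"
    using assms by (auto simp: SU2_def)
  have d: "a * d - b * c = 1"
    using D by (simp add: det_2 a_def b_def c_def d_def)
  have e: "(B ** conj_transpose B) $ i $ j = (if i = j then 1 else 0)" for i j
    unfolding * by (simp add: mat_def)
  have e11: "a * cnj a + b * cnj b = 1"
    using e[of 1 1] by (simp add: matrix_matrix_mult_def sum_2 conj_transpose_def a_def b_def)
  have e12: "a * cnj c + b * cnj d = 0"
    using e[of 1 2] by (simp add: matrix_matrix_mult_def sum_2 conj_transpose_def a_def b_def c_def d_def)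
  have e22: "c * cnj c + d * cnj d = 1"
    using e[of 2 2] by (simp add: matrix_matrix_mult_def sum_2 conj_transpose_def c_def d_def)
  have e21: "c * cnj a + d * cnj b = 0"
    using arg_cong[OF e12, of cnj] by (simp add: mult.commute)
  have 1: "d = cnj a" using d e11 e21 by algebra
  have 2: "c = - cnj b" using d e11 e21 by algebra
  show "B $ 2 $ 2 = cnj (B $ 1 $ 1)" using 1 by (simp add: a_def d_def)
  show "B $ 1 $ 2 = - cnj (B $ 2 $ 1)" using 2 by (simp add: b_def c_def)
  show "B $ 1 $ 1 * cnj (B $ 1 $ 1) + B $ 2 $ 1 * cnj (B $ 2 $ 1) = 1"
    using e11 2 by (simp add: a_def b_def c_def mult.commute)
qed

lemma SU2_mult: "B \<in> SU2 \<Longrightarrow> C \<in> SU2 \<Longrightarrow> B ** C \<in> SU2"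
proof -
  assume B: "B \<in> SU2" and C: "C \<in> SU2"
  have "conj_transpose (B ** C) = conj_transpose C ** conj_transpose B"
    by (simp add: conj_transpose_def matrix_matrix_mult_def vec_eq_iff sum_2 mult.commute)
  then have "(B ** C) ** conj_transpose (B ** C) =
      B ** (C ** conj_transpose C) ** conj_transpose B"
    by (simp add: matrix_mul_assoc)
  then show ?thesis
    using B C by (simp add: SU2_def det_mul)
qed

lemma SU2_adj:
  assumes "B \<in> SU2"
  shows "conj_transpose B \<in> SU2" "conj_transpose B ** B = mat 1"
proof -
  show *: "conj_transpose B ** B = mat 1"
    using assms by (simp add: SU2_def matrix_left_right_inverse)
  have "conj_transpose (conj_transpose B) = B"
    by (simp add: conj_transpose_def vec_eq_iff)
  moreover have "det (conj_transpose B) = cnj (det B)"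
    by (simp add: det_2 conj_transpose_def mult.commute)
  ultimately show "conj_transpose B \<in> SU2"
    using assms * by (simp add: SU2_def)
qed

lemma I_star_one: "mat 1 \<in> I_star"
proof -
  have "conj_transpose (mat 1 :: complex^2^2) = mat 1"
    by (simp add: conj_transpose_def vec_eq_iff mat_def)
  then show ?thesis
    by (simp add: I_star_def SU2_def)
qed

lemma I_star_mult: "B \<in> I_star \<Longrightarrow> C \<in> I_star \<Longrightarrow> B ** C \<in> I_star"
  unfolding I_star_def by (simp add: SU2_mult matrix_vector_mul_assoc [symmetric])

lemma I_star_adj: "B \<in> I_star \<Longrightarrow> conj_transpose B \<in> I_star"
proof -
  assume B: "B \<in> I_star"
  then have S: "B \<in> SU2" by (simp add: I_star_def)
  have "I12 ((conj_transpose B *v w) $ 1) ((conj_transpose B *v w) $ 2) = I12 (w $ 1) (w $ 2)" for w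
  proof -
    have "B *v (conj_transpose B *v w) = w"
      using S by (simp add: matrix_vector_mul_assoc SU2_def)
    then show ?thesis
      using B unfolding I_star_def by (metis (mono_tags, lifting) mem_Collect_eq)
  qed
  then show ?thesis using S by (simp add: I_star_def SU2_adj)
qed

lemma I_star_sphere:
  assumes "B \<in> I_star" "z \<in> S3"
  shows "B *v z \<in> S3"
proof -
  have "B \<in> SU2" using assms by (simp add: I_star_def)
  note e = SU2_entries[OF this]
  obtain a c where a: "B $ 1 $ 1 = a" and c: "B $ 2 $ 1 = c" by auto
  have n: "complex_of_real ((norm w)\<^sup>2) = w $ 1 * cnj (w $ 1) + w $ 2 * cnj (w $ 2)" for w :: "complex^2"
    by (simp add: norm_vec_def L2_set_def sum_2 complex_norm_square[symmetric])
  have "complex_of_real ((norm (B *v z))\<^sup>2) = (a * cnj a + c * cnj c) * complex_of_real ((norm z)\<^sup>2)"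
    unfolding n by (simp add: matrix_vector_mult_def sum_2 e(1,2) a c) algebra
  also have "\<dots> = 1"
    using e(3) assms(2) by (simp add: a c)
  finally have "(norm (B *v z))\<^sup>2 = 1" using of_real_eq_1_iff by blast
  then show ?thesis by (simp add: power2_eq_1_iff) (smt (verit) norm_ge_zero)
qed

lemma orbit_eq:
  assumes "B \<in> I_star"
  shows "orbit (B *v z) = orbit z"
proof -
  have 1: "orbit (C *v w) \<subseteq> orbit w" if "C \<in> I_star" for C w
    using that by (auto simp: orbit_def matrix_vector_mul_assoc intro!: imageI I_star_mult)
  have "conj_transpose B *v (B *v z) = z"
    using assms by (simp add: matrix_vector_mul_assoc SU2_adj I_star_def)
  with 1[OF I_star_adj[OF assms], of "B *v z"] 1[OF assms, of z] show ?thesis by auto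
qed

lemma fibre_proj: "z \<in> S3 \<Longrightarrow> fibre (proj z) = orbit z"
  unfolding proj_def by (rule Abs_dodec_inverse) blast

lemma proj_surj: "proj ` S3 = UNIV"
proof -
  have "p \<in> proj ` S3" for p
    by (cases p) (auto simp: proj_def)
  then show ?thesis by auto
qed

lemma proj_eq_iff:
  assumes "z \<in> S3" "w \<in> S3"
  shows "proj z = proj w \<longleftrightarrow> (\<exists>B\<in>I_star. z = B *v w)"
proof
  assume "proj z = proj w"
  then have "orbit z = orbit w" using assms fibre_proj by metis
  moreover have "z \<in> orbit z" using I_star_one by (force simp: orbit_def)
  ultimately show "\<exists>B\<in>I_star. z = B *v w" by (auto simp: orbit_def)
next
  assume "\<exists>B\<in>I_star. z = B *v w"
  then show "proj z = proj w" by (auto simp: proj_def orbit_eq)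
qed

lemma descend_proj:
  assumes "\<And>B w. B \<in> I_star \<Longrightarrow> w \<in> S3 \<Longrightarrow> u (B *v w) = u w" and z: "z \<in> S3"
  shows "descend u (proj z) = u z"
proof -
  have "u ` orbit z = {u z}"
    using assms I_star_one by (auto simp: orbit_def image_image)
  then show ?thesis unfolding descend_def fibre_proj[OF z] by simp
qed

lemma degree_I12_le:
  fixes p q :: "complex poly"
  assumes "degree p \<le> 1" "degree q \<le> 1"
  shows "degree (I12 p q) \<le> 12"
proof -
  have *: "degree (p ^ m * q ^ n) \<le> m + n" for m n
  proof -
    have "degree (p ^ m * q ^ n) \<le> degree (p ^ m) + degree (q ^ n)" by (rule degree_mult_le)
    also have "degree (p ^ m) \<le> degree p * m" by (rule degree_power_le)
    also have "degree (q ^ n) \<le> degree q * n" by (rule degree_power_le)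
    also have "degree p * m + degree q * n \<le> 1 * m + 1 * n"
      using assms by (intro add_mono mult_right_mono) auto
    finally show ?thesis by simp
  qed
  have "11 * p ^ 6 * q ^ 6 = smult 11 (p ^ 6 * q ^ 6)"
    by (simp add: numeral_poly)
  then have "degree (11 * p ^ 6 * q ^ 6) \<le> 12"
    using *[of 6 6] by simp
  then show ?thesis
    unfolding I12_def using *[of 11 1] *[of 1 11]
    by (intro degree_diff_le degree_add_le) auto
qed

lemma poly_I12: "poly (I12 p q) t = I12 (poly p t) (poly q t)"
  for p q :: "complex poly"
  by (simp add: I12_def)

lemma I12_scale: "I12 (c * x) (c * y) = c ^ 12 * I12 x y" for c :: complex
  unfolding I12_def by algebra

lemma A_fun_expansion:
  "I12 (z $ 1 * x - cnj (z $ 2) * y) (z $ 2 * x + cnj (z $ 1) * y) =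
     (\<Sum>j\<le>12. A_fun j z * x ^ (12 - j) * y ^ j)"
proof -
  define p where "p = [: z $ 1, - cnj (z $ 2) :]"
  define q where "q = [: z $ 2, cnj (z $ 1) :]"
  have deg: "degree (I12 p q) \<le> 12"
    by (rule degree_I12_le) (simp_all add: p_def q_def)
  have e: "I12 (poly p t) (poly q t) = (\<Sum>j\<le>12. A_fun j z * t ^ j)" for t
  proof -
    have "poly (I12 p q) t = poly (\<Sum>j\<le>12. monom (coeff (I12 p q) j) j) t"
      by (simp only: poly_as_sum_of_monoms'[OF deg])
    then show ?thesis
      by (simp add: poly_I12 poly_sum poly_monom A_fun_def p_def q_def)
  qed
  have nz: "I12 (z $ 1 * x - cnj (z $ 2) * y) (z $ 2 * x + cnj (z $ 1) * y) =
     (\<Sum>j\<le>12. A_fun j z * x ^ (12 - j) * y ^ j)" if "x \<noteq> 0" for x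
  proof -
    have "I12 (z $ 1 * x - cnj (z $ 2) * y) (z $ 2 * x + cnj (z $ 1) * y) =
        I12 (x * poly p (y / x)) (x * poly q (y / x))"
      using that by (simp add: p_def q_def algebra_simps)
    also have "\<dots> = (\<Sum>j\<le>12. x ^ 12 * (A_fun j z * (y / x) ^ j))"
      unfolding I12_scale e sum_distrib_left ..
    also have "\<dots> = (\<Sum>j\<le>12. A_fun j z * x ^ (12 - j) * y ^ j)"
      using that by (intro sum.cong) (auto simp: power_divide power_diff)
    finally show ?thesis .
  qed
  define D where "D = I12 [: - cnj (z $ 2) * y, z $ 1 :] [: cnj (z $ 1) * y, z $ 2 :] -
    (\<Sum>j\<le>12. monom (A_fun j z * y ^ j) (12 - j))"
  have D: "poly D t = I12 (z $ 1 * t - cnj (z $ 2) * y) (z $ 2 * t + cnj (z $ 1) * y) -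
     (\<Sum>j\<le>12. A_fun j z * t ^ (12 - j) * y ^ j)" for t
    by (simp add: D_def poly_I12 poly_sum poly_monom algebra_simps)
  have "D = 0"
  proof (rule ccontr)
    assume "D \<noteq> 0"
    then have "finite {t. poly D t = 0}" by (rule poly_roots_finite)
    moreover have "- {0} \<subseteq> {t. poly D t = 0}" using nz by (auto simp: D)
    ultimately have "finite (- {0 :: complex})" by (rule rev_finite_subset)
    then show False by (simp add: infinite_UNIV_char_0)
  qed
  then show ?thesis using D[of x] by simp
qed

lemma A_fun_invariant:
  assumes "B \<in> I_star"
  shows "A_fun j (B *v z) = A_fun j z"
proof -
  have "B \<in> SU2" using assms by (simp add: I_star_def)
  note e = SU2_entries(1,2)[OF this]
  define p where "p = [: z $ 1, - cnj (z $ 2) :]"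
  define q where "q = [: z $ 2, cnj (z $ 1) :]"
  define p' where "p' = [: (B *v z) $ 1, - cnj ((B *v z) $ 2) :]"
  define q' where "q' = [: (B *v z) $ 2, cnj ((B *v z) $ 1) :]"
  have "poly (I12 p' q') t = poly (I12 p q) t" for t
  proof -
    define w :: "complex^2" where "w = vector [poly p t, poly q t]"
    have "poly p' t = (B *v w) $ 1" "poly q' t = (B *v w) $ 2"
      by (simp_all add: p'_def q'_def p_def q_def w_def e
          matrix_vector_mult_def sum_2 algebra_simps)
    then have "poly (I12 p' q') t = I12 (w $ 1) (w $ 2)"
      using assms by (simp add: poly_I12 I_star_def)
    then show ?thesis by (simp add: poly_I12 w_def)
  qed
  then have "I12 p' q' = I12 p q" using poly_eq_poly_eq_iff by blast
  then show ?thesis by (simp add: A_fun_def p_def q_def p'_def q'_def)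
qed

lemma F_fun_proj: "z \<in> S3 \<Longrightarrow> F_fun j (proj z) = A_fun j z"
  unfolding F_fun_def by (rule descend_proj) (auto simp: A_fun_invariant)

lemma hopf_equivariant:
  assumes "B \<in> SU2"
  obtains R where "rotation_matrix R" "\<And>z. hopf (B *v z) = R *v hopf z"
proof -
  note e = SU2_entries[OF assms]
  define p q r s where "p = Re (B $ 1 $ 1)" and "q = Im (B $ 1 $ 1)"
    and "r = Re (B $ 2 $ 1)" and "s = Im (B $ 2 $ 1)"
  have a: "B $ 1 $ 1 = Complex p q" and b: "B $ 2 $ 1 = Complex r s"
    by (simp_all add: p_def q_def r_def s_def)
  have n: "p\<^sup>2 + q\<^sup>2 + r\<^sup>2 + s\<^sup>2 = 1"
    using arg_cong[OF e(3), of Re] by (simp add: a b power2_eq_square)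
  define R :: "real^3^3" where "R = vector [
     vector [p\<^sup>2 - q\<^sup>2 - r\<^sup>2 + s\<^sup>2, - 2 * p * q + 2 * r * s, 2 * p * r + 2 * q * s],
     vector [2 * p * q + 2 * r * s, p\<^sup>2 - q\<^sup>2 + r\<^sup>2 - s\<^sup>2, 2 * q * r - 2 * p * s],
     vector [- 2 * p * r + 2 * q * s, 2 * p * s + 2 * q * r, p\<^sup>2 + q\<^sup>2 - r\<^sup>2 - s\<^sup>2]]"
  have R: "R $ 1 $ 1 = p\<^sup>2 - q\<^sup>2 - r\<^sup>2 + s\<^sup>2" "R $ 1 $ 2 = - 2 * p * q + 2 * r * s"
    "R $ 1 $ 3 = 2 * p * r + 2 * q * s" "R $ 2 $ 1 = 2 * p * q + 2 * r * s"
    "R $ 2 $ 2 = p\<^sup>2 - q\<^sup>2 + r\<^sup>2 - s\<^sup>2" "R $ 2 $ 3 = 2 * q * r - 2 * p * s"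
    "R $ 3 $ 1 = - 2 * p * r + 2 * q * s" "R $ 3 $ 2 = 2 * p * s + 2 * q * r"
    "R $ 3 $ 3 = p\<^sup>2 + q\<^sup>2 - r\<^sup>2 - s\<^sup>2"
    by (simp_all add: R_def)
  have "(transpose R ** R) $ i $ j = (if i = j then (p\<^sup>2 + q\<^sup>2 + r\<^sup>2 + s\<^sup>2)\<^sup>2 else 0)" for i j
    using exhaust_3[of i] exhaust_3[of j]
    by (elim disjE; hypsubst; simp add: matrix_matrix_mult_def sum_3 transpose_def R;
        simp add: power2_eq_square algebra_simps)
  then have "transpose R ** R = mat 1"
    by (simp add: vec_eq_iff mat_def n)
  moreover have "det R = (p\<^sup>2 + q\<^sup>2 + r\<^sup>2 + s\<^sup>2) ^ 3"
    unfolding det_3 R by (simp add: power2_eq_square power3_eq_cube algebra_simps)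
  ultimately have "rotation_matrix R"
    using n by (simp add: rotation_matrix_def orthogonal_matrix)
  moreover have "hopf (B *v z) = R *v hopf z" for z
  proof -
    obtain t u v w where z: "z $ 1 = Complex t u" "z $ 2 = Complex v w"
      by (meson complex.exhaust)
    show ?thesis
      unfolding vec_eq_iff forall_3 hopf_def matrix_vector_mult_def
      by (simp add: sum_3 sum_2 R e(1,2) a b z cmod_power2)
         (simp add: power2_eq_square algebra_simps)
  qed
  ultimately show ?thesis using that by blast
qed

lemma hopf_sphere:
  assumes "z \<in> S3"
  shows "hopf z \<in> sphere 0 1"
proof -
  obtain a b c d where z: "z $ 1 = Complex a b" "z $ 2 = Complex c d"
    by (meson complex.exhaust)
  have "(norm z)\<^sup>2 = a\<^sup>2 + b\<^sup>2 + c\<^sup>2 + d\<^sup>2"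
    by (simp add: norm_vec_def L2_set_def sum_2 z cmod_power2)
  then have n: "a\<^sup>2 + b\<^sup>2 + c\<^sup>2 + d\<^sup>2 = 1" using assms by simp
  have "(norm (hopf z))\<^sup>2 = (a\<^sup>2 + b\<^sup>2 + c\<^sup>2 + d\<^sup>2)\<^sup>2"
    by (simp add: norm_vec_def L2_set_def sum_3 hopf_def z cmod_power2) algebra
  then have "norm (hopf z) = 1"
    unfolding n by (simp add: power2_eq_1_iff) (smt (verit) norm_ge_zero)
  then show ?thesis by simp
qed

lemma seed_proj:
  assumes "\<forall>R\<in>A5. \<forall>x\<in>sphere 0 1. Y (R *v x) = Y x" and "z \<in> S3"
  shows "seed Y (proj z) = Y (hopf z)"
proof -
  have "Y (hopf (B *v w)) = Y (hopf w)" if B: "B \<in> I_star" and w: "w \<in> S3" for B w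
  proof -
    have "B \<in> SU2" using B by (simp add: I_star_def)
    then obtain R where R: "rotation_matrix R" "\<And>z. hopf (B *v z) = R *v hopf z"
      by (rule hopf_equivariant) blast
    then have "R \<in> A5" using B by (auto simp: A5_def)
    then show ?thesis using assms(1) hopf_sphere[OF w] by (simp add: R(2))
  qed
  then show ?thesis
    unfolding seed_def using descend_proj[of "Y \<circ> hopf" z] assms(2) by simp
qed

lemma quotient_map_line: "quotient_map (top_of_set nonzero_E) proj_E line"
proof -
  have "istopology (\<lambda>U. U \<subseteq> line ` nonzero_E \<and>
     openin (top_of_set nonzero_E) {f \<in> nonzero_E. line f \<in> U})" (is "istopology ?T")
    unfolding istopology_def
  proof (intro conjI allI impI)
    fix U V assume U: "?T U" and V: "?T V"
    show "U \<inter> V \<subseteq> line ` nonzero_E" using U by blast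
    have "openin (top_of_set nonzero_E)
        ({f \<in> nonzero_E. line f \<in> U} \<inter> {f \<in> nonzero_E. line f \<in> V})"
      using U V by (blast intro: openin_Int)
    moreover have "{f \<in> nonzero_E. line f \<in> U} \<inter> {f \<in> nonzero_E. line f \<in> V} =
        {f \<in> nonzero_E. line f \<in> U \<inter> V}" by blast
    ultimately show "openin (top_of_set nonzero_E) {f \<in> nonzero_E. line f \<in> U \<inter> V}"
      by (simp only:)
  next
    fix K assume K: "\<forall>U\<in>K. ?T U"
    show "\<Union>K \<subseteq> line ` nonzero_E" using K by blast
    have "openin (top_of_set nonzero_E)
        (\<Union> ((\<lambda>U. {f \<in> nonzero_E. line f \<in> U}) ` K))"
      using K by (intro openin_Union) blast
    moreover have "\<Union> ((\<lambda>U. {f \<in> nonzero_E. line f \<in> U}) ` K) =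
        {f \<in> nonzero_E. line f \<in> \<Union>K}" by blast
    ultimately show "openin (top_of_set nonzero_E) {f \<in> nonzero_E. line f \<in> \<Union>K}"
      by (simp only:)
  qed
  then have "openin proj_E = ?T"
    unfolding proj_E_def by (rule topology_inverse')
  then have o: "openin proj_E U \<longleftrightarrow> ?T U" for U by (rule fun_cong)
  have "openin (top_of_set nonzero_E) {f \<in> nonzero_E. line f \<in> line ` nonzero_E}"
    by (rule openin_subopen[THEN iffD2]) (use openin_subtopology_self in blast)
  then have t: "topspace proj_E = line ` nonzero_E"
    using o unfolding topspace_def by blast
  show ?thesis
    unfolding quotient_map_def t topspace_euclidean_subtopology using o by blast
qed

end

theory Submission
  imports Defs
begin

text \<open>
  Write \<open>A_j\<close> for \<open>A_fun j\<close>. Six is a lower bound because of the fundamental group. Lift a Morse function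
  to the 3-sphere and let the sublevel sets grow. If all saddles of index 1 formed at most one orbit
  of \<open>I_star\<close>, then components would be merged by one element of the group only, and connectedness of the
  sphere would force that element to generate the group; but the group is not cyclic. So there
  are two saddles of index 1 and, passing to the negative function, two of index 2, besides a minimum
  and a maximum. No flow is used, only the shape of sublevel sets near nondegenerate points.

  The seed is a multiple of \<open>A_6\<close>, whose critical set is \<open>A_5 = 0\<close>: the 62 Hopf fibres
  over the vertices, edge midpoints and face centres of the icosahedron. For \<open>e2 = e3 = e5 = t\<close> the
  derivative along the fibres is \<open>t\<close> times a function which is nonconstant on these circles because
  \<open>A_1\<close>, \<open>A_4\<close> and \<open>A_3\<close>, respectively, do not vanish there. Its zeros on the critical
  circles form six orbits, all nondegenerate, and the inverse function theorem together with
  compactness bounds the number of critical points by six for small \<open>t > 0\<close>.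
\<close>

section \<open>Merging of components of sublevel sets\<close>

text \<open>Homology is of no use for the lower bound: \<open>I_star\<close> is perfect,
  \<open>M\<close> is a homology sphere, and the Morse inequalities yield two critical points only.
  The bound has to see that one element does not generate the fundamental group; the 3-sphere enters
  as the connected cover on which this group acts freely, permuting the components of sublevel sets.
  The two pairs of saddles differ because tangent spaces have dimension three: index 1 for a
  function is index 2 for its negative.

  For the upper bound, the obstacle is that the seed is constant on Hopf fibres. The elements of the
  group that preserve a critical fibre rotate it by the \<open>n\<close>-th roots of unity,
  \<open>n\<close> being 10, 4 or 6 for vertices, edges and faces, and the critical fibres of each
  kind form one circle in \<open>M\<close>. On a fibre \<open>A_j\<close> is a constant times the
  power \<open>12 - 2 j\<close> of the phase. The term with \<open>12 - 2 j = n\<close> survives,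
  which explains the choice \<open>j\<close> = 1, 4, 3, and its real part has one maximum and one
  minimum on the quotient circle: three times two critical points. As \<open>Y\<close> is an
  arbitrary invariant harmonic, its proportionality to \<open>A_6\<close> has to be proved as
  well.\<close>

definition sublevel :: "'a set \<Rightarrow> ('a \<Rightarrow> real) \<Rightarrow> real \<Rightarrow> 'a set" where
  "sublevel S G c = {x\<in>S. G x < c}"

text \<open>A point is tame if locally the lower sublevel lies in one component of the open sublevel,
  so that passing its level merges no two components; a saddle of index 1 is only bitame.\<close>
definition tame :: "'a::topological_space set \<Rightarrow> ('a \<Rightarrow> real) \<Rightarrow> 'a \<Rightarrow> bool" where
  "tame S G q \<longleftrightarrow> (\<exists>N K. open N \<and> q \<in> N \<and> connected K \<and>
     N \<inter> sublevel S G (G q) \<subseteq> K \<and> K \<subseteq> sublevel S G (G q))"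

definition bitame :: "'a::topological_space set \<Rightarrow> ('a \<Rightarrow> real) \<Rightarrow> 'a \<Rightarrow> bool" where
  "bitame S G q \<longleftrightarrow> (\<exists>N K L. open N \<and> q \<in> N \<and> connected K \<and> connected L \<and>
     N \<inter> sublevel S G (G q) \<subseteq> K \<union> L \<and> K \<union> L \<subseteq> sublevel S G (G q))"

text \<open>Minima need not be strict. Their finiteness, assumed below, makes each of them isolated
  among the points that are not higher.\<close>

definition local_minima :: "'a::topological_space set \<Rightarrow> ('a \<Rightarrow> real) \<Rightarrow> 'a set" where
  "local_minima S G = {q\<in>S. q \<notin> closure (sublevel S G (G q))}"

text \<open>The elements are bijections of the whole type, so that \<open>inv\<close> is a true
  inverse and the maps need not be restricted to \<open>S\<close>.\<close>

definition transformation_group :: "'a set \<Rightarrow> ('a \<Rightarrow> 'a) set \<Rightarrow> bool" where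
  "transformation_group S \<Gamma> \<longleftrightarrow> id \<in> \<Gamma> \<and> (\<forall>f\<in>\<Gamma>. \<forall>g\<in>\<Gamma>. f \<circ> g \<in> \<Gamma>) \<and>
     (\<forall>f\<in>\<Gamma>. bij f \<and> inv f \<in> \<Gamma> \<and> f ` S \<subseteq> S)"

lemma sublevel_mono: "a \<le> b \<Longrightarrow> sublevel S G a \<subseteq> sublevel S G b"
  by (auto simp: sublevel_def)

lemma connected_component_bij:
  assumes "connected_component L x y" "continuous_on L f" "f ` L \<subseteq> L"
  shows "connected_component L (f x) (f y)"
proof -
  obtain t where t: "connected t" "t \<subseteq> L" "x \<in> t" "y \<in> t"
    using assms(1) unfolding connected_component_def by blast
  have "connected (f ` t)"
    using t assms(2) by (meson connected_continuous_image continuous_on_subset)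
  moreover have "f ` t \<subseteq> L" using t assms(3) by blast
  ultimately show ?thesis unfolding connected_component_def using t by blast
qed

section \<open>Components of sublevel sets on a compact, locally path connected space\<close>

locale tame_setup =
  fixes S :: "'a::euclidean_space set" and G :: "'a \<Rightarrow> real"
  assumes compact_S: "compact S" and lpc: "locally path_connected S"
    and cont: "continuous_on S G" and fin: "finite (local_minima S G)"
begin

abbreviation "L \<equiv> sublevel S G"

lemma openin_L: "openin (top_of_set S) (L c)"
proof -
  have "L c = S \<inter> G -` {..<c}" by (auto simp: sublevel_def)
  then show ?thesis using continuous_openin_preimage_gen[OF cont, of "{..<c}"] by simp
qed

lemma openin_component: "openin (top_of_set S) (connected_component_set (L c) x)"
proof -
  have "locally connected (L c)"
    using locally_open_subset[OF lpc openin_L] locally_path_connected_imp_locally_connected by blast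
  then have "openin (top_of_set (L c)) (connected_component_set (L c) x)"
    using openin_connected_component_locally_connected by blast
  then show ?thesis using openin_L openin_trans by blast
qed

text \<open>Relatively open subsets of \<open>S\<close> are locally path connected, so components
  are path components; a path is compact, and its highest point lies strictly below
  \<open>b\<close>.\<close>

lemma component_descends:
  assumes "connected_component (L b) x y"
  obtains t where "t < b" "connected_component (L t) x y"
proof -
  have "locally path_connected (L b)" using locally_open_subset[OF lpc openin_L] by blast
  then have "path_component (L b) x y"
    using assms path_component_eq_connected_component by metis
  then obtain g where g: "path g" "path_image g \<subseteq> L b" "pathstart g = x" "pathfinish g = y"
    unfolding path_component_def by blast
  have "compact (path_image g)" using g compact_path_image by blast
  moreover have "continuous_on (path_image g) G"
    by (rule continuous_on_subset[OF cont]) (use g(2) in \<open>auto simp: sublevel_def\<close>)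
  ultimately obtain m where m: "m \<in> path_image g" "\<And>u. u \<in> path_image g \<Longrightarrow> G u \<le> G m"
    using continuous_attains_sup[of "path_image g" G] by (meson path_image_nonempty)
  have "G m < b" using m g by (auto simp: sublevel_def)
  define t where "t = (G m + b) / 2"
  have t: "G m < t" "t < b" using \<open>G m < b\<close> by (auto simp: t_def)
  have "path_image g \<subseteq> L t" using g m t by (force simp: sublevel_def)
  then have "connected_component (L t) x y"
    unfolding connected_component_def using g connected_path_image
    by (metis pathfinish_in_path_image pathstart_in_path_image)
  then show ?thesis using that t by blast
qed

text \<open>A splitting of the open sublevel set survives in the closed one:
  \<open>K \<inter> closure A\<close> is closed in \<open>K\<close>, and it is open in
  \<open>K\<close> because near each point of level \<open>c\<close> only one of the two sides is
  visible.\<close>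

lemma separation:
  assumes A: "openin (top_of_set S) A" "openin (top_of_set S) A'" "A \<inter> A' = {}" "A \<union> A' = L c"
    and loc: "\<And>q. q \<in> S \<Longrightarrow> G q = c \<Longrightarrow> \<exists>N. open N \<and> q \<in> N \<and> (N \<inter> A = {} \<or> N \<inter> A' = {})"
    and K: "connected K" "K \<subseteq> {x\<in>S. G x \<le> c}" "x \<in> K" "x \<in> A" "y \<in> K" "G y < c"
  shows "y \<in> A"
proof -
  have not_both: "q \<in> A" if q: "q \<in> closure A" "q \<in> L c" for q
  proof (rule ccontr)
    assume "q \<notin> A"
    then have "q \<in> A'" using q A by blast
    then obtain O' where O': "open O'" "A' = S \<inter> O'" using A(2) by (auto simp: openin_open)
    have "O' \<inter> A \<noteq> {}" using q(1) O' \<open>q \<in> A'\<close> by (metis IntD2 Int_commute open_Int_closure_eq_empty disjoint_iff)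
    moreover have "A \<subseteq> S" using A by (auto simp: sublevel_def)
    ultimately show False using O' A(3) by blast
  qed
  have "\<exists>N. open N \<and> q \<in> N \<and> N \<inter> K \<subseteq> closure A" if q: "q \<in> K" "q \<in> closure A" for q
  proof (cases "G q < c")
    case True
    then have "q \<in> A" using not_both q K(2) by (auto simp: sublevel_def)
    then obtain O' where O': "open O'" "A = S \<inter> O'" using A(1) by (auto simp: openin_open)
    have "O' \<inter> K \<subseteq> A" using O' K(2) by blast
    then show ?thesis using O' \<open>q \<in> A\<close> closure_subset[of A] by (intro exI[of _ O']) blast
  next
    case False
    then have c: "G q = c" "q \<in> S" using q K(2) by force+
    then obtain N where N: "open N" "q \<in> N" "N \<inter> A = {} \<or> N \<inter> A' = {}" using loc by blast
    have "N \<inter> A \<noteq> {}" using q N by (metis IntI empty_iff open_Int_closure_eq_empty)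
    then have NA': "N \<inter> A' = {}" using N by blast
    \<comment> \<open>The other local minima are cut out; every remaining point of level
      \<open>c\<close> is then a limit of points below \<open>c\<close>.\<close>
    define N' where "N' = N - (local_minima S G - {q})"
    have N': "open N'" unfolding N'_def using N(1) fin by (simp add: finite_imp_closed open_Diff)
    have qM: "q \<notin> local_minima S G"
    proof -
      have "q \<in> closure (L c)" using q A(4) closure_mono[of A "L c"] by blast
      then show ?thesis using c by (simp add: local_minima_def)
    qed
    have "x' \<in> closure A" if x': "x' \<in> N' \<inter> K" for x'
    proof (cases "G x' < c")
      case True
      then show ?thesis using x' NA' A(4) K(2) closure_subset[of A] unfolding N'_def sublevel_def by blast
    next
      case False
      then have c': "G x' = c" "x' \<in> S" using x' K(2) by force+
      have "x' \<notin> local_minima S G" using x' qM unfolding N'_def by blast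
      then have "x' \<in> closure (L c)" using c' by (simp add: local_minima_def)
      then have "x' \<in> closure (N' \<inter> L c)"
        using N' x' open_Int_closure_subset by blast
      moreover have "N' \<inter> L c \<subseteq> A" using NA' A(4) unfolding N'_def by blast
      ultimately show ?thesis using closure_mono by blast
    qed
    then show ?thesis using N' N(2) by (intro exI[of _ N']) (auto simp: N'_def)
  qed
  then have "openin (top_of_set K) (K \<inter> closure A)"
    by (subst openin_subopen) (metis (no_types, lifting) IntD1 IntD2 IntI Int_commute le_inf_iff openin_open_Int subset_refl inf_le1)
  moreover have "closedin (top_of_set K) (K \<inter> closure A)" by (simp add: closedin_closed_Int)
  moreover have "x \<in> K \<inter> closure A" using K closure_subset by blast
  ultimately have "K \<inter> closure A = K" using K(1) unfolding connected_clopen by blast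
  then have "y \<in> closure A" using K by blast
  then show ?thesis using not_both K by (auto simp: sublevel_def)
qed

text \<open>The components of \<open>x\<close> in the closed sublevel sets at levels decreasing to
  \<open>a\<close> are nested, compact and connected; their intersection is connected, contains
  \<open>y\<close> and lies at levels up to \<open>a\<close>.\<close>

lemma connected_limit:
  assumes "\<And>t. t > a \<Longrightarrow> connected_component (L t) x y"
  obtains K where "connected K" "K \<subseteq> {x\<in>S. G x \<le> a}" "x \<in> K" "y \<in> K"
proof -
  define s :: "nat \<Rightarrow> real" where "s n = a + inverse (real (Suc n))" for n
  define C where "C n = connected_component_set {x\<in>S. G x \<le> s n} x" for n
  have cl: "closed {x\<in>S. G x \<le> b}" for b
    using continuous_closed_preimage[OF cont compact_imp_closed[OF compact_S], of "{..b}"]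
    by (simp add: vimage_def Int_def)
  have "compact (C n)" for n
    unfolding C_def using closed_connected_component[OF cl]
    by (rule compact_Int_closed[OF compact_S, of "C n" for n, unfolded C_def, THEN back_subst[of compact]])
       (use connected_component_subset in \<open>blast\<close>)
  moreover have "connected (C n)" for n by (simp add: C_def)
  moreover have "C n \<subseteq> C m" if "m \<le> n" for m n
  proof -
    have "s n \<le> s m" using that by (simp add: s_def field_simps)
    then show ?thesis unfolding C_def by (intro connected_component_mono) auto
  qed
  ultimately have con: "connected (\<Inter> (range C))" by (rule connected_nest)
  have xy: "x \<in> C n" "y \<in> C n" for n
  proof -
    have "connected_component (L (s n)) x y" by (rule assms) (simp add: s_def)
    moreover have "L (s n) \<subseteq> {x\<in>S. G x \<le> s n}" by (auto simp: sublevel_def)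
    ultimately have "connected_component {x\<in>S. G x \<le> s n} x y" by (meson connected_component_of_subset)
    then show "y \<in> C n" "x \<in> C n" using connected_component_in connected_component_refl by (fastforce simp: C_def)+
  qed
  have "\<Inter> (range C) \<subseteq> {x\<in>S. G x \<le> a}"
  proof
    fix z assume z: "z \<in> \<Inter> (range C)"
    then have *: "z \<in> S" "G z \<le> s n" for n
      unfolding C_def using connected_component_subset by blast+
    have "G z \<le> a"
    proof (rule LIMSEQ_le_const)
      show "s \<longlonglongrightarrow> a" unfolding s_def using LIMSEQ_inverse_real_of_nat_add by blast
    qed (use * in blast)
    then show "z \<in> {x\<in>S. G x \<le> a}" using * by blast
  qed
  then show ?thesis using that con xy by blast
qed

text \<open>A connected subset of the sublevel set cannot meet both halves of an open splitting, and
  all lower points near a tame point lie in one such subset.\<close>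

lemma tame_separates:
  assumes t: "tame S G q" and A: "openin (top_of_set S) A" "openin (top_of_set S) A'"
    "A \<inter> A' = {}" "A \<union> A' = L (G q)"
  shows "\<exists>N. open N \<and> q \<in> N \<and> (N \<inter> A = {} \<or> N \<inter> A' = {})"
proof -
  obtain N K where N: "open N" "q \<in> N" "connected K" "N \<inter> L (G q) \<subseteq> K" "K \<subseteq> L (G q)"
    using t by (auto simp: tame_def)
  have "K \<inter> A = {} \<or> K \<inter> A' = {}"
  proof (rule ccontr)
    assume n: "\<not> ?thesis"
    obtain O1 O2 where O: "open O1" "A = S \<inter> O1" "open O2" "A' = S \<inter> O2"
      using A by (auto simp: openin_open)
    have "K \<subseteq> S" using N(5) by (auto simp: sublevel_def)
    then have "O1 \<inter> O2 \<inter> K = {}" "K \<subseteq> O1 \<union> O2" "O1 \<inter> K \<noteq> {}" "O2 \<inter> K \<noteq> {}"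
      using O A N n by auto
    then show False using N(3) O unfolding connected_def by blast
  qed
  then have "N \<inter> A = {} \<or> N \<inter> A' = {}" using N(4) A(4) by blast
  then show ?thesis using N(1,2) by blast
qed

lemma component_split:
  obtains A' where "openin (top_of_set S) A'" "connected_component_set (L c) x \<inter> A' = {}"
    "connected_component_set (L c) x \<union> A' = L c"
proof
  let ?A = "connected_component_set (L c) x"
  let ?A' = "\<Union> ((\<lambda>z. connected_component_set (L c) z) ` (L c - ?A))"
  show "openin (top_of_set S) ?A'" using openin_component by (intro openin_Union) auto
  show "?A \<inter> ?A' = {}"
    by (auto dest: connected_component_sym connected_component_trans)
  show "?A \<union> ?A' = L c"
    using connected_component_in connected_component_refl by fastforce
qed

text \<open>If \<open>x\<close> and \<open>y\<close> were not joined at some level above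
  \<open>a\<close>, consider the infimum \<open>t0\<close> of the levels where they are. By
  \<open>component_descends\<close> it is not attained; by \<open>connected_limit\<close> they are
  joined in the closed sublevel set at \<open>t0\<close>; and tameness at this level lets
  \<open>separation\<close> join them in the open one, a contradiction.\<close>

lemma no_merge:
  assumes xy: "connected_component (L b) x y" "G x \<le> a" "G y \<le> a"
    and tame: "\<And>q. q \<in> S \<Longrightarrow> a < G q \<Longrightarrow> G q < b \<Longrightarrow> tame S G q"
  obtains K where "connected K" "K \<subseteq> {x\<in>S. G x \<le> a}" "x \<in> K" "y \<in> K"
proof (rule connected_limit)
  define T where "T = {t. a < t \<and> connected_component (L t) x y}"
  fix t assume t: "t > a"
  show "connected_component (L t) x y"
  proof (rule ccontr)
    assume n: "\<not> ?thesis"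
    have lb: "t \<le> u" if u: "u \<in> T" for u
      using n u sublevel_mono[of u t S G] connected_component_of_subset[of "L u" x y "L t"]
      by (force simp: T_def not_le)
    have bT: "b \<in> T"
    proof -
      have "b > t" using n sublevel_mono[of b t S G] connected_component_of_subset[OF xy(1)] by force
      then show ?thesis using xy t by (simp add: T_def)
    qed
    define t0 where "t0 = Inf T"
    have bdd: "bdd_below T" using lb by (intro bdd_belowI)
    have t0: "t \<le> t0" unfolding t0_def using lb bT by (intro cInf_greatest) auto
    have notin: "u \<notin> T" if "u \<le> t0" for u
    proof
      assume "u \<in> T"
      then obtain u' where u': "u' < u" "connected_component (L u') x y"
        using component_descends unfolding T_def by blast
      have "u' > a"
      proof (rule ccontr)
        assume "\<not> ?thesis"
        then have "L u' \<subseteq> L t" using t by (intro sublevel_mono) simp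
        then show False using u'(2) n connected_component_of_subset by blast
      qed
      then have "u' \<in> T" using u' by (simp add: T_def)
      then have "t0 \<le> u'" unfolding t0_def using bdd by (intro cInf_lower)
      then show False using u' that by simp
    qed
    have t0b: "t0 < b" using notin bT not_le by blast
    have "connected_component (L u) x y" if "u > t0" for u
    proof -
      have "T \<noteq> {}" "Inf T < u" using that bT unfolding t0_def by blast+
      then obtain v where v: "v \<in> T" "v < u" using cInf_lessD[of T u] by blast
      then show ?thesis using sublevel_mono[of v u S G] connected_component_of_subset[of "L v" x y "L u"]
        by (auto simp: T_def)
    qed
    then obtain K where K: "connected K" "K \<subseteq> {x\<in>S. G x \<le> t0}" "x \<in> K" "y \<in> K"
      by (rule connected_limit)
    let ?A = "connected_component_set (L t0) x"
    obtain A' where A': "openin (top_of_set S) A'" "?A \<inter> A' = {}" "?A \<union> A' = L t0"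
      by (rule component_split)
    have "x \<in> L t0" using K xy t t0 by (auto simp: sublevel_def)
    have "y \<in> ?A"
    proof (rule separation[OF openin_component A' _ K(1,2)])
      show "\<exists>N. open N \<and> q \<in> N \<and> (N \<inter> ?A = {} \<or> N \<inter> A' = {})" if "q \<in> S" "G q = t0" for q
        using tame_separates[OF tame openin_component A'(1,2)] that A'(3) t t0 t0b by auto
    qed (use \<open>x \<in> L t0\<close> K xy t t0 in \<open>auto simp: connected_component_refl\<close>)
    then have "t0 \<in> T" using t t0 by (simp add: T_def)
    then show False using notin by blast
  qed
qed (use that in blast)

text \<open>Points near \<open>m\<close> that are not higher than \<open>m\<close> are themselves
  local minima, hence equal to \<open>m\<close> by finiteness; so \<open>{m}\<close> is clopen in
  \<open>K\<close>.\<close>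

lemma local_minimum_isolated:
  assumes "m \<in> local_minima S G" "connected K" "K \<subseteq> {x\<in>S. G x \<le> G m}" "m \<in> K"
  shows "K = {m}"
proof -
  have m: "m \<in> S" "m \<notin> closure (L (G m))" using assms by (auto simp: local_minima_def)
  define N where "N = - closure (L (G m)) - (local_minima S G - {m})"
  have N: "open N" "m \<in> N"
    unfolding N_def using fin m by (auto simp: finite_imp_closed intro!: open_Diff)
  have "q = m" if q: "q \<in> N \<inter> K" for q
  proof -
    have "q \<in> S" "G q \<le> G m" using q assms by auto
    moreover have "\<not> G q < G m" using q closure_subset[of "L (G m)"] \<open>q \<in> S\<close> unfolding N_def sublevel_def by blast
    ultimately have "G q = G m" by simp
    then have "q \<in> local_minima S G" using q \<open>q \<in> S\<close> by (simp add: local_minima_def N_def)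
    then show ?thesis using q by (auto simp: N_def)
  qed
  then have "K \<inter> N = {m}" using N assms by blast
  then have "openin (top_of_set K) {m}" using N(1) by (metis openin_open_Int)
  then show ?thesis using assms(2,4) unfolding connected_clopen
    by (metis closedin_closed_Int closed_singleton Int_insert_right_if1 Int_empty_right insert_not_empty)
qed

end

section \<open>Sublevel sets under a free group action\<close>

locale equivariant_setup = tame_setup +
  fixes \<Gamma> :: "('a \<Rightarrow> 'a) set"
  assumes grp: "transformation_group S \<Gamma>"
    and gcont: "\<And>f. f \<in> \<Gamma> \<Longrightarrow> continuous_on S f"
    and inva: "\<And>f x. f \<in> \<Gamma> \<Longrightarrow> x \<in> S \<Longrightarrow> G (f x) = G x"
    and free: "\<And>f x. f \<in> \<Gamma> \<Longrightarrow> x \<in> S \<Longrightarrow> f x = x \<Longrightarrow> f = id"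
begin

lemma G_mem: "f \<in> \<Gamma> \<Longrightarrow> x \<in> S \<Longrightarrow> f x \<in> S"
  using grp unfolding transformation_group_def by blast

lemma G_comp: "f \<in> \<Gamma> \<Longrightarrow> g \<in> \<Gamma> \<Longrightarrow> f \<circ> g \<in> \<Gamma>"
  using grp unfolding transformation_group_def by blast

lemma G_inv: "f \<in> \<Gamma> \<Longrightarrow> inv f \<in> \<Gamma>" "f \<in> \<Gamma> \<Longrightarrow> inv f (f x) = x" "f \<in> \<Gamma> \<Longrightarrow> f (inv f x) = x"
  using grp unfolding transformation_group_def
  by (auto simp: bij_is_inj bij_is_surj surj_f_inv_f)

lemma component_image:
  assumes "f \<in> \<Gamma>" "connected_component (L c) x y"
  shows "connected_component (L c) (f x) (f y)"
proof (rule connected_component_bij[OF assms(2)])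
  show "continuous_on (L c) f" using gcont[OF assms(1)] continuous_on_subset by (fastforce simp: sublevel_def)
  show "f ` L c \<subseteq> L c" using assms by (auto simp: sublevel_def inva G_mem)
qed

lemma tame_image:
  assumes f: "f \<in> \<Gamma>" and q0: "q0 \<in> S" and t: "tame S G q0"
  shows "tame S G (f q0)"
proof -
  obtain N K where N: "open N" "q0 \<in> N" "connected K" "N \<inter> L (G q0) \<subseteq> K" "K \<subseteq> L (G q0)"
    using t by (auto simp: tame_def)
  have "K \<subseteq> S" using N(5) by (auto simp: sublevel_def)
  then have "connected (f ` K)"
    using N(3) gcont[OF f] connected_continuous_image continuous_on_subset by blast
  moreover have "f ` K \<subseteq> L (G (f q0))" using N(5) f q0 by (auto simp: sublevel_def inva G_mem)
  moreover have "openin (top_of_set S) (S \<inter> inv f -` N)"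
    using continuous_openin_preimage_gen[OF gcont[OF G_inv(1)[OF f]] N(1)] .
  then obtain V where V: "open V" "S \<inter> inv f -` N = S \<inter> V" by (auto simp: openin_open)
  have "f q0 \<in> S \<inter> inv f -` N" using q0 f N(2) G_inv(2)[OF f] G_mem by simp
  then have "f q0 \<in> V" using V by blast
  moreover have "V \<inter> L (G (f q0)) \<subseteq> f ` K"
  proof
    fix z assume z: "z \<in> V \<inter> L (G (f q0))"
    then have zS: "z \<in> S" "G z < G (f q0)" by (auto simp: sublevel_def)
    then have "inv f z \<in> N" using V z by blast
    moreover have "inv f z \<in> L (G q0)"
      using zS f q0 G_inv(1)[OF f] by (simp add: sublevel_def inva G_mem)
    ultimately have "inv f z \<in> K" using N by blast
    then show "z \<in> f ` K" using G_inv(3)[OF f] by (metis imageI)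
  qed
  ultimately show ?thesis using V(1) unfolding tame_def by blast
qed

text \<open>As long as nothing merges, a component contains essentially one local minimum, and the free
  action moves it.\<close>
lemma stabilizer_trivial:
  assumes f: "f \<in> \<Gamma>" and x: "connected_component (L s) x (f x)"
    and tame: "\<And>q. q \<in> S \<Longrightarrow> G q < s \<Longrightarrow> tame S G q"
  shows "f = id"
proof -
  let ?C = "connected_component_set (L s) x"
  have xL: "x \<in> L s" using x connected_component_in by metis
  then have "x \<in> ?C" by (simp add: connected_component_refl)
  have CS: "?C \<subseteq> L s" by (rule connected_component_subset)
  then have CS': "?C \<subseteq> S" by (auto simp: sublevel_def)
  have sub: "closure ?C \<subseteq> S"
    using CS' compact_imp_closed[OF compact_S] closure_minimal by blast
  then have "compact (closure ?C)"
    using compact_S by (meson bounded_subset closed_closure compact_eq_bounded_closed)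
  then obtain m where m: "m \<in> closure ?C" "\<And>z. z \<in> closure ?C \<Longrightarrow> G m \<le> G z"
    using continuous_attains_inf[of "closure ?C" G] \<open>x \<in> ?C\<close> continuous_on_subset[OF cont sub]
    by fastforce
  have mL: "m \<in> L s"
    using m(2)[of x] xL sub m(1) \<open>x \<in> ?C\<close> closure_subset[of ?C] by (force simp: sublevel_def)
  \<comment> \<open>The component is closed relative to \<open>L s\<close> and \<open>m\<close> lies
    strictly below \<open>s\<close>, so the minimum over the closure is attained in the component
    itself.\<close>
  have mC: "m \<in> ?C"
  proof -
    have "closedin (top_of_set (L s)) ?C" by (rule closedin_connected_component)
    then obtain T where "closed T" "?C = L s \<inter> T" by (auto simp: closedin_closed)
    then show ?thesis using m(1) mL by (metis IntI closure_minimal inf_le2 subsetD)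
  qed
  have "connected_component (L s) x m" using mC by simp
  then have "connected_component (L s) (f x) (f m)" using component_image[OF f] by blast
  then have c: "connected_component (L s) m (f m)"
    using x mC connected_component_sym[of "L s" x m]
      connected_component_trans[of "L s" m x "f x"] connected_component_trans[of "L s" m "f x" "f m"] by simp
  have mS: "m \<in> S" using mL by (simp add: sublevel_def)
  have mM: "m \<in> local_minima S G"
  proof -
    obtain U where U: "open U" "?C = S \<inter> U" using openin_component[of s x] by (auto simp: openin_open)
    have "U \<inter> L (G m) = {}"
    proof (rule ccontr)
      assume "U \<inter> L (G m) \<noteq> {}"
      then obtain z where "z \<in> U" "z \<in> S" "G z < G m" by (auto simp: sublevel_def)
      then have "z \<in> ?C" using U by blast
      then show False using m(2)[of z] closure_subset[of ?C] \<open>G z < G m\<close> by force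
    qed
    moreover have "m \<in> U" using U mC by blast
    ultimately have "m \<notin> closure (L (G m))" using U(1) by (metis IntI empty_iff open_Int_closure_eq_empty)
    then show ?thesis using mS by (simp add: local_minima_def)
  qed
  \<comment> \<open>\<open>m\<close> and \<open>f m\<close> have the same level. Descending to it
    leaves them in one connected set, which is reduced to \<open>m\<close>, and freeness gives
    \<open>f = id\<close>.\<close>
  obtain K where K: "connected K" "K \<subseteq> {x\<in>S. G x \<le> G m}" "m \<in> K" "f m \<in> K"
    using no_merge[OF c] tame inva[OF f mS] by (metis order_refl)
  have "K = {m}" by (rule local_minimum_isolated[OF mM K(1,2,3)])
  then show ?thesis using K free[OF f mS] by blast
qed

text \<open>Only the level of \<open>q0\<close> merges components. The two components meeting at \<open>q0\<close> are joined by
  some \<open>h\<close> (or not at all), so the translates of a component under a subgroup containing \<open>h\<close>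
  are never merged with the others, although \<open>S\<close> is connected.\<close>
theorem generated_by_one:
  assumes S: "connected S" "S \<noteq> {}" and q0: "q0 \<in> S"
    and W: "\<And>q. q \<in> S \<Longrightarrow> \<not> tame S G q \<Longrightarrow> \<exists>f\<in>\<Gamma>. q = f q0"
    and bi: "\<not> tame S G q0 \<Longrightarrow> bitame S G q0"
  obtains h where "h \<in> \<Gamma>" "\<And>H. H \<subseteq> \<Gamma> \<Longrightarrow> transformation_group S H \<Longrightarrow> h \<in> H \<Longrightarrow> H = \<Gamma>"
proof -
  obtain b where b: "\<And>x. x \<in> S \<Longrightarrow> G x < b"
  proof -
    obtain m where "\<And>x. x \<in> S \<Longrightarrow> G x \<le> G m"
      using continuous_attains_sup[OF compact_S S(2) cont] by blast
    then show ?thesis using that[of "G m + 1"] by force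
  qed
  then have Lb: "L b = S" by (auto simp: sublevel_def)
  have conn: "connected_component (L b) x y" if "x \<in> S" "y \<in> S" for x y
    using S that unfolding Lb connected_component_def by blast
  have id: "id \<in> \<Gamma>" using grp by (simp add: transformation_group_def)
  show ?thesis
  proof (cases "tame S G q0")
    case True
    \<comment> \<open>Nothing ever merges: all of \<open>S\<close> is one component, and since
      stabilizers of components are trivial, so is the group.\<close>
    have all: "tame S G q" if q: "q \<in> S" for q
      using W[OF q] tame_image[OF _ q0 True] by blast
    have triv: "f = id" if "f \<in> \<Gamma>" for f
      using stabilizer_trivial[OF that conn[OF q0 G_mem[OF that q0]]] all by blast
    show ?thesis
    proof (rule that[OF id])
      fix H assume "H \<subseteq> \<Gamma>" "id \<in> H"
      then show "H = \<Gamma>" using triv by blast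
    qed
  next
    case False
    define s where "s = G q0"
    obtain N K1 K2 where N: "open N" "q0 \<in> N" "connected K1" "connected K2" "N \<inter> L s \<subseteq> K1 \<union> K2" "K1 \<union> K2 \<subseteq> L s"
      using bi[OF False] by (auto simp: bitame_def s_def)
    \<comment> \<open>If one of the two sheets were empty, the other would make \<open>q0\<close>
      tame.\<close>
    have "K1 \<noteq> {}" "K2 \<noteq> {}" using False N unfolding tame_def s_def by fastforce+
    then obtain x1 x2 where x: "x1 \<in> K1" "x2 \<in> K2" by blast
    have xL: "x1 \<in> L s" "x2 \<in> L s" using x N by blast+
    then have xS: "x1 \<in> S" "x2 \<in> S" "G x1 < s" "G x2 < s" by (auto simp: sublevel_def)
    have tame_off: "tame S G q" if "q \<in> S" "G q \<noteq> s" for q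
      using W[OF that(1)] that q0 inva by (metis s_def)
    define cc where "cc = connected_component (L s)"
    have cc_sym: "cc u v \<Longrightarrow> cc v u" for u v
      unfolding cc_def by (rule connected_component_sym)
    have cc_trans: "cc u v \<Longrightarrow> cc v w \<Longrightarrow> cc u w" for u v w
      unfolding cc_def by (rule connected_component_trans)
    have cc_im: "cc (f u) (f v)" if "f \<in> \<Gamma>" "cc u v" for f u v
      using that component_image unfolding cc_def by blast
    \<comment> \<open>Below \<open>s\<close> stabilizers of components are trivial, so an element is
      determined by the component that contains its image of a single point.\<close>
    have eq: "f = g" if "f \<in> \<Gamma>" "g \<in> \<Gamma>" "cc (f u) (g u)" "u \<in> S" for f g u
    proof -
      have "cc (inv g (f u)) (inv g (g u))" using cc_im[OF G_inv(1) that(3)] that by blast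
      then have "cc u ((inv g \<circ> f) u)" using G_inv(2)[OF that(2)] cc_sym by simp
      then have "inv g \<circ> f = id"
        using stabilizer_trivial[of "inv g \<circ> f" s u] tame_off G_comp[OF G_inv(1)[OF that(2)] that(1)] unfolding cc_def by blast
      then show ?thesis using G_inv(3)[OF that(2)] by (metis comp_apply ext id_apply)
    qed
    \<comment> \<open>The transition between the two sheets at \<open>q0\<close>. If no element
      carries the component of \<open>x1\<close> to that of \<open>x2\<close>, the default
      \<open>id\<close> lies in every subgroup.\<close>
    define h where "h = (if \<exists>h\<in>\<Gamma>. cc (h x1) x2 then SOME h. h \<in> \<Gamma> \<and> cc (h x1) x2 else id)"
    have h: "h \<in> \<Gamma>"
    proof (cases "\<exists>h\<in>\<Gamma>. cc (h x1) x2")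
      case True
      then have "\<exists>h. h \<in> \<Gamma> \<and> cc (h x1) x2" by blast
      then have "(SOME h. h \<in> \<Gamma> \<and> cc (h x1) x2) \<in> \<Gamma>" by (rule someI2_ex) blast
      then show ?thesis using True by (simp add: h_def)
    next
      case False
      then show ?thesis using id unfolding h_def by (simp only: if_False)
    qed
    have hu: "f = h" if "f \<in> \<Gamma>" "cc (f x1) x2" for f
    proof -
      have "\<exists>h. h \<in> \<Gamma> \<and> cc (h x1) x2" using that by blast
      then have "cc ((SOME h. h \<in> \<Gamma> \<and> cc (h x1) x2) x1) x2" by (rule someI2_ex) blast
      moreover have "\<exists>h\<in>\<Gamma>. cc (h x1) x2" using that by blast
      ultimately have "cc (h x1) x2" by (simp add: h_def)
      then show ?thesis using eq[OF that(1) h] that(2) cc_sym cc_trans xS by blast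
    qed
    show ?thesis
    proof (rule that[OF h])
      fix H assume H: "H \<subseteq> \<Gamma>" "transformation_group S H" "h \<in> H"
      have Hc: "f \<circ> g \<in> H" "inv f \<in> H" if "f \<in> H" "g \<in> H" for f g
        using that H(2) by (auto simp: transformation_group_def)
      have Hid: "id \<in> H" using H(2) by (simp add: transformation_group_def)
      have rel12: "inv g \<circ> f = h" if "f \<in> \<Gamma>" "g \<in> \<Gamma>" "cc (f x1) (g x2)" for f g
      proof -
        have "cc ((inv g \<circ> f) x1) x2"
          using cc_im[OF G_inv(1)[OF that(2)] that(3)] G_inv(2)[OF that(2)] by simp
        then show ?thesis using hu G_comp[OF G_inv(1)[OF that(2)] that(1)] by blast
      qed
      have in1: "f \<in> H" if "f \<in> \<Gamma>" "g \<in> H" "cc (f x1) (g x2)" for f g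
      proof -
        have "inv g \<circ> f = h" using rel12 that H(1) by blast
        then have "f = g \<circ> h" using G_inv(3)[of g] that(2) H(1) by (metis comp_apply ext subsetD)
        then show ?thesis using Hc(1) that(2) H(3) by blast
      qed
      have in2: "g \<in> H" if "g \<in> \<Gamma>" "f \<in> H" "cc (f x1) (g x2)" for f g
      proof -
        have *: "inv g \<circ> f = h" using rel12 that H(1) by blast
        have "f x = g (h x)" for x using *[symmetric] G_inv(3)[OF that(1)] by simp
        then have "g x = (f \<circ> inv h) x" for x using G_inv(3)[OF h] by (metis comp_apply)
        then have "g = f \<circ> inv h" by blast
        then show ?thesis using Hc that(2) H(3) by blast
      qed
      \<comment> \<open>All components met by the translates of the two sheets under
        \<open>H\<close>; the remaining components make up \<open>A'\<close>.\<close>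
      define A where "A = (\<Union>g\<in>H. connected_component_set (L s) (g x1) \<union> connected_component_set (L s) (g x2))"
      define A' where "A' = (\<Union>z\<in>L s - A. connected_component_set (L s) z)"
      have memA: "z \<in> A \<longleftrightarrow> (\<exists>g\<in>H. cc (g x1) z \<or> cc (g x2) z)" for z
        by (auto simp: A_def cc_def)
      have oA: "openin (top_of_set S) A" "openin (top_of_set S) A'"
        unfolding A_def A'_def using openin_component by (auto intro!: openin_Union openin_Un)
      have AL: "A \<subseteq> L s" unfolding A_def using connected_component_subset by blast
      have AA': "A \<inter> A' = {}"
        unfolding A'_def using memA cc_trans cc_sym unfolding cc_def by blast
      have "A' \<subseteq> L s" unfolding A'_def using connected_component_subset by blast
      moreover have "z \<in> A'" if "z \<in> L s" "z \<notin> A" for z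
        unfolding A'_def using that by (intro UN_I[of z]) (simp_all add: connected_component_refl)
      ultimately have un: "A \<union> A' = L s" using AL by blast
      have loc: "\<exists>N. open N \<and> q \<in> N \<and> (N \<inter> A = {} \<or> N \<inter> A' = {})" if q: "q \<in> S" "G q = s" for q
      proof (cases "tame S G q")
        case True
        then show ?thesis using tame_separates[OF True oA AA'] un q by simp
      next
        case False
        then obtain f where f: "f \<in> \<Gamma>" "q = f q0" using W q by blast
        \<comment> \<open>The saddle \<open>f q0\<close> joins the component of \<open>f x1\<close>
          to that of \<open>f x2\<close>. Both lie in \<open>A\<close> or neither does, because the
          transition \<open>h\<close> belongs to \<open>H\<close>.\<close>
        have iff: "f x1 \<in> A \<longleftrightarrow> f x2 \<in> A"
        proof
          assume "f x1 \<in> A"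
          then have "f \<in> H" using memA eq[OF f(1)] in1[OF f(1)] H(1) cc_sym xS by (metis subsetD)
          then show "f x2 \<in> A" using memA cc_im[OF f(1)] xL unfolding cc_def by (metis connected_component_refl)
        next
          assume "f x2 \<in> A"
          then have "f \<in> H" using memA eq[OF f(1)] in2[OF f(1)] H(1) cc_sym xS by (metis subsetD)
          then show "f x1 \<in> A" using memA cc_im[OF f(1)] xL unfolding cc_def by (metis connected_component_refl)
        qed
        have "openin (top_of_set S) (S \<inter> inv f -` N)"
          using continuous_openin_preimage_gen[OF gcont[OF G_inv(1)[OF f(1)]] N(1)] .
        then obtain V where V: "open V" "S \<inter> inv f -` N = S \<inter> V" by (auto simp: openin_open)
        have qV: "q \<in> V" using V q f N G_inv by blast
        have VL: "cc (f x1) z \<or> cc (f x2) z" if z: "z \<in> V \<inter> L s" for z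
        proof -
          have zS: "z \<in> S" "G z < s" using z by (auto simp: sublevel_def)
          then have "inv f z \<in> N" using V z by blast
          moreover have "inv f z \<in> L s"
            using zS f G_inv(1)[OF f(1)] by (simp add: sublevel_def inva G_mem)
          ultimately have "inv f z \<in> K1 \<union> K2" using N by blast
          then have "cc x1 (inv f z) \<or> cc x2 (inv f z)"
            unfolding cc_def connected_component_def using x N by blast
          then show ?thesis using cc_im[OF f(1)] G_inv(3)[OF f(1)] by metis
        qed
        show ?thesis
        proof (cases "f x1 \<in> A")
          case True
          have "z \<in> A" if z: "z \<in> V \<inter> L s" for z
          proof -
            obtain x' where x': "x' \<in> A" "cc x' z" using VL[OF z] iff True by blast
            then show ?thesis unfolding memA using cc_trans by blast
          qed
          then have "V \<inter> L s \<subseteq> A" by blast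
          then show ?thesis using V(1) qV un AA' by blast
        next
          case False
          have "z \<notin> A" if z: "z \<in> V \<inter> L s" for z
          proof
            assume "z \<in> A"
            obtain x' where x': "x' \<notin> A" "cc x' z" using VL[OF z] iff False by blast
            then show False using \<open>z \<in> A\<close> cc_trans cc_sym unfolding memA by blast
          qed
          then have "V \<inter> A = {}" using AL by blast
          then show ?thesis using V(1) qV by blast
        qed
      qed
      have "f \<in> H" if f: "f \<in> \<Gamma>" for f
      proof -
        have fx: "f x1 \<in> S" "G (f x1) < s" using f xS by (simp_all add: G_mem inva)
        \<comment> \<open>Above level \<open>s\<close> every point is tame, so the connectedness of
          \<open>S\<close> descends to the closed sublevel set at \<open>s\<close>.\<close>
        obtain K where K: "connected K" "K \<subseteq> {x\<in>S. G x \<le> s}" "x1 \<in> K" "f x1 \<in> K"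
          using no_merge[OF conn[OF xS(1) fx(1)], of s] tame_off xS fx by (metis less_eq_real_def less_irrefl)
        have "x1 \<in> A" using memA Hid xL unfolding cc_def by (metis id_apply connected_component_refl)
        have "f x1 \<in> A"
          using separation[OF oA AA' un loc K(1,2,3) \<open>x1 \<in> A\<close> K(4) fx(2)] .
        then show ?thesis using memA eq[OF f] in1[OF f] H(1) cc_sym xS by (metis subsetD)
      qed
      then show "H = \<Gamma>" using H(1) by blast
    qed
  qed
qed

end

section \<open>Second derivatives\<close>

lemma Ck_on_cong:
  assumes "open S" "\<And>x. x \<in> S \<Longrightarrow> f x = g x" "Ck_on k S f"
  shows "Ck_on k S g"
  using assms(2,3)
proof (induction k arbitrary: f g)
  case 0
  then show ?case by (simp cong: continuous_on_cong)
next
  case (Suc k)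
  have d: "f differentiable at x" if "x \<in> S" for x using Suc.prems that by simp
  have e: "frechet_derivative f (at x) = frechet_derivative g (at x)" if "x \<in> S" for x
    using frechet_derivative_transform_within_open[OF d[OF that] assms(1) that] Suc.prems(1) by blast
  have "g differentiable at x" if x: "x \<in> S" for x
    using d[OF x] has_derivative_transform_within_open[OF _ assms(1) x] Suc.prems(1)
    unfolding differentiable_def by blast
  moreover have "Ck_on k S (\<lambda>x. frechet_derivative g (at x) v)" for v
    by (rule Suc.IH[of "\<lambda>x. frechet_derivative f (at x) v"]) (use Suc.prems(2) e in auto)
  ultimately show ?case by simp
qed

text \<open>Coinduction: if the directional derivatives of each member of a class agree on
  \<open>S\<close> with members of the class, all of them are smooth. No higher derivative has to be
  computed.\<close>

lemma Ck_on_coinduct: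
  assumes "open S" "f \<in> C"
    and step: "\<And>f. f \<in> C \<Longrightarrow> \<exists>D. (\<forall>x\<in>S. (f has_derivative D x) (at x)) \<and>
      (\<forall>v. \<exists>g\<in>C. \<forall>x\<in>S. D x v = g x)"
  shows "Ck_on k S f"
  using assms(2)
proof (induction k arbitrary: f)
  case 0
  then obtain D where "\<forall>x\<in>S. (f has_derivative D x) (at x)" using step by blast
  then show ?case
    by (auto simp: continuous_on_eq_continuous_at[OF assms(1)] intro: has_derivative_continuous)
next
  case (Suc k)
  then obtain D where D: "\<forall>x\<in>S. (f has_derivative D x) (at x)"
    "\<forall>v. \<exists>g\<in>C. \<forall>x\<in>S. D x v = g x" using step by blast
  have e: "frechet_derivative f (at x) = D x" if "x \<in> S" for x
    using D(1) that frechet_derivative_at by metis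
  have "Ck_on k S (\<lambda>x. frechet_derivative f (at x) v)" for v
  proof -
    obtain g where g: "g \<in> C" "\<forall>x\<in>S. D x v = g x" using D(2) by blast
    show ?thesis by (rule Ck_on_cong[OF assms(1) _ Suc.IH[OF g(1)]]) (simp add: g e)
  qed
  then show ?case using D(1) by (auto simp: differentiable_def)
qed

lemma Ck_on_cmult:
  assumes "open S" "Ck_on k S f"
  shows "Ck_on k S (\<lambda>x. c * f x)"
  using assms(2)
proof (induction k arbitrary: f)
  case 0
  then show ?case by (auto intro: continuous_intros)
next
  case (Suc k)
  have d: "((\<lambda>x. c * f x) has_derivative (\<lambda>v. c * frechet_derivative f (at x) v)) (at x)" if "x \<in> S" for x
    using Suc.prems that by (auto intro!: has_derivative_mult_right simp: frechet_derivative_works)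
  have "Ck_on k S (\<lambda>x. frechet_derivative (\<lambda>x. c * f x) (at x) v)" for v
    by (rule Ck_on_cong[OF assms(1) _ Suc.IH[of "\<lambda>x. frechet_derivative f (at x) v"]])
       (use Suc.prems frechet_derivative_at[OF d] in \<open>simp_all flip: fun_eq_iff\<close>, metis)
  then show ?case using d by (auto simp: differentiable_def)
qed

lemma real_polynomial_function_derivative:
  assumes "real_polynomial_function P"
  shows "\<exists>D. (\<forall>x. (P has_derivative D x) (at x)) \<and> (\<forall>v. real_polynomial_function (\<lambda>x. D x v))"
  using assms
proof induction
  case (linear f)
  then show ?case
    by (intro exI[of _ "\<lambda>_. f"]) (auto intro: bounded_linear_imp_has_derivative)
next
  case (const c)
  show ?case by (intro exI[of _ "\<lambda>_ _. 0"]) auto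
next
  case (add f g)
  then obtain D E where "\<forall>x. (f has_derivative D x) (at x)" "\<forall>v. real_polynomial_function (\<lambda>x. D x v)"
    "\<forall>x. (g has_derivative E x) (at x)" "\<forall>v. real_polynomial_function (\<lambda>x. E x v)" by blast
  then show ?case by (intro exI[of _ "\<lambda>x v. D x v + E x v"]) (auto intro: has_derivative_add)
next
  case (mult f g)
  then obtain D E where "\<forall>x. (f has_derivative D x) (at x)" "\<forall>v. real_polynomial_function (\<lambda>x. D x v)"
    "\<forall>x. (g has_derivative E x) (at x)" "\<forall>v. real_polynomial_function (\<lambda>x. E x v)" by blast
  then show ?case using mult.hyps
    by (intro exI[of _ "\<lambda>x v. f x * E x v + D x v * g x"] conjI allI has_derivative_mult
        real_polynomial_function.intros(3,4)) auto
qed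

text \<open>By the quotient rule a derivative has the same shape with exponent \<open>n + 1\<close>,
  so these functions form a class for \<open>Ck_on_coinduct\<close>. Powers of the squared norm keep
  the numerators polynomial.\<close>

lemma smooth_on_poly_over_norm:
  fixes P :: "'a::euclidean_space \<Rightarrow> real"
  assumes "real_polynomial_function P"
  shows "smooth_on (- {0}) (\<lambda>x. P x / (x \<bullet> x) ^ n)"
  unfolding smooth_on_def
proof
  fix k
  define C where "C = {\<lambda>x::'a. P x / (x \<bullet> x) ^ n |P n. real_polynomial_function P}"
  show "Ck_on k (- {0}) (\<lambda>x. P x / (x \<bullet> x) ^ n)"
  proof (rule Ck_on_coinduct[where C = C])
    fix f assume "f \<in> C"
    then obtain P n where P: "real_polynomial_function P" and f: "f = (\<lambda>x. P x / (x \<bullet> x) ^ n)"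
      by (auto simp: C_def)
    obtain D where D: "\<forall>x. (P has_derivative D x) (at x)" "\<forall>v. real_polynomial_function (\<lambda>x. D x v)"
      using real_polynomial_function_derivative[OF P] by blast
    define E where "E x v = (D x v * (x \<bullet> x) - P x * (real n * (2 * (x \<bullet> v)))) / (x \<bullet> x) ^ Suc n" for x v
    have "(f has_derivative E x) (at x)" if x: "x \<noteq> 0" for x
    proof -
      have "((\<lambda>x. P x / (x \<bullet> x) ^ n) has_derivative E x) (at x)"
      proof (rule has_derivative_eq_rhs)
        have a: "((\<lambda>x::'a. x \<bullet> x) has_derivative (\<lambda>v. 2 * (x \<bullet> v))) (at x)"
          by (auto intro!: derivative_eq_intros simp: inner_commute)
        show "((\<lambda>x. P x / (x \<bullet> x) ^ n) has_derivative
          (\<lambda>v. - P x * (inverse ((x \<bullet> x) ^ n) * (real n * (2 * (x \<bullet> v)) * (x \<bullet> x) ^ (n - 1)) * inverse ((x \<bullet> x) ^ n)) + D x v / (x \<bullet> x) ^ n)) (at x)"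
          using D(1) x by (intro has_derivative_divide has_derivative_power a) auto
        have "x \<bullet> x \<noteq> 0" using x by simp
        then show "(\<lambda>v. - P x * (inverse ((x \<bullet> x) ^ n) * (real n * (2 * (x \<bullet> v)) * (x \<bullet> x) ^ (n - 1)) * inverse ((x \<bullet> x) ^ n)) + D x v / (x \<bullet> x) ^ n) = E x"
          unfolding E_def by (cases n) (auto simp: fun_eq_iff field_simps)
      qed
      then show ?thesis by (simp add: f)
    qed
    moreover have "(\<lambda>x. E x v) \<in> C" for v
    proof -
      have i: "real_polynomial_function (\<lambda>x::'a. x \<bullet> b)" for b
        by (intro real_polynomial_function.intros(1) bounded_linear_inner_left)
      have "real_polynomial_function (\<lambda>x::'a. \<Sum>b\<in>Basis. (x \<bullet> b) * (x \<bullet> b))"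
        by (intro real_polynomial_function_sum real_polynomial_function.intros(4) i) auto
      then have ii: "real_polynomial_function (\<lambda>x::'a. x \<bullet> x)" by (simp add: euclidean_inner[symmetric])
      show ?thesis unfolding C_def E_def using D(2) P
        by (auto intro!: exI[of _ "\<lambda>x. D x v * (x \<bullet> x) - P x * (real n * (2 * (x \<bullet> v)))"] exI[of _ "Suc n"]
            real_polynomial_function_diff real_polynomial_function.intros(4) i ii)
    qed
    ultimately show "\<exists>D. (\<forall>x\<in>- {0}. (f has_derivative D x) (at x)) \<and> (\<forall>v. \<exists>g\<in>C. \<forall>x\<in>- {0}. D x v = g x)"
      by (intro exI[of _ E] conjI ballI allI) (metis ComplD singletonI, metis)
  qed (use assms in \<open>auto simp: C_def\<close>)
qed

section \<open>Bilinearity, symmetry and continuity of the Hessian\<close>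

locale C2 =
  fixes S :: "'a::euclidean_space set" and U :: "'a \<Rightarrow> real"
  assumes open_S: "open S" and C2: "Ck_on 2 S U"
begin

abbreviation "DU x \<equiv> frechet_derivative U (at x)"
abbreviation "H \<equiv> second_deriv U"

lemma unfold_C2:
  "x \<in> S \<Longrightarrow> U differentiable at x"
  "x \<in> S \<Longrightarrow> (\<lambda>y. DU y w) differentiable at x"
  "continuous_on S (\<lambda>x. H x v w)"
  using C2 unfolding numeral_2_eq_2 by (auto simp: second_deriv_def)

lemma has_derivative_U: "x \<in> S \<Longrightarrow> (U has_derivative DU x) (at x)"
  using unfold_C2 by (simp add: frechet_derivative_works)

lemma has_derivative_DU: "x \<in> S \<Longrightarrow> ((\<lambda>y. DU y w) has_derivative (\<lambda>v. H x v w)) (at x)"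
  using unfold_C2(2) unfolding second_deriv_def by (simp add: frechet_derivative_works)

lemma linear_DU: "x \<in> S \<Longrightarrow> linear (DU x)"
  using has_derivative_U has_derivative_linear by blast

lemma linear_H1: "x \<in> S \<Longrightarrow> linear (\<lambda>v. H x v w)"
  using has_derivative_DU has_derivative_linear by blast

lemma linear_H2:
  assumes x: "x \<in> S"
  shows "linear (\<lambda>w. H x v w)"
proof
  show "H x v (a + b) = H x v a + H x v b" for a b
  proof -
    have "((\<lambda>y. DU y a + DU y b) has_derivative (\<lambda>v. H x v a + H x v b)) (at x)"
      using has_derivative_DU[OF x] by (intro has_derivative_add)
    then have "((\<lambda>y. DU y (a + b)) has_derivative (\<lambda>v. H x v a + H x v b)) (at x)"
      by (rule has_derivative_transform_within_open[OF _ open_S x]) (simp add: linear_add[OF linear_DU])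
    then show ?thesis
      using fun_cong[OF has_derivative_unique[OF has_derivative_DU[OF x, of "a + b"]], of _ v] by blast
  qed
  show "H x v (r *\<^sub>R a) = r *\<^sub>R H x v a" for r a
  proof -
    have "((\<lambda>y. r * DU y a) has_derivative (\<lambda>v. r * H x v a)) (at x)"
      using has_derivative_DU[OF x] by (intro has_derivative_mult_right)
    then have "((\<lambda>y. DU y (r *\<^sub>R a)) has_derivative (\<lambda>v. r * H x v a)) (at x)"
      by (rule has_derivative_transform_within_open[OF _ open_S x]) (simp add: linear_scale[OF linear_DU])
    then have "H x v (r *\<^sub>R a) = r * H x v a"
      using fun_cong[OF has_derivative_unique[OF has_derivative_DU[OF x, of "r *\<^sub>R a"]], of _ v] by blast
    then show ?thesis by simp
  qed
qed

lemma line_derivative: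
  assumes "x + t *\<^sub>R p \<in> S"
  shows "((\<lambda>t. U (x + t *\<^sub>R p)) has_real_derivative DU (x + t *\<^sub>R p) p) (at t)"
    "((\<lambda>t. DU (x + t *\<^sub>R p) w) has_real_derivative H (x + t *\<^sub>R p) p w) (at t)"
proof -
  have l: "((\<lambda>t. x + t *\<^sub>R p) has_derivative (\<lambda>s. s *\<^sub>R p)) (at t)"
    by (auto intro!: derivative_eq_intros)
  show "((\<lambda>t. U (x + t *\<^sub>R p)) has_real_derivative DU (x + t *\<^sub>R p) p) (at t)"
    using has_derivative_compose[OF l has_derivative_U[OF assms]]
    by (simp add: has_field_derivative_def linear_scale[OF linear_DU[OF assms]] mult.commute[of _ "DU _ _"] mult_commute_abs)
  show "((\<lambda>t. DU (x + t *\<^sub>R p) w) has_real_derivative H (x + t *\<^sub>R p) p w) (at t)"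
    using has_derivative_compose[OF l has_derivative_DU[OF assms]]
    by (simp add: has_field_derivative_def linear_scale[OF linear_H1[OF assms]] mult_commute_abs)
qed

text \<open>The mean value theorem, first in direction \<open>v\<close> and then in direction
  \<open>w\<close>. The left side is symmetric in the two directions, so comparing both orders gives
  the symmetry of \<open>H\<close>.\<close>

lemma second_difference:
  assumes h: "h > 0" and sub: "\<And>s t. 0 \<le> s \<Longrightarrow> s \<le> h \<Longrightarrow> 0 \<le> t \<Longrightarrow> t \<le> h \<Longrightarrow> x + s *\<^sub>R v + t *\<^sub>R w \<in> S"
  shows "\<exists>s t. 0 \<le> s \<and> s \<le> h \<and> 0 \<le> t \<and> t \<le> h \<and>
    U (x + h *\<^sub>R v + h *\<^sub>R w) - U (x + h *\<^sub>R v) - U (x + h *\<^sub>R w) + U x = h\<^sup>2 * H (x + s *\<^sub>R v + t *\<^sub>R w) w v"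
proof -
  define g where "g s = U (x + h *\<^sub>R w + s *\<^sub>R v) - U (x + s *\<^sub>R v)" for s
  have "\<exists>s>0. s < h \<and> g h - g 0 = (h - 0) * (DU (x + h *\<^sub>R w + s *\<^sub>R v) v - DU (x + s *\<^sub>R v) v)"
  proof (rule MVT2[OF h])
    fix s assume s: "0 \<le> s" "s \<le> h"
    have "x + h *\<^sub>R w + s *\<^sub>R v \<in> S" "x + s *\<^sub>R v \<in> S"
      using sub[of s h] sub[of s 0] s h by (simp_all add: add_ac)
    then show "DERIV g s :> DU (x + h *\<^sub>R w + s *\<^sub>R v) v - DU (x + s *\<^sub>R v) v"
      unfolding g_def by (intro DERIV_diff line_derivative)
  qed
  then obtain s where s: "0 < s" "s < h" "g h - g 0 = h * (DU (x + h *\<^sub>R w + s *\<^sub>R v) v - DU (x + s *\<^sub>R v) v)" by auto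
  have "\<exists>t>0. t < h \<and> DU (x + s *\<^sub>R v + h *\<^sub>R w) v - DU (x + s *\<^sub>R v + 0 *\<^sub>R w) v = (h - 0) * H (x + s *\<^sub>R v + t *\<^sub>R w) w v"
    by (rule MVT2[OF h], rule line_derivative) (use sub s in auto)
  then obtain t where t: "0 < t" "t < h" "DU (x + s *\<^sub>R v + h *\<^sub>R w) v - DU (x + s *\<^sub>R v) v = h * H (x + s *\<^sub>R v + t *\<^sub>R w) w v" by auto
  have "g h - g 0 = h\<^sup>2 * H (x + s *\<^sub>R v + t *\<^sub>R w) w v"
    using s(3) t(3) by (simp add: add_ac power2_eq_square)
  then show ?thesis using s t by (intro exI[of _ s] exI[of _ t]) (auto simp: g_def add_ac)
qed

lemma H_symmetric:
  assumes x: "x \<in> S"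
  shows "H x v w = H x w v"
proof (rule ccontr)
  assume ne: "H x v w \<noteq> H x w v"
  define e where "e = \<bar>H x v w - H x w v\<bar> / 2"
  have e: "e > 0" using ne by (simp add: e_def)
  have "isCont (\<lambda>y. H y v w) x" "isCont (\<lambda>y. H y w v) x"
    using unfold_C2(3) x continuous_on_eq_continuous_at[OF open_S] by blast+
  then have "\<exists>d>0. \<forall>y. dist y x < d \<longrightarrow> \<bar>H y v w - H x v w\<bar> < e"
    "\<exists>d>0. \<forall>y. dist y x < d \<longrightarrow> \<bar>H y w v - H x w v\<bar> < e"
    using e unfolding continuous_at_eps_delta dist_real_def by blast+
  then obtain d1 d2 where d: "d1 > 0" "\<And>y. dist y x < d1 \<Longrightarrow> \<bar>H y v w - H x v w\<bar> < e"
    "d2 > 0" "\<And>y. dist y x < d2 \<Longrightarrow> \<bar>H y w v - H x w v\<bar> < e" by blast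
  obtain d3 where d3: "d3 > 0" "ball x d3 \<subseteq> S" using x open_S open_contains_ball by blast
  define d where "d = Min {d1, d2, d3}"
  have d0: "d > 0" "d \<le> d1" "d \<le> d2" "d \<le> d3" using d d3 by (auto simp: d_def)
  \<comment> \<open>Small enough for the parallelogram spanned by the two scaled directions to stay
    in the ball of radius \<open>d\<close>; the summand 1 keeps the denominator positive.\<close>
  define h where "h = d / (2 * (norm v + norm w + 1))"
  have h: "h > 0" unfolding h_def using d0 by (simp add: add_nonneg_pos)
  have near: "dist (x + s *\<^sub>R v + t *\<^sub>R w) x < d" if "0 \<le> s" "s \<le> h" "0 \<le> t" "t \<le> h" for s t
  proof -
    have "dist (x + s *\<^sub>R v + t *\<^sub>R w) x \<le> s * norm v + t * norm w"
      using norm_triangle_ineq[of "s *\<^sub>R v" "t *\<^sub>R w"] that by (simp add: dist_norm algebra_simps)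
    also have "\<dots> \<le> h * (norm v + norm w + 1)"
      using that h by (simp add: distrib_left add_mono mult_right_mono)
        (smt (verit) mult_right_mono norm_ge_zero)
    also have "\<dots> = d / 2"
      unfolding h_def using add_nonneg_pos[of "norm v + norm w" 1] by (simp add: field_simps)
    also have "\<dots> < d" using d0 by simp
    finally show ?thesis .
  qed
  have inS: "x + s *\<^sub>R v + t *\<^sub>R w \<in> S" if "0 \<le> s" "s \<le> h" "0 \<le> t" "t \<le> h" for s t
    using near[OF that] d0 d3 by (auto simp: dist_commute)
  obtain s t where 1: "0 \<le> s" "s \<le> h" "0 \<le> t" "t \<le> h" "U (x + h *\<^sub>R v + h *\<^sub>R w) - U (x + h *\<^sub>R v) - U (x + h *\<^sub>R w) + U x = h\<^sup>2 * H (x + s *\<^sub>R v + t *\<^sub>R w) w v"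
    using second_difference[OF h inS] by blast
  have inS': "x + s *\<^sub>R w + t *\<^sub>R v \<in> S" if "0 \<le> s" "s \<le> h" "0 \<le> t" "t \<le> h" for s t
    using inS[of t s] that by (simp add: add_ac)
  obtain s' t' where 2: "0 \<le> s'" "s' \<le> h" "0 \<le> t'" "t' \<le> h" "U (x + h *\<^sub>R w + h *\<^sub>R v) - U (x + h *\<^sub>R w) - U (x + h *\<^sub>R v) + U x = h\<^sup>2 * H (x + s' *\<^sub>R w + t' *\<^sub>R v) v w"
    using second_difference[OF h inS'] by blast
  have "h\<^sup>2 * H (x + s *\<^sub>R v + t *\<^sub>R w) w v = h\<^sup>2 * H (x + t' *\<^sub>R v + s' *\<^sub>R w) v w"
  proof -
    have c: "x + a + b = x + b + a" for a b by simp
    show ?thesis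
      using 1(5) 2(5) unfolding c[of "h *\<^sub>R w" "h *\<^sub>R v"] c[of "s' *\<^sub>R w" "t' *\<^sub>R v"] by linarith
  qed
  then have eq: "H (x + s *\<^sub>R v + t *\<^sub>R w) w v = H (x + t' *\<^sub>R v + s' *\<^sub>R w) v w" using h by simp
  have "\<bar>H (x + s *\<^sub>R v + t *\<^sub>R w) w v - H x w v\<bar> < e" "\<bar>H (x + t' *\<^sub>R v + s' *\<^sub>R w) v w - H x v w\<bar> < e"
    using d(2,4) near 1 2 d0 by (meson less_le_trans)+
  then show False using eq unfolding e_def by (auto simp: abs_if split: if_splits)
qed

lemma H_sum:
  assumes "x \<in> S"
  shows "H x p q = (\<Sum>b\<in>Basis. \<Sum>c\<in>Basis. (p \<bullet> b) * (q \<bullet> c) * H x b c)"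
proof -
  have "H x p q = H x (\<Sum>b\<in>Basis. (p \<bullet> b) *\<^sub>R b) (\<Sum>c\<in>Basis. (q \<bullet> c) *\<^sub>R c)"
    by (simp add: euclidean_representation)
  also have "\<dots> = (\<Sum>b\<in>Basis. (p \<bullet> b) * H x b (\<Sum>c\<in>Basis. (q \<bullet> c) *\<^sub>R c))"
    by (subst linear_sum[OF linear_H1[OF assms]]) (simp add: linear_scale[OF linear_H1[OF assms]])
  also have "\<dots> = (\<Sum>b\<in>Basis. \<Sum>c\<in>Basis. (p \<bullet> b) * (q \<bullet> c) * H x b c)"
    by (subst linear_sum[OF linear_H2[OF assms]])
       (simp add: linear_scale[OF linear_H2[OF assms]] sum_distrib_left mult.assoc)
  finally show ?thesis .
qed

lemma H_close:
  assumes x: "x \<in> S" and e: "e > 0"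
  obtains d where "d > 0" "ball x d \<subseteq> S" "\<And>y p. dist y x < d \<Longrightarrow> \<bar>H y p p - H x p p\<bar> \<le> e * (norm p)\<^sup>2"
proof -
  \<comment> \<open>The number of pairs of basis vectors, among which the error \<open>e\<close> is
    divided.\<close>
  define N where "N = (real DIM('a))\<^sup>2"
  have N: "N > 0" by (simp add: N_def)
  have "\<exists>d>0. \<forall>y. dist y x < d \<longrightarrow> \<bar>H y b c - H x b c\<bar> < e / N" for b c
  proof -
    have "isCont (\<lambda>y. H y b c) x"
      using unfold_C2(3) x continuous_on_eq_continuous_at[OF open_S] by blast
    moreover have "e / N > 0" using e N by simp
    ultimately show ?thesis unfolding continuous_at_eps_delta dist_real_def by blast
  qed
  then obtain \<delta> where \<delta>: "\<And>b c. \<delta> b c > 0" "\<And>b c y. dist y x < \<delta> b c \<Longrightarrow> \<bar>H y b c - H x b c\<bar> < e / N" by metis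
  obtain d3 where d3: "d3 > 0" "ball x d3 \<subseteq> S" using x open_S open_contains_ball by blast
  define d where "d = Min (insert d3 ((\<lambda>(b,c). \<delta> b c) ` (Basis \<times> Basis)))"
  have d: "d > 0" "d \<le> d3"
    unfolding d_def using \<delta>(1) d3 by (auto intro!: Min_le)
  have d': "d \<le> \<delta> b c" if "b \<in> Basis" "c \<in> Basis" for b c
    unfolding d_def using that by (intro Min_le) force+
  have "\<bar>H y p p - H x p p\<bar> \<le> e * (norm p)\<^sup>2" if y: "dist y x < d" for y p
  proof -
    have yS: "y \<in> S" using y d d3 by (auto simp: dist_commute)
    have "\<bar>H y p p - H x p p\<bar> = \<bar>\<Sum>b\<in>Basis. \<Sum>c\<in>Basis. (p \<bullet> b) * (p \<bullet> c) * (H y b c - H x b c)\<bar>"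
      unfolding H_sum[OF yS, of p p] H_sum[OF x, of p p] by (simp add: sum_subtractf right_diff_distrib)
    also have "\<dots> \<le> (\<Sum>b\<in>Basis. \<Sum>c\<in>Basis. \<bar>(p \<bullet> b) * (p \<bullet> c) * (H y b c - H x b c)\<bar>)"
      by (rule order_trans[OF sum_abs sum_mono[OF sum_abs]])
    also have "\<dots> \<le> (\<Sum>b\<in>(Basis::'a set). \<Sum>c\<in>(Basis::'a set). norm p * norm p * (e / N))"
    proof (intro sum_mono)
      fix b c :: 'a assume b: "b \<in> Basis" "c \<in> Basis"
      have "\<bar>H y b c - H x b c\<bar> \<le> e / N" using \<delta>(2)[of y b c] d'[OF b] y by simp
      then show "\<bar>(p \<bullet> b) * (p \<bullet> c) * (H y b c - H x b c)\<bar> \<le> norm p * norm p * (e / N)"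
        unfolding abs_mult using b by (intro mult_mono) (auto simp: Basis_le_norm)
    qed
    also have "\<dots> = e * (norm p)\<^sup>2"
      using N by (simp add: N_def power2_eq_square)
    finally show ?thesis .
  qed
  then show ?thesis using that d d3 by (meson subset_ball subset_trans)
qed

lemma DU_continuous: "continuous_on S (\<lambda>x. DU x v)"
  using unfold_C2(2) open_S
  by (auto simp: continuous_on_eq_continuous_at intro!: differentiable_imp_continuous_within)

end

section \<open>Sublevel sets near points of the sphere\<close>

text \<open>Induction on the dimension: split off a vector with \<open>B e e\<close> nonzero and
  continue in its \<open>B\<close>-orthogonal complement. If there is none, \<open>B\<close>
  vanishes on \<open>T\<close> by polarization and any basis will do.\<close>

lemma B_orthogonal_basis:
  fixes T :: "'a::euclidean_space set" and B :: "'a \<Rightarrow> 'a \<Rightarrow> real"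
  assumes "subspace T" and l: "\<And>w. linear (\<lambda>v. B v w)" and sym: "\<And>v w. B v w = B w v"
  shows "\<exists>E. finite E \<and> independent E \<and> span E = T \<and> (\<forall>e\<in>E. \<forall>e'\<in>E. e \<noteq> e' \<longrightarrow> B e e' = 0)"
  using assms(1)
proof (induction "dim T" arbitrary: T rule: less_induct)
  case less
  have r: "B w (a + b) = B w a + B w b" "B w (c *\<^sub>R a) = c * B w a" "B (a + b) w = B a w + B b w"
    "B (c *\<^sub>R a) w = c * B a w" "B (a - b) w = B a w - B b w" for a b c w
    using linear_add[OF l] linear_scale[OF l] linear_diff[OF l] sym by (metis real_scaleR_def)+
  show ?case
  proof (cases "\<exists>e\<in>T. B e e \<noteq> 0")
    case False
    have "B v w = 0" if "v \<in> T" "w \<in> T" for v w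
    proof -
      have "B (v + w) (v + w) = 0" "B v v = 0" "B w w = 0"
        using False that subspace_add[OF less.prems] by auto
      then show ?thesis using sym[of v w] by (simp add: r)
    qed
    moreover obtain E where "E \<subseteq> T" "independent E" "T \<subseteq> span E" using basis_exists[of T] by metis
    moreover have "span E \<subseteq> T" using \<open>E \<subseteq> T\<close> less.prems span_minimal by blast
    ultimately show ?thesis using independent_bound by (metis subset_antisym subsetD)
  next
    case True
    then obtain e where e: "e \<in> T" "B e e \<noteq> 0" by blast
    define T' where "T' = {v\<in>T. B v e = 0}"
    have T': "subspace T'" unfolding T'_def using less.prems
      by (auto simp: subspace_def r linear_0[OF l])
    have "T' \<subset> T" using e by (auto simp: T'_def)
    then have "dim T' < dim T" using T' less.prems dim_psubset by (metis span_eq_iff)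
    then obtain E where E: "finite E" "independent E" "span E = T'" "\<forall>a\<in>E. \<forall>b\<in>E. a \<noteq> b \<longrightarrow> B a b = 0"
      using less.hyps T' by blast
    have ET': "E \<subseteq> T'" using E span_superset by blast
    have "e \<notin> span E" using e E by (simp add: T'_def)
    then have "independent (insert e E)" using E independent_insertI by blast
    moreover have "span (insert e E) = T"
    proof
      show "span (insert e E) \<subseteq> T" using ET' e less.prems by (intro span_minimal) (auto simp: T'_def)
      show "T \<subseteq> span (insert e E)"
      proof
        fix v assume v: "v \<in> T"
        have "v - (B v e / B e e) *\<^sub>R e \<in> T'"
          using v e less.prems by (simp add: T'_def r subspace_diff subspace_scale)
        then show "v \<in> span (insert e E)" using E(3) by (auto simp: span_insert)
      qed
    qed
    moreover have "\<forall>a\<in>insert e E. \<forall>b\<in>insert e E. a \<noteq> b \<longrightarrow> B a b = 0"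
    proof -
      have 1: "B a e = 0" if "a \<in> E" for a using ET' that by (auto simp: T'_def)
      then have "B e a = 0" if "a \<in> E" for a using that sym by metis
      then show ?thesis using E(4) 1 by blast
    qed
    ultimately show ?thesis using E(1) by (metis finite_insert)
  qed
qed

text \<open>Sylvester's decomposition: \<open>N\<close> and \<open>P\<close> are spanned by the
  basis vectors of negative and of positive square, and nondegeneracy excludes square zero. The
  projections \<open>n\<close> and \<open>p\<close> later define box neighbourhoods.\<close>

lemma definite_split:
  fixes T :: "'a::euclidean_space set" and B :: "'a \<Rightarrow> 'a \<Rightarrow> real"
  assumes T: "subspace T" and l: "\<And>w. linear (\<lambda>v. B v w)" and sym: "\<And>v w. B v w = B w v"
    and nd: "\<And>v. v \<in> T \<Longrightarrow> (\<And>w. w \<in> T \<Longrightarrow> B v w = 0) \<Longrightarrow> v = 0"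
  obtains N P n p where "subspace N" "subspace P" "N \<subseteq> T" "P \<subseteq> T" "linear n" "linear p"
    "\<And>v. v \<in> T \<Longrightarrow> n v \<in> N" "\<And>v. v \<in> T \<Longrightarrow> p v \<in> P" "\<And>v. v \<in> T \<Longrightarrow> n v + p v = v"
    "\<And>v. v \<in> N \<Longrightarrow> v \<noteq> 0 \<Longrightarrow> B v v < 0" "\<And>v. v \<in> P \<Longrightarrow> v \<noteq> 0 \<Longrightarrow> B v v > 0"
    "dim N + dim P = dim T"
proof -
  obtain E where E: "finite E" "independent E" "span E = T" "\<forall>e\<in>E. \<forall>e'\<in>E. e \<noteq> e' \<longrightarrow> B e e' = 0"
    using B_orthogonal_basis[of T B] T l sym by blast
  have l2: "linear (\<lambda>w. B v w)" for v using l[of v] sym by (simp add: sym)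
  have BE: "B e e \<noteq> 0" if e: "e \<in> E" for e
  proof
    assume z: "B e e = 0"
    have "B e w = 0" if "w \<in> T" for w
    proof (rule linear_eq_0_on_span[OF l2])
      show "B e x = 0" if "x \<in> E" for x using z E(4) e that by metis
      show "w \<in> span E" using that E by simp
    qed
    then have "e = 0" using nd E span_base e by blast
    then show False using E(2) e dependent_zero by blast
  qed
  have diag: "B (\<Sum>e\<in>F. u e *\<^sub>R e) (\<Sum>e\<in>F. u e *\<^sub>R e) = (\<Sum>e\<in>F. (u e)\<^sup>2 * B e e)" if F: "F \<subseteq> E" for F u
  proof -
    have fF: "finite F" using F E finite_subset by blast
    have "B (\<Sum>e\<in>F. u e *\<^sub>R e) (\<Sum>e\<in>F. u e *\<^sub>R e) = (\<Sum>e\<in>F. u e * (\<Sum>e'\<in>F. u e' * B e e'))"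
      unfolding linear_sum[OF l] linear_sum[OF l2] linear_scale[OF l] linear_scale[OF l2] real_scaleR_def
      by (intro sum.cong refl arg_cong2[where f = "(*)"] sym)
    also have "\<dots> = (\<Sum>e\<in>F. u e * (u e * B e e))"
    proof (rule sum.cong[OF refl])
      fix e assume e: "e \<in> F"
      have "(\<Sum>e'\<in>F. u e' * B e e') = (\<Sum>e'\<in>F. if e' = e then u e * B e e else 0)"
      proof (rule sum.cong[OF refl])
        fix e' assume "e' \<in> F"
        then have "e' \<noteq> e \<Longrightarrow> B e e' = 0" using E(4)[rule_format, of e e'] F e by auto
        then show "u e' * B e e' = (if e' = e then u e * B e e else 0)" by simp
      qed
      then show "u e * (\<Sum>e'\<in>F. u e' * B e e') = u e * (u e * B e e)" using fF e by simp
    qed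
    finally show ?thesis by (simp add: power2_eq_square mult.assoc)
  qed
  have pos: "(\<Sum>e\<in>F. (u e)\<^sup>2 * \<bar>B e e\<bar>) > 0" if "F \<subseteq> E" "(\<Sum>e\<in>F. u e *\<^sub>R e) \<noteq> 0" for F u
  proof -
    have fF: "finite F" using that E finite_subset by blast
    have "\<exists>e\<in>F. u e \<noteq> 0"
    proof (rule ccontr)
      assume "\<not> ?thesis"
      then show False using that by (simp add: sum.neutral)
    qed
    then obtain e where e: "e \<in> F" "u e \<noteq> 0" by blast
    show ?thesis by (rule sum_pos2[OF fF e(1)]) (use e BE that in auto)
  qed
  define En where "En = {e\<in>E. B e e < 0}"
  define Ep where "Ep = {e\<in>E. \<not> B e e < 0}"
  have EE: "En \<union> Ep = E" "En \<inter> Ep = {}" "En \<subseteq> E" "Ep \<subseteq> E" by (auto simp: En_def Ep_def)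
  then have fin: "finite En" "finite Ep" using E finite_subset by blast+
  have ind: "independent En" "independent Ep" using E(2) EE independent_mono by blast+
  obtain n :: "'a \<Rightarrow> 'a" where n: "linear n" "\<And>e. e \<in> E \<Longrightarrow> n e = (if B e e < 0 then e else 0)"
    using linear_independent_extend[OF E(2), of "\<lambda>e. if B e e < 0 then e else 0"] by blast
  define p where "p v = v - n v" for v
  have p: "linear p" unfolding p_def using n(1) by (intro linear_compose_sub) (auto simp: linear_id[unfolded id_def])
  have sub: "span En \<subseteq> T" "span Ep \<subseteq> T" using EE E span_mono by metis+
  show ?thesis
  proof (rule that[of "span En" "span Ep" n p])
    show "n v \<in> span En" if "v \<in> T" for v
    proof -
      have "n ` span E \<subseteq> span En"
        unfolding linear_span_image[OF n(1), symmetric]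
        by (intro span_minimal) (auto simp: n(2) En_def span_base span_zero)
      then show ?thesis using that E by blast
    qed
    show "p v \<in> span Ep" if "v \<in> T" for v
    proof -
      have "p ` span E \<subseteq> span Ep"
        unfolding linear_span_image[OF p, symmetric]
        by (intro span_minimal) (auto simp: n(2) p_def Ep_def span_base span_zero)
      then show ?thesis using that E by blast
    qed
    show "B v v < 0" if v: "v \<in> span En" "v \<noteq> 0" for v
    proof -
      obtain u where u: "v = (\<Sum>e\<in>En. u e *\<^sub>R e)" using v(1) fin unfolding span_finite[OF fin(1)] by auto
      have "B v v = (\<Sum>e\<in>En. (u e)\<^sup>2 * B e e)" unfolding u by (rule diag[OF EE(3)])
      also have "\<dots> = - (\<Sum>e\<in>En. (u e)\<^sup>2 * \<bar>B e e\<bar>)"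
        unfolding sum_negf[symmetric] by (rule sum.cong) (auto simp: En_def)
      also have "\<dots> < 0" using pos[OF EE(3)] v(2) u by simp
      finally show ?thesis .
    qed
    show "B v v > 0" if v: "v \<in> span Ep" "v \<noteq> 0" for v
    proof -
      obtain u where u: "v = (\<Sum>e\<in>Ep. u e *\<^sub>R e)" using v(1) fin unfolding span_finite[OF fin(2)] by auto
      have "B v v = (\<Sum>e\<in>Ep. (u e)\<^sup>2 * B e e)" unfolding u by (rule diag[OF EE(4)])
      also have "\<dots> = (\<Sum>e\<in>Ep. (u e)\<^sup>2 * \<bar>B e e\<bar>)" by (rule sum.cong) (auto simp: Ep_def)
      also have "\<dots> > 0" using pos[OF EE(4)] v(2) u by simp
      finally show ?thesis .
    qed
    have "dim (span En) = card En" "dim (span Ep) = card Ep" "dim T = card E"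
      using ind E dim_span_eq_card_independent by metis+
    then show "dim (span En) + dim (span Ep) = dim T" using card_Un_disjoint[OF fin EE(2)] EE(1) by simp
  qed (use n p sub in \<open>auto simp: p_def\<close>)
qed

text \<open>Takes the place of a deformation retraction onto \<open>C\<close>: each point reaches
  \<open>C\<close> along a segment inside \<open>K\<close>.\<close>

lemma connected_with_core:
  fixes K :: "'a::real_normed_vector set"
  assumes C: "connected C" "C \<subseteq> K" and seg: "\<And>x. x \<in> K \<Longrightarrow> \<exists>y\<in>C. closed_segment x y \<subseteq> K"
  shows "connected K"
proof (cases "C = {}")
  case True
  then have "K = {}" using seg by blast
  then show ?thesis by simp
next
  case False
  then obtain c where c: "c \<in> C" by blast
  have "connected_component K x c" if x: "x \<in> K" for x
  proof -
    obtain y where y: "y \<in> C" "closed_segment x y \<subseteq> K" using seg[OF x] by blast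
    have "connected (closed_segment x y \<union> C)"
      using y by (intro connected_Un C(1)) auto
    then show ?thesis unfolding connected_component_def using y C c
      by (intro exI[of _ "closed_segment x y \<union> C"]) auto
  qed
  then show ?thesis unfolding connected_iff_connected_component
    by (meson connected_component_sym connected_component_trans)
qed

text \<open>Dimension 0 is included because the set is then empty. Only in dimension 1 does removing
  the origin disconnect, which is why only saddles of index 1 merge components.\<close>

lemma connected_punctured_subspace:
  fixes N :: "'a::euclidean_space set"
  assumes N: "subspace N" "dim N \<noteq> 1" and r: "r > 0"
  shows "connected {m\<in>N. m \<noteq> 0 \<and> norm m < r}"
proof -
  have "aff_dim (N \<inter> ball 0 r) = aff_dim N"
  proof (rule aff_dim_convex_Int_open)
    have "0 \<in> N \<inter> ball 0 r" using N(1) r by (simp add: subspace_0)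
    then show "N \<inter> ball 0 r \<noteq> {}" by blast
  qed (use N in \<open>auto simp: subspace_imp_convex\<close>)
  then have "aff_dim (N \<inter> ball 0 r) \<noteq> 1" using N by (simp add: aff_dim_subspace)
  moreover have "convex (N \<inter> ball 0 r)" using N by (simp add: convex_Int subspace_imp_convex)
  ultimately have "connected (N \<inter> ball 0 r - {0})" by (rule connected_punctured_convex[rotated])
  moreover have "N \<inter> ball 0 r - {0} = {m\<in>N. m \<noteq> 0 \<and> norm m < r}" by auto
  ultimately show ?thesis by simp
qed

lemma punctured_line_halves:
  fixes N :: "'a::euclidean_space set"
  assumes N: "subspace N" "dim N = 1" and r: "r > 0"
  obtains C1 C2 where "connected C1" "connected C2" "C1 \<union> C2 = {m\<in>N. m \<noteq> 0 \<and> norm m < r}"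
proof -
  obtain e where e: "e \<noteq> 0" "N = span {e}"
  proof -
    obtain E where E: "E \<subseteq> N" "independent E" "N \<subseteq> span E" "card E = dim N" using basis_exists by blast
    obtain e where e: "E = {e}" using E(4) N(2) card_1_singletonE by metis
    have "e \<noteq> 0" using E(2) e by auto
    moreover have "N = span {e}" using E e N(1) by (simp add: span_minimal subset_antisym)
    ultimately show ?thesis using that by blast
  qed
  have eq: "(\<lambda>t. t *\<^sub>R e) ` {0<..<r / norm e} \<union> (\<lambda>t. t *\<^sub>R e) ` {- (r / norm e)<..<0} = {m\<in>N. m \<noteq> 0 \<and> norm m < r}"
    (is "?A \<union> ?B = ?C")
  proof (intro set_eqI iffI)
    fix x assume "x \<in> ?A \<union> ?B"
    then obtain t where "x = t *\<^sub>R e" "t \<in> {0<..<r / norm e} \<union> {- (r / norm e)<..<0}" by blast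
    then have t: "x = t *\<^sub>R e" "t \<noteq> 0" "\<bar>t\<bar> < r / norm e" by auto
    then have "\<bar>t\<bar> * norm e < r" using e(1) by (simp add: pos_less_divide_eq)
    then show "x \<in> ?C" using t e unfolding e(2) by (simp add: span_base span_scale)
  next
    fix x assume x: "x \<in> ?C"
    then obtain t where t: "x = t *\<^sub>R e" unfolding e(2) span_singleton by blast
    have "t \<noteq> 0" using x t by auto
    moreover have "\<bar>t\<bar> < r / norm e" using x e(1) t by (simp add: pos_less_divide_eq)
    ultimately have "t \<in> {0<..<r / norm e} \<union> {- (r / norm e)<..<0}" by (auto simp: abs_if split: if_splits)
    then show "x \<in> ?A \<union> ?B" unfolding t image_Un[symmetric] by (rule imageI)
  qed
  have "connected ((\<lambda>t. t *\<^sub>R e) ` {a<..<b})" for a b :: real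
    by (intro connected_continuous_image continuous_intros) (simp add: convex_connected)
  then show ?thesis using that eq by blast
qed

section \<open>Local shape of sublevel sets of functions that are constant along rays\<close>

locale radial = C2 "- {0}" U for U :: "'a::euclidean_space \<Rightarrow> real" +
  assumes homog: "\<And>r x. r > 0 \<Longrightarrow> x \<noteq> 0 \<Longrightarrow> U (r *\<^sub>R x) = U x"
begin

definition T where "T z = {v. v \<bullet> z = 0}"

text \<open>Central projection of the affine tangent plane to the sphere. As \<open>U\<close> is
  constant along rays, its value at \<open>chart z v\<close> is \<open>U (z + v)\<close>, and the
  local analysis takes place in a vector space.\<close>

definition chart where "chart z v = (z + v) /\<^sub>R norm (z + v)"

lemma T_subspace: "subspace (T z)"
  by (auto simp: T_def subspace_def inner_add_left)

lemma chart_nonzero: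
  assumes "norm z = 1" "v \<in> T z"
  shows "z + v \<noteq> 0"
proof
  assume "z + v = 0"
  then have "(z + v) \<bullet> z = 0" by simp
  then show False using assms by (simp add: T_def inner_add_left dot_square_norm)
qed

lemma chart_U: "norm z = 1 \<Longrightarrow> v \<in> T z \<Longrightarrow> U (chart z v) = U (z + v)"
  unfolding chart_def using homog[of "inverse (norm (z + v))" "z + v"] chart_nonzero[of z v] by simp

lemma chart_sphere: "norm z = 1 \<Longrightarrow> v \<in> T z \<Longrightarrow> chart z v \<in> sphere 0 1"
  using chart_nonzero[of z v] by (simp add: chart_def)

lemma chart_continuous: "norm z = 1 \<Longrightarrow> continuous_on (T z) (chart z)"
  unfolding chart_def by (intro continuous_intros) (simp add: chart_nonzero)

lemma chart_nbhd:
  assumes z: "norm z = 1" and O: "open O'" "0 \<in> O'"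
  obtains N where "open N" "z \<in> N" "\<And>x. x \<in> N \<Longrightarrow> norm x = 1 \<Longrightarrow> \<exists>v\<in>T z \<inter> O'. x = chart z v"
proof -
  define A where "A = {x. x \<bullet> z > 0}"
  have A: "open A" unfolding A_def by (intro open_Collect_less continuous_intros)
  \<comment> \<open>The inverse of the central projection, on the open half space around
    \<open>z\<close>.\<close>
  define \<phi> where "\<phi> x = x /\<^sub>R (x \<bullet> z) - z" for x
  have "continuous_on A \<phi>" unfolding \<phi>_def A_def by (auto intro!: continuous_intros)
  then have "open (A \<inter> \<phi> -` O')" using A O(1) continuous_open_preimage by blast
  moreover have zz: "z \<bullet> z = 1" using z by (simp add: dot_square_norm)
  moreover have "z \<in> A \<inter> \<phi> -` O'" using O zz by (simp add: A_def \<phi>_def)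
  moreover have "\<exists>v\<in>T z \<inter> O'. x = chart z v" if x: "x \<in> A \<inter> \<phi> -` O'" "norm x = 1" for x
  proof
    have "x \<bullet> z > 0" using x by (simp add: A_def)
    then show "\<phi> x \<in> T z \<inter> O'" using x zz by (simp add: T_def \<phi>_def inner_diff_left)
    show "x = chart z (\<phi> x)" using \<open>x \<bullet> z > 0\<close> x(2) by (simp add: chart_def \<phi>_def)
  qed
  ultimately show ?thesis using that by blast
qed

lemma tame_by_chart:
  assumes z: "norm z = 1" and O: "open O'" "0 \<in> O'"
    and K: "connected K" "{v\<in>T z \<inter> O'. U (z + v) < U z} \<subseteq> K" "K \<subseteq> {v\<in>T z. U (z + v) < U z}"
  shows "tame (sphere 0 1) U z"
proof -
  obtain N where N: "open N" "z \<in> N" "\<And>x. x \<in> N \<Longrightarrow> norm x = 1 \<Longrightarrow> \<exists>v\<in>T z \<inter> O'. x = chart z v"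
    using chart_nbhd[OF z O] by blast
  have "connected (chart z ` K)"
    using K chart_continuous[OF z] by (intro connected_continuous_image) (auto elim: continuous_on_subset)
  moreover have "N \<inter> sublevel (sphere 0 1) U (U z) \<subseteq> chart z ` K"
  proof
    fix x assume x: "x \<in> N \<inter> sublevel (sphere 0 1) U (U z)"
    then obtain v where v: "v \<in> T z \<inter> O'" "x = chart z v" using N by (auto simp: sublevel_def)
    then have "v \<in> K" using x K(2) chart_U[OF z] by (auto simp: sublevel_def)
    then show "x \<in> chart z ` K" using v by blast
  qed
  moreover have "chart z ` K \<subseteq> sublevel (sphere 0 1) U (U z)"
    using K(3) chart_U[OF z] chart_sphere[OF z] by (auto simp: sublevel_def)
  ultimately show ?thesis unfolding tame_def using N by blast
qed

lemma bitame_by_chart: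
  assumes z: "norm z = 1" and O: "open O'" "0 \<in> O'"
    and K: "connected K" "connected L" "{v\<in>T z \<inter> O'. U (z + v) < U z} \<subseteq> K \<union> L"
      "K \<union> L \<subseteq> {v\<in>T z. U (z + v) < U z}"
  shows "bitame (sphere 0 1) U z"
proof -
  obtain N where N: "open N" "z \<in> N" "\<And>x. x \<in> N \<Longrightarrow> norm x = 1 \<Longrightarrow> \<exists>v\<in>T z \<inter> O'. x = chart z v"
    using chart_nbhd[OF z O] by blast
  have "connected (chart z ` K)" "connected (chart z ` L)"
    using K chart_continuous[OF z] by (intro connected_continuous_image; auto elim: continuous_on_subset)+
  moreover have "N \<inter> sublevel (sphere 0 1) U (U z) \<subseteq> chart z ` K \<union> chart z ` L"
  proof
    fix x assume x: "x \<in> N \<inter> sublevel (sphere 0 1) U (U z)"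
    then obtain v where v: "v \<in> T z \<inter> O'" "x = chart z v" using N by (auto simp: sublevel_def)
    then have "v \<in> K \<union> L" using x K(3) chart_U[OF z] by (auto simp: sublevel_def)
    then show "x \<in> chart z ` K \<union> chart z ` L" using v by blast
  qed
  moreover have "chart z ` K \<union> chart z ` L \<subseteq> sublevel (sphere 0 1) U (U z)"
    using K(4) chart_U[OF z] chart_sphere[OF z] by (auto simp: sublevel_def)
  ultimately show ?thesis unfolding bitame_def using N by blast
qed

text \<open>A descent direction \<open>w\<close> pushes all nearby lower points to a small disc that
  lies entirely below the level of \<open>z\<close>; the region swept out is connected, with this
  disc as its core.\<close>

lemma tame_noncritical:
  assumes z: "norm z = 1" and v: "v \<in> T z" "DU z v \<noteq> 0"
  shows "tame (sphere 0 1) U z"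
proof -
  have zS: "z \<in> - {0}" using z by auto
  define w where "w = (if DU z v < 0 then v else - v)"
  have w: "w \<in> T z" "DU z w < 0"
    using v linear_neg[OF linear_DU[OF zS]] by (auto simp: w_def T_def)
  have w0: "w \<noteq> 0" using w linear_0[OF linear_DU[OF zS]] by auto
  have "isCont (\<lambda>x. DU x w) z"
    using DU_continuous zS open_S by (simp add: continuous_on_eq_continuous_at)
  then have "\<forall>\<^sub>F x in at z. DU x w < 0" using w(2) by (simp add: isCont_def order_tendstoD)
  then obtain d where d: "d > 0" "\<And>x. x \<noteq> z \<Longrightarrow> dist x z < d \<Longrightarrow> DU x w < 0"
    unfolding eventually_at by blast
  define \<rho> where "\<rho> = min d 1"
  have \<rho>: "\<rho> > 0" using d by (simp add: \<rho>_def)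
  have neg: "x \<in> - {0}" "DU x w < 0" if "dist x z < \<rho>" for x
    using that d w(2) z by (auto simp: \<rho>_def dist_norm, cases "x = z", auto)
  \<comment> \<open>The travel along \<open>w\<close> uses up half of the radius in which
    \<open>U\<close> decreases; the starting points stay within the other half.\<close>
  define \<sigma> where "\<sigma> = \<rho> / (2 * norm w)"
  have \<sigma>: "\<sigma> > 0" "\<sigma> * norm w = \<rho> / 2" using \<rho> w0 by (auto simp: \<sigma>_def)
  have dec: "U (x + b *\<^sub>R w) < U (x + a *\<^sub>R w)" if x: "dist x z < \<rho> / 2" "0 \<le> a" "a < b" "b \<le> \<sigma>" for x a b
  proof (rule DERIV_neg_imp_decreasing[OF x(3)])
    fix t assume t: "a \<le> t" "t \<le> b"
    have "dist (x + t *\<^sub>R w) z \<le> dist x z + t * norm w"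
      using norm_triangle_ineq[of "x - z" "t *\<^sub>R w"] t x by (simp add: dist_norm algebra_simps)
    also have "\<dots> < \<rho> / 2 + \<sigma> * norm w"
      using x t by (intro add_less_le_mono mult_right_mono) auto
    finally have *: "dist (x + t *\<^sub>R w) z < \<rho>" using \<sigma> by simp
    show "\<exists>y. ((\<lambda>a. U (x + a *\<^sub>R w)) has_real_derivative y) (at t) \<and> y < 0"
      using line_derivative(1)[OF neg(1)[OF *]] neg(2)[OF *] by blast
  qed
  have "U (z + \<sigma> *\<^sub>R w) < U z" using dec[of z 0 \<sigma>] \<rho> \<sigma> by simp
  moreover have "isCont U (z + \<sigma> *\<^sub>R w)"
    using has_derivative_continuous[OF has_derivative_U] chart_nonzero[OF z] w T_subspace subspace_scale
    by (metis Compl_iff singletonD)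
  ultimately have "\<forall>\<^sub>F x in nhds (z + \<sigma> *\<^sub>R w). U x < U z"
    unfolding isCont_def tendsto_at_iff_tendsto_nhds by (rule order_tendstoD(2)[rotated])
  then obtain e where e: "e > 0" "\<And>x. dist x (z + \<sigma> *\<^sub>R w) < e \<Longrightarrow> U x < U z"
    unfolding eventually_nhds_metric by blast
  define r where "r = min e (\<rho> / 2)"
  have r: "r > 0" "r \<le> e" "r \<le> \<rho> / 2" using e \<rho> by (auto simp: r_def)
  define K where "K = {u + s *\<^sub>R w |u s. u \<in> T z \<and> norm u < r \<and> 0 \<le> s \<and> s \<le> \<sigma> \<and> U (z + (u + s *\<^sub>R w)) < U z}"
  define C where "C = (\<lambda>u. u + \<sigma> *\<^sub>R w) ` (T z \<inter> ball 0 r)"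
  have "connected C" unfolding C_def
    by (intro connected_continuous_image continuous_intros convex_connected convex_Int
        subspace_imp_convex T_subspace convex_ball)
  moreover have "C \<subseteq> K"
  proof
    fix x assume "x \<in> C"
    then obtain u where u: "x = u + \<sigma> *\<^sub>R w" "u \<in> T z" "norm u < r" by (auto simp: C_def)
    have "U (z + (u + \<sigma> *\<^sub>R w)) < U z" using e(2)[of "z + (u + \<sigma> *\<^sub>R w)"] u r by (simp add: dist_norm)
    then show "x \<in> K" unfolding K_def using u \<sigma> by (intro CollectI exI[of _ u] exI[of _ \<sigma>]) auto
  qed
  moreover have "\<exists>y\<in>C. closed_segment x y \<subseteq> K" if x: "x \<in> K" for x
  proof -
    obtain u s where u: "x = u + s *\<^sub>R w" "u \<in> T z" "norm u < r" "0 \<le> s" "s \<le> \<sigma>" "U (z + (u + s *\<^sub>R w)) < U z"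
      using x by (auto simp: K_def)
    have "closed_segment x (u + \<sigma> *\<^sub>R w) \<subseteq> K"
    proof
      fix y assume "y \<in> closed_segment x (u + \<sigma> *\<^sub>R w)"
      then obtain t where t: "0 \<le> t" "t \<le> 1" "y = (1 - t) *\<^sub>R x + t *\<^sub>R (u + \<sigma> *\<^sub>R w)"
        by (auto simp: closed_segment_def)
      define s' where "s' = (1 - t) * s + t * \<sigma>"
      have y: "y = u + s' *\<^sub>R w" unfolding t(3) u(1) s'_def by (simp add: algebra_simps)
      have s': "s \<le> s'" "s' \<le> \<sigma>"
      proof -
        have "t * s \<le> t * \<sigma>" "(1 - t) * s \<le> (1 - t) * \<sigma>" using u t by (auto intro: mult_left_mono)
        then show "s \<le> s'" "s' \<le> \<sigma>" by (auto simp: s'_def algebra_simps)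
      qed
      have "U (z + u + s' *\<^sub>R w) \<le> U (z + u + s *\<^sub>R w)"
        using dec[of "z + u" s s'] s' u r by (cases "s = s'") (auto simp: dist_norm)
      then show "y \<in> K" unfolding K_def using u s' y
        by (intro CollectI exI[of _ u] exI[of _ s']) (auto simp: add_ac)
    qed
    moreover have "u + \<sigma> *\<^sub>R w \<in> C" using u by (auto simp: C_def)
    ultimately show ?thesis by blast
  qed
  ultimately have "connected K" by (rule connected_with_core)
  show ?thesis
  proof (rule tame_by_chart[OF z _ _ \<open>connected K\<close>, of "ball 0 r"])
    show "{v \<in> T z \<inter> ball 0 r. U (z + v) < U z} \<subseteq> K"
    proof
      fix v assume "v \<in> {v \<in> T z \<inter> ball 0 r. U (z + v) < U z}"
      then show "v \<in> K" unfolding K_def using \<sigma> by (intro CollectI exI[of _ v] exI[of _ 0]) auto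
    qed
    show "K \<subseteq> {v \<in> T z. U (z + v) < U z}"
      using w T_subspace by (auto simp: K_def intro: subspace_add subspace_scale)
  qed (use r in auto)
qed

text \<open>A substitute for the Morse lemma. In a small box \<open>U\<close> is below its central
  value along \<open>N\<close>, not below it along \<open>P\<close>, and convex in the directions of
  \<open>P\<close> throughout, so that a segment in such a direction stays below a level if its ends
  do. By compactness of the unit sphere the Hessian is bounded away from 0 on \<open>N\<close> and
  \<open>P\<close>, and the signs persist nearby.\<close>

lemma critical_box:
  assumes z: "norm z = 1" and crit: "\<And>v. v \<in> T z \<Longrightarrow> DU z v = 0"
    and N: "subspace N" "N \<subseteq> T z" "\<And>v. v \<in> N \<Longrightarrow> v \<noteq> 0 \<Longrightarrow> H z v v < 0"
    and P: "subspace P" "P \<subseteq> T z" "\<And>v. v \<in> P \<Longrightarrow> v \<noteq> 0 \<Longrightarrow> H z v v > 0"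
  obtains r where "r > 0"
    "\<And>m. m \<in> N \<Longrightarrow> m \<noteq> 0 \<Longrightarrow> norm m < r \<Longrightarrow> U (z + m) < U z"
    "\<And>q. q \<in> P \<Longrightarrow> norm q < r \<Longrightarrow> U (z + q) \<ge> U z"
    "\<And>m q t. m \<in> N \<Longrightarrow> q \<in> P \<Longrightarrow> norm m < r \<Longrightarrow> norm q < r \<Longrightarrow> U (z + m) < c \<Longrightarrow>
       U (z + m + q) < c \<Longrightarrow> 0 \<le> t \<Longrightarrow> t \<le> 1 \<Longrightarrow> U (z + m + t *\<^sub>R q) < c"
proof -
  have zS: "z \<in> - {0}" using z by auto
  have definite: "\<exists>\<kappa>>0. \<forall>v\<in>V. \<kappa> * (norm v)\<^sup>2 \<le> \<bar>H z v v\<bar>"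
    if V: "subspace V" "\<And>v. v \<in> V \<Longrightarrow> v \<noteq> 0 \<Longrightarrow> H z v v \<noteq> 0" for V
  proof (cases "V \<inter> sphere 0 1 = {}")
    case True
    have "v = 0" if "v \<in> V" for v
    proof (rule ccontr)
      assume "v \<noteq> 0"
      then have "v /\<^sub>R norm v \<in> V \<inter> sphere 0 1" using that V(1) by (simp add: subspace_scale)
      then show False using True by blast
    qed
    then have "1 * (norm v)\<^sup>2 \<le> \<bar>H z v v\<bar>" if "v \<in> V" for v using that by fastforce
    then show ?thesis using zero_less_one by blast
  next
    case False
    have "compact (V \<inter> sphere 0 1)" by (intro closed_Int_compact closed_subspace V(1) compact_sphere)
    moreover have "continuous_on UNIV (\<lambda>v. H z v v)"
    proof -
      have "(\<lambda>v. H z v v) = (\<lambda>v. \<Sum>b\<in>Basis. \<Sum>c\<in>Basis. (v \<bullet> b) * (v \<bullet> c) * H z b c)"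
        by (intro ext H_sum[OF zS])
      then show ?thesis by (simp only:) (intro continuous_intros)
    qed
    then have "continuous_on (V \<inter> sphere 0 1) (\<lambda>v. \<bar>H z v v\<bar>)"
      by (intro continuous_intros) (auto elim: continuous_on_subset)
    ultimately obtain u where u: "u \<in> V \<inter> sphere 0 1" "\<And>v. v \<in> V \<inter> sphere 0 1 \<Longrightarrow> \<bar>H z u u\<bar> \<le> \<bar>H z v v\<bar>"
      using continuous_attains_inf[OF _ False] by blast
    have "\<bar>H z u u\<bar> * (norm v)\<^sup>2 \<le> \<bar>H z v v\<bar>" if "v \<in> V" for v
    proof (cases "v = 0")
      case True
      then show ?thesis using linear_0[OF linear_H1[OF zS]] by simp
    next
      case False
      then have "\<bar>H z u u\<bar> \<le> \<bar>H z (v /\<^sub>R norm v) (v /\<^sub>R norm v)\<bar>"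
        using that V(1) by (intro u(2)) (simp add: subspace_scale)
      also have "H z (v /\<^sub>R norm v) (v /\<^sub>R norm v) = H z v v / (norm v)\<^sup>2"
        unfolding linear_scale[OF linear_H1[OF zS]] linear_scale[OF linear_H2[OF zS]]
        by (simp add: power2_eq_square divide_inverse)
      finally show ?thesis using False by (simp add: field_simps abs_divide)
    qed
    moreover have "\<bar>H z u u\<bar> > 0"
    proof -
      have "u \<noteq> 0" using u(1) by auto
      then show ?thesis using u(1) V(2)[of u] by simp
    qed
    ultimately show ?thesis by blast
  qed
  obtain \<kappa>1 where k1: "\<kappa>1 > 0" "\<And>v. v \<in> N \<Longrightarrow> \<kappa>1 * (norm v)\<^sup>2 \<le> \<bar>H z v v\<bar>"
    using definite[of N] N by (metis less_irrefl)
  obtain \<kappa>2 where k2: "\<kappa>2 > 0" "\<And>v. v \<in> P \<Longrightarrow> \<kappa>2 * (norm v)\<^sup>2 \<le> \<bar>H z v v\<bar>"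
    using definite[of P] P by (metis less_irrefl)
  \<comment> \<open>Smaller than both bounds, so that an error of this size in the Hessian does not
    spoil its sign on \<open>N\<close> or \<open>P\<close>.\<close>
  define \<kappa> where "\<kappa> = min \<kappa>1 \<kappa>2 / 2"
  have k: "\<kappa> > 0" "\<kappa> < \<kappa>1" "\<kappa> < \<kappa>2" using k1 k2 by (auto simp: \<kappa>_def)
  obtain d where d: "d > 0" "ball z d \<subseteq> - {0}" "\<And>y p. dist y z < d \<Longrightarrow> \<bar>H y p p - H z p p\<bar> \<le> \<kappa> * (norm p)\<^sup>2"
    using H_close[OF zS k(1)] by metis
  have yS: "y \<in> - {0}" if "dist y z < d" for y using d(2) that by (auto simp: dist_commute)
  have HN: "H y v v < 0" if "dist y z < d" "v \<in> N" "v \<noteq> 0" for y v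
  proof -
    have "\<kappa> * (norm v)\<^sup>2 < \<kappa>1 * (norm v)\<^sup>2" using k that by simp
    then show ?thesis using d(3)[OF that(1), of v] k1(2)[OF that(2)] N(3)[OF that(2,3)] by linarith
  qed
  have HP: "H y v v \<ge> 0" if "dist y z < d" "v \<in> P" for y v
  proof (cases "v = 0")
    case True
    then show ?thesis using linear_0[OF linear_H1[OF yS[OF that(1)]]] by simp
  next
    case False
    have "\<kappa> * (norm v)\<^sup>2 \<le> \<kappa>2 * (norm v)\<^sup>2" using k by (intro mult_right_mono) auto
    then show ?thesis using d(3)[OF that(1), of v] k2(2)[OF that(2)] P(3)[OF that(2) False] by linarith
  qed
  \<comment> \<open>Halved so that a vector of \<open>N\<close> plus a vector of \<open>P\<close>
    still has norm below \<open>d\<close>.\<close>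
  define r where "r = d / 2"
  have r: "r > 0" using d by (simp add: r_def)
  show ?thesis
  proof (rule that[OF r])
    fix m assume m: "m \<in> N" "m \<noteq> 0" "norm m < r"
    have dist: "dist (z + t *\<^sub>R m) z < d" if "0 \<le> t" "t \<le> 1" for t
    proof -
      have "dist (z + t *\<^sub>R m) z = t * norm m" using that by (simp add: dist_norm)
      also have "\<dots> \<le> 1 * norm m" using that by (intro mult_right_mono) auto
      also have "\<dots> < d" using m d by (simp add: r_def)
      finally show ?thesis .
    qed
    obtain t where t: "0 < t" "t < 1" "U (z + 1 *\<^sub>R m) - U (z + 0 *\<^sub>R m) = (1 - 0) * DU (z + t *\<^sub>R m) m"
      using MVT2[of 0 1 "\<lambda>t. U (z + t *\<^sub>R m)" "\<lambda>t. DU (z + t *\<^sub>R m) m"] line_derivative(1)[OF yS[OF dist]] by auto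
    obtain s where s: "0 < s" "s < t" "DU (z + t *\<^sub>R m) m - DU (z + 0 *\<^sub>R m) m = (t - 0) * H (z + s *\<^sub>R m) m m"
      using MVT2[of 0 t "\<lambda>t. DU (z + t *\<^sub>R m) m" "\<lambda>t. H (z + t *\<^sub>R m) m m"] line_derivative(2)[OF yS[OF dist]] t by auto
    have "H (z + s *\<^sub>R m) m m < 0" using HN[OF dist] s t m by simp
    then have "t * H (z + s *\<^sub>R m) m m < 0" using t by (intro mult_pos_neg)
    moreover have "DU z m = 0" using crit N(2) m(1) by blast
    ultimately show "U (z + m) < U z" using t(3) s(3) by simp
  next
    fix q assume q: "q \<in> P" "norm q < r"
    have dist: "dist (z + t *\<^sub>R q) z < d" if "0 \<le> t" "t \<le> 1" for t
    proof -
      have "dist (z + t *\<^sub>R q) z = t * norm q" using that by (simp add: dist_norm)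
      also have "\<dots> \<le> 1 * norm q" using that by (intro mult_right_mono) auto
      also have "\<dots> < d" using q d by (simp add: r_def)
      finally show ?thesis .
    qed
    obtain t where t: "0 < t" "t < 1" "U (z + 1 *\<^sub>R q) - U (z + 0 *\<^sub>R q) = (1 - 0) * DU (z + t *\<^sub>R q) q"
      using MVT2[of 0 1 "\<lambda>t. U (z + t *\<^sub>R q)" "\<lambda>t. DU (z + t *\<^sub>R q) q"] line_derivative(1)[OF yS[OF dist]] by auto
    obtain s where s: "0 < s" "s < t" "DU (z + t *\<^sub>R q) q - DU (z + 0 *\<^sub>R q) q = (t - 0) * H (z + s *\<^sub>R q) q q"
      using MVT2[of 0 t "\<lambda>t. DU (z + t *\<^sub>R q) q" "\<lambda>t. H (z + t *\<^sub>R q) q q"] line_derivative(2)[OF yS[OF dist]] t by auto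
    have "H (z + s *\<^sub>R q) q q \<ge> 0" using HP[OF dist] s t q by simp
    then have "t * H (z + s *\<^sub>R q) q q \<ge> 0" using t by simp
    moreover have "DU z q = 0" using crit P(2) q(1) by blast
    ultimately show "U (z + q) \<ge> U z" using t(3) s(3) by simp
  next
    fix m q and t :: real
    assume mq: "m \<in> N" "q \<in> P" "norm m < r" "norm q < r" and less: "U (z + m) < c" "U (z + m + q) < c"
      and t: "0 \<le> t" "t \<le> 1"
    have dist: "dist (z + m + t *\<^sub>R q) z < d" if "0 \<le> t" "t \<le> 1" for t
    proof -
      have "t * norm q \<le> norm q" using that mult_right_mono[of t 1 "norm q"] by simp
      then show ?thesis using norm_triangle_ineq[of m "t *\<^sub>R q"] mq that by (simp add: dist_norm r_def add.assoc)
    qed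
    have "convex_on {0..1} (\<lambda>t. U (z + m + t *\<^sub>R q))"
    proof (rule f''_ge0_imp_convex)
      fix s :: real assume s: "s \<in> {0..1}"
      note y = yS[OF dist, of s] line_derivative[OF yS[OF dist, of s]]
      show "((\<lambda>t. U (z + m + t *\<^sub>R q)) has_real_derivative DU (z + m + s *\<^sub>R q) q) (at s)"
        "((\<lambda>t. DU (z + m + t *\<^sub>R q) q) has_real_derivative H (z + m + s *\<^sub>R q) q q) (at s)"
        using y s by auto
      show "H (z + m + s *\<^sub>R q) q q \<ge> 0" using HP[OF dist mq(2)] s by simp
    qed simp
    then have "U (z + m + t *\<^sub>R q) \<le> (1 - t) * U (z + m) + t * U (z + m + q)"
      using convex_onD[of "{0..1}" "\<lambda>t. U (z + m + t *\<^sub>R q)" t 0 1] t by simp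
    also have "\<dots> < c" using convex_bound_lt[OF less, of "1 - t" t] t by simp
    finally show "U (z + m + t *\<^sub>R q) < c" .
  qed
qed

text \<open>Low points of the box slide along \<open>P\<close> to the punctured ball of
  \<open>N\<close>, so the low region has the components of that ball: at most one unless
  \<open>dim N = 1\<close>, when there are two.\<close>

lemma critical_types:
  assumes z: "norm z = 1" and crit: "\<And>v. v \<in> T z \<Longrightarrow> DU z v = 0"
    and N: "subspace N" "N \<subseteq> T z" "\<And>v. v \<in> N \<Longrightarrow> v \<noteq> 0 \<Longrightarrow> H z v v < 0"
    and P: "subspace P" "P \<subseteq> T z" "\<And>v. v \<in> P \<Longrightarrow> v \<noteq> 0 \<Longrightarrow> H z v v > 0"
    and np: "linear n" "linear p" "\<And>v. v \<in> T z \<Longrightarrow> n v \<in> N" "\<And>v. v \<in> T z \<Longrightarrow> p v \<in> P"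
      "\<And>v. v \<in> T z \<Longrightarrow> n v + p v = v"
  shows "dim N \<noteq> 1 \<Longrightarrow> tame (sphere 0 1) U z" "bitame (sphere 0 1) U z"
    "z \<in> local_minima (sphere 0 1) U \<Longrightarrow> dim N = 0"
proof -
  obtain r where r: "r > 0"
    "\<And>m. m \<in> N \<Longrightarrow> m \<noteq> 0 \<Longrightarrow> norm m < r \<Longrightarrow> U (z + m) < U z"
    "\<And>q. q \<in> P \<Longrightarrow> norm q < r \<Longrightarrow> U (z + q) \<ge> U z"
    "\<And>m q t. m \<in> N \<Longrightarrow> q \<in> P \<Longrightarrow> norm m < r \<Longrightarrow> norm q < r \<Longrightarrow> U (z + m) < U z \<Longrightarrow>
       U (z + m + q) < U z \<Longrightarrow> 0 \<le> t \<Longrightarrow> t \<le> 1 \<Longrightarrow> U (z + m + t *\<^sub>R q) < U z"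
    using critical_box[OF z crit N P, of "U z"] by blast
  define O' where "O' = {v. norm (n v) < r \<and> norm (p v) < r}"
  have "continuous_on UNIV n" "continuous_on UNIV p"
    using np(1,2) by (simp_all add: linear_continuous_on linear_conv_bounded_linear)
  then have O': "open O'" "0 \<in> O'"
    unfolding O'_def using np(1,2) r(1)
    by (auto simp: linear_0 intro!: open_Collect_conj open_Collect_less continuous_intros)
  define N0 where "N0 = {m\<in>N. m \<noteq> 0 \<and> norm m < r}"
  \<comment> \<open>The low points of the box with \<open>N\<close>-component in \<open>C\<close>.
    Taking for \<open>C\<close> a half of a punctured line gives one of the two sheets at a saddle
    of index 1.\<close>
  define K where "K C = {m + q |m q. m \<in> C \<and> q \<in> P \<and> norm q < r \<and> U (z + m + q) < U z}" for C
  have Kc: "connected (K C)" if C: "connected C" "C \<subseteq> N0" for C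
  proof (rule connected_with_core[OF C(1)])
    show "C \<subseteq> K C"
    proof
      fix m assume "m \<in> C"
      then show "m \<in> K C" unfolding K_def using r(1,2) C(2) subspace_0[OF P(1)]
        by (intro CollectI exI[of _ m] exI[of _ 0]) (auto simp: N0_def)
    qed
    fix x assume "x \<in> K C"
    then obtain m q where mq: "x = m + q" "m \<in> C" "q \<in> P" "norm q < r" "U (z + m + q) < U z"
      by (auto simp: K_def)
    have m: "m \<in> N" "m \<noteq> 0" "norm m < r" using mq C by (auto simp: N0_def)
    have "closed_segment x m \<subseteq> K C"
    proof
      fix y assume "y \<in> closed_segment x m"
      then obtain t where t: "0 \<le> t" "t \<le> 1" "y = (1 - t) *\<^sub>R x + t *\<^sub>R m"
        by (auto simp: closed_segment_def)
      have y: "y = m + (1 - t) *\<^sub>R q" unfolding t(3) mq(1) by (simp add: algebra_simps)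
      have "norm ((1 - t) *\<^sub>R q) < r"
        using mult_right_mono[of "1 - t" 1 "norm q"] t mq(4) by simp
      moreover have "U (z + m + (1 - t) *\<^sub>R q) < U z"
        using r(4)[OF m(1) mq(3) m(3) mq(4) r(2)[OF m] mq(5), of "1 - t"] t by simp
      ultimately show "y \<in> K C" unfolding K_def using y mq P(1)
        by (intro CollectI exI[of _ m] exI[of _ "(1 - t) *\<^sub>R q"]) (auto simp: subspace_scale)
    qed
    then show "\<exists>y\<in>C. closed_segment x y \<subseteq> K C" using mq by blast
  qed
  have sub: "{v\<in>T z \<inter> O'. U (z + v) < U z} \<subseteq> K N0"
  proof
    fix v assume v: "v \<in> {v\<in>T z \<inter> O'. U (z + v) < U z}"
    then have v': "v \<in> T z" "norm (n v) < r" "norm (p v) < r" "U (z + v) < U z" by (auto simp: O'_def)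
    have e: "n v + p v = v" using np v' by blast
    have "n v \<noteq> 0"
    proof
      assume "n v = 0"
      then have "p v = v" using e by simp
      then show False using r(3)[of "p v"] np(4)[OF v'(1)] v' by simp
    qed
    then show "v \<in> K N0" unfolding K_def N0_def using v' np e
      by (intro CollectI exI[of _ "n v"] exI[of _ "p v"]) (auto simp: add.assoc)
  qed
  have low: "K C \<subseteq> {v\<in>T z. U (z + v) < U z}" if "C \<subseteq> N0" for C
    using that N(2) P(2) T_subspace by (auto simp: K_def N0_def add.assoc intro!: subspace_add)
  show "tame (sphere 0 1) U z" if "dim N \<noteq> 1"
    by (rule tame_by_chart[OF z O' Kc[of N0] sub low])
       (use connected_punctured_subspace[OF N(1) that r(1)] in \<open>auto simp: N0_def\<close>)
  show "bitame (sphere 0 1) U z"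
  proof -
    obtain C1 C2 where C: "connected C1" "connected C2" "C1 \<union> C2 = N0"
    proof (cases "dim N = 1")
      case True
      then show ?thesis using punctured_line_halves[OF N(1) _ r(1)] that unfolding N0_def by blast
    next
      case False
      then show ?thesis using connected_punctured_subspace[OF N(1) _ r(1)] that[of N0 N0] unfolding N0_def by blast
    qed
    have "K N0 = K C1 \<union> K C2" unfolding C(3)[symmetric] by (auto simp: K_def)
    then show ?thesis
      using bitame_by_chart[OF z O' Kc[of C1] Kc[of C2]] C sub low[of N0] by auto
  qed
  show "dim N = 0" if zm: "z \<in> local_minima (sphere 0 1) U"
  proof (rule ccontr)
    assume "dim N \<noteq> 0"
    then obtain m where m: "m \<in> N" "m \<noteq> 0" by (metis dim_eq_0 subsetI singletonI)
    \<comment> \<open>Scaling a vector of \<open>N\<close> down to zero yields points lower than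
      \<open>z\<close> that converge to \<open>z\<close>.\<close>
    define s where "s k = (r / (2 * norm m)) * inverse (real (Suc k))" for k
    have s: "s \<longlonglongrightarrow> 0" unfolding s_def using LIMSEQ_inverse_real_of_nat tendsto_mult_right_zero by blast
    have s0: "s k > 0" "s k * norm m < r" for k
    proof -
      show "s k > 0" using r(1) m by (simp add: s_def)
      have "s k * norm m = (r / 2) * inverse (real (Suc k))" using m by (simp add: s_def)
      also have "\<dots> \<le> r / 2 * 1" using r(1) by (intro mult_left_mono) (auto simp: field_simps)
      finally show "s k * norm m < r" using r(1) by simp
    qed
    have mem: "s k *\<^sub>R m \<in> N" "s k *\<^sub>R m \<in> T z" for k using m N by (auto simp: subspace_scale)
    have lim: "(\<lambda>k. s k *\<^sub>R m) \<longlonglongrightarrow> 0 *\<^sub>R m" by (intro tendsto_intros s)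
    have "(\<lambda>k. chart z (s k *\<^sub>R m)) \<longlonglongrightarrow> chart z (0 *\<^sub>R m)"
      by (rule continuous_on_tendsto_compose[OF chart_continuous[OF z] lim])
         (simp_all add: mem(2) subspace_0[OF T_subspace])
    then have "(\<lambda>k. chart z (s k *\<^sub>R m)) \<longlonglongrightarrow> z" using z by (simp add: chart_def)
    moreover have "chart z (s k *\<^sub>R m) \<in> sublevel (sphere 0 1) U (U z)" for k
      unfolding sublevel_def using chart_sphere[OF z mem(2)] chart_U[OF z mem(2)[of k]] r(2)[OF mem(1)[of k]] m s0[of k] by simp
    ultimately have "z \<in> closure (sublevel (sphere 0 1) U (U z))"
      unfolding closure_sequential by (intro exI[of _ "\<lambda>k. chart z (s k *\<^sub>R m)"] conjI allI)
    then show False using zm by (simp add: local_minima_def)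
  qed
qed

end

section \<open>The lower bound\<close>

lemma I_star_complex_entries:
  "(B *v z) $ 1 = B $ 1 $ 1 * z $ 1 + B $ 1 $ 2 * z $ 2"
  "(B *v z) $ 2 = B $ 2 $ 1 * z $ 1 + B $ 2 $ 2 * z $ 2" for B :: "complex^2^2"
  by (simp_all add: matrix_vector_mult_def sum_2)

lemma norm_complex2: "(norm z)\<^sup>2 = (cmod (z $ 1))\<^sup>2 + (cmod (z $ 2))\<^sup>2" for z :: "complex^2"
  by (simp add: norm_vec_def L2_set_def sum_2)

text \<open>The eigenvalues of an element of SU(2) are inverse to each other, so the eigenvalue 1
  forces the identity. The computation pairs the two fixed point equations with the conjugate
  coordinates of \<open>z\<close>.\<close>

lemma I_star_free:
  assumes B: "B \<in> I_star" and z: "z \<in> S3" "B *v z = z"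
  shows "B = mat 1"
proof -
  have "B \<in> SU2" using B by (simp add: I_star_def)
  note e = SU2_entries[OF this]
  define a b where "a = B $ 1 $ 1" and "b = B $ 2 $ 1"
  define x y where "x = z $ 1" and "y = z $ 2"
  have 1: "a * x - cnj b * y = x" "b * x + cnj a * y = y"
    using z(2) I_star_complex_entries[of B z] e by (auto simp: a_def b_def x_def y_def)
  have n: "x * cnj x + y * cnj y = 1"
  proof -
    have "(cmod x)\<^sup>2 + (cmod y)\<^sup>2 = 1" using norm_complex2[of z] z(1) by (simp add: x_def y_def)
    then have "complex_of_real ((cmod x)\<^sup>2 + (cmod y)\<^sup>2) = 1" by (simp only: of_real_1)
    then show ?thesis by (simp only: of_real_add complex_norm_square)
  qed
  have "(a - 1) * (x * cnj x + y * cnj y) = 0"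
  proof -
    have c: "cnj b * cnj x + a * cnj y = cnj y" using arg_cong[OF 1(2), of cnj] by simp
    have "a * x - x = cnj b * y" "a * cnj y - cnj y = - (cnj b * cnj x)"
      using 1(1) c by (simp_all add: algebra_simps)
    moreover have "(a - 1) * (x * cnj x + y * cnj y) = (a * x - x) * cnj x + (a * cnj y - cnj y) * y"
      by (simp add: algebra_simps)
    ultimately have "(a - 1) * (x * cnj x + y * cnj y) = cnj b * y * cnj x + - (cnj b * cnj x) * y"
      by (simp only:)
    then show ?thesis by (simp only: mult.commute mult.left_commute mult_minus_left) simp
  qed
  then have a: "a = 1" using n by simp
  have "cnj b * y = 0" "b * x = 0" using 1 a by auto
  then have b: "b = 0" using n by auto
  show ?thesis using a b e by (simp add: vec_eq_iff forall_2 mat_def a_def b_def)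
qed

definition rotations :: "(complex^2 \<Rightarrow> complex^2) set" where
  "rotations = (\<lambda>B z. B *v z) ` I_star"

lemma inv_rotation:
  assumes "B \<in> I_star"
  shows "bij (\<lambda>z. B *v z)" "inv (\<lambda>z. B *v z) = (\<lambda>z. conj_transpose B *v z)"
proof -
  have 1: "conj_transpose B *v (B *v z) = z" "B *v (conj_transpose B *v z) = z" for z
    using assms by (simp_all add: matrix_vector_mul_assoc SU2_adj I_star_def SU2_def)
  show "bij (\<lambda>z. B *v z)" by (rule bij_betw_byWitness[of _ "\<lambda>z. conj_transpose B *v z"]) (auto simp: 1)
  show "inv (\<lambda>z. B *v z) = (\<lambda>z. conj_transpose B *v z)"
    by (rule inv_unique_comp) (auto simp: 1 fun_eq_iff)
qed

lemma rotations_group: "transformation_group S3 rotations"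
  unfolding transformation_group_def
proof (intro conjI ballI)
  show "id \<in> rotations" unfolding rotations_def
    by (rule image_eqI[OF _ I_star_one]) (simp add: fun_eq_iff)
  fix f assume "f \<in> rotations"
  then obtain B where B: "B \<in> I_star" "f = (\<lambda>z. B *v z)" by (auto simp: rotations_def)
  show "bij f" using B inv_rotation by blast
  show "inv f \<in> rotations" unfolding B(2) inv_rotation(2)[OF B(1)] rotations_def
    using I_star_adj[OF B(1)] by blast
  show "f ` S3 \<subseteq> S3" using B I_star_sphere by auto
  fix g assume "g \<in> rotations"
  then obtain C where C: "C \<in> I_star" "g = (\<lambda>z. C *v z)" by (auto simp: rotations_def)
  show "f \<circ> g \<in> rotations" unfolding rotations_def
    by (rule image_eqI[OF _ I_star_mult[OF B(1) C(1)]]) (simp add: fun_eq_iff B C matrix_vector_mul_assoc)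
qed

section \<open>Explicit elements of the group and its noncommutativity\<close>

definition \<epsilon> :: complex where "\<epsilon> = cis (2 * pi / 5)"

lemma eps_pow5: "\<epsilon> ^ 5 = 1" unfolding \<epsilon>_def Complex.DeMoivre by simp

lemma eps_neq_1: "\<epsilon> \<noteq> 1"
proof
  assume "\<epsilon> = 1"
  then have "sin (2 * pi / 5) = 0" by (simp add: \<epsilon>_def complex_eq_iff)
  moreover have "sin (2 * pi / 5) > 0" using pi_gt_zero by (intro sin_gt_zero) (simp_all add: field_simps)
  ultimately show False by simp
qed

lemma cnj_eps: "cnj \<epsilon> = \<epsilon> ^ 4"
proof -
  have "\<epsilon> * cnj \<epsilon> = 1" by (simp add: \<epsilon>_def cis_cnj cis_mult)
  moreover have "\<epsilon> * \<epsilon> ^ 4 = 1" using eps_pow5 by (simp add: numeral_eq_Suc)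
  moreover have "\<epsilon> \<noteq> 0" by (simp add: \<epsilon>_def)
  ultimately show ?thesis by (metis mult_left_cancel)
qed

definition mat2 :: "complex \<Rightarrow> complex \<Rightarrow> complex^2^2" where
  "mat2 a b = vector [vector [a, - cnj b], vector [b, cnj a]]"

lemma mat2_nth [simp]:
  "mat2 a b $ 1 $ 1 = a" "mat2 a b $ 1 $ 2 = - cnj b" "mat2 a b $ 2 $ 1 = b" "mat2 a b $ 2 $ 2 = cnj a"
  by (simp_all add: mat2_def)

lemma mat2_SU2: "a * cnj a + b * cnj b = 1 \<Longrightarrow> mat2 a b \<in> SU2"
  by (simp add: SU2_def det_2 vec_eq_iff forall_2 matrix_matrix_mult_def sum_2 conj_transpose_def mat_def algebra_simps)

lemma mat2_I_star:
  assumes "a * cnj a + b * cnj b = 1"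
    and "\<And>x y. I12 (a * x - cnj b * y) (b * x + cnj a * y) = I12 x y"
  shows "mat2 a b \<in> I_star"
  using assms mat2_SU2 by (simp add: I_star_def I_star_complex_entries)

text \<open>\<open>rotD\<close> is diagonal of order five; \<open>rotJ\<close> has order four and
  conjugates \<open>rotD\<close> to its inverse, so the two do not commute.\<close>

definition "rotD = mat2 (\<epsilon> ^ 3) 0"
definition "rotJ = mat2 0 (- 1)"

lemma rotD_I_star: "rotD \<in> I_star"
  unfolding rotD_def
proof (rule mat2_I_star)
  have c: "cnj (\<epsilon> ^ 3) = \<epsilon> ^ 2"
  proof -
    have "cnj (\<epsilon> ^ 3) = \<epsilon> ^ 12" by (simp add: cnj_eps power_mult[symmetric])
    also have "\<dots> = \<epsilon> ^ 5 * \<epsilon> ^ 5 * \<epsilon> ^ 2" by (simp add: power_add[symmetric])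
    finally show ?thesis by (simp add: eps_pow5)
  qed
  show "\<epsilon> ^ 3 * cnj (\<epsilon> ^ 3) + 0 * cnj 0 = 1" unfolding c using eps_pow5 by algebra
  show "I12 (\<epsilon> ^ 3 * x - cnj 0 * y) (0 * x + cnj (\<epsilon> ^ 3) * y) = I12 x y" for x y
    unfolding c I12_def using eps_pow5 by (simp add: power_mult_distrib) algebra
qed

lemma rotJ_I_star: "rotJ \<in> I_star"
  unfolding rotJ_def by (rule mat2_I_star) (simp_all add: I12_def algebra_simps)

text \<open>No powers of \<open>h\<close> are formed. The centralizer of \<open>h\<close> is a
  subgroup containing \<open>h\<close>, hence everything; so the centralizer of \<open>rotD\<close>
  contains \<open>h\<close> and is everything too. But \<open>rotJ\<close> does not commute with
  \<open>rotD\<close>.\<close>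

lemma I_star_not_monogenic:
  assumes h: "h \<in> rotations"
    and all: "\<And>H. H \<subseteq> rotations \<Longrightarrow> transformation_group S3 H \<Longrightarrow> h \<in> H \<Longrightarrow> H = rotations"
  shows False
proof -
  note grp = rotations_group[unfolded transformation_group_def]
  have centralizer: "transformation_group S3 {f\<in>rotations. f \<circ> g = g \<circ> f}" if g: "g \<in> rotations" for g
    unfolding transformation_group_def
  proof (intro conjI ballI)
    show "id \<in> {f\<in>rotations. f \<circ> g = g \<circ> f}" using grp by simp
    fix f assume f: "f \<in> {f\<in>rotations. f \<circ> g = g \<circ> f}"
    then have bf: "bij f" and fi: "inv f \<in> rotations" and fS: "f ` S3 \<subseteq> S3" using grp by blast+
    have c: "f (g x) = g (f x)" for x using f by (metis (mono_tags, lifting) comp_apply mem_Collect_eq)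
    show "bij f" by fact
    show "f ` S3 \<subseteq> S3" by fact
    have "inv f (g x) = g (inv f x)" for x
    proof -
      have "f (g (inv f x)) = g x" using c bf by (simp add: bij_is_surj surj_f_inv_f)
      then show ?thesis using bf by (metis bij_is_inj inv_f_f)
    qed
    then show "inv f \<in> {f\<in>rotations. f \<circ> g = g \<circ> f}" using fi by auto
    fix f' assume f': "f' \<in> {f\<in>rotations. f \<circ> g = g \<circ> f}"
    then have c': "f' (g x) = g (f' x)" for x by (metis (mono_tags, lifting) comp_apply mem_Collect_eq)
    have "f \<circ> f' \<in> rotations" using f f' grp by blast
    then show "f \<circ> f' \<in> {f\<in>rotations. f \<circ> g = g \<circ> f}" using c c' by (auto simp: fun_eq_iff)
  qed
  define d where "d = (\<lambda>z. rotD *v z)"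
  define j where "j = (\<lambda>z. rotJ *v z)"
  have d: "d \<in> rotations" and j: "j \<in> rotations"
    using rotD_I_star rotJ_I_star by (auto simp: d_def j_def rotations_def)
  have 1: "{f\<in>rotations. f \<circ> h = h \<circ> f} = rotations"
    by (rule all[OF _ centralizer[OF h]]) (use h in auto)
  have "h \<circ> d = d \<circ> h" using 1 d by (metis (mono_tags, lifting) mem_Collect_eq)
  then have "{f\<in>rotations. f \<circ> d = d \<circ> f} = rotations"
    by (intro all[OF _ centralizer[OF d]]) (use h in auto)
  then have "j \<circ> d = d \<circ> j" using j by blast
  then have "(j \<circ> d) (axis 1 1) $ 2 = (d \<circ> j) (axis 1 1) $ 2" by simp
  then have e: "\<epsilon> ^ 3 = cnj (\<epsilon> ^ 3)"
    by (simp add: j_def d_def rotD_def rotJ_def I_star_complex_entries axis_def)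
  have "cnj (\<epsilon> ^ 3) = (\<epsilon> ^ 4) ^ 3" by (simp add: cnj_eps)
  also have "\<dots> = \<epsilon> ^ 5 * \<epsilon> ^ 5 * \<epsilon> ^ 2" by (simp add: power_add[symmetric] power_mult[symmetric])
  finally have "\<epsilon> ^ 3 = \<epsilon> ^ 2" using e eps_pow5 by simp
  then have "\<epsilon> = 1" using eps_pow5 by algebra
  then show False using eps_neq_1 by blast
qed

section \<open>Finiteness of the group\<close>

lemma finite_power_eq: "finite {a::complex. a ^ 10 * k = 1}"
proof -
  have "finite {a. poly (monom k 10 - 1) a = 0}"
  proof (rule poly_roots_finite)
    have "coeff (monom k 10 - 1) 0 \<noteq> coeff 0 0" by simp
    then show "monom k 10 - 1 \<noteq> 0" by metis
  qed
  then show ?thesis by (simp add: poly_monom mult.commute)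
qed

text \<open>The coefficient linear in \<open>y\<close> is the derivative of \<open>I12\<close> at
  \<open>z\<close> in the direction with coordinates \<open>- cnj (z $ 2)\<close> and
  \<open>cnj (z $ 1)\<close>.\<close>

lemma A_fun_1:
  "A_fun 1 z = (11 * (z $ 1) ^ 10 * z $ 2 + 66 * (z $ 1) ^ 5 * (z $ 2) ^ 6 - (z $ 2) ^ 11) * (- cnj (z $ 2)) +
    ((z $ 1) ^ 11 + 66 * (z $ 1) ^ 6 * (z $ 2) ^ 5 - 11 * z $ 1 * (z $ 2) ^ 10) * cnj (z $ 1)"
proof -
  have c1: "coeff (p * q) 1 = coeff p 0 * coeff q 1 + coeff p 1 * coeff q 0" for p q :: "complex poly"
    by (simp add: coeff_mult)
  have cp: "coeff ([:a, b:] ^ Suc n) 1 = of_nat (Suc n) * b * a ^ n" "coeff ([:a, b:] ^ n) 0 = a ^ n" for a b :: complex and n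
    using coeff_linear_poly_power[of 1 "Suc n" a b] coeff_linear_poly_power[of 0 n a b] by simp_all
  have "A_fun 1 z = coeff (I12 [: z $ 1, - cnj (z $ 2) :] [: z $ 2, cnj (z $ 1) :]) 1"
    by (simp only: A_fun_def)
  also have "\<dots> = coeff ([: z $ 1, - cnj (z $ 2) :] ^ Suc 10 * [: z $ 2, cnj (z $ 1) :] ^ Suc 0) 1
      + 11 * coeff ([: z $ 1, - cnj (z $ 2) :] ^ Suc 5 * [: z $ 2, cnj (z $ 1) :] ^ Suc 5) 1
      - coeff ([: z $ 1, - cnj (z $ 2) :] ^ Suc 0 * [: z $ 2, cnj (z $ 1) :] ^ Suc 10) 1"
    by (simp add: I12_def numeral_poly mult.assoc eval_nat_numeral)
  also have "\<dots> = (11 * (z $ 1) ^ 10 * z $ 2 + 66 * (z $ 1) ^ 5 * (z $ 2) ^ 6 - (z $ 2) ^ 11) * (- cnj (z $ 2)) +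
    ((z $ 1) ^ 11 + 66 * (z $ 1) ^ 6 * (z $ 2) ^ 5 - 11 * z $ 1 * (z $ 2) ^ 10) * cnj (z $ 1)"
    unfolding c1 cp by (simp add: eval_nat_numeral algebra_simps)
  finally show ?thesis .
qed

text \<open>The first column \<open>(a, b)\<close> determines the matrix. Invariance of
  \<open>I12\<close> at the first basis vector gives \<open>I12 a b = 0\<close> and thus finitely
  many slopes \<open>b / a\<close>. This equation is homogeneous; invariance of \<open>A_1\<close>
  fixes the scale, up to finitely many choices.\<close>

lemma I_star_finite: "finite I_star"
proof -
  define R where "R = {w::complex. w + 11 * w ^ 6 - w ^ 11 = 0}"
  \<comment> \<open>Chosen so that the equation from \<open>A_1\<close> reads
    \<open>a ^ 10 * k w = 1\<close> once a factor \<open>a * cnj a\<close> is eliminated by the unit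
    norm of the column.\<close>
  define k where "k w = ((11 * w + 66 * w ^ 6 - w ^ 11) * (- cnj w) + (1 + 66 * w ^ 5 - 11 * w ^ 10)) / (1 + w * cnj w)" for w
  define F where "F = (\<lambda>b. (0, b)) ` {b. b ^ 10 * 1 = 1} \<union> (\<Union>w\<in>R. (\<lambda>a. (a, a * w)) ` {a. a ^ 10 * k w = 1})"
  have "finite R"
  proof -
    define p :: "complex poly" where "p = monom 1 1 + monom 11 6 - monom 1 11"
    have "coeff p 1 = 1" by (simp add: p_def)
    then have "p \<noteq> 0" by auto
    then have "finite {w. poly p w = 0}" by (rule poly_roots_finite)
    then show ?thesis by (simp add: R_def p_def poly_monom)
  qed
  then have F: "finite F" unfolding F_def using finite_power_eq by blast
  define f where "f B = (B $ 1 $ 1, B $ 2 $ 1)" for B :: "complex^2^2"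
  have "inj_on f I_star"
  proof (rule inj_onI)
    fix B C assume "B \<in> I_star" "C \<in> I_star" and eq: "f B = f C"
    then have "B \<in> SU2" "C \<in> SU2" by (auto simp: I_star_def)
    then show "B = C" using eq SU2_entries(1,2)[of B] SU2_entries(1,2)[of C]
      by (simp add: f_def vec_eq_iff forall_2)
  qed
  moreover have "f ` I_star \<subseteq> F"
  proof
    fix x assume "x \<in> f ` I_star"
    then obtain B where B: "B \<in> I_star" "x = f B" by blast
    define a b where "a = B $ 1 $ 1" and "b = B $ 2 $ 1"
    define e1 :: "complex^2" where "e1 = axis 1 1"
    have e1: "e1 $ 1 = 1" "e1 $ 2 = 0" by (simp_all add: e1_def axis_def)
    have col: "(B *v e1) $ 1 = a" "(B *v e1) $ 2 = b"
      by (simp_all add: I_star_complex_entries e1 a_def b_def)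
    have n: "a * cnj a + b * cnj b = 1"
      using SU2_entries(3)[of B] B by (simp add: I_star_def a_def b_def)
    have "I12 ((B *v e1) $ 1) ((B *v e1) $ 2) = I12 (e1 $ 1) (e1 $ 2)"
      using B by (simp add: I_star_def)
    then have I: "I12 a b = 0" by (simp add: col e1 I12_def)
    have "A_fun 1 (B *v e1) = A_fun 1 e1" by (rule A_fun_invariant[OF B(1)])
    then have A: "(11 * a ^ 10 * b + 66 * a ^ 5 * b ^ 6 - b ^ 11) * (- cnj b) + (a ^ 11 + 66 * a ^ 6 * b ^ 5 - 11 * a * b ^ 10) * cnj a = 1"
      unfolding A_fun_1 col e1 by simp
    show "x \<in> F"
    proof (cases "a = 0")
      case True
      then have "b * cnj b = 1" "b ^ 11 * cnj b = 1" using A n by simp_all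
      then have "b ^ 10 * 1 = 1" by algebra
      then show ?thesis unfolding F_def B(2) f_def using True a_def b_def by simp
    next
      case False
      define w where "w = b / a"
      have b: "b = a * w" using False by (simp add: w_def)
      have "a ^ 12 * (w + 11 * w ^ 6 - w ^ 11) = 0" using I unfolding I12_def b by algebra
      then have "w \<in> R" using False by (simp add: R_def)
      moreover have "a ^ 10 * k w = 1"
      proof -
        have n': "a * cnj a * (1 + w * cnj w) = 1" using n unfolding b by (simp add: algebra_simps)
        then have nz: "1 + w * cnj w \<noteq> 0" by auto
        have "a ^ 11 * cnj a * ((11 * w + 66 * w ^ 6 - w ^ 11) * (- cnj w) + (1 + 66 * w ^ 5 - 11 * w ^ 10)) = 1"
          using A unfolding b complex_cnj_mult by algebra
        then have "a ^ 11 * cnj a * (k w * (1 + w * cnj w)) = 1" using nz by (simp add: k_def)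
        then show ?thesis using n' by algebra
      qed
      moreover have "x = (a, a * w)" unfolding B(2) f_def using b a_def b_def by simp
      ultimately show ?thesis unfolding F_def by blast
    qed
  qed
  ultimately show ?thesis using F inj_on_finite by blast
qed

section \<open>Critical points on the sphere and on the quotient\<close>

lemma rotation_isometry:
  assumes "B \<in> I_star"
  shows "norm (B *v z) = norm z" "(B *v v) \<bullet> (B *v w) = v \<bullet> w"
proof -
  have n: "norm (B *v z) = norm z" for z
  proof (cases "z = 0")
    case False
    have "B *v (z /\<^sub>R norm z) \<in> S3" by (rule I_star_sphere[OF assms]) (use False in simp)
    moreover have "B *v (z /\<^sub>R norm z) = (B *v z) /\<^sub>R norm z"
      by (simp add: vec_eq_iff forall_2 I_star_complex_entries algebra_simps)
    ultimately show ?thesis using False by (simp add: field_simps)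
  qed (simp add: matrix_vector_mult_0_right)
  then show "norm (B *v z) = norm z" .
  have "(norm (B *v (v + w)))\<^sup>2 = (norm (v + w))\<^sup>2" "(norm (B *v v))\<^sup>2 = (norm v)\<^sup>2" "(norm (B *v w))\<^sup>2 = (norm w)\<^sup>2" by (simp_all add: n)
  then show "(B *v v) \<bullet> (B *v w) = v \<bullet> w"
    unfolding matrix_vector_right_distrib power2_norm_eq_inner by (simp add: inner_simps inner_commute)
qed

lemma rotation_linear: "linear (\<lambda>z. B *v z)" for B :: "complex^2^2"
  by (rule linearI) (simp_all add: vec_eq_iff forall_2 I_star_complex_entries algebra_simps)

lemma radial_lift_S3: "z \<in> S3 \<Longrightarrow> radial_lift g z = g (proj z)"
  by (simp add: radial_lift_def)

lemma radial_lift_rotation: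
  assumes B: "B \<in> I_star"
  shows "radial_lift g (B *v z) = radial_lift g z"
proof (cases "z = 0")
  case True
  then show ?thesis by (simp add: matrix_vector_mult_0_right)
next
  case False
  have "(B *v z) /\<^sub>R norm (B *v z) = B *v (z /\<^sub>R norm z)"
    unfolding rotation_isometry(1)[OF B] using linear_scale[OF rotation_linear] by metis
  moreover have "orbit (B *v (z /\<^sub>R norm z)) = orbit (z /\<^sub>R norm z)" by (rule orbit_eq[OF B])
  ultimately show ?thesis by (simp add: radial_lift_def proj_def)
qed

lemma radial_radial_lift:
  assumes "smooth_M g"
  shows "radial (radial_lift g)"
proof
  show "open (- {0::complex^2})" by (intro open_Compl closed_singleton)
  show "Ck_on 2 (- {0}) (radial_lift g)" using assms by (simp add: smooth_M_def smooth_on_def)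
  show "radial_lift g (r *\<^sub>R x) = radial_lift g x" if "r > 0" "x \<noteq> 0" for r x
  proof -
    have "inverse (r * norm x) * r = inverse (norm x)" using that by (simp add: field_simps)
    then have "(r *\<^sub>R x) /\<^sub>R norm (r *\<^sub>R x) = x /\<^sub>R norm x"
      using that by (simp only: norm_scaleR abs_of_pos scaleR_scaleR)
    then show ?thesis by (simp only: radial_lift_def)
  qed
qed

lemma (in radial) continuous_on_sphere: "continuous_on (sphere 0 1) U"
proof (rule continuous_at_imp_continuous_on, rule ballI)
  fix x :: 'a assume "x \<in> sphere 0 1"
  then have "x \<in> - {0}" by auto
  then show "isCont U x" using has_derivative_continuous[OF has_derivative_U] by blast
qed

definition lifted_critical :: "(dodec \<Rightarrow> real) \<Rightarrow> (complex^2) set" where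
  "lifted_critical g = {z\<in>S3. \<forall>v\<in>tangent z. frechet_derivative (radial_lift g) (at z) v = 0}"

text \<open>\<open>critical_points\<close> quantifies over the whole fibre; since the lift is
  invariant under isometries that permute the fibre, one of its points decides.\<close>

lemma lifted_critical_iff:
  assumes g: "smooth_M g" and z: "z \<in> S3"
  shows "proj z \<in> critical_points g \<longleftrightarrow> z \<in> lifted_critical g"
proof
  assume "proj z \<in> critical_points g"
  moreover have "z \<in> fibre (proj z)" unfolding fibre_proj[OF z] orbit_def using I_star_one by force
  ultimately show "z \<in> lifted_critical g" using z by (simp add: critical_points_def lifted_critical_def)
next
  assume zc: "z \<in> lifted_critical g"
  interpret radial "radial_lift g" by (rule radial_radial_lift[OF g])
  show "proj z \<in> critical_points g"
    unfolding critical_points_def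
  proof (intro CollectI ballI)
    fix w v assume "w \<in> fibre (proj z)" and v: "v \<in> tangent w"
    then obtain B where B: "B \<in> I_star" "w = B *v z" unfolding fibre_proj[OF z] orbit_def by blast
    define u where "u = conj_transpose B *v v"
    have vu: "v = B *v u" unfolding u_def
      using B by (simp add: matrix_vector_mul_assoc I_star_def SU2_def)
    have w0: "w \<in> - {0}" "z \<in> - {0}" using I_star_sphere[OF B(1) z] z B(2) by auto
    have "((\<lambda>x. radial_lift g (B *v x)) has_derivative (\<lambda>x. DU w (B *v x))) (at z)"
      using has_derivative_compose[OF linear_imp_has_derivative[OF rotation_linear] has_derivative_U[OF w0(1)[unfolded B(2)]]] B(2) by simp
    then have "(radial_lift g has_derivative (\<lambda>x. DU w (B *v x))) (at z)"
      unfolding radial_lift_rotation[OF B(1)] .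
    then have "DU w (B *v u) = DU z u" using has_derivative_unique[OF has_derivative_U[OF w0(2)]] by metis
    moreover have "u \<in> tangent z" using v rotation_isometry(2)[OF B(1), of u z] by (simp add: tangent_def vu B(2))
    ultimately show "DU w v = 0" using zc vu by (simp add: lifted_critical_def)
  qed
qed

text \<open>Being constant along rays, the lift has an unconstrained local minimum at
  \<open>z\<close>, so its full differential vanishes there.\<close>

lemma local_minimum_critical:
  assumes g: "smooth_M g" and z: "z \<in> local_minima S3 (radial_lift g)"
  shows "z \<in> lifted_critical g"
proof -
  interpret radial "radial_lift g" by (rule radial_radial_lift[OF g])
  have z': "z \<in> S3" "z \<in> - {0}" "z \<notin> closure (sublevel S3 (radial_lift g) (radial_lift g z))"
    using z by (auto simp: local_minima_def)
  define N where "N = (- {0}) \<inter> (\<lambda>x. x /\<^sub>R norm x) -` (- closure (sublevel S3 (radial_lift g) (radial_lift g z)))"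
  have "open N" unfolding N_def
    by (intro continuous_open_preimage continuous_intros) auto
  moreover have "z \<in> N" using z' by (simp add: N_def)
  moreover have "\<forall>x\<in>N. radial_lift g z \<le> radial_lift g x"
  proof (rule ccontr)
    assume "\<not> ?thesis"
    then obtain x where x: "x \<in> N" "radial_lift g x < radial_lift g z" by force
    have "radial_lift g (x /\<^sub>R norm x) = radial_lift g x"
      using homog[of "inverse (norm x)" x] x(1) by (simp add: N_def)
    then have "x /\<^sub>R norm x \<in> sublevel S3 (radial_lift g) (radial_lift g z)"
      using x by (simp add: sublevel_def N_def)
    then show False using x(1) closure_subset by (auto simp: N_def)
  qed
  ultimately have "DU z = (\<lambda>v. 0)"
    using differential_zero_maxmin[OF _ _ has_derivative_U[OF z'(2)]] by blast
  then show ?thesis using z' by (simp add: lifted_critical_def)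
qed

lemma finite_lifted_critical:
  assumes "smooth_M g" "finite (critical_points g)"
  shows "finite (lifted_critical g)"
proof (rule finite_subset)
  show "lifted_critical g \<subseteq> (\<Union>p\<in>critical_points g. fibre p)"
  proof
    fix z assume z: "z \<in> lifted_critical g"
    then have zS: "z \<in> S3" by (simp add: lifted_critical_def)
    have "z \<in> fibre (proj z)" unfolding fibre_proj[OF zS] orbit_def using I_star_one by force
    then show "z \<in> (\<Union>p\<in>critical_points g. fibre p)" using lifted_critical_iff[OF assms(1) zS] z by blast
  qed
  have "finite (fibre p)" for p
  proof -
    obtain z where "z \<in> S3" "p = proj z" using proj_surj by (metis UNIV_I imageE)
    then show ?thesis by (simp add: fibre_proj orbit_def I_star_finite)
  qed
  then show "finite (\<Union>p\<in>critical_points g. fibre p)" using assms(2) by blast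
qed

text \<open>Dimension three enters here: \<open>dim N + dim P = 3\<close> prevents both from being
  1, so a critical point is tame for the function or for its negative. At a local minimum
  \<open>dim P = 3\<close>.\<close>

lemma critical_type:
  assumes g: "morse g" and z: "z \<in> lifted_critical g"
  shows "tame S3 (radial_lift g) z \<or> tame S3 (\<lambda>x. - radial_lift g x) z"
    "bitame S3 (radial_lift g) z"
    "z \<in> local_minima S3 (radial_lift g) \<Longrightarrow> tame S3 (\<lambda>x. - radial_lift g x) z"
proof -
  have sm: "smooth_M g" using g by (simp add: morse_def)
  interpret radial "radial_lift g" by (rule radial_radial_lift[OF sm])
  have Ck': "Ck_on 2 (- {0}) (\<lambda>x. - radial_lift g x)" using Ck_on_cmult[OF open_S C2, of "- 1"] by simp
  interpret m: radial "\<lambda>x. - radial_lift g x"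
    by unfold_locales (use Ck' homog in auto)
  have zS: "z \<in> S3" "norm z = 1" "z \<in> - {0}" using z by (auto simp: lifted_critical_def)
  have Tt: "T z = tangent z" by (simp add: T_def tangent_def)
  have crit: "DU z v = 0" if "v \<in> T z" for v using z that by (simp add: lifted_critical_def Tt)
  have nd: "v = 0" if "v \<in> T z" "\<And>w. w \<in> T z \<Longrightarrow> H z v w = 0" for v
  proof -
    have "proj z \<in> critical_points g" using lifted_critical_iff[OF sm zS(1)] z by blast
    then have "nondegenerate_at g (proj z)" using g by (simp add: morse_def)
    moreover have "z \<in> fibre (proj z)" unfolding fibre_proj[OF zS(1)] orbit_def using I_star_one by force
    ultimately show ?thesis using that unfolding nondegenerate_at_def Tt by blast
  qed
  obtain N P n p where *: "subspace N" "subspace P" "N \<subseteq> T z" "P \<subseteq> T z" "linear n" "linear p"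
    "\<And>v. v \<in> T z \<Longrightarrow> n v \<in> N" "\<And>v. v \<in> T z \<Longrightarrow> p v \<in> P" "\<And>v. v \<in> T z \<Longrightarrow> n v + p v = v"
    "\<And>v. v \<in> N \<Longrightarrow> v \<noteq> 0 \<Longrightarrow> H z v v < 0" "\<And>v. v \<in> P \<Longrightarrow> v \<noteq> 0 \<Longrightarrow> H z v v > 0"
    "dim N + dim P = dim (T z)"
    using definite_split[OF T_subspace linear_H1[OF zS(3)] H_symmetric[OF zS(3)] nd] by blast
  have "dim (T z) = DIM(complex^2) - 1"
    unfolding T_def using dim_hyperplane[of z] zS(3) by (simp add: inner_commute)
  then have dim: "dim N + dim P = 3" using *(12) by simp
  have DU': "m.DU x v = - DU x v" if "x \<in> - {0}" for x v
    using has_derivative_unique[OF m.has_derivative_U[OF that] has_derivative_minus[OF has_derivative_U[OF that]]] by metis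
  have H': "m.H z v w = - H z v w" for v w
  proof -
    have "((\<lambda>y. - DU y w) has_derivative (\<lambda>v. - H z v w)) (at z)"
      using has_derivative_minus[OF has_derivative_DU[OF zS(3)]] .
    then have "((\<lambda>y. m.DU y w) has_derivative (\<lambda>v. - H z v w)) (at z)"
      by (rule has_derivative_transform_within_open[OF _ open_S zS(3)]) (simp add: DU')
    then show ?thesis using has_derivative_unique[OF m.has_derivative_DU[OF zS(3)]] by metis
  qed
  have T': "m.T z = T z" by (simp add: m.T_def T_def)
  note up = critical_types[OF zS(2) crit *(1,3,10,2,4,11,5,6,7,8,9)]
  have up1: "tame S3 (radial_lift g) z" if "dim N \<noteq> 1" by (rule up(1)[OF _ _ _ _ _ _ _ _ that])
  have up3: "dim N = 0" if "z \<in> local_minima S3 (radial_lift g)" by (rule up(3)[OF _ _ _ _ _ _ _ _ that])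
  have swap: "p v + n v = v" if "v \<in> T z" for v using *(9)[OF that] by (simp add: add.commute)
  have a1: "m.DU z v = 0" if "v \<in> T z" for v using crit[OF that] DU'[OF zS(3), of v] by simp
  have a2: "m.H z v v < 0" if "v \<in> P" "v \<noteq> 0" for v using *(11)[OF that] H'[of v v] by simp
  have a3: "m.H z v v > 0" if "v \<in> N" "v \<noteq> 0" for v using *(10)[OF that] H'[of v v] by simp
  note down = m.critical_types(1)[unfolded T', OF zS(2) a1 *(2,4) a2 *(1,3) a3 *(6,5,8,7) swap]
  have down1: "tame S3 (\<lambda>x. - radial_lift g x) z" if "dim P \<noteq> 1" by (rule down[OF _ _ _ _ _ _ _ _ that])
  show "tame S3 (radial_lift g) z \<or> tame S3 (\<lambda>x. - radial_lift g x) z"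
  proof (cases "dim N = 1")
    case True
    then have "dim P \<noteq> 1" using dim by simp
    then show ?thesis using down1 by blast
  qed (use up1 in blast)
  show "bitame S3 (radial_lift g) z" by (rule up(2))
  show "tame S3 (\<lambda>x. - radial_lift g x) z" if "z \<in> local_minima S3 (radial_lift g)"
  proof -
    have "dim P \<noteq> 1" using up3[OF that] dim by linarith
    then show ?thesis by (rule down1)
  qed
qed

lemma nontame_critical:
  assumes g: "smooth_M g" and z: "z \<in> S3" "\<not> tame S3 (radial_lift g) z"
  shows "z \<in> lifted_critical g"
proof -
  interpret radial "radial_lift g" by (rule radial_radial_lift[OF g])
  show ?thesis using tame_noncritical[of z] z by (auto simp: lifted_critical_def T_def tangent_def)
qed

lemma equivariant_radial_lift:
  assumes sm: "smooth_M g" and fin: "finite (critical_points g)"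
  shows "equivariant_setup S3 (radial_lift g) rotations"
proof -
  interpret radial "radial_lift g" by (rule radial_radial_lift[OF sm])
  have "finite (local_minima S3 (radial_lift g))"
    by (rule finite_subset[OF _ finite_lifted_critical[OF sm fin]]) (use local_minimum_critical[OF sm] in blast)
  moreover have "continuous_on S3 (radial_lift g)" by (rule continuous_on_sphere)
  ultimately show ?thesis
  proof unfold_locales
    show "f \<in> rotations \<Longrightarrow> continuous_on S3 f" for f
      using rotation_linear by (auto simp: rotations_def linear_continuous_on linear_conv_bounded_linear)
    show "f \<in> rotations \<Longrightarrow> x \<in> S3 \<Longrightarrow> radial_lift g (f x) = radial_lift g x" for f x
      by (auto simp: rotations_def radial_lift_rotation)
    show "f \<in> rotations \<Longrightarrow> x \<in> S3 \<Longrightarrow> f x = x \<Longrightarrow> f = id" for f x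
      using I_star_free by (fastforce simp: rotations_def)
  qed (use rotations_group locally_path_connected_sphere in auto)
qed

text \<open>If the saddles of index 1 formed at most one orbit, the group would be contained in every subgroup
  containing a single element \<open>h\<close>, in particular in the centralizer of \<open>h\<close>.\<close>
lemma two_saddles:
  assumes g: "morse g" and fin: "finite (critical_points g)"
  obtains q1 q2 where "q1 \<in> lifted_critical g" "q2 \<in> lifted_critical g"
    "\<not> tame S3 (radial_lift g) q1" "\<not> tame S3 (radial_lift g) q2" "proj q1 \<noteq> proj q2"
proof (rule ccontr)
  assume n: "\<not> thesis"
  have sm: "smooth_M g" using g by (simp add: morse_def)
  interpret equivariant_setup S3 "radial_lift g" rotations by (rule equivariant_radial_lift[OF sm fin])
  have ex: "\<exists>q0\<in>S3. \<forall>q\<in>S3. \<not> tame S3 (radial_lift g) q \<longrightarrow> proj q = proj q0"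
  proof (cases "\<exists>q0\<in>S3. \<not> tame S3 (radial_lift g) q0")
    case True
    then show ?thesis using n that nontame_critical[OF sm] by metis
  next
    case False
    have "axis 1 1 \<in> S3" by (simp add: norm_axis_1)
    then show ?thesis using False by blast
  qed
  then obtain q0 where q0: "q0 \<in> S3" "\<And>q. q \<in> S3 \<Longrightarrow> \<not> tame S3 (radial_lift g) q \<Longrightarrow> proj q = proj q0" by blast
  have W: "\<exists>f\<in>rotations. q = f q0" if "q \<in> S3" "\<not> tame S3 (radial_lift g) q" for q
    using q0(2)[OF that] proj_eq_iff[OF that(1) q0(1)] by (auto simp: rotations_def)
  have bi: "bitame S3 (radial_lift g) q0" if "\<not> tame S3 (radial_lift g) q0"
    using critical_type(2)[OF g nontame_critical[OF sm q0(1) that]] .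
  have con: "connected S3" by (rule connected_sphere) simp
  have ne: "S3 \<noteq> {}" using q0 by blast
  obtain h where h: "h \<in> rotations" "\<And>H. H \<subseteq> rotations \<Longrightarrow> transformation_group S3 H \<Longrightarrow> h \<in> H \<Longrightarrow> H = rotations"
    using generated_by_one[OF con ne q0(1) W bi] by blast
  show False by (rule I_star_not_monogenic[OF h])
qed

lemma radial_lift_uminus: "radial_lift (\<lambda>p. - g p) = (\<lambda>x. - radial_lift g x)"
  by (simp add: radial_lift_def fun_eq_iff)

lemma critical_points_cmult:
  assumes g: "smooth_M g" and c: "c \<noteq> 0"
  shows "smooth_M (\<lambda>p. c * g p)" "critical_points (\<lambda>p. c * g p) = critical_points g"
    "nondegenerate_at (\<lambda>p. c * g p) q \<longleftrightarrow> nondegenerate_at g q"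
proof -
  interpret radial "radial_lift g" by (rule radial_radial_lift[OF g])
  have r: "radial_lift (\<lambda>p. c * g p) = (\<lambda>x. c * radial_lift g x)"
    by (simp add: radial_lift_def fun_eq_iff)
  show sm: "smooth_M (\<lambda>p. c * g p)"
    using g Ck_on_cmult[OF open_S] by (simp add: smooth_M_def smooth_on_def r)
  interpret m: radial "\<lambda>x. c * radial_lift g x" using radial_radial_lift[OF sm] by (simp add: r)
  have DU': "m.DU x v = c * DU x v" if "x \<in> - {0}" for x v
    using has_derivative_unique[OF m.has_derivative_U[OF that] has_derivative_mult_right[OF has_derivative_U[OF that]]] by metis
  have H': "m.H z v w = c * H z v w" if z: "z \<in> - {0}" for z v w
  proof -
    have "((\<lambda>y. c * DU y w) has_derivative (\<lambda>v. c * H z v w)) (at z)"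
      using has_derivative_mult_right[OF has_derivative_DU[OF z]] .
    then have "((\<lambda>y. m.DU y w) has_derivative (\<lambda>v. c * H z v w)) (at z)"
      by (rule has_derivative_transform_within_open[OF _ open_S z]) (simp add: DU')
    then show ?thesis using has_derivative_unique[OF m.has_derivative_DU[OF z]] by metis
  qed
  have fib: "z \<in> - {0}" if zp: "z \<in> fibre p" for z p
  proof -
    obtain w where "w \<in> S3" "p = proj w" using proj_surj by (metis UNIV_I imageE)
    then obtain B where "B \<in> I_star" "z = B *v w"
      using zp unfolding \<open>p = proj w\<close> fibre_proj[OF \<open>w \<in> S3\<close>] orbit_def by blast
    then have "z \<in> S3" using I_star_sphere[OF _ \<open>w \<in> S3\<close>] by blast
    then show ?thesis by auto
  qed
  show "critical_points (\<lambda>p. c * g p) = critical_points g"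
    unfolding critical_points_def r using DU' fib c by (metis (no_types, lifting) mult_eq_0_iff)
  show "nondegenerate_at (\<lambda>p. c * g p) q \<longleftrightarrow> nondegenerate_at g q"
    unfolding nondegenerate_at_def r using H' fib c by (metis (no_types, lifting) mult_eq_0_iff)
qed

lemma morse_cmult: "morse g \<Longrightarrow> c \<noteq> 0 \<Longrightarrow> morse (\<lambda>p. c * g p)"
  using critical_points_cmult by (simp add: morse_def)

text \<open>Tameness for \<open>U\<close> and for \<open>V = - U\<close> tells the six orbits apart:
  \<open>q1\<close> and \<open>q2\<close> are not tame for \<open>U\<close>, \<open>r1\<close> and
  \<open>r2\<close> are not tame for \<open>V\<close>, the minimum \<open>a\<close> and the maximum
  \<open>b\<close> are tame for both. If \<open>a\<close> and \<open>b\<close> had the same image,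
  \<open>U\<close> would be constant and every point tame.\<close>

theorem morse_at_least_six:
  assumes g: "morse g" and fin: "finite (critical_points g)"
  shows "6 \<le> card (critical_points g)"
proof -
  define U where "U = radial_lift g"
  define V where "V = radial_lift (\<lambda>p. - g p)"
  have VU: "V = (\<lambda>x. - U x)" by (simp add: U_def V_def radial_lift_uminus)
  have sm: "smooth_M g" using g by (simp add: morse_def)
  have g': "morse (\<lambda>p. - g p)" and cp': "critical_points (\<lambda>p. - g p) = critical_points g" and sm': "smooth_M (\<lambda>p. - g p)"
    using morse_cmult[OF g, of "- 1"] critical_points_cmult[OF sm, of "- 1"] by simp_all
  have fin': "finite (critical_points (\<lambda>p. - g p))" using fin cp' by simp
  obtain q1 q2 where q: "q1 \<in> lifted_critical g" "q2 \<in> lifted_critical g" "\<not> tame S3 U q1" "\<not> tame S3 U q2" "proj q1 \<noteq> proj q2"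
    using two_saddles[OF g fin] unfolding U_def by blast
  obtain r1 r2 where r: "r1 \<in> lifted_critical (\<lambda>p. - g p)" "r2 \<in> lifted_critical (\<lambda>p. - g p)" "\<not> tame S3 V r1" "\<not> tame S3 V r2" "proj r1 \<noteq> proj r2"
    using two_saddles[OF g' fin'] unfolding V_def by blast
  interpret radial U unfolding U_def by (rule radial_radial_lift[OF sm])
  have cont: "continuous_on S3 U"
    by (rule continuous_on_sphere)
  have ne: "S3 \<noteq> {}" using q(1) by (auto simp: lifted_critical_def)
  obtain a where a: "a \<in> S3" "\<And>x. x \<in> S3 \<Longrightarrow> U a \<le> U x"
    using continuous_attains_inf[OF compact_sphere ne cont] by blast
  obtain b where b: "b \<in> S3" "\<And>x. x \<in> S3 \<Longrightarrow> U x \<le> U b"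
    using continuous_attains_sup[OF compact_sphere ne cont] by blast
  \<comment> \<open>There is nothing below an absolute minimum, so the empty set witnesses
    tameness.\<close>
  have la: "sublevel S3 U (U a) = {}" using a by (force simp: sublevel_def)
  have lb: "sublevel S3 V (V b) = {}" using b by (force simp: sublevel_def VU)
  have ta: "tame S3 U a" unfolding tame_def la by (intro exI[of _ UNIV] exI[of _ "{}"]) auto
  have tb: "tame S3 V b" unfolding tame_def lb by (intro exI[of _ UNIV] exI[of _ "{}"]) auto
  have ma: "a \<in> local_minima S3 U" and mb: "b \<in> local_minima S3 V"
    using a b la lb by (simp_all add: local_minima_def)
  have ca: "a \<in> lifted_critical g" using local_minimum_critical[OF sm] ma by (simp add: U_def)
  have cb: "b \<in> lifted_critical (\<lambda>p. - g p)" using local_minimum_critical[OF sm'] mb by (simp add: V_def)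
  have Va: "tame S3 V a" using critical_type(3)[OF g ca] ma by (simp add: U_def[symmetric] VU)
  have Ub: "tame S3 U b" using critical_type(3)[OF g' cb] mb by (simp add: V_def[symmetric] VU)
  have excl: "tame S3 U z \<or> tame S3 V z" if "z \<in> lifted_critical g" for z
    using critical_type(1)[OF g that] by (simp add: U_def[symmetric] VU)
  have tinv: "tame S3 U x \<longleftrightarrow> tame S3 U y" "tame S3 V x \<longleftrightarrow> tame S3 V y" "U x = U y"
    if xy: "x \<in> S3" "y \<in> S3" "proj x = proj y" for x y
  proof -
    show "U x = U y" using xy by (simp add: U_def radial_lift_S3)
    have *: "tame S3 U x \<Longrightarrow> tame S3 U y" "tame S3 V x \<Longrightarrow> tame S3 V y"
      if xy: "x \<in> S3" "y \<in> S3" "proj y = proj x" for x y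
    proof -
      obtain f where f: "f \<in> rotations" "y = f x"
        using xy proj_eq_iff by (auto simp: rotations_def)
      show "tame S3 U x \<Longrightarrow> tame S3 U y"
        unfolding f(2) U_def by (rule equivariant_setup.tame_image[OF equivariant_radial_lift[OF sm fin] f(1) xy(1)])
      show "tame S3 V x \<Longrightarrow> tame S3 V y"
        unfolding f(2) V_def by (rule equivariant_setup.tame_image[OF equivariant_radial_lift[OF sm' fin'] f(1) xy(1)])
    qed
    show "tame S3 U x \<longleftrightarrow> tame S3 U y" "tame S3 V x \<longleftrightarrow> tame S3 V y"
      using * xy by metis+
  qed
  have inS: "q1 \<in> S3" "q2 \<in> S3" "r1 \<in> S3" "r2 \<in> S3" using q r by (auto simp: lifted_critical_def)
  have cpr: "proj ` {q1, q2, r1, r2, a, b} \<subseteq> critical_points g"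
    using q r ca cb lifted_critical_iff[OF sm] lifted_critical_iff[OF sm'] inS a b cp' by auto
  have exr: "tame S3 U r1" "tame S3 U r2" using excl r lifted_critical_iff[OF sm] lifted_critical_iff[OF sm'] inS cp' by metis+
  have ab: "proj a \<noteq> proj b"
  proof
    assume "proj a = proj b"
    then have "U x = U a" if "x \<in> S3" for x using tinv(3)[OF a(1) b(1)] a(2)[OF that] b(2)[OF that] by simp
    then have "sublevel S3 U (U q1) = {}" using inS(1) by (force simp: sublevel_def)
    then have "tame S3 U q1" unfolding tame_def by (intro exI[of _ UNIV] exI[of _ "{}"]) auto
    then show False using q by blast
  qed
  have "card (proj ` {q1, q2, r1, r2, a, b}) = 6"
  proof -
    have "proj q1 \<noteq> proj r1" "proj q1 \<noteq> proj r2" "proj q2 \<noteq> proj r1" "proj q2 \<noteq> proj r2"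
      "proj q1 \<noteq> proj a" "proj q2 \<noteq> proj a" "proj q1 \<noteq> proj b" "proj q2 \<noteq> proj b"
      "proj r1 \<noteq> proj a" "proj r2 \<noteq> proj a" "proj r1 \<noteq> proj b" "proj r2 \<noteq> proj b"
      using tinv inS a(1) b(1) q r exr ta tb Va Ub by metis+
    then show ?thesis using q(5) r(5) ab by simp
  qed
  then show ?thesis using card_mono[OF fin cpr] by simp
qed

section \<open>Derivatives of the functions $A_j$\<close>

definition cpoly :: "('a::real_normed_vector \<Rightarrow> complex) \<Rightarrow> bool" where
  "cpoly f \<longleftrightarrow> real_polynomial_function (\<lambda>x. Re (f x)) \<and> real_polynomial_function (\<lambda>x. Im (f x))"

lemma cpoly_const [simp]: "cpoly (\<lambda>_. c)"
  by (auto simp: cpoly_def)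

lemma cpoly_linear: "bounded_linear f \<Longrightarrow> cpoly f"
  unfolding cpoly_def
  by (auto intro!: real_polynomial_function.intros(1) bounded_linear_compose[OF bounded_linear_Re] bounded_linear_compose[OF bounded_linear_Im])

lemma cpoly_add: "cpoly f \<Longrightarrow> cpoly g \<Longrightarrow> cpoly (\<lambda>x. f x + g x)"
  by (auto simp: cpoly_def)

lemma cpoly_mult: "cpoly f \<Longrightarrow> cpoly g \<Longrightarrow> cpoly (\<lambda>x. f x * g x)"
  by (auto simp: cpoly_def intro!: real_polynomial_function_diff)

lemma cpoly_cnj: "cpoly f \<Longrightarrow> cpoly (\<lambda>x. cnj (f x))"
  by (auto simp: cpoly_def real_polynomial_function_minus)

lemma cpoly_minus: "cpoly f \<Longrightarrow> cpoly (\<lambda>x. - f x)"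
  by (auto simp: cpoly_def real_polynomial_function_minus)

lemma cpoly_diff: "cpoly f \<Longrightarrow> cpoly g \<Longrightarrow> cpoly (\<lambda>x. f x - g x)"
  using cpoly_add[OF _ cpoly_minus, of f g] by simp

lemma cpoly_sum: "(\<And>i. i \<in> I \<Longrightarrow> cpoly (f i)) \<Longrightarrow> cpoly (\<lambda>x. \<Sum>i\<in>I. f i x)"
  by (induction I rule: infinite_finite_induct) (auto intro: cpoly_add)

lemma cpoly_nth [simp]: "cpoly (\<lambda>z::complex^2. z $ k)"
  by (intro cpoly_linear bounded_linear_vec_nth)

lemma cpoly_derivative:
  assumes "cpoly f"
  shows "\<exists>D. (\<forall>x. (f has_derivative D x) (at x)) \<and> (\<forall>v. cpoly (\<lambda>x. D x v))"
proof -
  obtain D E where D: "\<forall>x. ((\<lambda>x. Re (f x)) has_derivative D x) (at x)" "\<forall>v. real_polynomial_function (\<lambda>x. D x v)"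
    and E: "\<forall>x. ((\<lambda>x. Im (f x)) has_derivative E x) (at x)" "\<forall>v. real_polynomial_function (\<lambda>x. E x v)"
    using assms real_polynomial_function_derivative[of "\<lambda>x. Re (f x)"]
      real_polynomial_function_derivative[of "\<lambda>x. Im (f x)"] unfolding cpoly_def by blast
  have "((\<lambda>x. complex_of_real (Re (f x)) + \<i> * complex_of_real (Im (f x))) has_derivative
     (\<lambda>v. complex_of_real (D x v) + \<i> * complex_of_real (E x v))) (at x)" for x
    using D(1)[rule_format, of x] E(1)[rule_format, of x]
    by (intro has_derivative_add has_derivative_mult_right has_derivative_of_real)
  then have "(f has_derivative (\<lambda>v. complex_of_real (D x v) + \<i> * complex_of_real (E x v))) (at x)" for x
    by (simp only: complex_eq[symmetric])
  moreover have "cpoly (\<lambda>x. complex_of_real (D x v) + \<i> * complex_of_real (E x v))" for v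
    using D(2) E(2) by (simp add: cpoly_def)
  ultimately show ?thesis
    by (intro exI[of _ "\<lambda>x v. complex_of_real (D x v) + \<i> * complex_of_real (E x v)"]) blast
qed

lemma cpoly_frechet:
  assumes "cpoly f"
  shows "(f has_derivative frechet_derivative f (at x)) (at x)" "cpoly (\<lambda>x. frechet_derivative f (at x) v)"
proof -
  obtain D where D: "\<And>x. (f has_derivative D x) (at x)" "\<And>v. cpoly (\<lambda>x. D x v)"
    using cpoly_derivative[OF assms] by blast
  have e: "frechet_derivative f (at x) = D x" for x using frechet_derivative_at[OF D(1)] by simp
  show "(f has_derivative frechet_derivative f (at x)) (at x)" "cpoly (\<lambda>x. frechet_derivative f (at x) v)"
    using D by (simp_all add: e)
qed

lemma rpf_continuous: "real_polynomial_function f \<Longrightarrow> continuous_on S f"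
  using continuous_on_polymonial_function real_polynomial_function_eq by blast

lemma cpoly_continuous: "cpoly f \<Longrightarrow> continuous_on S f"
proof -
  assume "cpoly f"
  then have "continuous_on S (\<lambda>x. complex_of_real (Re (f x)) + \<i> * complex_of_real (Im (f x)))"
    unfolding cpoly_def by (intro continuous_intros rpf_continuous) auto
  then show ?thesis by (simp only: complex_eq[symmetric])
qed

lemma cpoly_A_fun: "cpoly (A_fun j)"
proof -
  define cp where "cp P \<longleftrightarrow> (\<forall>j. cpoly (\<lambda>z::complex^2. coeff (P z) j))" for P
  have mult: "cp (\<lambda>z. P z * Q z)" if "cp P" "cp Q" for P Q
    using that unfolding cp_def coeff_mult by (auto intro!: cpoly_sum cpoly_mult)
  have const: "cp (\<lambda>_. p)" for p by (simp add: cp_def)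
  have power: "cp (\<lambda>z. P z ^ n)" if "cp P" for P n
    by (induction n) (auto intro: const mult that)
  have lin: "cp (\<lambda>z. [: f z, g z :])" if "cpoly f" "cpoly g" for f g
    unfolding cp_def
  proof
    fix j
    consider "j = 0" | "j = 1" | k where "j = Suc (Suc k)" by (cases j rule: nat.exhaust) (auto, metis not0_implies_Suc)
    then show "cpoly (\<lambda>z. coeff [: f z, g z :] j)" using that by cases simp_all
  qed
  have "cp (\<lambda>z. I12 [: z $ 1, - cnj (z $ 2) :] [: z $ 2, cnj (z $ 1) :])"
  proof -
    have p: "cp (\<lambda>z. [: z $ 1, - cnj (z $ 2) :])" "cp (\<lambda>z. [: z $ 2, cnj (z $ 1) :])"
      by (intro lin cpoly_cnj cpoly_minus cpoly_nth)+
    have add: "cp (\<lambda>z. P z + Q z)" "cp (\<lambda>z. P z - Q z)" if "cp P" "cp Q" for P Q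
      using that unfolding cp_def by (auto intro: cpoly_add cpoly_diff)
    show ?thesis unfolding I12_def by (intro add mult power p const)
  qed
  then show ?thesis unfolding cp_def A_fun_def[abs_def] by blast
qed

definition DA :: "nat \<Rightarrow> complex^2 \<Rightarrow> complex^2 \<Rightarrow> complex" where
  "DA j z = frechet_derivative (A_fun j) (at z)"

lemma DA: "(A_fun j has_derivative DA j z) (at z)" "cpoly (\<lambda>z. DA j z v)"
  unfolding DA_def using cpoly_frechet[OF cpoly_A_fun] by blast+

section \<open>The generating polynomial of the functions \<open>A_j\<close>\<close>

definition lf :: "complex \<Rightarrow> complex^2 \<Rightarrow> complex" where "lf s z = z $ 1 - cnj (z $ 2) * s"
definition lg :: "complex \<Rightarrow> complex^2 \<Rightarrow> complex" where "lg s z = z $ 2 + cnj (z $ 1) * s"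

text \<open>Relations among the \<open>A_j\<close> and their derivatives are proved for this
  polynomial in \<open>s\<close> and read off by comparing coefficients.\<close>

lemma gen: "(\<Sum>j\<le>12. A_fun j z * s ^ j) = I12 (lf s z) (lg s z)"
  using A_fun_expansion[of z 1 s] by (simp add: lf_def lg_def)

lemma bounded_linear_lf: "bounded_linear (lf s)" "bounded_linear (lg s)"
  unfolding linear_conv_bounded_linear[symmetric]
  by (rule linearI; simp add: lf_def lg_def algebra_simps)+

lemma has_derivative_lf: "(lf s has_derivative lf s) (at z)" "(lg s has_derivative lg s) (at z)"
  using bounded_linear_lf by (simp_all add: bounded_linear_imp_has_derivative)

lemma pow_lf: "((\<lambda>z. lf s z ^ n) has_derivative (\<lambda>v. of_nat n * lf s v * lf s z ^ (n - 1))) (at z)"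
  and pow_lg: "((\<lambda>z. lg s z ^ n) has_derivative (\<lambda>v. of_nat n * lg s v * lg s z ^ (n - 1))) (at z)"
  by (rule has_derivative_power[OF has_derivative_lf(1)], rule has_derivative_power[OF has_derivative_lf(2)])

definition I12x :: "complex \<Rightarrow> complex \<Rightarrow> complex" where "I12x x y = 11 * x ^ 10 * y + 66 * x ^ 5 * y ^ 6 - y ^ 11"
definition I12y :: "complex \<Rightarrow> complex \<Rightarrow> complex" where "I12y x y = x ^ 11 + 66 * x ^ 6 * y ^ 5 - 11 * x * y ^ 10"

lemma gen_derivative:
  "(\<Sum>j\<le>12. DA j z v * s ^ j) = I12x (lf s z) (lg s z) * lf s v + I12y (lf s z) (lg s z) * lg s v"
proof -
  have A: "((\<lambda>z. I12 (lf s z) (lg s z)) has_derivative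
    (\<lambda>v. I12x (lf s z) (lg s z) * lf s v + I12y (lf s z) (lg s z) * lg s v)) (at z)"
    unfolding I12_def
    by (rule has_derivative_eq_rhs,
        (rule has_derivative_diff | rule has_derivative_add | rule pow_lf pow_lg has_derivative_lf has_derivative_const
          | rule has_derivative_mult)+, rule ext)
       (simp add: I12x_def I12y_def algebra_simps)
  have B: "((\<lambda>z. \<Sum>j\<le>12. A_fun j z * s ^ j) has_derivative (\<lambda>v. \<Sum>j\<le>12. DA j z v * s ^ j)) (at z)"
    by (intro has_derivative_sum has_derivative_mult_left DA)
  show ?thesis by (rule fun_cong[OF has_derivative_unique[OF B[unfolded gen] A]])
qed

lemma gen_pderiv:
  "(\<Sum>j\<le>12. of_nat j * A_fun j z * s ^ (j - 1)) = I12x (lf s z) (lg s z) * (- cnj (z $ 2)) + I12y (lf s z) (lg s z) * cnj (z $ 1)"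
proof -
  have l: "((\<lambda>s. lf s z) has_field_derivative (- cnj (z $ 2))) (at s)" "((\<lambda>s. lg s z) has_field_derivative cnj (z $ 1)) (at s)"
    unfolding lf_def lg_def by (auto intro!: derivative_eq_intros)
  have "((\<lambda>s. I12 (lf s z) (lg s z)) has_field_derivative
     I12x (lf s z) (lg s z) * (- cnj (z $ 2)) + I12y (lf s z) (lg s z) * cnj (z $ 1)) (at s)"
    unfolding I12_def I12x_def I12y_def
    by (rule DERIV_cong, (rule DERIV_diff | rule DERIV_add | rule DERIV_power l DERIV_const | rule DERIV_mult)+)
       (simp add: algebra_simps)
  moreover have "((\<lambda>s. \<Sum>j\<le>12. A_fun j z * s ^ j) has_field_derivative
     (\<Sum>j\<le>12. of_nat j * A_fun j z * s ^ (j - 1))) (at s)"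
    by (rule DERIV_cong, rule DERIV_sum, (rule derivative_intros)+) (simp add: algebra_simps)
  ultimately show ?thesis unfolding gen by (metis DERIV_unique)
qed

lemma gen_euler: "I12x x y * x + I12y x y * y = 12 * I12 x y"
  unfolding I12x_def I12y_def I12_def by algebra

text \<open>Together with the fibre direction \<open>\<i> z\<close>, the vectors \<open>hat \<kappa> z\<close> span the tangent space; along
  them the derivatives of the \<open>A_j\<close> are combinations of \<open>A_(j-1)\<close> and \<open>A_(j+1)\<close>.\<close>
definition hat :: "complex \<Rightarrow> complex^2 \<Rightarrow> complex^2" where
  "hat \<kappa> z = vector [- \<kappa> * cnj (z $ 2), \<kappa> * cnj (z $ 1)]"

lemma coeffs_eqI:
  fixes a b :: "nat \<Rightarrow> complex"
  assumes "\<And>s. (\<Sum>j\<le>12. a j * s ^ j) = (\<Sum>j\<le>12. b j * s ^ j)" "j \<le> 12"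
  shows "a j = b j"
  using polyfun_eq_coeffs[of a 12 b] assms by blast

lemma sum_12: "(\<Sum>j\<le>12. f j) = f 0 + f 1 + f 2 + f 3 + f 4 + f 5 + f 6 + f 7 + f 8 + f 9 + f 10 + f 11 + f (12::nat)"
  for f :: "nat \<Rightarrow> complex"
  by (simp add: numeral_eq_Suc)

text \<open>\<open>hat \<kappa> z\<close> is the direction of a right translation in SU(2), which
  acts on \<open>s\<close> by Moebius transformations. On the generating polynomial \<open>F\<close>
  of degree 12 this is the operator \<open>(\<kappa> + cnj \<kappa> * s\<^sup>2) * F' - 12 * cnj
  \<kappa> * s * F\<close>, which shifts coefficients by one place up or down. For
  \<open>j = 11\<close> there is no upper neighbour.\<close>

lemma DA_hat:
  "j < 12 \<Longrightarrow> DA (Suc j) z (hat \<kappa> z) = (if j = 11 then 0 else \<kappa> * of_nat (j + 2) * A_fun (j + 2) z) - cnj \<kappa> * of_nat (12 - j) * A_fun j z"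
proof -
  assume j: "j < 12"
  define b where "b i = (if i = 0 then \<kappa> * A_fun 1 z else
     (if i = 12 then 0 else \<kappa> * of_nat (i + 1) * A_fun (i + 1) z) - cnj \<kappa> * of_nat (13 - i) * A_fun (i - 1) z)" for i
  have "(\<Sum>j\<le>12. DA j z (hat \<kappa> z) * s ^ j) = (\<Sum>j\<le>12. b j * s ^ j)" for s
  proof -
    define F where "F = (\<Sum>j\<le>12. A_fun j z * s ^ j)"
    define F' where "F' = (\<Sum>j\<le>12. of_nat j * A_fun j z * s ^ (j - 1))"
    have "(\<Sum>j\<le>12. DA j z (hat \<kappa> z) * s ^ j) = (\<kappa> + cnj \<kappa> * s\<^sup>2) * F' - 12 * cnj \<kappa> * s * F"
      unfolding F_def F'_def gen_derivative gen_pderiv gen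
      using gen_euler[of "lf s z" "lg s z"]
      by (simp add: hat_def lf_def lg_def) algebra
    also have "\<dots> = (\<Sum>j\<le>12. b j * s ^ j)"
      unfolding F_def F'_def sum_12 b_def by (simp add: algebra_simps eval_nat_numeral)
    finally show ?thesis .
  qed
  then have "DA (Suc j) z (hat \<kappa> z) = b (Suc j)" using coeffs_eqI[of "\<lambda>j. DA j z (hat \<kappa> z)" b "Suc j"] j by simp
  then show ?thesis by (simp add: b_def)
qed

definition cscale :: "complex \<Rightarrow> complex^2 \<Rightarrow> complex^2" where
  "cscale \<omega> z = vector [\<omega> * z $ 1, \<omega> * z $ 2]"

lemma cscale_nth [simp]: "cscale \<omega> z $ 1 = \<omega> * z $ 1" "cscale \<omega> z $ 2 = \<omega> * z $ 2"
  by (simp_all add: cscale_def)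

lemma hat_nth [simp]: "hat \<kappa> z $ 1 = - \<kappa> * cnj (z $ 2)" "hat \<kappa> z $ 2 = \<kappa> * cnj (z $ 1)"
  by (simp_all add: hat_def)

text \<open>A phase multiplies \<open>A_j\<close> by its power with exponent
  \<open>12 - 2 j\<close>, and this is the infinitesimal form; the second claim is Euler's relation
  in degree 12.\<close>

lemma DA_cscale:
  assumes j: "j \<le> 12"
  shows "DA j z (cscale \<i> z) = \<i> * (12 - 2 * of_nat j) * A_fun j z" "DA j z z = 12 * A_fun j z"
proof -
  have "(\<Sum>j\<le>12. DA j z (cscale \<i> z) * s ^ j) = (\<Sum>j\<le>12. (\<i> * (12 - 2 * of_nat j) * A_fun j z) * s ^ j)" for s
  proof -
    define F where "F = (\<Sum>j\<le>12. A_fun j z * s ^ j)"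
    define F' where "F' = (\<Sum>j\<le>12. of_nat j * A_fun j z * s ^ (j - 1))"
    have "(\<Sum>j\<le>12. DA j z (cscale \<i> z) * s ^ j) = \<i> * (12 * F - 2 * s * F')"
      unfolding F_def F'_def gen_derivative gen_pderiv gen
      using gen_euler[of "lf s z" "lg s z"]
      by (simp add: lf_def lg_def) algebra
    also have "\<dots> = (\<Sum>j\<le>12. (\<i> * (12 - 2 * of_nat j) * A_fun j z) * s ^ j)"
      unfolding F_def F'_def sum_12 by (simp add: algebra_simps eval_nat_numeral)
    finally show ?thesis .
  qed
  then show "DA j z (cscale \<i> z) = \<i> * (12 - 2 * of_nat j) * A_fun j z"
    using coeffs_eqI[of "\<lambda>j. DA j z (cscale \<i> z)" "\<lambda>j. \<i> * (12 - 2 * of_nat j) * A_fun j z" j] j by blast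
  have "(\<Sum>j\<le>12. DA j z z * s ^ j) = (\<Sum>j\<le>12. (12 * A_fun j z) * s ^ j)" for s
    unfolding gen_derivative gen_euler gen[symmetric] by (simp add: sum_distrib_left mult.assoc)
  then show "DA j z z = 12 * A_fun j z"
    using coeffs_eqI[of "\<lambda>j. DA j z z" "\<lambda>j. 12 * A_fun j z" j] j by blast
qed

lemma A_fun_cscale:
  assumes j: "j \<le> 12"
  shows "A_fun j (cscale \<omega> z) = \<omega> ^ (12 - j) * cnj \<omega> ^ j * A_fun j z"
proof -
  have "(\<Sum>j\<le>12. A_fun j (cscale \<omega> z) * s ^ j) = (\<Sum>j\<le>12. (\<omega> ^ (12 - j) * cnj \<omega> ^ j * A_fun j z) * s ^ j)" for s
    using A_fun_expansion[of z \<omega> "cnj \<omega> * s"] unfolding gen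
    by (simp add: lf_def lg_def mult_ac power_mult_distrib)
  then show ?thesis
    using coeffs_eqI[of "\<lambda>j. A_fun j (cscale \<omega> z)" "\<lambda>j. \<omega> ^ (12 - j) * cnj \<omega> ^ j * A_fun j z" j] j by blast
qed

lemma A_fun_scaleR:
  assumes j: "j \<le> 12"
  shows "A_fun j (r *\<^sub>R z) = of_real r ^ 12 * A_fun j z"
proof -
  have "r *\<^sub>R z = cscale (of_real r) z"
    by (simp add: vec_eq_iff forall_2) (simp add: scaleR_conv_of_real)
  then show ?thesis using A_fun_cscale[OF j, of "of_real r" z] j by (simp add: power_add[symmetric])
qed

text \<open>\<open>I12\<close> has real coefficients and is unchanged when \<open>(x, y)\<close> is
  replaced by \<open>(- y, x)\<close>. Hence conjugating the two linear forms reverses the order of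
  the coefficients, up to signs.\<close>

lemma A_fun_cnj:
  assumes j: "j \<le> 12"
  shows "A_fun (12 - j) z = (- 1) ^ j * cnj (A_fun j z)"
proof -
  have *: "(\<Sum>j\<le>12. cnj (A_fun j z) * s ^ j) = (\<Sum>j\<le>12. ((- 1) ^ (12 - j) * A_fun (12 - j) z) * s ^ j)" for s
  proof -
    have "(\<Sum>j\<le>12. cnj (A_fun j z) * s ^ j) = cnj (\<Sum>j\<le>12. A_fun j z * cnj s ^ j)" by simp
    also have "\<dots> = cnj (I12 (lf (cnj s) z) (lg (cnj s) z))" unfolding gen ..
    also have "\<dots> = I12 (z $ 1 * (- s) - cnj (z $ 2) * 1) (z $ 2 * (- s) + cnj (z $ 1) * 1)"
      unfolding lf_def lg_def I12_def by simp algebra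
    also have "\<dots> = (\<Sum>j\<le>12. A_fun j z * (- s) ^ (12 - j))" using A_fun_expansion[of z "- s" 1] by simp
    also have "\<dots> = (\<Sum>j\<le>12. A_fun (12 - j) z * (- s) ^ (12 - (12 - j)))"
      by (rule sum.reindex_bij_witness[of _ "\<lambda>j. 12 - j" "\<lambda>j. 12 - j"]) auto
    also have "\<dots> = (\<Sum>j\<le>12. ((- 1) ^ (12 - j) * A_fun (12 - j) z) * s ^ j)"
    proof (rule sum.cong[OF refl])
      fix j :: nat assume "j \<in> {..12}"
      then have "12 - (12 - j) = j" "even (12 - j) \<longleftrightarrow> even j" by auto
      then show "A_fun (12 - j) z * (- s) ^ (12 - (12 - j)) = ((- 1) ^ (12 - j) * A_fun (12 - j) z) * s ^ j"
        by (simp add: power_minus[of s j] uminus_power_if)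
    qed
    finally show ?thesis .
  qed
  have "cnj (A_fun j z) = (- 1) ^ (12 - j) * A_fun (12 - j) z"
    using coeffs_eqI[of "\<lambda>j. cnj (A_fun j z)" "\<lambda>j. (- 1) ^ (12 - j) * A_fun (12 - j) z" j] * j by blast
  moreover have "even (12 - j) \<longleftrightarrow> even j" using j by auto
  ultimately show ?thesis by (auto simp: uminus_power_if)
qed

lemma A_fun_6_7: "A_fun 7 z = - cnj (A_fun 5 z)" "A_fun 6 z = complex_of_real (Re (A_fun 6 z))"
proof -
  show "A_fun 7 z = - cnj (A_fun 5 z)" using A_fun_cnj[of 5 z] by simp
  have "cnj (A_fun 6 z) = A_fun 6 z" using A_fun_cnj[of 6 z] by simp
  then show "A_fun 6 z = complex_of_real (Re (A_fun 6 z))" by (simp add: complex_eq_iff)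
qed

lemma sum_Basis_complex2:
  "(\<Sum>b\<in>(Basis::(complex^2) set). f b) = f (axis 1 1) + f (axis 1 \<i>) + f (axis 2 1) + f (axis 2 \<i>)" for f :: "complex^2 \<Rightarrow> 'b::comm_monoid_add"
proof -
  have B: "(Basis::(complex^2) set) = {axis 1 1, axis 1 \<i>, axis 2 1, axis 2 \<i>}"
    unfolding Basis_vec_def Basis_complex_def UNIV_2 by auto
  show ?thesis unfolding B by (subst sum.insert; simp add: axis_eq_axis add_ac)+
qed

text \<open>The forms \<open>lf s\<close> and \<open>lg s\<close> span an isotropic plane for the
  complexified inner product, so every polynomial in them is harmonic. This holds for all
  \<open>s\<close>, hence for each coefficient.\<close>

lemma laplacian_A_fun: "laplacian (\<lambda>z. Re (A_fun j z)) z = 0" if j: "j \<le> 12"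
proof -
  define D2 where "D2 j v w = frechet_derivative (\<lambda>y. DA j y w) (at z) v" for j v w
  have d2: "((\<lambda>y. DA j y w) has_derivative (\<lambda>v. D2 j v w)) (at z)" for j w
    unfolding D2_def using cpoly_frechet[OF DA(2)] by simp
  have 1: "second_deriv (\<lambda>z. Re (A_fun j z)) z v w = Re (D2 j v w)" for v w
  proof -
    have "frechet_derivative (\<lambda>z. Re (A_fun j z)) (at y) w = Re (DA j y w)" for y
      by (rule frechet_derivative_at[OF has_derivative_Re[OF DA(1)], THEN fun_cong, symmetric])
    then show ?thesis unfolding second_deriv_def
      by (simp only:) (rule frechet_derivative_at[OF has_derivative_Re[OF d2[of j w]], THEN fun_cong, symmetric])
  qed
  \<comment> \<open>The polynomial factors on the right are the second partial derivatives of
    \<open>I12\<close>.\<close>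
  have 2: "(\<Sum>j\<le>12. D2 j v v * s ^ j) =
     (110 * lf s z ^ 9 * lg s z + 330 * lf s z ^ 4 * lg s z ^ 6) * lf s v ^ 2
     + 2 * (11 * lf s z ^ 10 + 396 * lf s z ^ 5 * lg s z ^ 5 - 11 * lg s z ^ 10) * lf s v * lg s v
     + (330 * lf s z ^ 6 * lg s z ^ 4 - 110 * lf s z * lg s z ^ 9) * lg s v ^ 2" for s v
  proof -

    have A: "((\<lambda>z. I12x (lf s z) (lg s z) * lf s v + I12y (lf s z) (lg s z) * lg s v) has_derivative
      (\<lambda>w. ((110 * lf s z ^ 9 * lg s z + 330 * lf s z ^ 4 * lg s z ^ 6) * lf s w
       + (11 * lf s z ^ 10 + 396 * lf s z ^ 5 * lg s z ^ 5 - 11 * lg s z ^ 10) * lg s w) * lf s v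
       + ((11 * lf s z ^ 10 + 396 * lf s z ^ 5 * lg s z ^ 5 - 11 * lg s z ^ 10) * lf s w
       + (330 * lf s z ^ 6 * lg s z ^ 4 - 110 * lf s z * lg s z ^ 9) * lg s w) * lg s v)) (at z)"
      unfolding I12x_def I12y_def
      by (rule has_derivative_eq_rhs,
        (rule has_derivative_diff | rule has_derivative_add | rule pow_lf pow_lg has_derivative_lf has_derivative_const
          | rule has_derivative_mult)+, rule ext)
       (simp add: algebra_simps)
    have B: "((\<lambda>z. \<Sum>j\<le>12. DA j z v * s ^ j) has_derivative (\<lambda>w. \<Sum>j\<le>12. D2 j w v * s ^ j)) (at z)"
      by (intro has_derivative_sum has_derivative_mult_left d2)
    from fun_cong[OF has_derivative_unique[OF B[unfolded gen_derivative] A], of v] show ?thesis by (simp add: algebra_simps power2_eq_square)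
  qed
  have "(\<Sum>j\<le>12. (\<Sum>b\<in>Basis. D2 j b b) * s ^ j) = (\<Sum>j\<le>12. 0 * s ^ j)" for s
  proof -
    have "(\<Sum>j\<le>12. (\<Sum>b\<in>Basis. D2 j b b) * s ^ j) = (\<Sum>b\<in>Basis. \<Sum>j\<le>12. D2 j b b * s ^ j)"
      unfolding sum_distrib_right by (rule sum.swap)
    also have "\<dots> = 0"
      unfolding 2 sum_Basis_complex2 by (simp add: lf_def lg_def axis_def algebra_simps power2_eq_square)
    finally show ?thesis by simp
  qed
  then have "(\<Sum>b\<in>Basis. D2 j b b) = 0"
    using coeffs_eqI[of "\<lambda>j. \<Sum>b\<in>Basis. D2 j b b" "\<lambda>j. 0" j] j by blast
  then have "Re (\<Sum>b\<in>Basis. D2 j b b) = 0" by simp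
  then show ?thesis unfolding laplacian_def 1 by (simp only: Re_sum)
qed

section \<open>Explicit coefficients\<close>

lemma coeff_linear_power':
  "coeff ([:a, b:] ^ n) i = of_nat (n choose i) * b ^ i * a ^ (n - i)" for a b :: complex
proof (cases "i \<le> n")
  case False
  have "degree ([:a, b:] ^ n) \<le> degree [:a, b:] * n" by (rule degree_power_le)
  also have "\<dots> \<le> 1 * n" by (intro mult_right_mono) auto
  finally have "degree ([:a, b:] ^ n) < i" using False by simp
  then show ?thesis using False by (simp add: coeff_eq_0 binomial_eq_0)
qed (rule coeff_linear_poly_power)

text \<open>The coefficient of \<open>x ^ (m + n - j) * y ^ j\<close> in
  \<open>(\<alpha> x - cnj \<beta> y) ^ m * (\<beta> x + cnj \<alpha> y) ^ n\<close>.\<close>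
definition cprod :: "nat \<Rightarrow> nat \<Rightarrow> nat \<Rightarrow> complex^2 \<Rightarrow> complex" where
  "cprod m n j z = (\<Sum>i\<le>j. (of_nat (m choose i) * (- cnj (z $ 2)) ^ i * (z $ 1) ^ (m - i)) *
     (of_nat (n choose (j - i)) * cnj (z $ 1) ^ (j - i) * (z $ 2) ^ (n - (j - i))))"

lemma A_fun_cprod: "A_fun j z = cprod 11 1 j z + 11 * cprod 6 6 j z - cprod 1 11 j z"
proof -
  have "A_fun j z = coeff (I12 [: z $ 1, - cnj (z $ 2) :] [: z $ 2, cnj (z $ 1) :]) j"
    by (simp only: A_fun_def)
  also have "\<dots> = coeff ([: z $ 1, - cnj (z $ 2) :] ^ 11 * [: z $ 2, cnj (z $ 1) :] ^ 1) j
      + 11 * coeff ([: z $ 1, - cnj (z $ 2) :] ^ 6 * [: z $ 2, cnj (z $ 1) :] ^ 6) j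
      - coeff ([: z $ 1, - cnj (z $ 2) :] ^ 1 * [: z $ 2, cnj (z $ 1) :] ^ 11) j"
    by (simp add: I12_def numeral_poly mult.assoc)
  finally show ?thesis unfolding cprod_def coeff_mult coeff_linear_power' .
qed

lemma A_fun_5: "A_fun 5 z = (let \<alpha> = z $ 1; \<beta> = z $ 2; a = \<alpha> * cnj \<alpha>; b = \<beta> * cnj \<beta> in
  \<alpha> ^ 6 * cnj \<beta> ^ 4 * (330 * a - 462 * b) - \<beta> ^ 6 * cnj \<alpha> ^ 4 * (462 * a - 330 * b)
   + 66 * \<alpha> * \<beta> * (a ^ 5 - 15 * a ^ 4 * b + 50 * a ^ 3 * b ^ 2 - 50 * a ^ 2 * b ^ 3 + 15 * a * b ^ 4 - b ^ 5))"
  unfolding A_fun_cprod cprod_def Let_def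
  by (simp add: eval_nat_numeral) (simp add: algebra_simps)

lemma A_fun_6: "A_fun 6 z = (let \<alpha> = z $ 1; \<beta> = z $ 2; a = \<alpha> * cnj \<alpha>; b = \<beta> * cnj \<beta> in
  11 * (a ^ 6 - 36 * a ^ 5 * b + 225 * a ^ 4 * b ^ 2 - 400 * a ^ 3 * b ^ 3 + 225 * a ^ 2 * b ^ 4 - 36 * a * b ^ 5 + b ^ 6)
  - 462 * (a - b) * (\<alpha> ^ 5 * cnj \<beta> ^ 5 + cnj \<alpha> ^ 5 * \<beta> ^ 5))"
  unfolding A_fun_cprod cprod_def Let_def
  by (simp add: eval_nat_numeral) (simp add: algebra_simps)

section \<open>Zeros of $A_5$\<close>

definition gold :: real where "gold = (1 + sqrt 5) / 2"

lemma gold_sq: "gold\<^sup>2 = gold + 1"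
  by (simp add: gold_def power2_eq_square field_simps)

lemma gold_pos: "gold > 0"
  by (simp add: gold_def add_pos_nonneg)

abbreviation "\<phi> \<equiv> complex_of_real gold"

lemma gold_sq_complex: "\<phi>\<^sup>2 = \<phi> + 1"
  using gold_sq by (metis of_real_1 of_real_add of_real_power)

lemma eps_cyclotomic: "1 + \<epsilon> + \<epsilon> ^ 2 + \<epsilon> ^ 3 + \<epsilon> ^ 4 = 0"
proof -
  have "(\<epsilon> - 1) * (1 + \<epsilon> + \<epsilon> ^ 2 + \<epsilon> ^ 3 + \<epsilon> ^ 4) = 0" using eps_pow5 by algebra
  then show ?thesis using eps_neq_1 by simp
qed

text \<open>Both sums are roots of \<open>X ^ 2 + X - 1\<close>; the sign of the cosine of
  \<open>4 * pi / 5\<close> tells which is which.\<close>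

lemma eps_gold: "\<epsilon> ^ 2 + \<epsilon> ^ 3 = - \<phi>" "\<epsilon> + \<epsilon> ^ 4 = \<phi> - 1"
proof -
  define c where "c = cos (4 * pi / 5)"
  have e2: "\<epsilon> ^ 2 = cis (4 * pi / 5)" unfolding \<epsilon>_def Complex.DeMoivre by simp
  have "\<epsilon> ^ 3 = cnj (\<epsilon> ^ 2)"
  proof -
    have "cnj (\<epsilon> ^ 2) = \<epsilon> ^ 5 * \<epsilon> ^ 3" by (simp add: cnj_eps power_mult[symmetric] power_add[symmetric])
    then show ?thesis by (simp add: eps_pow5)
  qed
  then have s: "\<epsilon> ^ 2 + \<epsilon> ^ 3 = complex_of_real (2 * c)"
    unfolding e2 by (simp add: complex_eq_iff c_def)
  have "(\<epsilon> ^ 2 + \<epsilon> ^ 3)\<^sup>2 + (\<epsilon> ^ 2 + \<epsilon> ^ 3) - 1 = 0" using eps_pow5 eps_cyclotomic by algebra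
  then have "complex_of_real ((2 * c)\<^sup>2 + 2 * c - 1) = 0" unfolding s by simp
  then have "(2 * c)\<^sup>2 + 2 * c - 1 = 0" by (simp only: of_real_eq_0_iff)
  then have "(2 * c + gold) * (2 * c - (gold - 1)) = 0" using gold_sq by algebra
  moreover have "c < 0"
  proof -
    have "c = - cos (pi - 4 * pi / 5)" unfolding c_def by (simp only: cos_pi_minus)
    also have "pi - 4 * pi / 5 = pi / 5" by simp
    finally show ?thesis using cos_gt_zero[of "pi / 5"] by simp
  qed
  moreover have "gold > 1" by (simp add: gold_def)
  ultimately have "2 * c = - gold" by auto
  then show 1: "\<epsilon> ^ 2 + \<epsilon> ^ 3 = - \<phi>" using s by simp
  then show "\<epsilon> + \<epsilon> ^ 4 = \<phi> - 1" using eps_cyclotomic by algebra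
qed

definition "gnorm = sqrt (1 + gold\<^sup>2)"

lemma gnorm: "gnorm > 0" "gnorm\<^sup>2 = 1 + gold\<^sup>2"
  unfolding gnorm_def by (auto intro: add_pos_nonneg)

definition "ct = \<i> / complex_of_real gnorm"

lemma ct: "ct\<^sup>2 * (1 + \<phi>\<^sup>2) = - 1" "cnj ct = - ct" "cmod ct = 1 / gnorm"
proof -
  have "complex_of_real gnorm ^ 2 = 1 + \<phi>\<^sup>2" using gnorm(2) by (metis of_real_1 of_real_add of_real_power)
  moreover have "1 + \<phi>\<^sup>2 \<noteq> 0" using gnorm by (metis calculation of_real_eq_0_iff power_not_zero less_irrefl)
  ultimately show "ct\<^sup>2 * (1 + \<phi>\<^sup>2) = - 1" by (simp add: ct_def power_divide)
  show "cnj ct = - ct" by (simp add: ct_def)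
  show "cmod ct = 1 / gnorm" using gnorm by (simp add: ct_def norm_divide)
qed

text \<open>A lift of a half turn, with trace 0, that moves the pole to another vertex. Up to the
  scalar \<open>ct\<close> it is a real symmetric matrix of determinant
  \<open>- (1 + gold\<^sup>2)\<close>; the factor \<open>\<i>\<close> in \<open>ct\<close> corrects
  the sign and the denominator the size.\<close>

definition "rotT = mat2 (- ct * \<phi>) ct"

lemma rotT_apply: "(rotT *v z) $ 1 = ct * (- \<phi> * z $ 1 + z $ 2)" "(rotT *v z) $ 2 = ct * (z $ 1 + \<phi> * z $ 2)"
  by (simp_all add: rotT_def I_star_complex_entries ct algebra_simps)

lemma rotT_I_star: "rotT \<in> I_star"
  unfolding rotT_def
proof (rule mat2_I_star)
  show "- ct * \<phi> * cnj (- ct * \<phi>) + ct * cnj ct = 1"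
    using ct(1,2) by simp algebra
  fix x y
  \<comment> \<open>The real matrix scales \<open>I12\<close> by a factor which
    \<open>ct ^ 12\<close> cancels.\<close>
  have id: "I12 (- \<phi> * x + y) (x + \<phi> * y) = (1 + \<phi>\<^sup>2) ^ 6 * I12 x y"
    using gold_sq_complex unfolding I12_def by algebra
  have "ct ^ 12 * (1 + \<phi>\<^sup>2) ^ 6 = (ct\<^sup>2 * (1 + \<phi>\<^sup>2)) ^ 6" by (simp add: power_mult_distrib)
  then have c: "ct ^ 12 * (1 + \<phi>\<^sup>2) ^ 6 = 1" unfolding ct by simp
  have "I12 (- ct * \<phi> * x - cnj ct * y) (ct * x + cnj (- ct * \<phi>) * y) = I12 (ct * (- \<phi> * x + y)) (ct * (x + \<phi> * y))"
    by (simp add: ct algebra_simps)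
  also have "\<dots> = (ct ^ 12 * (1 + \<phi>\<^sup>2) ^ 6) * I12 x y" unfolding I12_scale id by simp
  finally show "I12 (- ct * \<phi> * x - cnj ct * y) (ct * x + cnj (- ct * \<phi>) * y) = I12 x y" using c by simp
qed

lemma diag_I_star:
  assumes "\<zeta> ^ 10 = 1"
  shows "mat2 \<zeta> 0 \<in> I_star" "cmod \<zeta> = 1" "\<zeta> * cnj \<zeta> = 1"
proof -
  have "cmod \<zeta> ^ 10 = 1" using assms by (metis norm_one norm_power)
  then show n: "cmod \<zeta> = 1" using power_eq_imp_eq_base[of "cmod \<zeta>" 10 1] by simp
  then show z: "\<zeta> * cnj \<zeta> = 1" by (simp add: complex_norm_square[symmetric])
  then have c9: "cnj \<zeta> = \<zeta> ^ 9" using assms by algebra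
  have p: "\<zeta> ^ (10 * k) = 1" for k by (simp only: power_mult assms power_one)
  have c: "cnj \<zeta> ^ 11 * \<zeta> = 1" "cnj \<zeta> * \<zeta> ^ 11 = 1" "cnj \<zeta> ^ 6 * \<zeta> ^ 6 = 1"
    using p[of 10] p[of 2] p[of 6] unfolding c9 power_mult[symmetric] power_add[symmetric] power_Suc2[symmetric] by simp_all
  show "mat2 \<zeta> 0 \<in> I_star"
    by (rule mat2_I_star) (use z c in \<open>simp_all add: I12_def power_mult_distrib\<close>, algebra)
qed

lemma diag_apply: "(mat2 \<zeta> 0 *v z) $ 1 = \<zeta> * z $ 1" "(mat2 \<zeta> 0 *v z) $ 2 = cnj \<zeta> * z $ 2"
  by (simp_all add: I_star_complex_entries)

lemma rotJ_apply: "(rotJ *v z) $ 1 = z $ 2" "(rotJ *v z) $ 2 = - z $ 1"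
  by (simp_all add: rotJ_def I_star_complex_entries)

lemma vec2_eqI: "u $ 1 = v $ 1 \<Longrightarrow> u $ 2 = v $ 2 \<Longrightarrow> u = (v::complex^2)"
  by (simp add: vec_eq_iff forall_2)

lemma cscale_cscale [simp]: "cscale a (cscale b z) = cscale (a * b) z" "cscale 1 z = z"
  by (rule vec2_eqI; simp add: mult.assoc)+

lemma mult_cscale: "B *v cscale a z = cscale a (B *v z)" for B :: "complex^2^2"
  by (rule vec2_eqI) (simp_all add: I_star_complex_entries algebra_simps)

lemma norm_cscale: "norm (cscale a z) = cmod a * norm z"
proof -
  have "(norm (cscale a z))\<^sup>2 = (cmod a * norm z)\<^sup>2"
    unfolding norm_complex2 power_mult_distrib by (simp add: norm_mult power_mult_distrib algebra_simps)
  then show ?thesis by (metis norm_ge_zero mult_nonneg_nonneg power2_eq_imp_eq)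
qed

section \<open>Orbits up to a phase\<close>

text \<open>For unit vectors this says that the Hopf images lie in one orbit of
  \<open>A5\<close>.\<close>

definition rel :: "complex^2 \<Rightarrow> complex^2 \<Rightarrow> bool" where
  "rel z w \<longleftrightarrow> (\<exists>B\<in>I_star. \<exists>\<omega>. cmod \<omega> = 1 \<and> z = B *v cscale \<omega> w)"

lemma rel_sym: "rel z w \<Longrightarrow> rel w z"
proof -
  assume "rel z w"
  then obtain B \<omega> where B: "B \<in> I_star" "cmod \<omega> = 1" "z = B *v cscale \<omega> w" by (auto simp: rel_def)
  have "cnj \<omega> * \<omega> = 1" using B(2) by (metis complex_norm_square mult.commute of_real_1 one_power2)
  then have "w = conj_transpose B *v cscale (cnj \<omega>) z"
    unfolding B(3) using B(1)
    by (simp add: mult_cscale matrix_vector_mul_assoc SU2_adj I_star_def)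
  then show ?thesis unfolding rel_def using I_star_adj[OF B(1)] B(2) by (intro bexI exI[of _ "cnj \<omega>"]) auto
qed

lemma rel_trans: "rel z w \<Longrightarrow> rel w u \<Longrightarrow> rel z u"
proof -
  assume "rel z w" "rel w u"
  then obtain B \<omega> C \<eta> where B: "B \<in> I_star" "cmod \<omega> = 1" "z = B *v cscale \<omega> w"
    "C \<in> I_star" "cmod \<eta> = 1" "w = C *v cscale \<eta> u" by (auto simp: rel_def)
  have "z = (B ** C) *v cscale (\<omega> * \<eta>) u"
    unfolding B(3,6) by (simp add: mult_cscale matrix_vector_mul_assoc)
  then show ?thesis unfolding rel_def using I_star_mult[OF B(1,4)] B(2,5)
    by (intro bexI exI[of _ "\<omega> * \<eta>"]) (auto simp: norm_mult)
qed

lemma rel_rotation: "B \<in> I_star \<Longrightarrow> rel (B *v z) z"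
  unfolding rel_def by (intro bexI exI[of _ 1]) auto

lemma rel_cscale: "cmod \<omega> = 1 \<Longrightarrow> rel (cscale \<omega> z) z"
  unfolding rel_def by (intro bexI[OF _ I_star_one] exI[of _ \<omega>]) auto

lemma rel_A_fun:
  assumes "rel z w" "j \<le> 12" "A_fun j z = 0"
  shows "A_fun j w = 0"
proof -
  obtain B \<omega> where B: "B \<in> I_star" "cmod \<omega> = 1" "z = B *v cscale \<omega> w" using assms by (auto simp: rel_def)
  then have "\<omega> \<noteq> 0" by auto
  then show ?thesis using assms(3) unfolding B(3) A_fun_invariant[OF B(1)] A_fun_cscale[OF assms(2)] by simp
qed

lemma rel_norm: "rel z w \<Longrightarrow> norm z = norm w"
  unfolding rel_def using rotation_isometry(1) norm_cscale by fastforce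

text \<open>Unit vectors lying over a vertex, an edge midpoint and a face centre of the icosahedron. The slope
  \<open>w0\<close> is that of a real eigenvector of an element of order six.\<close>
definition zN :: "complex^2" where "zN = vector [1, 0]"
definition zE :: "complex^2" where "zE = vector [1, \<i>] /\<^sub>R sqrt 2"
definition w0 :: real where "w0 = (sqrt (gold ^ 4 + 4) - gold\<^sup>2) / 2"
definition zF :: "complex^2" where "zF = vector [1, complex_of_real w0] /\<^sub>R sqrt (1 + w0\<^sup>2)"

lemma w0: "w0\<^sup>2 + gold\<^sup>2 * w0 - 1 = 0" "w0 > 0"
proof -
  have "(sqrt (gold ^ 4 + 4))\<^sup>2 = gold ^ 4 + 4" by simp
  then show "w0\<^sup>2 + gold\<^sup>2 * w0 - 1 = 0"
    unfolding w0_def by (simp add: power2_eq_square field_simps) algebra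
  have "gold\<^sup>2 < sqrt (gold ^ 4 + 4)" by (rule real_less_rsqrt) (simp add: power_mult[symmetric])
  then show "w0 > 0" by (simp add: w0_def)
qed

lemma zN_nth [simp]: "zN $ 1 = 1" "zN $ 2 = 0" by (simp_all add: zN_def)

lemma zE_nth: "zE $ 1 = complex_of_real (1 / sqrt 2)" "zE $ 2 = \<i> * complex_of_real (1 / sqrt 2)"
  unfolding zE_def vector_scaleR_component vector_2 by (simp_all add: scaleR_conv_of_real field_simps)

lemma zF_nth: "zF $ 1 = complex_of_real (1 / sqrt (1 + w0\<^sup>2))" "zF $ 2 = complex_of_real (w0 / sqrt (1 + w0\<^sup>2))"
  unfolding zF_def vector_scaleR_component vector_2 by (simp_all add: scaleR_conv_of_real field_simps)

lemma S3_iff: "z \<in> S3 \<longleftrightarrow> (cmod (z $ 1))\<^sup>2 + (cmod (z $ 2))\<^sup>2 = 1"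
proof -
  have "z \<in> S3 \<longleftrightarrow> (norm z)\<^sup>2 = 1" by (simp add: power2_eq_1_iff) (smt (verit) norm_ge_zero)
  then show ?thesis by (simp add: norm_complex2)
qed

lemma base_S3: "zN \<in> S3" "zE \<in> S3" "zF \<in> S3"
proof -
  show "zN \<in> S3" "zE \<in> S3" unfolding S3_iff zE_nth zN_nth norm_mult norm_of_real by (simp_all add: power_divide)
  have "1 + w0\<^sup>2 > 0" by (simp add: add_pos_nonneg)
  then show "zF \<in> S3" unfolding S3_iff zF_nth norm_of_real
    by (simp add: power_divide add_divide_distrib[symmetric])
qed

lemma rel_N: "z \<in> S3 \<Longrightarrow> z $ 1 = 0 \<or> z $ 2 = 0 \<Longrightarrow> rel z zN"
proof -
  assume z: "z \<in> S3" "z $ 1 = 0 \<or> z $ 2 = 0"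
  have *: "rel w zN" if "w \<in> S3" "w $ 2 = 0" for w
  proof -
    have "cmod (w $ 1) = 1" using that(1) unfolding S3_iff that(2)
      by (simp add: power2_eq_1_iff) (smt (verit) norm_ge_zero)
    moreover have "w = cscale (w $ 1) zN" by (rule vec2_eqI) (simp_all add: that)
    ultimately show ?thesis using rel_cscale by metis
  qed
  show ?thesis
  proof (cases "z $ 2 = 0")
    case False
    then have "rel (rotJ *v z) zN" using z by (intro * I_star_sphere rotJ_I_star) (auto simp: rotJ_apply)
    then show ?thesis using rel_rotation[OF rotJ_I_star] rel_sym rel_trans by blast
  qed (use * z in blast)
qed

lemma fifth_roots: "x ^ 5 = 1 \<Longrightarrow> \<exists>k. x = \<epsilon> ^ k"
proof -
  assume "x ^ 5 = 1"
  then have "x \<in> {z. z ^ 5 = 1}" by simp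
  also have "{z::complex. z ^ 5 = 1} = (\<lambda>k. cis (2 * pi * real k / real 5)) ` {..<5}"
    using Complex.bij_betw_roots_unity[of 5] unfolding bij_betw_def by simp
  finally obtain k :: nat where "x = cis (2 * pi * real k / real 5)" by blast
  also have "\<dots> = \<epsilon> ^ k" unfolding \<epsilon>_def Complex.DeMoivre by (simp add: mult_ac)
  finally show ?thesis by blast
qed

lemma eps_power: "(\<epsilon> ^ k) ^ 5 = 1" "(\<epsilon> ^ k) ^ 10 = 1"
proof -
  show 1: "(\<epsilon> ^ k) ^ 5 = 1" using eps_pow5 by (metis power_mult mult.commute power_one)
  have "(\<epsilon> ^ k) ^ 10 = ((\<epsilon> ^ k) ^ 5) ^ 2" by (simp only: power_mult[symmetric] mult.assoc) simp
  then show "(\<epsilon> ^ k) ^ 10 = 1" using 1 by simp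
qed

text \<open>Clearing the common factor of \<open>A_fun 5\<close>; here \<open>\<tau> = u ^ 5\<close> with \<open>u = \<alpha> * cnj \<beta>\<close>.\<close>

lemma A_fun_5_times:
  assumes a: "complex_of_real a = z $ 1 * cnj (z $ 1)" and b: "complex_of_real b = z $ 2 * cnj (z $ 2)"
    and t: "\<tau> = (z $ 1 * cnj (z $ 2)) ^ 5"
  shows "A_fun 5 z * cnj (z $ 1) * cnj (z $ 2) = \<tau> * of_real (a * (330 * a - 462 * b)) - cnj \<tau> * of_real (b * (462 * a - 330 * b))
    + of_real (66 * a * b * (a ^ 5 - 15 * a ^ 4 * b + 50 * a ^ 3 * b ^ 2 - 50 * a ^ 2 * b ^ 3 + 15 * a * b ^ 4 - b ^ 5))"
  unfolding A_fun_5 Let_def t of_real_mult of_real_diff of_real_add of_real_power of_real_numeral a b complex_cnj_power complex_cnj_mult complex_cnj_cnj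
  by algebra

text \<open>With \<open>a = b\<close> the cleared equation says that \<open>u ^ 5\<close> is purely
  imaginary. A diagonal element moves \<open>u\<close> to \<open>- \<i> / 2\<close>, its value at
  \<open>zE\<close>, or to \<open>\<i> / 2\<close>; in the second case \<open>rotT\<close> leads
  back to the first.\<close>

lemma rel_equator:
  assumes z: "z \<in> S3" "cmod (z $ 1) = cmod (z $ 2)" "A_fun 5 z = 0"
  shows "rel z zE"
proof -
  have half: "(cmod (z $ 1))\<^sup>2 = 1 / 2" "(cmod (z $ 2))\<^sup>2 = 1 / 2" using z(1,2) unfolding S3_iff by auto
  have ab: "complex_of_real (1 / 2) = z $ 1 * cnj (z $ 1)" "complex_of_real (1 / 2) = z $ 2 * cnj (z $ 2)"
    unfolding complex_norm_square[symmetric] half by (rule refl)+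
  define u where "u = z $ 1 * cnj (z $ 2)"
  have uu: "u * cnj u = 1 / 4" using ab unfolding u_def by simp algebra
  then have u0: "u \<noteq> 0" "cnj u \<noteq> 0" by auto
  have "u ^ 5 = - ((cnj u) ^ 5)"
    using A_fun_5_times[OF ab refl] z(3) by (simp add: u_def[symmetric]) (metis minus_minus)
  then have "(- (u / cnj u)) ^ 5 = 1" using u0 by (simp add: power_divide)
  then obtain k where k: "- (u / cnj u) = \<epsilon> ^ k" using fifth_roots by blast
  define \<zeta> where "\<zeta> = \<epsilon> ^ k"
  have \<zeta>: "\<zeta> ^ 5 = 1" "\<zeta> ^ 10 = 1" using eps_power by (simp_all add: \<zeta>_def)
  note d = diag_I_star[OF \<zeta>(2)]
  have uc: "u = - \<zeta> * cnj u" using k u0 by (simp add: \<zeta>_def field_simps) (metis minus_minus)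
  \<comment> \<open>\<open>mat2 \<zeta> 0\<close> multiplies \<open>u\<close> by the square of
    \<open>\<zeta>\<close>; for this fifth root of unity the product is purely imaginary.\<close>
  define v where "v = \<zeta>\<^sup>2 * u"
  have c4: "cnj \<zeta> = \<zeta> ^ 4" using \<zeta>(1) d(3) by algebra
  have cv: "cnj v = - v"
  proof -
    have "cnj v = (\<zeta> ^ 4)\<^sup>2 * cnj u" by (simp add: v_def c4)
    also have "\<dots> = - (\<zeta>\<^sup>2 * (- \<zeta> * cnj u))" using \<zeta>(1) by algebra
    also have "\<zeta>\<^sup>2 * (- \<zeta> * cnj u) = v" unfolding v_def using arg_cong[OF uc, of "\<lambda>t. \<zeta>\<^sup>2 * t"] by (rule sym)
    finally show ?thesis .
  qed
  have "v * cnj v = 1 / 4" unfolding v_def using uu d(3) by simp algebra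
  then have "(v - \<i> / 2) * (v + \<i> / 2) = 0" unfolding cv by (simp add: algebra_simps power2_eq_square) algebra
  then have v: "v = \<i> / 2 \<or> v = - \<i> / 2"
    by (metis divide_minus_left eq_iff_diff_eq_0 eq_neg_iff_add_eq_0 mult_eq_0_iff)
  define z' where "z' = mat2 \<zeta> 0 *v z"
  have z': "z' \<in> S3" "rel z' z" unfolding z'_def using I_star_sphere[OF d(1) z(1)] rel_rotation[OF d(1)] by auto
  have v': "z' $ 1 * cnj (z' $ 2) = v"
    unfolding z'_def diag_apply v_def u_def by (simp add: power2_eq_square)
  have half': "z' $ 1 * cnj (z' $ 1) = 1 / 2" "z' $ 2 * cnj (z' $ 2) = 1 / 2"
    unfolding z'_def diag_apply using ab d(3) by (simp, algebra)+
  have key: "z' $ 2 = 2 * cnj v * z' $ 1"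
  proof -
    have "cnj (z' $ 1) * z' $ 2 = cnj v" using arg_cong[OF v', of cnj] by simp
    then have "2 * (z' $ 1 * cnj (z' $ 1)) * z' $ 2 = 2 * cnj v * z' $ 1" by simp
    then show ?thesis unfolding half' by simp
  qed
  have m: "cmod (z' $ 1 * complex_of_real (sqrt 2)) = 1"
  proof -
    have "complex_of_real ((cmod (z' $ 1))\<^sup>2) = complex_of_real (1 / 2)" unfolding complex_norm_square half' by simp
    then have "(cmod (z' $ 1))\<^sup>2 = 1 / 2" by (simp only: of_real_eq_iff)
    then have "(cmod (z' $ 1 * complex_of_real (sqrt 2)))\<^sup>2 = 1" by (simp add: norm_mult power_mult_distrib)
    then show ?thesis by (simp add: power2_eq_1_iff) (smt (verit) norm_ge_zero)
  qed
  have s: "complex_of_real (sqrt 2) * complex_of_real (1 / sqrt 2) = 1"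
    unfolding of_real_mult[symmetric] by simp
  from v show ?thesis
  proof
    assume "v = - \<i> / 2"
    then have "z' $ 2 = \<i> * z' $ 1" using key by simp
    then have "z' = cscale (z' $ 1 * complex_of_real (sqrt 2)) zE"
      by (intro vec2_eqI) (use s in \<open>simp_all add: zE_nth\<close>)
    then have "rel z' zE" using rel_cscale[OF m] by metis
    then show ?thesis using z'(2) rel_sym rel_trans by blast
  next
    assume "v = \<i> / 2"
    then have "2 * v = \<i>" by (simp add: mult.commute)
    then have e: "z' $ 2 = - \<i> * z' $ 1" using key unfolding cv by simp
    define \<eta> where "\<eta> = ct * (- \<phi> - \<i>) * (z' $ 1 * complex_of_real (sqrt 2))"
    have "cmod (- \<phi> - \<i>) = gnorm"
      by (simp add: cmod_def gnorm_def power2_eq_square)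
    then have "cmod \<eta> = 1" unfolding \<eta>_def norm_mult[of "ct * _"] m by (simp add: norm_mult ct) (use gnorm in simp)
    moreover have "rotT *v z' = cscale \<eta> zE"
    proof (rule vec2_eqI)
      show "(rotT *v z') $ 1 = cscale \<eta> zE $ 1"
        unfolding rotT_apply e cscale_nth zE_nth \<eta>_def using s by algebra
      show "(rotT *v z') $ 2 = cscale \<eta> zE $ 2"
        unfolding rotT_apply e cscale_nth zE_nth \<eta>_def using s i_squared by algebra
    qed
    ultimately have "rel (rotT *v z') zE" using rel_cscale by metis
    then show ?thesis using z'(2) rel_rotation[OF rotT_I_star] rel_sym rel_trans by blast
  qed
qed

text \<open>The quadratic form factors into the slope \<open>w0\<close> of \<open>zF\<close> and the
  perpendicular slope, and \<open>rotJ\<close> takes the second to the first.\<close>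

lemma rel_face:
  assumes xy: "x\<^sup>2 + y\<^sup>2 = 1" "y\<^sup>2 + gold\<^sup>2 * x * y - x\<^sup>2 = 0"
  shows "rel (vector [complex_of_real x, complex_of_real y]) zF"
proof -
  have *: "rel z zF" if z: "z \<in> S3" "z $ 2 = complex_of_real w0 * z $ 1" for z
  proof -
    define r where "r = sqrt (1 + w0\<^sup>2)"
    have r: "r > 0" "r\<^sup>2 = 1 + w0\<^sup>2" unfolding r_def by (auto intro: add_pos_nonneg)
    have "(cmod (z $ 1))\<^sup>2 * r\<^sup>2 = 1"
      using z(1) unfolding S3_iff z(2) r by (simp add: norm_mult power_mult_distrib algebra_simps)
    then have "(cmod (z $ 1 * complex_of_real r))\<^sup>2 = 1" by (simp add: norm_mult power_mult_distrib)
    then have "cmod (z $ 1 * complex_of_real r) = 1" by (simp add: power2_eq_1_iff) (smt (verit) norm_ge_zero)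
    moreover have "z = cscale (z $ 1 * complex_of_real r) zF"
      by (rule vec2_eqI) (use r z(2) in \<open>simp_all add: zF_nth r_def[symmetric]\<close>)
    ultimately show ?thesis using rel_cscale by metis
  qed
  define z :: "complex^2" where "z = vector [complex_of_real x, complex_of_real y]"
  have zn: "z $ 1 = complex_of_real x" "z $ 2 = complex_of_real y" by (simp_all add: z_def)
  have zS: "z \<in> S3" unfolding S3_iff zn norm_of_real by (simp add: xy)
  have "(y - w0 * x) * (w0 * y + x) = 0" using xy(2) w0(1) by algebra
  then consider "y = w0 * x" | "x = - w0 * y" by auto
  then have "rel z zF"
  proof cases
    case 1
    then show ?thesis by (intro * zS) (simp add: zn)
  next
    case 2
    then have "rel (rotJ *v z) zF" by (intro * I_star_sphere rotJ_I_star zS) (simp add: rotJ_apply zn)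
    then show ?thesis using rel_rotation[OF rotJ_I_star] rel_sym rel_trans by blast
  qed
  then show ?thesis by (simp add: z_def)
qed

text \<open>The condition on \<open>\<zeta>\<close> expresses that a turn about the axis followed by
  the half turn \<open>rotT\<close> brings the point to the equator, where
  \<open>rel_equator\<close> applies.\<close>

lemma rel_edge:
  assumes z: "z \<in> S3" "z $ 1 = complex_of_real x" "z $ 2 = complex_of_real y" "A_fun 5 z = 0"
    and \<zeta>: "\<zeta> ^ 10 = 1" "x\<^sup>2 - y\<^sup>2 = 4 * x * y * Re (\<zeta>\<^sup>2)"
  shows "rel z zE"
proof -
  note d = diag_I_star[OF \<zeta>(1)]
  define v where "v = rotT *v (mat2 \<zeta> 0 *v z)"
  have vz: "rel v z" unfolding v_def
    using rel_trans rel_rotation[OF rotT_I_star] rel_rotation[OF d(1)] by blast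
  have vS: "v \<in> S3" unfolding v_def by (intro I_star_sphere rotT_I_star d(1) z(1))
  obtain p q where pq: "\<zeta> = Complex p q" by (meson complex.exhaust)
  have n: "p\<^sup>2 + q\<^sup>2 = 1" using d(2) by (simp add: pq cmod_def)
  have rz: "Re (\<zeta>\<^sup>2) = p\<^sup>2 - q\<^sup>2" by (simp add: pq power2_eq_square)
  have "(cmod (v $ 1))\<^sup>2 - (cmod (v $ 2))\<^sup>2 = (cmod ct)\<^sup>2 * ((- gold * p * x + p * y)\<^sup>2 + (- gold * q * x - q * y)\<^sup>2
     - ((p * x + gold * p * y)\<^sup>2 + (q * x - gold * q * y)\<^sup>2))"
    unfolding v_def rotT_apply diag_apply z(2,3) norm_mult power_mult_distrib
    by (simp add: pq cmod_power2) (simp add: algebra_simps power2_eq_square)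
  also have "(- gold * p * x + p * y)\<^sup>2 + (- gold * q * x - q * y)\<^sup>2
     - ((p * x + gold * p * y)\<^sup>2 + (q * x - gold * q * y)\<^sup>2) = 0"
    using n \<zeta>(2) gold_sq unfolding rz by algebra
  finally have "(cmod (v $ 1))\<^sup>2 = (cmod (v $ 2))\<^sup>2" by simp
  then have "cmod (v $ 1) = cmod (v $ 2)" by (metis norm_ge_zero power2_eq_imp_eq)
  then have "rel v zE" using rel_equator[OF vS] rel_A_fun[OF rel_sym[OF vz]] z(4) by auto
  then show ?thesis using vz rel_sym rel_trans by blast
qed

text \<open>Real points lie over a mirror circle of the icosahedron, which carries four vertices,
  four edge midpoints and four face centres. The factors of \<open>A_5\<close> on it are sorted by
  these kinds.\<close>

lemma rel_real:
  assumes z: "z \<in> S3" "z $ 1 = complex_of_real x" "z $ 2 = complex_of_real y" "A_fun 5 z = 0"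
  shows "rel z zN \<or> rel z zE \<or> rel z zF"
proof -
  have n: "x\<^sup>2 + y\<^sup>2 = 1" using z(1) unfolding S3_iff z(2,3) by simp
  \<comment> \<open>The nonzero coordinates of the Hopf image, in the plane of the mirror
    circle.\<close>
  define P Q where "P = x\<^sup>2 - y\<^sup>2" and "Q = 2 * x * y"
  have "A_fun 5 z = complex_of_real (66 * x * y * (x\<^sup>2 + x * y - y\<^sup>2) * (P\<^sup>2 + P * Q - Q\<^sup>2) * (P\<^sup>2 - 3 / 2 * P * Q + Q\<^sup>2 / 4))"
    unfolding A_fun_5 Let_def z(2,3) P_def Q_def complex_cnj_complex_of_real
    by (simp add: power2_eq_square) (simp add: field_simps, algebra)
  then have "66 * x * y * (x\<^sup>2 + x * y - y\<^sup>2) * (P\<^sup>2 + P * Q - Q\<^sup>2) * (P\<^sup>2 - 3 / 2 * P * Q + Q\<^sup>2 / 4) = 0"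
    using z(4) by (metis of_real_eq_0_iff)
  then consider "x = 0 \<or> y = 0" | "x\<^sup>2 + x * y - y\<^sup>2 = 0" | "P\<^sup>2 + P * Q - Q\<^sup>2 = 0" | "P\<^sup>2 - 3 / 2 * P * Q + Q\<^sup>2 / 4 = 0"
    by auto
  then show ?thesis
  proof cases
    case 1
    then show ?thesis using rel_N[OF z(1)] z(2,3) by auto
  next
    case 2
    then have "(y - gold * x) * (x + gold * y) = 0" using gold_sq by algebra
    then have "(rotT *v z) $ 1 = 0 \<or> (rotT *v z) $ 2 = 0"
      unfolding rotT_apply z(2,3) by (auto simp flip: of_real_mult of_real_add of_real_minus simp del: of_real_mult of_real_add of_real_minus)
    then have "rel (rotT *v z) zN" by (intro rel_N I_star_sphere rotT_I_star z(1))
    then show ?thesis using rel_rotation[OF rotT_I_star] rel_sym rel_trans by blast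
  next
    case 3
    have re: "Re (\<epsilon> ^ 2) = - gold / 2" "Re (\<epsilon> ^ 4) = (gold - 1) / 2"
    proof -
      have c: "cnj (\<epsilon> ^ 2) = \<epsilon> ^ 3" "cnj (\<epsilon> ^ 4) = \<epsilon>"
      proof -
        have "cnj (\<epsilon> ^ 2) = \<epsilon> ^ 5 * \<epsilon> ^ 3" by (simp add: cnj_eps power_mult[symmetric] power_add[symmetric])
        then show "cnj (\<epsilon> ^ 2) = \<epsilon> ^ 3" by (simp add: eps_pow5)
        show "cnj (\<epsilon> ^ 4) = \<epsilon>" unfolding cnj_eps[symmetric] by simp
      qed
      have "Re (\<epsilon> ^ 3) = Re (\<epsilon> ^ 2)" unfolding c(1)[symmetric] by (rule cnj.simps)
      moreover have "Re \<epsilon> = Re (\<epsilon> ^ 4)" using arg_cong[OF c(2), of Re] by (simp only: cnj.simps)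
      ultimately show "Re (\<epsilon> ^ 2) = - gold / 2" "Re (\<epsilon> ^ 4) = (gold - 1) / 2"
        using arg_cong[OF eps_gold(1), of Re] arg_cong[OF eps_gold(2), of Re] by simp_all
    qed
    \<comment> \<open>Two pairs of edge midpoints, which need different fifth roots of unity to
      reach the equator.\<close>
    have "(Q - gold * P) * (Q + (gold - 1) * P) = 0" using 3 gold_sq by algebra
    then consider "Q - gold * P = 0" | "Q + (gold - 1) * P = 0" by auto
    then show ?thesis
    proof cases
      case 1
      have "x\<^sup>2 - y\<^sup>2 = 4 * x * y * ((gold - 1) / 2)" using 1 gold_sq unfolding P_def Q_def by algebra
      then have "rel z zE" using rel_edge[OF z, of "\<epsilon> ^ 2"] eps_power(2)[of 2] re(2) by simp
      then show ?thesis by blast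
    next
      case 2
      have "x\<^sup>2 - y\<^sup>2 = 4 * x * y * (- gold / 2)" using 2 gold_sq unfolding P_def Q_def by algebra
      then have "rel z zE" using rel_edge[OF z, of "\<epsilon>"] eps_power(2)[of 1] re(1) by simp
      then show ?thesis by blast
    qed
  next
    case 4
    then have "(Q - (2 * gold + 2) * P) * (Q - (4 - 2 * gold) * P) = 0" using gold_sq by algebra
    then consider "Q = (2 * gold + 2) * P" | "Q = (4 - 2 * gold) * P" by auto
    then show ?thesis
    proof cases
      case 1
      \<comment> \<open>The coordinates after \<open>rotT\<close>, without the phase
        \<open>\<i>\<close>. This pair of face centres is moved to the pair that
        \<open>rel_face\<close> treats.\<close>
      define x' y' where "x' = (- gold * x + y) / gnorm" and "y' = (x + gold * y) / gnorm"
      have g: "gnorm * x' = - gold * x + y" "gnorm * y' = x + gold * y" using gnorm by (auto simp: x'_def y'_def)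
      have "gnorm\<^sup>2 * (x'\<^sup>2 + y'\<^sup>2) = gnorm\<^sup>2 * 1" using g n gnorm(2) by algebra
      then have 1: "x'\<^sup>2 + y'\<^sup>2 = 1" using gnorm(1) by simp
      have "gnorm\<^sup>2 * (y'\<^sup>2 + gold\<^sup>2 * x' * y' - x'\<^sup>2) = 0"
        using g \<open>Q = (2 * gold + 2) * P\<close> gold_sq unfolding P_def Q_def by algebra
      then have 2: "y'\<^sup>2 + gold\<^sup>2 * x' * y' - x'\<^sup>2 = 0" using gnorm(1) by simp
      have "rotT *v z = cscale \<i> (vector [complex_of_real x', complex_of_real y'])"
        by (rule vec2_eqI) (simp_all add: rotT_apply z(2,3) ct_def x'_def y'_def)
      then have "rel (rotT *v z) zF" using rel_face[OF 1 2] rel_cscale[of \<i>] rel_trans by simp metis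
      then show ?thesis using rel_rotation[OF rotT_I_star] rel_sym rel_trans by blast
    next
      case 2
      then have "y\<^sup>2 + gold\<^sup>2 * x * y - x\<^sup>2 = 0" using gold_sq unfolding P_def Q_def by algebra
      moreover have "z = vector [complex_of_real x, complex_of_real y]" by (rule vec2_eqI) (simp_all add: z)
      ultimately show ?thesis using rel_face[OF n] by simp
    qed
  qed
qed

text \<open>The imaginary part of the cleared equation is a multiple of
  \<open>Im (u ^ 5) * (a\<^sup>2 - b\<^sup>2)\<close>. So a zero lies over a pole, over the equator
  or over a meridian with \<open>u ^ 5\<close> real, and the meridians are rotated to the circle of
  real points. This reduces a problem on the 2-sphere to one on circles.\<close>

lemma zeros_of_A_fun_5:
  assumes z: "z \<in> S3" "A_fun 5 z = 0"
  shows "rel z zN \<or> rel z zE \<or> rel z zF"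
proof -
  define a b where "a = (cmod (z $ 1))\<^sup>2" and "b = (cmod (z $ 2))\<^sup>2"
  have ab: "complex_of_real a = z $ 1 * cnj (z $ 1)" "complex_of_real b = z $ 2 * cnj (z $ 2)"
    unfolding complex_norm_square[symmetric] a_def b_def by (rule refl)+
  define u where "u = z $ 1 * cnj (z $ 2)"
  have "Im (u ^ 5) * (330 * (a\<^sup>2 - b\<^sup>2)) = 0"
  proof -
    define \<tau> where "\<tau> = u ^ 5"
    have "\<tau> = (z $ 1 * cnj (z $ 2)) ^ 5" by (simp add: \<tau>_def u_def)
    from arg_cong[OF A_fun_5_times[OF ab this], of Im] z(2)
    have "0 = Im \<tau> * (a * (330 * a - 462 * b)) + Im \<tau> * (b * (462 * a - 330 * b))" by simp
    then show ?thesis unfolding \<tau>_def[symmetric] by algebra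
  qed
  then consider "u = 0" | "a\<^sup>2 = b\<^sup>2" | "u \<noteq> 0" "Im (u ^ 5) = 0" by auto
  then show ?thesis
  proof cases
    case 1
    then show ?thesis using rel_N[OF z(1)] by (auto simp: u_def)
  next
    case 2
    then have "a = b" unfolding a_def b_def by (metis power2_eq_imp_eq zero_le_power2)
    then have "cmod (z $ 1) = cmod (z $ 2)" unfolding a_def b_def by (metis power2_eq_imp_eq norm_ge_zero)
    then show ?thesis using rel_equator z by blast
  next
    case 3
    then have "cnj (u ^ 5) = u ^ 5" by (simp only: complex_eq_iff cnj.simps) simp
    then have "(u / cnj u) ^ 5 = 1" using 3(1) by (simp add: power_divide)
    then obtain k where k: "u / cnj u = \<epsilon> ^ k" using fifth_roots by blast
    define \<zeta> where "\<zeta> = \<epsilon> ^ k"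
    have \<zeta>: "\<zeta> ^ 5 = 1" "\<zeta> ^ 10 = 1" using eps_power by (simp_all add: \<zeta>_def)
    note d = diag_I_star[OF \<zeta>(2)]
    have uc: "u = \<zeta> * cnj u" using k 3(1) by (simp add: \<zeta>_def field_simps)
    have c4: "cnj \<zeta> = \<zeta> ^ 4" using \<zeta>(1) d(3) by algebra
    \<comment> \<open>Rotating by this fifth root of unity makes \<open>u\<close> real; once the
      phase of \<open>z' $ 1\<close> is removed, the vector itself is real.\<close>
    define v where "v = \<zeta>\<^sup>2 * u"
    have cv: "cnj v = v"
    proof -
      have "cnj v = (\<zeta> ^ 4)\<^sup>2 * cnj u" by (simp add: v_def c4)
      also have "\<dots> = \<zeta>\<^sup>2 * (\<zeta> * cnj u)" using \<zeta>(1) by algebra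
      finally show ?thesis using uc by (simp add: v_def)
    qed
    define z' where "z' = mat2 \<zeta> 0 *v z"
    have z': "z' \<in> S3" "rel z' z" unfolding z'_def using I_star_sphere[OF d(1) z(1)] rel_rotation[OF d(1)] by auto
    have v': "z' $ 1 * cnj (z' $ 2) = v"
      unfolding z'_def diag_apply v_def u_def by (simp add: power2_eq_square)
    have v0: "v \<noteq> 0" using 3(1) d(2) by (auto simp: v_def)
    define x where "x = cmod (z' $ 1)"
    have x0: "x > 0" using v0 v' by (auto simp: x_def)
    define \<omega> where "\<omega> = z' $ 1 / complex_of_real x"
    have \<omega>: "cmod \<omega> = 1" "\<omega> * cnj \<omega> = 1"
    proof -
      show 1: "cmod \<omega> = 1" using x0 by (simp add: \<omega>_def norm_divide x_def)
      show "\<omega> * cnj \<omega> = 1" unfolding complex_norm_square[symmetric] 1 by simp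
    qed
    define y where "y = Re v / x"
    have vr: "v = complex_of_real (Re v)" using cv by (simp add: complex_eq_iff)
    have z2: "z' $ 2 = \<omega> * complex_of_real y"
    proof -
      have z1: "z' $ 1 = \<omega> * complex_of_real x" using x0 by (simp add: \<omega>_def)
      have "cnj (z' $ 1) * z' $ 2 = v" using arg_cong[OF v', of cnj] cv by simp
      then have "cnj \<omega> * z' $ 2 * complex_of_real x = complex_of_real (y * x)"
        using vr x0 unfolding z1 by (simp add: y_def mult_ac)
      then have "cnj \<omega> * z' $ 2 = complex_of_real y" using x0 by simp
      then have "\<omega> * cnj \<omega> * z' $ 2 = \<omega> * complex_of_real y" by (simp only: mult.assoc)
      then show ?thesis using \<omega>(2) by simp
    qed
    define w where "w = cscale (cnj \<omega>) z'"
    have wn: "w $ 1 = complex_of_real x" "w $ 2 = complex_of_real y"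
    proof -
      have z1: "z' $ 1 = \<omega> * complex_of_real x" using x0 by (simp add: \<omega>_def)
      have "cnj \<omega> * (\<omega> * t) = t" for t using \<omega>(2) by (simp add: mult.assoc[symmetric] mult.commute)
      then show "w $ 1 = complex_of_real x" "w $ 2 = complex_of_real y"
        unfolding w_def cscale_nth z1 z2 by blast+
    qed
    have wz: "rel w z" using rel_cscale[of "cnj \<omega>" z'] \<omega>(1) z'(2) rel_trans unfolding w_def by simp
    then have "A_fun 5 w = 0" using rel_A_fun[OF rel_sym[OF wz]] z(2) by simp
    moreover have "w \<in> S3" using rel_norm[OF wz] z(1) by simp
    ultimately have "rel w zN \<or> rel w zE \<or> rel w zF" using rel_real wn by blast
    then show ?thesis using wz rel_sym rel_trans by blast
  qed
qed

section \<open>Stabilizers of the critical fibres\<close>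

text \<open>The stabilizer of the Hopf fibre through \<open>z\<close>, seen through the phases by
  which it rotates this fibre.\<close>

definition stab :: "complex^2 \<Rightarrow> complex set" where
  "stab z = {\<zeta>. cmod \<zeta> = 1 \<and> (\<exists>B\<in>I_star. B *v z = cscale \<zeta> z)}"

lemma stab_mult: "\<zeta> \<in> stab z \<Longrightarrow> \<eta> \<in> stab z \<Longrightarrow> \<zeta> * \<eta> \<in> stab z"
proof -
  assume "\<zeta> \<in> stab z" "\<eta> \<in> stab z"
  then obtain B C where B: "B \<in> I_star" "B *v z = cscale \<zeta> z" "C \<in> I_star" "C *v z = cscale \<eta> z"
    "cmod \<zeta> = 1" "cmod \<eta> = 1" by (auto simp: stab_def)
  have "(C ** B) *v z = cscale (\<zeta> * \<eta>) z"
    by (simp add: matrix_vector_mul_assoc[symmetric] B mult_cscale)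
  then show ?thesis unfolding stab_def using I_star_mult[OF B(3,1)] B(5,6) by (auto simp: norm_mult)
qed

lemma stab_minus_one: "- 1 \<in> stab z"
proof -
  have "(rotJ ** rotJ) *v z = cscale (- 1) z"
    unfolding matrix_vector_mul_assoc[symmetric] by (rule vec2_eqI) (simp_all add: rotJ_apply)
  then show ?thesis unfolding stab_def using I_star_mult[OF rotJ_I_star rotJ_I_star] by auto
qed

lemma A_fun_phase:
  assumes "cmod \<omega> = 1" "2 * j + n = 12"
  shows "A_fun j (cscale \<omega> z) = \<omega> ^ n * A_fun j z"
proof -
  have "\<omega> * cnj \<omega> = 1" using assms(1) by (simp add: complex_norm_square[symmetric])
  then have "\<omega> ^ j * cnj \<omega> ^ j = 1" by (simp add: power_mult_distrib[symmetric])
  moreover have "12 - j = n + j" using assms(2) by simp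
  ultimately have "\<omega> ^ (12 - j) * cnj \<omega> ^ j = \<omega> ^ n" by (simp add: power_add mult.assoc)
  then show ?thesis using A_fun_cscale[of j \<omega> z] assms(2) by simp
qed

text \<open>Invariance, together with the weight \<open>n\<close> of \<open>A_j\<close> along the
  fibre, gives \<open>A_fun j z = \<zeta> ^ n * A_fun j z\<close>.\<close>

lemma stab_zero:
  assumes "\<zeta> \<in> stab z" "2 * j + n = 12" "\<zeta> ^ n \<noteq> 1"
  shows "A_fun j z = 0"
proof -
  obtain B where B: "B \<in> I_star" "B *v z = cscale \<zeta> z" "cmod \<zeta> = 1" using assms(1) by (auto simp: stab_def)
  have "A_fun j z = \<zeta> ^ n * A_fun j z"
    using A_fun_invariant[OF B(1), of j z] A_fun_phase[OF B(3) assms(2)] B(2) by simp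
  then show ?thesis using assms(3) by simp
qed

text \<open>If \<open>B z = \<zeta> z\<close> with \<open>B\<close> in the group and \<open>\<zeta>\<close> a primitive \<open>n\<close>-th root of unity, then
  \<open>A_i z = 0\<close> unless \<open>n\<close> divides \<open>12 - 2 i\<close>; this leaves one of \<open>A_1\<close>, \<open>A_3\<close>, \<open>A_4\<close>.\<close>
definition base :: "complex^2 \<Rightarrow> nat \<Rightarrow> nat \<Rightarrow> bool" where
  "base z j n \<longleftrightarrow> z \<in> S3 \<and> j \<in> {1, 3, 4} \<and> 2 * j + n = 12 \<and> A_fun j z \<noteq> 0 \<and>
     (\<forall>i\<in>{1, 3, 4, 5} - {j}. A_fun i z = 0) \<and> 6 * cmod (A_fun 6 z) \<noteq> 8 * cmod (A_fun 4 z) \<and>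
     (\<forall>\<zeta>. \<zeta> ^ n = 1 \<longrightarrow> \<zeta> \<in> stab z)"

lemma eps_powers_neq_1: "\<epsilon> ^ 2 \<noteq> 1" "\<epsilon> ^ 4 \<noteq> 1" "\<epsilon> ^ 6 \<noteq> 1"
proof -
  show "\<epsilon> ^ 2 \<noteq> 1" using eps_pow5 eps_neq_1 by algebra
  show "\<epsilon> ^ 4 \<noteq> 1" using eps_pow5 eps_neq_1 by algebra
  show "\<epsilon> ^ 6 \<noteq> 1" using eps_pow5 eps_neq_1 by algebra
qed

lemma base_N: "base zN 1 10"
proof -
  have st: "\<zeta> \<in> stab zN" if "\<zeta> ^ 10 = 1" for \<zeta>
  proof -
    have "mat2 \<zeta> 0 *v zN = cscale \<zeta> zN" by (rule vec2_eqI) (simp_all add: diag_apply)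
    then show ?thesis unfolding stab_def using diag_I_star[OF that] by auto
  qed
  have e: "\<epsilon> \<in> stab zN" using st eps_power(2)[of 1] by simp
  have "A_fun 1 zN = 1" unfolding A_fun_1 by simp
  moreover have "A_fun 6 zN = 11" unfolding A_fun_6 Let_def by simp
  moreover have "A_fun 3 zN = 0" "A_fun 4 zN = 0" "A_fun 5 zN = 0"
    using stab_zero[OF e, of 3 6] stab_zero[OF e, of 4 4] stab_zero[OF e, of 5 2] eps_powers_neq_1 by auto
  ultimately show ?thesis unfolding base_def using st base_S3 by auto
qed

lemma real_scale_12: "A_fun j (z /\<^sub>R sqrt 2) = A_fun j z / 64" if "j \<le> 12"
proof -
  have "(sqrt 2) ^ 12 = 64" using power_mult[of "sqrt 2" 2 6] by simp
  then have "complex_of_real (sqrt 2) ^ 12 = 64" by (metis of_real_numeral of_real_power)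
  then show ?thesis using A_fun_scaleR[OF that, of "inverse (sqrt 2)" z] by (simp add: power_inverse field_simps)
qed

lemma base_E: "base zE 4 4"
proof -
  define e :: "complex^2" where "e = vector [1, \<i>]"
  have en: "e $ 1 = 1" "e $ 2 = \<i>" by (simp_all add: e_def)
  have ze: "zE = e /\<^sub>R sqrt 2" by (simp add: zE_def e_def)
  have i: "\<i> \<in> stab zE"
  proof -
    have "rotJ *v zE = cscale \<i> zE" by (rule vec2_eqI) (simp_all add: rotJ_apply zE_nth)
    then show ?thesis unfolding stab_def using rotJ_I_star by auto
  qed
  have st: "\<zeta> \<in> stab zE" if "\<zeta> ^ 4 = 1" for \<zeta>
  proof -
    have "(\<zeta> - 1) * (\<zeta> + 1) * (\<zeta> - \<i>) * (\<zeta> + \<i>) = 0" using that i_squared by algebra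
    then have "\<zeta> = 1 \<or> \<zeta> = - 1 \<or> \<zeta> = \<i> \<or> \<zeta> = - \<i>"
      by (metis eq_iff_diff_eq_0 eq_neg_iff_add_eq_0 mult_eq_0_iff)
    moreover have "- 1 * - 1 \<in> stab zE" "- 1 * \<i> \<in> stab zE" using stab_mult stab_minus_one i by blast+
    ultimately show ?thesis using i stab_minus_one by auto
  qed
  have "A_fun 1 zE = 0" "A_fun 3 zE = 0" "A_fun 5 zE = 0"
    using stab_zero[OF i, of 1 10] stab_zero[OF i, of 3 6] stab_zero[OF i, of 5 2]
    by (simp_all add: eval_nat_numeral complex_eq_iff)
  \<comment> \<open>Values at the vector before normalization; degree 12 and length
    \<open>sqrt 2\<close> account for the divisor 64.\<close>
  moreover have "A_fun 6 e = - 220"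
    unfolding A_fun_6 Let_def en by (simp add: eval_nat_numeral)
  then have A6: "A_fun 6 zE = - 220 / 64" using real_scale_12[of 6 e] by (simp add: ze)
  moreover have "A_fun 4 e = - 165 + 330 * \<i>"
    unfolding A_fun_cprod cprod_def en by (simp add: eval_nat_numeral)
  then have A4: "A_fun 4 zE = (- 165 + 330 * \<i>) / 64" using real_scale_12[of 4 e] by (simp add: ze)
  moreover have "6 * cmod (A_fun 6 zE) \<noteq> 8 * cmod (A_fun 4 zE)"
  proof
    assume "6 * cmod (A_fun 6 zE) = 8 * cmod (A_fun 4 zE)"
    then have "(6 * cmod (- 220 / 64))\<^sup>2 = (8 * cmod ((- 165 + 330 * \<i>) / 64))\<^sup>2" unfolding A4 A6 by simp
    then show False by (simp add: norm_divide power_mult_distrib power_divide cmod_power2)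
  qed
  moreover have "A_fun 4 zE \<noteq> 0" unfolding A4 by (simp add: complex_eq_iff)
  ultimately show ?thesis unfolding base_def using st base_S3 by auto
qed

lemma face_rotation: "\<exists>\<zeta>\<in>stab zF. \<zeta> ^ 4 + \<zeta>\<^sup>2 + 1 = 0"
proof -
  define r where "r = complex_of_real (1 / sqrt (1 + w0\<^sup>2))"
  define w where "w = complex_of_real w0"
  have zn: "zF $ 1 = r" "zF $ 2 = r * w" by (simp_all add: zF_nth r_def w_def)
  have w: "w\<^sup>2 + \<phi>\<^sup>2 * w - 1 = 0"
  proof -
    have "complex_of_real (w0\<^sup>2 + gold\<^sup>2 * w0 - 1) = 0" using w0(1) by simp
    then show ?thesis by (simp add: w_def)
  qed
  have e4: "(\<epsilon> ^ 4) ^ 10 = 1" by (rule eps_power)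
  have ce4: "cnj (\<epsilon> ^ 4) = \<epsilon>" unfolding cnj_eps[symmetric] by simp
  \<comment> \<open>A lift of a rotation by a third of a turn about the face centre;
    \<open>\<zeta>\<close> is its eigenvalue on the real eigenvector \<open>zF\<close>.\<close>
  define M where "M = mat2 (\<epsilon> ^ 4) 0 ** rotT ** mat2 (\<epsilon> ^ 4) 0"
  have MI: "M \<in> I_star" unfolding M_def using diag_I_star[OF e4] rotT_I_star by (intro I_star_mult) auto
  define \<zeta> where "\<zeta> = ct * (- \<phi> * \<epsilon> ^ 3 + w)"
  have Mz: "M *v zF = cscale \<zeta> zF"
    unfolding M_def matrix_vector_mul_assoc[symmetric]
  proof (rule vec2_eqI)
    show "(mat2 (\<epsilon> ^ 4) 0 *v (rotT *v (mat2 (\<epsilon> ^ 4) 0 *v zF))) $ 1 = cscale \<zeta> zF $ 1"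
      unfolding diag_apply rotT_apply ce4 zn cscale_nth \<zeta>_def using eps_pow5 by algebra
    show "(mat2 (\<epsilon> ^ 4) 0 *v (rotT *v (mat2 (\<epsilon> ^ 4) 0 *v zF))) $ 2 = cscale \<zeta> zF $ 2"
      unfolding diag_apply rotT_apply ce4 zn cscale_nth \<zeta>_def using eps_pow5 w eps_gold(1) by algebra
  qed
  have "cmod \<zeta> = 1" using rotation_isometry(1)[OF MI, of zF] base_S3(3) unfolding Mz by (auto simp: norm_cscale)
  then have "\<zeta> \<in> stab zF" unfolding stab_def using MI Mz by auto
  moreover have "\<zeta> ^ 4 + \<zeta>\<^sup>2 + 1 = 0"
  proof -
    \<comment> \<open>The trace of \<open>M\<close>. Its sign can stay open, since
      \<open>X ^ 4 + X ^ 2 + 1\<close> is the product of the characteristic polynomials for the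
      traces 1 and -1.\<close>
    define tr where "tr = ct * \<phi> * (\<epsilon> ^ 2 - \<epsilon> ^ 3)"
    have "tr\<^sup>2 = ct\<^sup>2 * (\<phi>\<^sup>2 * (\<epsilon> + \<epsilon> ^ 4 - 2))" unfolding tr_def using eps_pow5 by algebra
    also have "\<phi>\<^sup>2 * (\<epsilon> + \<epsilon> ^ 4 - 2) = - (1 + \<phi>\<^sup>2)" unfolding eps_gold using gold_sq_complex by algebra
    finally have tr: "tr\<^sup>2 = 1" using ct(1) by (simp only: mult_minus_right) simp
    have "(\<zeta> + ct * \<phi> * \<epsilon> ^ 3) * (\<zeta> - ct * \<phi> * \<epsilon> ^ 2) = ct\<^sup>2"
      unfolding \<zeta>_def using w eps_gold(1) by algebra
    then have "\<zeta>\<^sup>2 - tr * \<zeta> - ct\<^sup>2 * (1 + \<phi>\<^sup>2) = 0" unfolding tr_def using eps_pow5 by algebra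
    then have "\<zeta>\<^sup>2 + 1 = tr * \<zeta>" using ct(1) by (simp add: algebra_simps)
    then have "(\<zeta>\<^sup>2 + 1)\<^sup>2 = tr\<^sup>2 * \<zeta>\<^sup>2" by (simp add: power_mult_distrib)
    then show ?thesis using tr by algebra
  qed
  ultimately show ?thesis by blast
qed

lemma base_F: "base zF 3 6"
proof -
  obtain \<zeta>0 where z0: "\<zeta>0 \<in> stab zF" "\<zeta>0 ^ 4 + \<zeta>0\<^sup>2 + 1 = 0" using face_rotation by blast
  have p: "\<zeta>0 ^ 6 = 1" "\<zeta>0 ^ 2 \<noteq> 1" "\<zeta>0 ^ 4 \<noteq> 1"
  proof -
    show 6: "\<zeta>0 ^ 6 = 1" using z0(2) by algebra
    show 2: "\<zeta>0 ^ 2 \<noteq> 1"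
    proof
      assume "\<zeta>0 ^ 2 = 1"
      then have "(3::complex) = 0" using z0(2) by algebra
      then show False by simp
    qed
    show "\<zeta>0 ^ 4 \<noteq> 1" using 6 2 by algebra
  qed
  then have "\<zeta>0 ^ 10 \<noteq> 1" by algebra
  then have A0: "A_fun 1 zF = 0" "A_fun 4 zF = 0" "A_fun 5 zF = 0"
    using stab_zero[OF z0(1), of 1 10] stab_zero[OF z0(1), of 4 4] stab_zero[OF z0(1), of 5 2] p by auto
  have st: "\<zeta> \<in> stab zF" if "\<zeta> ^ 6 = 1" for \<zeta>
  proof -
    have "(\<zeta> - 1) * (\<zeta> + 1) * (\<zeta> - \<zeta>0) * (\<zeta> + \<zeta>0) * (\<zeta> - \<zeta>0\<^sup>2) * (\<zeta> + \<zeta>0\<^sup>2) = 0"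
      using that z0(2) by algebra
    then have "\<zeta> = 1 \<or> \<zeta> = - 1 \<or> \<zeta> = \<zeta>0 \<or> \<zeta> = - \<zeta>0 \<or> \<zeta> = \<zeta>0\<^sup>2 \<or> \<zeta> = - (\<zeta>0\<^sup>2)"
      by (metis eq_iff_diff_eq_0 eq_neg_iff_add_eq_0 mult_eq_0_iff)
    moreover have "- 1 * - 1 \<in> stab zF" "- 1 * \<zeta>0 \<in> stab zF" "\<zeta>0 * \<zeta>0 \<in> stab zF" "- 1 * (\<zeta>0 * \<zeta>0) \<in> stab zF"
      using stab_mult stab_minus_one z0(1) by blast+
    ultimately show ?thesis using z0(1) stab_minus_one by (auto simp: power2_eq_square)
  qed
  define r where "r = complex_of_real (1 / sqrt (1 + w0\<^sup>2))"
  define w where "w = complex_of_real w0"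
  have zn: "zF $ 1 = r" "zF $ 2 = r * w" "cnj r = r" "cnj w = w" by (simp_all add: zF_nth r_def w_def)
  have r: "r \<noteq> 0" using add_pos_nonneg[of 1 "w0\<^sup>2"] by (simp add: r_def)
  have w: "w\<^sup>2 = 1 - (\<phi> + 1) * w"
  proof -
    have "complex_of_real (w0\<^sup>2 + gold\<^sup>2 * w0 - 1) = 0" using w0(1) by simp
    then show ?thesis using gold_sq_complex by (simp add: w_def algebra_simps)
  qed
  have nz: "1 + w\<^sup>2 \<noteq> 0"
  proof -
    have "1 + w\<^sup>2 = complex_of_real (1 + w0\<^sup>2)" by (simp add: w_def)
    moreover have "1 + w0\<^sup>2 \<noteq> 0" using add_pos_nonneg[of 1 "w0\<^sup>2"] by simp
    ultimately show ?thesis by (metis of_real_eq_0_iff)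
  qed
  \<comment> \<open>Powers of \<open>w\<close> become linear polynomials in \<open>w\<close> with
    coefficients in the golden integers, each from the previous one by the quadratic equations of
    \<open>w\<close> and \<open>\<phi>\<close>.\<close>
  have w3: "w ^ 3 = (- 1 - 1 * \<phi>) + (3 + 3 * \<phi>) * w"
  proof -
    have "w ^ 3 = w * w ^ 2" by (simp add: power_Suc[symmetric] del: power_Suc)
    then show ?thesis using w gold_sq_complex by algebra
  qed
  have w4: "w ^ 4 = (3 + 3 * \<phi>) + (- 7 - 10 * \<phi>) * w"
  proof -
    have "w ^ 4 = w * w ^ 3" by (simp add: power_Suc[symmetric] del: power_Suc)
    then show ?thesis using w3 w gold_sq_complex by algebra
  qed
  have w5: "w ^ 5 = (- 7 - 10 * \<phi>) + (20 + 30 * \<phi>) * w"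
  proof -
    have "w ^ 5 = w * w ^ 4" by (simp add: power_Suc[symmetric] del: power_Suc)
    then show ?thesis using w4 w gold_sq_complex by algebra
  qed
  have w6: "w ^ 6 = (20 + 30 * \<phi>) + (- 57 - 90 * \<phi>) * w"
  proof -
    have "w ^ 6 = w * w ^ 5" by (simp add: power_Suc[symmetric] del: power_Suc)
    then show ?thesis using w5 w gold_sq_complex by algebra
  qed
  have w7: "w ^ 7 = (- 57 - 90 * \<phi>) + (167 + 267 * \<phi>) * w"
  proof -
    have "w ^ 7 = w * w ^ 6" by (simp add: power_Suc[symmetric] del: power_Suc)
    then show ?thesis using w6 w gold_sq_complex by algebra
  qed
  have w8: "w ^ 8 = (167 + 267 * \<phi>) + (- 491 - 791 * \<phi>) * w"
  proof -
    have "w ^ 8 = w * w ^ 7" by (simp add: power_Suc[symmetric] del: power_Suc)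
    then show ?thesis using w7 w gold_sq_complex by algebra
  qed
  have w9: "w ^ 9 = (- 491 - 791 * \<phi>) + (1449 + 2340 * \<phi>) * w"
  proof -
    have "w ^ 9 = w * w ^ 8" by (simp add: power_Suc[symmetric] del: power_Suc)
    then show ?thesis using w8 w gold_sq_complex by algebra
  qed
  have w10: "w ^ 10 = (1449 + 2340 * \<phi>) + (- 4280 - 6920 * \<phi>) * w"
  proof -
    have "w ^ 10 = w * w ^ 9" by (simp add: power_Suc[symmetric] del: power_Suc)
    then show ?thesis using w9 w gold_sq_complex by algebra
  qed
  have w11: "w ^ 11 = (- 4280 - 6920 * \<phi>) + (12649 + 20460 * \<phi>) * w"
  proof -
    have "w ^ 11 = w * w ^ 10" by (simp add: power_Suc[symmetric] del: power_Suc)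
    then show ?thesis using w10 w gold_sq_complex by algebra
  qed
  have w12: "w ^ 12 = (12649 + 20460 * \<phi>) + (- 37389 - 60489 * \<phi>) * w"
  proof -
    have "w ^ 12 = w * w ^ 11" by (simp add: power_Suc[symmetric] del: power_Suc)
    then show ?thesis using w11 w gold_sq_complex by algebra
  qed
  have q6: "(1 + w\<^sup>2) ^ 6 = (24300 + 39150 * \<phi>) + (- 71685 - 115830 * \<phi>) * w"
  proof -
    have "(1 + w\<^sup>2)\<^sup>2 = (6 + 3 * \<phi>) + (- 9 - 12 * \<phi>) * w" using w gold_sq_complex by algebra
    moreover have "(1 + w\<^sup>2) ^ 6 = (1 + w\<^sup>2)\<^sup>2 * (1 + w\<^sup>2)\<^sup>2 * (1 + w\<^sup>2)\<^sup>2" by (simp add: power_add[symmetric])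
    ultimately show ?thesis using w gold_sq_complex by algebra
  qed
  \<comment> \<open>As \<open>r ^ 12 * (1 + w\<^sup>2) ^ 6\<close> is 1, this is the value
    \<open>55 * sqrt 5 / 27\<close> of \<open>A_3\<close> at \<open>zF\<close>; the next claim is
    the value \<open>- 55 / 9\<close> of \<open>A_6\<close>.\<close>
  have 3: "27 * A_fun 3 zF = r ^ 12 * (55 * (2 * \<phi> - 1) * (1 + w\<^sup>2) ^ 6)"
  proof -
    have e1: "A_fun 3 zF = r ^ 12 * (55 * w ^ 2 + 220 * w ^ 3 - 165 * w ^ 4 - 990 * w ^ 5 + 990 * w ^ 7 - 165 * w ^ 8 - 220 * w ^ 9 + 55 * w ^ 10)"
      unfolding A_fun_cprod cprod_def zn complex_cnj_mult by (simp add: eval_nat_numeral) (simp add: algebra_simps)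
    have e2: "27 * (55 * w ^ 2 + 220 * w ^ 3 - 165 * w ^ 4 - 990 * w ^ 5 + 990 * w ^ 7 - 165 * w ^ 8 - 220 * w ^ 9 + 55 * w ^ 10) = 55 * (2 * \<phi> - 1) * (1 + w\<^sup>2) ^ 6"
      unfolding w3 w4 w5 w6 w7 w8 w9 w10 q6 using w gold_sq_complex by algebra
    show ?thesis unfolding e1 by (subst mult.left_commute) (simp only: e2)
  qed
  have 6: "9 * A_fun 6 zF = r ^ 12 * (- 55 * (1 + w\<^sup>2) ^ 6)"
  proof -
    have e1: "A_fun 6 zF = r ^ 12 * (11 - 396 * w ^ 2 + 2475 * w ^ 4 - 924 * w ^ 5 - 4400 * w ^ 6 + 924 * w ^ 7 + 2475 * w ^ 8 - 396 * w ^ 10 + 11 * w ^ 12)"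
      unfolding A_fun_6 Let_def zn complex_cnj_mult by (simp add: eval_nat_numeral) (simp add: algebra_simps)
    have e2: "9 * (11 - 396 * w ^ 2 + 2475 * w ^ 4 - 924 * w ^ 5 - 4400 * w ^ 6 + 924 * w ^ 7 + 2475 * w ^ 8 - 396 * w ^ 10 + 11 * w ^ 12) = - 55 * (1 + w\<^sup>2) ^ 6"
      unfolding w3 w4 w5 w6 w7 w8 w9 w10 w11 w12 q6 using w gold_sq_complex by algebra
    show ?thesis unfolding e1 by (subst mult.left_commute) (simp only: e2)
  qed
  have "(2 * \<phi> - 1) \<noteq> 0"
  proof -
    have "2 * gold - 1 = sqrt 5" by (simp add: gold_def field_simps)
    then have "2 * \<phi> - 1 = complex_of_real (sqrt 5)" by (metis of_real_1 of_real_diff of_real_mult of_real_numeral)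
    then show ?thesis by simp
  qed
  then have "A_fun 3 zF \<noteq> 0" "A_fun 6 zF \<noteq> 0" using 3 6 r nz by auto
  then show ?thesis unfolding base_def using st base_S3 A0 by auto
qed

lemma base_exists:
  assumes "z \<in> S3" "A_fun 5 z = 0"
  obtains z0 j n where "z0 \<in> {zN, zE, zF}" "base z0 j n" "rel z z0"
  using zeros_of_A_fun_5[OF assms] base_N base_E base_F by blast

section \<open>Homogeneous polynomials on the sphere\<close>

lemma inner_complex2: "v \<bullet> z = Re (v $ 1 * cnj (z $ 1) + v $ 2 * cnj (z $ 2))" for v z :: "complex^2"
  by (simp add: inner_vec_def sum_2 inner_complex_def)

text \<open>\<open>z\<close> and \<open>hat 1 z\<close> form a unitary basis. The component of
  \<open>v\<close> along the second is \<open>\<kappa>\<close>; the component \<open>s\<close> along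
  the first is imaginary because \<open>v\<close> is tangent.\<close>

lemma tangent_frame:
  assumes z: "z \<in> S3" and v: "v \<in> tangent z"
  obtains \<theta> \<kappa> where "v = \<theta> *\<^sub>R cscale \<i> z + hat \<kappa> z"
proof -
  define \<kappa> where "\<kappa> = v $ 2 * z $ 1 - v $ 1 * z $ 2"
  define s where "s = v $ 1 * cnj (z $ 1) + v $ 2 * cnj (z $ 2)"
  have "Re s = 0" using v by (simp add: tangent_def inner_complex2 s_def)
  then have s: "s = complex_of_real (Im s) * \<i>" by (simp add: complex_eq_iff)
  have n: "z $ 1 * cnj (z $ 1) + z $ 2 * cnj (z $ 2) = 1"
  proof -
    have "complex_of_real ((cmod (z $ 1))\<^sup>2 + (cmod (z $ 2))\<^sup>2) = 1" using z unfolding S3_iff by (simp only: of_real_1)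
    then show ?thesis by (simp only: of_real_add complex_norm_square)
  qed
  have "v = Im s *\<^sub>R cscale \<i> z + hat \<kappa> z"
  proof (rule vec2_eqI)
    have "v $ 1 = s * z $ 1 - \<kappa> * cnj (z $ 2)" unfolding s_def \<kappa>_def using n by algebra
    also have "s * z $ 1 = complex_of_real (Im s) * (\<i> * z $ 1)" using s by simp
    finally show "v $ 1 = (Im s *\<^sub>R cscale \<i> z + hat \<kappa> z) $ 1"
      by (simp only: vector_add_component vector_scaleR_component cscale_nth hat_nth) (simp add: scaleR_conv_of_real)
    have "v $ 2 = s * z $ 2 + \<kappa> * cnj (z $ 1)" unfolding s_def \<kappa>_def using n by algebra
    also have "s * z $ 2 = complex_of_real (Im s) * (\<i> * z $ 2)" using s by simp
    finally show "v $ 2 = (Im s *\<^sub>R cscale \<i> z + hat \<kappa> z) $ 2"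
      by (simp only: vector_add_component vector_scaleR_component cscale_nth hat_nth) (simp add: scaleR_conv_of_real)
  qed
  then show ?thesis using that by blast
qed

lemma frame_tangent: "cscale \<i> z \<bullet> z = 0" "hat \<kappa> z \<bullet> z = 0"
  unfolding inner_complex2 by (simp_all add: algebra_simps)

lemma frame_linear: "linear (cscale \<i>)" "linear (hat \<kappa>)"
  by (rule linearI; rule vec2_eqI; simp add: algebra_simps)+

text \<open>Injectivity of \<open>f\<close> will separate critical points, and injectivity of the
  derivatives at neighbouring points will give their nondegeneracy. Continuity of the derivative on
  basis vectors is turned into a bound for the operator norm.\<close>

lemma C1_locally_injective:
  fixes f :: "'a::euclidean_space \<Rightarrow> 'b::euclidean_space"
  assumes der: "\<And>x. (f has_derivative f' x) (at x)"
    and cont: "\<And>b. b \<in> Basis \<Longrightarrow> isCont (\<lambda>x. f' x b) a"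
    and inj: "\<And>v. f' a v = 0 \<Longrightarrow> v = 0"
  obtains r where "r > 0" "inj_on f (ball a r)" "\<And>x v. x \<in> ball a r \<Longrightarrow> f' x v = 0 \<Longrightarrow> v = 0"
proof -
  have lin: "linear (f' x)" for x using der has_derivative_linear by blast
  have close: "\<exists>d>0. \<forall>x. dist a x < d \<longrightarrow> (\<forall>v. norm (f' x v - f' a v) \<le> e * norm v)" if e: "e > 0" for e
  proof -
    define N where "N = real DIM('a)"
    have N: "N > 0" by (simp add: N_def)
    have "\<exists>d>0. \<forall>x. dist x a < d \<longrightarrow> norm (f' x b - f' a b) < e / N" if "b \<in> Basis" for b
      using cont[OF that] e N unfolding continuous_at_eps_delta dist_norm by (meson divide_pos_pos)
    then obtain \<delta> where \<delta>: "\<And>b. b \<in> Basis \<Longrightarrow> \<delta> b > 0"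
      "\<And>b x. b \<in> Basis \<Longrightarrow> dist x a < \<delta> b \<Longrightarrow> norm (f' x b - f' a b) < e / N" by metis
    define d where "d = Min (\<delta> ` Basis)"
    have d: "d > 0" "\<And>b. b \<in> Basis \<Longrightarrow> d \<le> \<delta> b" unfolding d_def using \<delta>(1) by auto
    have "norm (f' x v - f' a v) \<le> e * norm v" if x: "dist a x < d" for x v
    proof -
      have "f' x v - f' a v = (\<Sum>b\<in>Basis. (v \<bullet> b) *\<^sub>R (f' x b - f' a b))"
      proof -
        have "f' y v = (\<Sum>b\<in>Basis. (v \<bullet> b) *\<^sub>R f' y b)" for y
          using linear_sum[OF lin[of y], of "\<lambda>b. (v \<bullet> b) *\<^sub>R b" Basis]
          by (simp add: euclidean_representation linear_scale[OF lin])
        then show ?thesis by (simp add: sum_subtractf scaleR_diff_right)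
      qed
      also have "norm \<dots> \<le> (\<Sum>b\<in>(Basis::'a set). norm v * (e / N))"
      proof (rule sum_norm_le)
        fix b :: 'a assume b: "b \<in> Basis"
        have "norm (f' x b - f' a b) \<le> e / N" using \<delta>(2)[OF b, of x] d(2)[OF b] x by (simp add: dist_commute)
        then show "norm ((v \<bullet> b) *\<^sub>R (f' x b - f' a b)) \<le> norm v * (e / N)"
          unfolding norm_scaleR using b by (intro mult_mono) (auto simp: Basis_le_norm)
      qed
      also have "\<dots> = e * norm v" using N by (simp add: N_def)
      finally show ?thesis .
    qed
    then show ?thesis using d(1) by blast
  qed
  have injf: "inj (f' a)" using linear_injective_0[OF lin] inj by blast
  obtain g' where g': "linear g'" "g' \<circ> f' a = id" using linear_injective_left_inverse[OF lin injf] by blast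
  have "\<exists>d>0. \<forall>x. dist a x < d \<longrightarrow> onorm (\<lambda>v. f' x v - f' a v) < e" if e: "e > 0" for e
  proof -
    obtain d where d: "d > 0" "\<And>x v. dist a x < d \<Longrightarrow> norm (f' x v - f' a v) \<le> (e / 2) * norm v"
      using close[of "e / 2"] e by (metis half_gt_zero)
    have "onorm (\<lambda>v. f' x v - f' a v) < e" if "dist a x < d" for x
      using onorm_le[of "\<lambda>v. f' x v - f' a v" "e / 2"] d(2)[OF that] \<open>e > 0\<close> by fastforce
    then show ?thesis using d(1) by blast
  qed
  then obtain r1 where r1: "r1 > 0" "inj_on f (ball a r1)"
    using has_derivative_locally_injective[of a UNIV g' f' f] g' der
    by (auto simp: linear_conv_bounded_linear)
  obtain B where B: "B > 0" "\<And>v. norm v * B \<le> norm (f' a v)"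
    using linear_inj_bounded_below_pos[OF lin injf] by (metis mult.commute)
  obtain d where d: "d > 0" "\<And>x v. dist a x < d \<Longrightarrow> norm (f' x v - f' a v) \<le> (B / 2) * norm v"
    using close[of "B / 2"] B(1) by (metis half_gt_zero)
  show ?thesis
  proof (rule that[of "min r1 d"])
    show "inj_on f (ball a (min r1 d))" using r1(2) by (rule inj_on_subset) auto
    fix x v assume x: "x \<in> ball a (min r1 d)" and z: "f' x v = 0"
    have "norm (f' a v) \<le> (B / 2) * norm v" using d(2)[of x v] x z by simp
    then have "norm v * B \<le> (B / 2) * norm v" using B(2)[of v] by linarith
    then have "norm v * (B / 2) \<le> 0" by (simp add: algebra_simps)
    then show "v = 0" using B(1) by (simp add: mult_le_0_iff)
  qed (use r1 d in auto)
qed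

section \<open>Functions on the quotient that lift to homogeneous polynomials of degree 12\<close>

locale polynomial_lift =
  fixes P :: "complex^2 \<Rightarrow> real" and f :: "dodec \<Rightarrow> real"
  assumes poly: "real_polynomial_function P" and hom: "\<And>r x. P (r *\<^sub>R x) = r ^ 12 * P x"
    and lift: "\<And>z. z \<in> S3 \<Longrightarrow> f (proj z) = P z"
begin

lemma radial_lift_eq:
  assumes "x \<noteq> 0"
  shows "radial_lift f x = P x / (x \<bullet> x) ^ 6"
proof -
  have "radial_lift f x = P (x /\<^sub>R norm x)" unfolding radial_lift_def using assms by (intro lift) simp
  also have "\<dots> = P x / (norm x) ^ 12" by (simp add: hom power_inverse divide_inverse)
  also have "(norm x) ^ 12 = (x \<bullet> x) ^ 6" by (simp add: power2_norm_eq_inner[symmetric] power_mult[symmetric])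
  finally show ?thesis .
qed

lemma smooth: "smooth_M f"
  unfolding smooth_M_def smooth_on_def
proof
  fix k
  show "Ck_on k (- {0}) (radial_lift f)"
    by (rule Ck_on_cong[of _ "\<lambda>x. P x / (x \<bullet> x) ^ 6"])
       (use smooth_on_poly_over_norm[OF poly, of 6] radial_lift_eq in \<open>auto simp: smooth_on_def open_Compl\<close>)
qed

sublocale radial "radial_lift f" by (rule radial_radial_lift[OF smooth])

abbreviation "DP z \<equiv> frechet_derivative P (at z)"

lemma has_derivative_P: "(P has_derivative DP z) (at z)"
proof -
  obtain D where "(P has_derivative D) (at z)" using real_polynomial_function_derivative[OF poly] by blast
  then show ?thesis using frechet_derivative_at by blast
qed

lemma DU_eq:
  assumes z: "z \<noteq> 0"
  shows "DU z v = (DP z v * (z \<bullet> z) - 12 * P z * (z \<bullet> v)) / (z \<bullet> z) ^ 7"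
proof -
  have a: "((\<lambda>x::complex^2. x \<bullet> x) has_derivative (\<lambda>v. 2 * (z \<bullet> v))) (at z)"
    by (auto intro!: derivative_eq_intros simp: inner_commute)
  have zz: "z \<bullet> z \<noteq> 0" using z by simp
  have "((\<lambda>x. P x / (x \<bullet> x) ^ 6) has_derivative
    (\<lambda>v. - P z * (inverse ((z \<bullet> z) ^ 6) * (real 6 * (2 * (z \<bullet> v)) * (z \<bullet> z) ^ (6 - 1)) * inverse ((z \<bullet> z) ^ 6)) + DP z v / (z \<bullet> z) ^ 6)) (at z)"
    using zz by (intro has_derivative_divide has_derivative_P has_derivative_power a) auto
  then have "(radial_lift f has_derivative
    (\<lambda>v. - P z * (inverse ((z \<bullet> z) ^ 6) * (real 6 * (2 * (z \<bullet> v)) * (z \<bullet> z) ^ (6 - 1)) * inverse ((z \<bullet> z) ^ 6)) + DP z v / (z \<bullet> z) ^ 6)) (at z)"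
    by (rule has_derivative_transform_within_open[OF _ open_S]) (use z radial_lift_eq in auto)
  then have "DU z v = - P z * (inverse ((z \<bullet> z) ^ 6) * (real 6 * (2 * (z \<bullet> v)) * (z \<bullet> z) ^ (6 - 1)) * inverse ((z \<bullet> z) ^ 6)) + DP z v / (z \<bullet> z) ^ 6"
    using fun_cong[OF frechet_derivative_at, symmetric] by blast
  also have "\<dots> = (DP z v * (z \<bullet> z) - 12 * P z * (z \<bullet> v)) / (z \<bullet> z) ^ 7"
    using zz by (simp add: field_simps eval_nat_numeral)
  finally show ?thesis .
qed

lemma lifted_critical_P:
  "z \<in> lifted_critical f \<longleftrightarrow> z \<in> S3 \<and> DP z (cscale \<i> z) = 0 \<and> (\<forall>\<kappa>. DP z (hat \<kappa> z) = 0)"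
proof -
  have tan: "DU z v = DP z v" if "z \<in> S3" "v \<in> tangent z" for v
  proof -
    have "z \<noteq> 0" "z \<bullet> z = 1" "z \<bullet> v = 0" using that by (auto simp: tangent_def inner_commute dot_square_norm)
    then show ?thesis by (simp add: DU_eq)
  qed
  have t: "cscale \<i> z \<in> tangent z" "hat \<kappa> z \<in> tangent z" for \<kappa> using frame_tangent by (auto simp: tangent_def)
  have lin: "linear (DP z)" using has_derivative_P has_derivative_linear by blast
  have "DP z v = 0" if h: "z \<in> S3" "DP z (cscale \<i> z) = 0" "\<forall>\<kappa>. DP z (hat \<kappa> z) = 0" "v \<in> tangent z" for v
  proof -
    obtain \<theta> \<kappa> where "v = \<theta> *\<^sub>R cscale \<i> z + hat \<kappa> z" by (rule tangent_frame[OF h(1,4)])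
    then show ?thesis using h by (simp add: linear_add[OF lin] linear_scale[OF lin])
  qed
  then show ?thesis unfolding lifted_critical_def using tan t by auto
qed

text \<open>Tests nondegeneracy without computing the Hessian. For a linear field \<open>W\<close>
  tangent to all spheres, the derivative of \<open>DU y (W y)\<close> at a critical point in
  direction \<open>v\<close> is \<open>H z v (W z)\<close>, as the other term contains
  \<open>DU z\<close>; and along \<open>W\<close> the derivatives of the lift and of
  \<open>P\<close> differ by a power of the norm only.\<close>

lemma field_derivative_zero:
  assumes z: "z \<in> lifted_critical f" and W: "linear W" "\<And>y. W y \<bullet> y = 0"
    and v: "v \<in> tangent z" "\<And>w. w \<in> tangent z \<Longrightarrow> second_deriv (radial_lift f) z v w = 0"
    and q: "((\<lambda>y. DP y (W y)) has_derivative q) (at z)"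
  shows "q v = 0"
proof -
  have zS: "z \<in> S3" "z \<in> - {0}" "z \<bullet> z = 1" using z by (auto simp: lifted_critical_def dot_square_norm)
  \<comment> \<open>The radial direction is covered by Euler's relation for
    \<open>P\<close>.\<close>
  have DUz: "DU z w = 0" for w
  proof -
    define c where "c = w \<bullet> z"
    have t: "w - c *\<^sub>R z \<in> tangent z" using zS by (simp add: tangent_def inner_diff_left c_def)
    have "DU z z = 0"
    proof -
      have DPz: "DP z z = 12 * P z"
      proof -
        have "((\<lambda>t. P (z + t *\<^sub>R z)) has_derivative (\<lambda>t. DP z (t *\<^sub>R z))) (at 0)"
          by (rule has_derivative_compose[of "\<lambda>t. z + t *\<^sub>R z" "\<lambda>t. t *\<^sub>R z"])
             (auto intro!: derivative_eq_intros simp: has_derivative_P)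
        moreover have "(\<lambda>t. P (z + t *\<^sub>R z)) = (\<lambda>t. (1 + t) ^ 12 * P z)"
          using hom[of "1 + _" z] by (simp add: scaleR_add_left)
        ultimately have "((\<lambda>t. (1 + t) ^ 12 * P z) has_derivative (\<lambda>t. DP z (t *\<^sub>R z))) (at (0::real))" by simp
        moreover have "((\<lambda>t. (1 + t) ^ 12 * P z) has_derivative (\<lambda>t. t * (12 * P z))) (at (0::real))"
          by (auto intro!: derivative_eq_intros)
        ultimately have "(\<lambda>t. DP z (t *\<^sub>R z)) = (\<lambda>t. t * (12 * P z))" by (rule has_derivative_unique)
        from fun_cong[OF this, of 1] show ?thesis by simp
      qed
      show ?thesis using zS by (simp add: DU_eq DPz)
    qed
    moreover have "DU z (w - c *\<^sub>R z) = 0" using z t by (simp add: lifted_critical_def)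
    ultimately show ?thesis
      using linear_diff[OF linear_DU[OF zS(2)], of w "c *\<^sub>R z"] linear_scale[OF linear_DU[OF zS(2)], of c z] by simp
  qed
  have "((\<lambda>y. \<Sum>b\<in>Basis. (W y \<bullet> b) * DU y b) has_derivative
    (\<lambda>v. \<Sum>b\<in>Basis. (W z \<bullet> b) * H z v b + (W v \<bullet> b) * DU z b)) (at z)"
    by (intro has_derivative_sum has_derivative_mult has_derivative_DU zS
        has_derivative_inner_left linear_imp_has_derivative W)
  moreover have "(\<Sum>b\<in>Basis. (W y \<bullet> b) * DU y b) = DU y (W y)" if "y \<in> - {0}" for y
    using linear_sum[OF linear_DU[OF that], of "\<lambda>b. (W y \<bullet> b) *\<^sub>R b" Basis]
    by (simp add: euclidean_representation linear_scale[OF linear_DU[OF that]])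
  moreover have "DU y (W y) = DP y (W y) / (y \<bullet> y) ^ 6" if "y \<in> - {0}" for y
  proof -
    have "y \<bullet> W y = 0" using W(2)[of y] by (simp add: inner_commute)
    then show ?thesis using that by (simp add: DU_eq field_simps eval_nat_numeral)
  qed
  ultimately have 1: "((\<lambda>y. DP y (W y) / (y \<bullet> y) ^ 6) has_derivative
    (\<lambda>v. \<Sum>b\<in>Basis. (W z \<bullet> b) * H z v b + (W v \<bullet> b) * DU z b)) (at z)"
    by (elim has_derivative_transform_within_open[OF _ open_S zS(2)]) simp
  have a: "((\<lambda>x::complex^2. x \<bullet> x) has_derivative (\<lambda>v. 2 * (z \<bullet> v))) (at z)"
    by (auto intro!: derivative_eq_intros simp: inner_commute)
  have Wt: "W z \<in> tangent z" using W by (simp add: tangent_def)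
  have q0: "DP z (W z) = 0"
    using DUz[of "W z"] zS Wt by (simp add: DU_eq tangent_def inner_commute)
  have "((\<lambda>y. DP y (W y) / (y \<bullet> y) ^ 6) has_derivative
    (\<lambda>v. - DP z (W z) * (inverse ((z \<bullet> z) ^ 6) * (real 6 * (2 * (z \<bullet> v)) * (z \<bullet> z) ^ (6 - 1)) * inverse ((z \<bullet> z) ^ 6)) + q v / (z \<bullet> z) ^ 6)) (at z)"
    using zS by (intro has_derivative_divide has_derivative_power a q) auto
  then have 2: "((\<lambda>y. DP y (W y) / (y \<bullet> y) ^ 6) has_derivative q) (at z)" by (simp add: q0 zS)
  have "q v = (\<Sum>b\<in>Basis. (W z \<bullet> b) * H z v b + (W v \<bullet> b) * DU z b)"
    using fun_cong[OF has_derivative_unique[OF 2 1], of v] .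
  also have "\<dots> = (\<Sum>b\<in>Basis. (W z \<bullet> b) * H z v b)" by (simp add: DUz)
  also have "\<dots> = H z v (W z)"
    using linear_sum[OF linear_H2[OF zS(2)], of v "\<lambda>b. (W z \<bullet> b) *\<^sub>R b" Basis]
    by (simp add: euclidean_representation linear_scale[OF linear_H2[OF zS(2)]])
  finally show ?thesis using v(2)[OF Wt] by simp
qed

text \<open>\<open>168 = 12 * (12 + 2)\<close> is the eigenvalue of the 3-sphere on harmonic
  polynomials of degree 12.\<close>

lemma laplacian_radial_lift:
  assumes z: "z \<in> S3"
  shows "laplacian (radial_lift f) z = laplacian P z - 168 * P z"
proof -
  have zS: "z \<in> - {0}" "z \<bullet> z = 1" using z by (auto simp: dot_square_norm)
  have DD: "((\<lambda>y. DP y w) has_derivative (\<lambda>v. second_deriv P z v w)) (at z)" for w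
  proof -
    obtain D where D: "\<And>x. (P has_derivative D x) (at x)" "\<And>v. real_polynomial_function (\<lambda>x. D x v)"
      using real_polynomial_function_derivative[OF poly] by blast
    have e: "DP x = D x" for x by (rule frechet_derivative_at[OF D(1), symmetric])
    obtain E where E: "((\<lambda>y. D y w) has_derivative E) (at z)"
      using real_polynomial_function_derivative[OF D(2)[of w]] by blast
    then have "E = frechet_derivative (\<lambda>y. D y w) (at z)" by (rule frechet_derivative_at)
    then show ?thesis unfolding second_deriv_def e using E by simp
  qed
  have a: "((\<lambda>x::complex^2. x \<bullet> x) has_derivative (\<lambda>v. 2 * (z \<bullet> v))) (at z)"
    by (auto intro!: derivative_eq_intros simp: inner_commute)
  have Hb: "H z b b = second_deriv P z b b - 24 * (z \<bullet> b) * DP z b - 12 * P z * (b \<bullet> b) + 168 * P z * (z \<bullet> b)\<^sup>2" for b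
  proof -
    have "((\<lambda>y. (DP y b * (y \<bullet> y) - 12 * P y * (y \<bullet> b)) / (y \<bullet> y) ^ 7) has_derivative
      (\<lambda>v. - (DP z b * (z \<bullet> z) - 12 * P z * (z \<bullet> b)) * (inverse ((z \<bullet> z) ^ 7) * (real 7 * (2 * (z \<bullet> v)) * (z \<bullet> z) ^ (7 - 1)) * inverse ((z \<bullet> z) ^ 7))
        + ((DP z b * (2 * (z \<bullet> v)) + second_deriv P z v b * (z \<bullet> z)) - ((12 * P z) * (v \<bullet> b) + (12 * DP z v) * (z \<bullet> b))) / (z \<bullet> z) ^ 7)) (at z)"
      using zS by (intro has_derivative_divide has_derivative_power has_derivative_diff has_derivative_mult has_derivative_mult_right
          has_derivative_inner_left has_derivative_ident a DD has_derivative_P) auto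
    then have "((\<lambda>y. DU y b) has_derivative
      (\<lambda>v. - (DP z b * (z \<bullet> z) - 12 * P z * (z \<bullet> b)) * (inverse ((z \<bullet> z) ^ 7) * (real 7 * (2 * (z \<bullet> v)) * (z \<bullet> z) ^ (7 - 1)) * inverse ((z \<bullet> z) ^ 7))
        + ((DP z b * (2 * (z \<bullet> v)) + second_deriv P z v b * (z \<bullet> z)) - ((12 * P z) * (v \<bullet> b) + (12 * DP z v) * (z \<bullet> b))) / (z \<bullet> z) ^ 7)) (at z)"
      by (rule has_derivative_transform_within_open[OF _ open_S zS(1)]) (simp add: DU_eq)
    from fun_cong[OF has_derivative_unique[OF has_derivative_DU[OF zS(1)] this], of b]
    show ?thesis by (simp add: zS algebra_simps power2_eq_square)
  qed
  have lin: "linear (DP z)" using has_derivative_P has_derivative_linear by blast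
  have s1: "(\<Sum>b\<in>Basis. (z \<bullet> b) * DP z b) = DP z z"
    using linear_sum[OF lin, of "\<lambda>b. (z \<bullet> b) *\<^sub>R b" Basis]
    by (simp add: euclidean_representation linear_scale[OF lin])
  have s2: "(\<Sum>b\<in>Basis. (z \<bullet> b)\<^sup>2) = 1"
    using euclidean_inner[of z z] zS by (simp add: power2_eq_square)
  have DPz: "DP z z = 12 * P z"
  proof -
    have "((\<lambda>t. P (z + t *\<^sub>R z)) has_derivative (\<lambda>t. DP z (t *\<^sub>R z))) (at 0)"
      by (rule has_derivative_compose[of "\<lambda>t. z + t *\<^sub>R z" "\<lambda>t. t *\<^sub>R z"])
         (auto intro!: derivative_eq_intros simp: has_derivative_P)
    moreover have "(\<lambda>t. P (z + t *\<^sub>R z)) = (\<lambda>t. (1 + t) ^ 12 * P z)"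
      using hom[of "1 + _" z] by (simp add: scaleR_add_left)
    ultimately have "((\<lambda>t. (1 + t) ^ 12 * P z) has_derivative (\<lambda>t. DP z (t *\<^sub>R z))) (at (0::real))" by simp
    moreover have "((\<lambda>t. (1 + t) ^ 12 * P z) has_derivative (\<lambda>t. t * (12 * P z))) (at (0::real))"
      by (auto intro!: derivative_eq_intros)
    ultimately have "(\<lambda>t. DP z (t *\<^sub>R z)) = (\<lambda>t. t * (12 * P z))" by (rule has_derivative_unique)
    from fun_cong[OF this, of 1] show ?thesis by simp
  qed
  have "laplacian (radial_lift f) z = laplacian P z - 24 * (\<Sum>b\<in>Basis. (z \<bullet> b) * DP z b)
     - (\<Sum>b\<in>(Basis::(complex^2) set). 12 * P z * (b \<bullet> b)) + 168 * P z * (\<Sum>b\<in>Basis. (z \<bullet> b)\<^sup>2)"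
    unfolding laplacian_def Hb by (simp add: sum.distrib sum_subtractf sum_distrib_left mult.assoc)
  also have "(\<Sum>b\<in>(Basis::(complex^2) set). 12 * P z * (b \<bullet> b)) = (\<Sum>b\<in>(Basis::(complex^2) set). 12 * P z)"
    by (rule sum.cong) (auto simp: inner_Basis)
  also have "\<dots> = 48 * P z" by simp
  finally show ?thesis unfolding s1 s2 DPz by simp
qed

end

section \<open>Perturbing the seed\<close>

definition family :: "real \<Rightarrow> real \<Rightarrow> real \<Rightarrow> real \<Rightarrow> complex^2 \<Rightarrow> real" where
  "family c e2 e3 e5 z = c * Re (A_fun 6 z) + e2 * Re (A_fun 4 z) + e3 * Re (A_fun 3 z) + e5 * Re (A_fun 1 z)"

lemma rpf_A_fun: "real_polynomial_function (\<lambda>z. Re (A_fun j z))"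
  using cpoly_A_fun[of j] by (simp add: cpoly_def)

lemma family_poly: "real_polynomial_function (family c e2 e3 e5)"
  unfolding family_def by (intro real_polynomial_function.intros(2-4) rpf_A_fun)

lemma family_hom: "family c e2 e3 e5 (r *\<^sub>R z) = r ^ 12 * family c e2 e3 e5 z"
proof -
  have "Re (A_fun j (r *\<^sub>R z)) = r ^ 12 * Re (A_fun j z)" if "j \<le> 12" for j
    unfolding A_fun_scaleR[OF that] of_real_power[symmetric] by simp
  then show ?thesis unfolding family_def by (simp add: algebra_simps)
qed

lemma family_derivative:
  "frechet_derivative (family c e2 e3 e5) (at z) v =
     c * Re (DA 6 z v) + e2 * Re (DA 4 z v) + e3 * Re (DA 3 z v) + e5 * Re (DA 1 z v)"
proof -
  have "(family c e2 e3 e5 has_derivative (\<lambda>v. c * Re (DA 6 z v) + e2 * Re (DA 4 z v) + e3 * Re (DA 3 z v) + e5 * Re (DA 1 z v))) (at z)"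
    unfolding family_def
    by (intro has_derivative_add has_derivative_mult_right has_derivative_Re DA)
  from fun_cong[OF frechet_derivative_at[OF this], of v] show ?thesis by simp
qed

lemma family_laplacian: "laplacian (family c e2 e3 e5) z = 0"
proof -
  have DD: "((\<lambda>y. Re (DA j y w)) has_derivative (\<lambda>v. second_deriv (\<lambda>z. Re (A_fun j z)) z v w)) (at z)" for j w
  proof -
    have e: "frechet_derivative (\<lambda>z. Re (A_fun j z)) (at y) w = Re (DA j y w)" for y
      by (rule frechet_derivative_at[OF has_derivative_Re[OF DA(1)], THEN fun_cong, symmetric])
    have "((\<lambda>y. Re (DA j y w)) has_derivative frechet_derivative (\<lambda>y. Re (DA j y w)) (at z)) (at z)"
      using has_derivative_Re[OF cpoly_frechet(1)[OF DA(2)[of j w], of z]] frechet_derivative_at by metis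
    then show ?thesis unfolding second_deriv_def e .
  qed
  have "second_deriv (family c e2 e3 e5) z b b = c * second_deriv (\<lambda>z. Re (A_fun 6 z)) z b b + e2 * second_deriv (\<lambda>z. Re (A_fun 4 z)) z b b
     + e3 * second_deriv (\<lambda>z. Re (A_fun 3 z)) z b b + e5 * second_deriv (\<lambda>z. Re (A_fun 1 z)) z b b" for b
  proof -
    have "((\<lambda>y. c * Re (DA 6 y b) + e2 * Re (DA 4 y b) + e3 * Re (DA 3 y b) + e5 * Re (DA 1 y b)) has_derivative
      (\<lambda>v. c * second_deriv (\<lambda>z. Re (A_fun 6 z)) z v b + e2 * second_deriv (\<lambda>z. Re (A_fun 4 z)) z v b
     + e3 * second_deriv (\<lambda>z. Re (A_fun 3 z)) z v b + e5 * second_deriv (\<lambda>z. Re (A_fun 1 z)) z v b)) (at z)"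
      by (intro has_derivative_add has_derivative_mult_right DD)
    from fun_cong[OF frechet_derivative_at[OF this], of b] show ?thesis
      unfolding second_deriv_def[of "family c e2 e3 e5"] family_derivative by simp
  qed
  then have "laplacian (family c e2 e3 e5) z = c * laplacian (\<lambda>z. Re (A_fun 6 z)) z + e2 * laplacian (\<lambda>z. Re (A_fun 4 z)) z
     + e3 * laplacian (\<lambda>z. Re (A_fun 3 z)) z + e5 * laplacian (\<lambda>z. Re (A_fun 1 z)) z"
    unfolding laplacian_def by (simp add: sum.distrib sum_distrib_left)
  then show ?thesis by (simp add: laplacian_A_fun)
qed

lemma polynomial_lift_family:
  assumes "\<And>z. z \<in> S3 \<Longrightarrow> f (proj z) = family c e2 e3 e5 z"
  shows "polynomial_lift (family c e2 e3 e5) f"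
  using assms by unfold_locales (simp_all add: family_poly family_hom)

lemma family_E168:
  assumes "\<And>z. z \<in> S3 \<Longrightarrow> f (proj z) = family c e2 e3 e5 z"
  shows "f \<in> E168"
proof -
  interpret polynomial_lift "family c e2 e3 e5" f by (rule polynomial_lift_family[OF assms])
  show ?thesis unfolding eigenspace_def
    using smooth laplacian_radial_lift lift by (auto simp: family_laplacian)
qed

section \<open>Gradient of the perturbed seed in the tangent frame\<close>

text \<open>The three brackets belong to \<open>A_4\<close>, \<open>A_3\<close> and
  \<open>A_1\<close>. A complex number stands for the horizontal gradient: the derivative of the sum
  of the real parts along \<open>hat \<kappa> z\<close> is
  \<open>Re (cnj \<kappa> * gradA z)\<close>.\<close>

definition gradA :: "complex^2 \<Rightarrow> complex" where
  "gradA z = (5 * cnj (A_fun 5 z) - 9 * A_fun 3 z) + (4 * cnj (A_fun 4 z) - 10 * A_fun 2 z) + (2 * cnj (A_fun 2 z) - 12 * A_fun 0 z)"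

text \<open>The factors 4, 6, 10 are the weights \<open>12 - 2 j\<close> along the fibre.\<close>

definition vert :: "complex^2 \<Rightarrow> real" where
  "vert z = 4 * Im (A_fun 4 z) + 6 * Im (A_fun 3 z) + 10 * Im (A_fun 1 z)"

definition horiz :: "real \<Rightarrow> real \<Rightarrow> complex^2 \<Rightarrow> complex" where
  "horiz c t z = of_real (- 14 * c) * A_fun 5 z + of_real t * gradA z"

lemma DA_frame:
  "DA 6 z (hat \<kappa> z) = \<kappa> * 7 * A_fun 7 z - cnj \<kappa> * 7 * A_fun 5 z"
  "DA 5 z (hat \<kappa> z) = \<kappa> * 6 * A_fun 6 z - cnj \<kappa> * 8 * A_fun 4 z"
  "DA 4 z (hat \<kappa> z) = \<kappa> * 5 * A_fun 5 z - cnj \<kappa> * 9 * A_fun 3 z"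
  "DA 3 z (hat \<kappa> z) = \<kappa> * 4 * A_fun 4 z - cnj \<kappa> * 10 * A_fun 2 z"
  "DA 1 z (hat \<kappa> z) = \<kappa> * 2 * A_fun 2 z - cnj \<kappa> * 12 * A_fun 0 z"
  using DA_hat[of 5 z \<kappa>] DA_hat[of 4 z \<kappa>] DA_hat[of 3 z \<kappa>] DA_hat[of 2 z \<kappa>] DA_hat[of 0 z \<kappa>]
  by (simp_all add: eval_nat_numeral)

lemma family_along_hat:
  "frechet_derivative (family c t t t) (at z) (hat \<kappa> z) = Re (cnj \<kappa> * horiz c t z)"
  unfolding family_derivative DA_frame horiz_def gradA_def A_fun_6_7(1)
  by (simp add: algebra_simps)

lemma family_along_fibre:
  "frechet_derivative (family c t t t) (at z) (cscale \<i> z) = - t * vert z"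
  unfolding family_derivative using DA_cscale(1)[of 6 z] DA_cscale(1)[of 4 z] DA_cscale(1)[of 3 z] DA_cscale(1)[of 1 z]
  by (simp add: vert_def algebra_simps)

text \<open>The limit of the critical points of \<open>family c t t t\<close> as \<open>t\<close> tends to 0: the derivative along the
  fibres carries a factor \<open>t\<close>, which is divided out.\<close>
definition crit0 :: "(complex^2) set" where
  "crit0 = {z\<in>S3. A_fun 5 z = 0 \<and> vert z = 0}"

lemma crit0_rotation: "B \<in> I_star \<Longrightarrow> B *v z \<in> crit0 \<longleftrightarrow> z \<in> crit0"
  using rotation_isometry(1)[of B z] by (simp add: crit0_def vert_def A_fun_invariant)

text \<open>On the fibre of \<open>z0\<close> one term of \<open>vert\<close> survives, and it
  equals \<open>n * Im (\<omega> ^ n * a)\<close>. It vanishes when \<open>\<omega> ^ n * a\<close>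
  is \<open>cmod a\<close> or its negative, that is on two cosets of the \<open>n\<close>-th roots
  of unity. Each coset lies in a single orbit because these roots belong to
  \<open>stab z0\<close>.\<close>

lemma base_reps:
  assumes b: "base z0 j n"
  obtains w1 w2 where "\<And>z. z \<in> crit0 \<Longrightarrow> rel z z0 \<Longrightarrow> \<exists>B\<in>I_star. z = B *v w1 \<or> z = B *v w2"
proof -
  define a where "a = A_fun j z0"
  have a: "a \<noteq> 0" and n: "2 * j + n = 12" and j: "j \<in> {1, 3, 4}"
    and zero: "\<And>i. i \<in> {1, 3, 4, 5} - {j} \<Longrightarrow> A_fun i z0 = 0" and st: "\<And>\<zeta>. \<zeta> ^ n = 1 \<Longrightarrow> \<zeta> \<in> stab z0"
    using b by (auto simp: base_def a_def)
  have n0: "n > 0" using n j by auto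
  \<comment> \<open>The phases \<open>\<omega>1\<close> and \<open>\<omega>2\<close> make the
    surviving term positive and negative real, respectively.\<close>
  define \<omega>1 where "\<omega>1 = cis (- Arg a / n)"
  define \<omega>2 where "\<omega>2 = \<omega>1 * cis (pi / n)"
  have w1: "\<omega>1 ^ n * a = complex_of_real (cmod a)"
  proof -
    have "\<omega>1 ^ n = cis (- Arg a)" unfolding \<omega>1_def Complex.DeMoivre using n0 by simp
    moreover have "a = complex_of_real (cmod a) * cis (Arg a)" using rcis_cmod_Arg[of a] by (simp add: rcis_def)
    ultimately have "\<omega>1 ^ n * a = complex_of_real (cmod a) * (cis (- Arg a) * cis (Arg a))" by (metis mult.left_commute)
    then show ?thesis by (simp add: cis_mult)
  qed
  have w2: "\<omega>2 ^ n = - (\<omega>1 ^ n)"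
  proof -
    have "cis (pi / n) ^ n = cis pi" unfolding Complex.DeMoivre using n0 by simp
    then show ?thesis by (simp add: \<omega>2_def power_mult_distrib cis_pi)
  qed
  have nz: "\<omega>1 \<noteq> 0" "\<omega>2 \<noteq> 0" by (simp_all add: \<omega>1_def \<omega>2_def)
  show ?thesis
  proof (rule that[of "cscale \<omega>1 z0" "cscale \<omega>2 z0"])
    fix z assume z: "z \<in> crit0" "rel z z0"
    then obtain B \<omega> where B: "B \<in> I_star" "cmod \<omega> = 1" "z = B *v cscale \<omega> z0" by (auto simp: rel_def)
    have A: "A_fun i z = \<omega> ^ (12 - 2 * i) * A_fun i z0" if "i \<le> 6" for i
      unfolding B(3) A_fun_invariant[OF B(1)] using A_fun_phase[OF B(2), of i "12 - 2 * i" z0] that by simp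
    have "vert z = real n * Im (\<omega> ^ n * a)"
    proof -
      have jn: "(j = 1 \<and> n = 10) \<or> (j = 3 \<and> n = 6) \<or> (j = 4 \<and> n = 4)" using j n by auto
      then show ?thesis
      proof (elim disjE conjE)
        assume jn: "j = 1" "n = 10"
        then have "A_fun 3 z0 = 0" "A_fun 4 z0 = 0" using zero by auto
        then show ?thesis using A[of 1] A[of 3] A[of 4] jn by (simp add: vert_def a_def)
      next
        assume jn: "j = 3" "n = 6"
        then have "A_fun 1 z0 = 0" "A_fun 4 z0 = 0" using zero by auto
        then show ?thesis using A[of 1] A[of 3] A[of 4] jn by (simp add: vert_def a_def)
      next
        assume jn: "j = 4" "n = 4"
        then have "A_fun 1 z0 = 0" "A_fun 3 z0 = 0" using zero by auto
        then show ?thesis using A[of 1] A[of 3] A[of 4] jn by (simp add: vert_def a_def)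
      qed
    qed
    then have "Im (\<omega> ^ n * a) = 0" using z(1) n0 by (simp add: crit0_def)
    then have r: "\<omega> ^ n * a = complex_of_real (Re (\<omega> ^ n * a))" by (simp add: complex_eq_iff)
    have "cmod (\<omega> ^ n * a) = cmod a" using B(2) by (simp add: norm_mult norm_power)
    then have "\<bar>Re (\<omega> ^ n * a)\<bar> = cmod a" using r by (metis norm_of_real)
    then consider "Re (\<omega> ^ n * a) = cmod a" | "Re (\<omega> ^ n * a) = - cmod a" by linarith
    then have "\<omega> ^ n * a = \<omega>1 ^ n * a \<or> \<omega> ^ n * a = \<omega>2 ^ n * a"
    proof cases
      case 1
      then have "\<omega> ^ n * a = \<omega>1 ^ n * a" using r w1 by (simp only:)
      then show ?thesis ..
    next
      case 2
      have "\<omega> ^ n * a = complex_of_real (- cmod a)" using r 2 by (simp only:)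
      also have "\<dots> = \<omega>2 ^ n * a" using w1 w2 by simp
      finally show ?thesis ..
    qed
    then have "\<omega> ^ n = \<omega>1 ^ n \<or> \<omega> ^ n = \<omega>2 ^ n" using a by auto
    then have "\<exists>\<eta>\<in>{\<omega>1, \<omega>2}. (\<omega> / \<eta>) ^ n = 1" using nz by (auto simp: power_divide)
    then obtain \<eta> where \<eta>: "\<eta> \<in> {\<omega>1, \<omega>2}" "(\<omega> / \<eta>) ^ n = 1" by blast
    obtain C where C: "C \<in> I_star" "C *v z0 = cscale (\<omega> / \<eta>) z0" using st[OF \<eta>(2)] by (auto simp: stab_def)
    have "cscale \<omega> z0 = C *v cscale \<eta> z0"
      unfolding mult_cscale C(2) using \<eta>(1) nz by auto
    then have "z = (B ** C) *v cscale \<eta> z0" unfolding B(3) by (simp add: matrix_vector_mul_assoc)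
    then show "\<exists>B\<in>I_star. z = B *v cscale \<omega>1 z0 \<or> z = B *v cscale \<omega>2 z0"
      using I_star_mult[OF B(1) C(1)] \<eta>(1) by auto
  qed
qed

lemma crit0_reps:
  obtains Z where "finite Z" "card Z \<le> 6" "Z \<subseteq> crit0" "\<And>z. z \<in> crit0 \<Longrightarrow> \<exists>B\<in>I_star. \<exists>w\<in>Z. z = B *v w"
proof -
  obtain a1 a2 where a: "\<And>z. z \<in> crit0 \<Longrightarrow> rel z zN \<Longrightarrow> \<exists>B\<in>I_star. z = B *v a1 \<or> z = B *v a2" using base_reps[OF base_N] by blast
  obtain b1 b2 where b: "\<And>z. z \<in> crit0 \<Longrightarrow> rel z zE \<Longrightarrow> \<exists>B\<in>I_star. z = B *v b1 \<or> z = B *v b2" using base_reps[OF base_E] by blast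
  obtain c1 c2 where c: "\<And>z. z \<in> crit0 \<Longrightarrow> rel z zF \<Longrightarrow> \<exists>B\<in>I_star. z = B *v c1 \<or> z = B *v c2" using base_reps[OF base_F] by blast
  define Z0 where "Z0 = set [a1, a2, b1, b2, c1, c2]"
  have "card Z0 \<le> 6" unfolding Z0_def using card_length[of "[a1, a2, b1, b2, c1, c2]"] by simp
  moreover have "finite Z0" by (simp add: Z0_def)
  ultimately have "finite (Z0 \<inter> crit0)" "card (Z0 \<inter> crit0) \<le> 6"
    by (auto intro: order_trans[OF card_mono])
  moreover have "\<exists>B\<in>I_star. \<exists>w\<in>Z0 \<inter> crit0. z = B *v w" if z: "z \<in> crit0" for z
  proof -
    have "rel z zN \<or> rel z zE \<or> rel z zF" using zeros_of_A_fun_5 z by (auto simp: crit0_def)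
    then obtain B w where "B \<in> I_star" "w \<in> Z0" "z = B *v w" using a[OF z] b[OF z] c[OF z] by (auto simp: Z0_def)
    then show ?thesis using z crit0_rotation by blast
  qed
  ultimately show ?thesis using that[of "Z0 \<inter> crit0"] by blast
qed

text \<open>By the first inequality the derivative of \<open>A_5\<close> along
  \<open>hat \<kappa> z\<close> vanishes only for \<open>\<kappa> = 0\<close>. The second concerns
  the derivative of \<open>vert\<close> along the fibre, whence the squared weights: one of the
  three terms is nonzero, and it is real since \<open>vert z = 0\<close>.\<close>

lemma crit0_nondegenerate:
  assumes z: "z \<in> crit0"
  shows "6 * cmod (A_fun 6 z) \<noteq> 8 * cmod (A_fun 4 z)"
    "Re (16 * A_fun 4 z + 36 * A_fun 3 z + 100 * A_fun 1 z) \<noteq> 0"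
proof -
  have zS: "z \<in> S3" "A_fun 5 z = 0" using z by (auto simp: crit0_def)
  obtain z0 j n where b: "base z0 j n" "rel z z0" using base_exists[OF zS] by blast
  then obtain B \<omega> where B: "B \<in> I_star" "cmod \<omega> = 1" "z = B *v cscale \<omega> z0" by (auto simp: rel_def)
  have A: "A_fun i z = \<omega> ^ (12 - 2 * i) * A_fun i z0" if "i \<le> 6" for i
    unfolding B(3) A_fun_invariant[OF B(1)] using A_fun_phase[OF B(2), of i "12 - 2 * i" z0] that by simp
  then have "cmod (A_fun i z) = cmod (A_fun i z0)" if "i \<le> 6" for i
    using that B(2) by (simp add: norm_mult norm_power)
  then show "6 * cmod (A_fun 6 z) \<noteq> 8 * cmod (A_fun 4 z)" using b(1) by (simp add: base_def)
  have nz: "A_fun j z \<noteq> 0" "j \<in> {1, 3, 4}" "\<And>i. i \<in> {1, 3, 4} - {j} \<Longrightarrow> A_fun i z = 0"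
    using b(1) A B(2) by (auto simp: base_def)
  have v: "vert z = 0" using z by (simp add: crit0_def)
  have j: "j = 1 \<or> j = 3 \<or> j = 4" using nz(2) by auto
  show "Re (16 * A_fun 4 z + 36 * A_fun 3 z + 100 * A_fun 1 z) \<noteq> 0"
    using j
  proof (elim disjE)
    assume "j = 1"
    then show ?thesis using nz v by (auto simp: vert_def complex_eq_iff)
  next
    assume "j = 3"
    then show ?thesis using nz v by (auto simp: vert_def complex_eq_iff)
  next
    assume "j = 4"
    then show ?thesis using nz v by (auto simp: vert_def complex_eq_iff)
  qed
qed

text \<open>Keeping \<open>t\<close> as a variable makes the neighbourhoods of injectivity uniform in \<open>t\<close>; the last
  component makes the map one between spaces of equal dimension, whose level 1 is the sphere.\<close>
definition Phi :: "real \<Rightarrow> real \<times> (complex^2) \<Rightarrow> real \<times> complex \<times> real \<times> real" where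
  "Phi c x = (fst x, horiz c (fst x) (snd x), vert (snd x), snd x \<bullet> snd x)"

definition DgradA where
  "DgradA z v = (5 * cnj (DA 5 z v) - 9 * DA 3 z v) + (4 * cnj (DA 4 z v) - 10 * DA 2 z v) + (2 * cnj (DA 2 z v) - 12 * DA 0 z v)"

definition Dvert where "Dvert z v = 4 * Im (DA 4 z v) + 6 * Im (DA 3 z v) + 10 * Im (DA 1 z v)"

definition DPhi :: "real \<Rightarrow> real \<times> (complex^2) \<Rightarrow> real \<times> (complex^2) \<Rightarrow> real \<times> complex \<times> real \<times> real" where
  "DPhi c x v = (fst v, of_real (- 14 * c) * DA 5 (snd x) (snd v) + (of_real (fst x) * DgradA (snd x) (snd v) + of_real (fst v) * gradA (snd x)),
     Dvert (snd x) (snd v), 2 * (snd x \<bullet> snd v))"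

lemma DgradA: "(gradA has_derivative DgradA z) (at z)" "(vert has_derivative Dvert z) (at z)"
proof -
  show "(gradA has_derivative DgradA z) (at z)"
    unfolding gradA_def DgradA_def
    by (intro has_derivative_add has_derivative_diff has_derivative_mult_right has_derivative_cnj DA)
  show "(vert has_derivative Dvert z) (at z)"
    unfolding vert_def Dvert_def
    by (intro has_derivative_add has_derivative_mult_right has_derivative_Im DA)
qed

lemma DPhi: "(Phi c has_derivative DPhi c x) (at x)"
proof -
  have s: "((\<lambda>x. f (snd x)) has_derivative (\<lambda>v. f' (snd v))) (at x)"
    if "(f has_derivative f') (at (snd x))" for f :: "complex^2 \<Rightarrow> 'b::real_normed_vector" and f' and x :: "real \<times> (complex^2)"
    using has_derivative_compose[OF has_derivative_snd[OF has_derivative_ident] that] .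
  have a: "((\<lambda>z::complex^2. z \<bullet> z) has_derivative (\<lambda>v. 2 * (z \<bullet> v))) (at z)" for z
    by (auto intro!: derivative_eq_intros simp: inner_commute)
  show ?thesis unfolding Phi_def DPhi_def horiz_def
    by (intro has_derivative_Pair has_derivative_add has_derivative_mult has_derivative_mult_right
        has_derivative_of_real has_derivative_fst has_derivative_ident s DA DgradA a)
qed

lemma DPhi_continuous: "isCont (\<lambda>x. DPhi c x b) a"
proof -
  have s: "continuous_on UNIV (\<lambda>x. f (snd x))" if "continuous_on UNIV f" for f :: "complex^2 \<Rightarrow> 'b::topological_space"
    using continuous_on_compose2[OF that continuous_on_snd[OF continuous_on_id]] by simp
  note c = cpoly_continuous[OF DA(2)] cpoly_continuous[OF cpoly_A_fun]
  have "continuous_on UNIV (\<lambda>x. DPhi c x b)"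
    unfolding DPhi_def DgradA_def Dvert_def gradA_def
    by (intro continuous_intros s c)
  then show ?thesis using continuous_on_eq_continuous_at[OF open_UNIV] by blast
qed

lemma DPhi_injective:
  assumes c: "c \<noteq> 0" and z: "z \<in> crit0" and v: "DPhi c (0, z) v = 0"
  shows "v = 0"
proof -
  have zS: "z \<in> S3" "A_fun 5 z = 0" using z by (auto simp: crit0_def)
  have v1: "fst v = 0" and v2: "DA 5 z (snd v) = 0" and v3: "Dvert z (snd v) = 0" and v4: "z \<bullet> snd v = 0"
    using v c by (auto simp: DPhi_def zero_prod_def)
  have "snd v \<in> tangent z" using v4 by (simp add: tangent_def inner_commute)
  then obtain \<theta> \<kappa> where e: "snd v = \<theta> *\<^sub>R cscale \<i> z + hat \<kappa> z" using tangent_frame[OF zS(1)] by blast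
  have lin: "linear (DA j z)" for j using DA(1) has_derivative_linear by blast
  have "\<kappa> * 6 * A_fun 6 z = cnj \<kappa> * 8 * A_fun 4 z"
    using v2 DA_cscale(1)[of 5 z] unfolding e linear_add[OF lin] linear_scale[OF lin] DA_frame by (simp add: zS)
  then have "cmod (\<kappa> * 6 * A_fun 6 z) = cmod (cnj \<kappa> * 8 * A_fun 4 z)" by (rule arg_cong)
  then have "cmod \<kappa> * (6 * cmod (A_fun 6 z)) = cmod \<kappa> * (8 * cmod (A_fun 4 z))" by (simp add: norm_mult)
  then have k: "\<kappa> = 0" using crit0_nondegenerate(1)[OF z] by simp
  then have e': "snd v = \<theta> *\<^sub>R cscale \<i> z"
    using e by (simp add: vec_eq_iff forall_2)
  have "Dvert z (snd v) = \<theta> * Re (16 * A_fun 4 z + 36 * A_fun 3 z + 100 * A_fun 1 z)"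
    using DA_cscale(1)[of 4 z] DA_cscale(1)[of 3 z] DA_cscale(1)[of 1 z]
    unfolding Dvert_def e' linear_scale[OF lin] by (simp add: algebra_simps)
  then have "\<theta> = 0" using v3 crit0_nondegenerate(2)[OF z] by simp
  then show ?thesis using v1 e' by (simp add: prod_eq_iff)
qed

text \<open>Compactness of the sphere: critical points for parameters tending to 0 accumulate
  somewhere, and by continuity in \<open>crit0\<close>. The radii may depend on the point in any
  way.\<close>

lemma near_crit0:
  assumes c: "c \<noteq> 0" and r: "\<And>z. z \<in> crit0 \<Longrightarrow> r z > 0"
  shows "\<exists>T>0. \<forall>t z. 0 < t \<longrightarrow> t < T \<longrightarrow> z \<in> S3 \<longrightarrow> horiz c t z = 0 \<longrightarrow> vert z = 0 \<longrightarrow>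
    (\<exists>w\<in>crit0. (t, z) \<in> ball (0, w) (r w))"
proof (rule ccontr)
  assume n: "\<not> ?thesis"
  have "\<exists>t z. 0 < t \<and> t < inverse (real (Suc n)) \<and> z \<in> S3 \<and> horiz c t z = 0 \<and> vert z = 0 \<and>
    (\<forall>w\<in>crit0. (t, z) \<notin> ball (0, w) (r w))" for n
  proof -
    have "inverse (real (Suc n)) > 0" by simp
    then show ?thesis using n by meson
  qed
  then obtain t z where tz: "\<And>n. 0 < t n" "\<And>n. t n < inverse (real (Suc n))" "\<And>n. z n \<in> S3"
    "\<And>n. horiz c (t n) (z n) = 0" "\<And>n. vert (z n) = 0" "\<And>n w. w \<in> crit0 \<Longrightarrow> (t n, z n) \<notin> ball (0, w) (r w)" by metis
  obtain w \<sigma> where w: "w \<in> S3" "strict_mono (\<sigma>::nat \<Rightarrow> nat)" "(z \<circ> \<sigma>) \<longlonglongrightarrow> w"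
    using compact_sphere[of "0::complex^2" 1] tz(3) unfolding compact_def by blast
  have "t \<longlonglongrightarrow> 0"
    by (rule tendsto_sandwich[OF _ _ tendsto_const LIMSEQ_inverse_real_of_nat]) (use tz(1,2) in \<open>auto intro!: eventuallyI less_imp_le\<close>)
  then have t0: "(t \<circ> \<sigma>) \<longlonglongrightarrow> 0" using w(2) LIMSEQ_subseq_LIMSEQ by blast
  have A: "(\<lambda>n. A_fun j ((z \<circ> \<sigma>) n)) \<longlonglongrightarrow> A_fun j w" for j
    using cpoly_continuous[OF cpoly_A_fun, of UNIV j] w(3) continuous_on_tendsto_compose[of UNIV "A_fun j" "z \<circ> \<sigma>" w] by simp
  have "(\<lambda>n. horiz c ((t \<circ> \<sigma>) n) ((z \<circ> \<sigma>) n)) \<longlonglongrightarrow> horiz c 0 w"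
    unfolding horiz_def gradA_def by (intro tendsto_intros A t0)
  then have "horiz c 0 w = 0" using tz(4) by (simp add: LIMSEQ_const_iff)
  then have "A_fun 5 w = 0" using c by (simp add: horiz_def)
  moreover have "(\<lambda>n. vert ((z \<circ> \<sigma>) n)) \<longlonglongrightarrow> vert w"
    unfolding vert_def by (intro tendsto_intros A)
  then have "vert w = 0" using tz(5) by (simp add: LIMSEQ_const_iff)
  ultimately have wc: "w \<in> crit0" using w(1) by (simp add: crit0_def)
  have "(\<lambda>n. ((t \<circ> \<sigma>) n, (z \<circ> \<sigma>) n)) \<longlonglongrightarrow> (0, w)" by (intro tendsto_Pair t0 w(3))
  then have "\<forall>\<^sub>F n in sequentially. ((t \<circ> \<sigma>) n, (z \<circ> \<sigma>) n) \<in> ball (0, w) (r w)"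
    by (rule topological_tendstoD) (use r[OF wc] in auto)
  then obtain n where "((t \<circ> \<sigma>) n, (z \<circ> \<sigma>) n) \<in> ball (0, w) (r w)"
    using eventually_happens by fastforce
  then show False using tz(6)[OF wc] by simp
qed

text \<open>Each critical orbit has a point in the ball around one of at most six representatives.
  At critical points \<open>Phi\<close> has the value \<open>(t, 0, 0, 1)\<close>, so its
  injectivity on the ball leaves one orbit per representative, and \<open>morse_at_least_six\<close>
  turns at most six into exactly six.\<close>

theorem perturbation:
  assumes c: "c \<noteq> 0"
  obtains T where "T > 0" "\<And>t f. 0 < t \<Longrightarrow> t < T \<Longrightarrow> (\<And>z. z \<in> S3 \<Longrightarrow> f (proj z) = family c t t t z) \<Longrightarrow>
    morse f \<and> finite (critical_points f) \<and> card (critical_points f) = 6"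
proof -
  have "\<exists>r>0. inj_on (Phi c) (ball (0, z) r) \<and> (\<forall>x\<in>ball (0, z) r. \<forall>v. DPhi c x v = 0 \<longrightarrow> v = 0)" if z: "z \<in> crit0" for z
    using C1_locally_injective[OF DPhi DPhi_continuous DPhi_injective[OF c z]] by metis
  then obtain r where r: "\<And>z. z \<in> crit0 \<Longrightarrow> r z > 0" "\<And>z. z \<in> crit0 \<Longrightarrow> inj_on (Phi c) (ball (0, z) (r z))"
    "\<And>z x v. z \<in> crit0 \<Longrightarrow> x \<in> ball (0, z) (r z) \<Longrightarrow> DPhi c x v = 0 \<Longrightarrow> v = 0" by metis
  obtain Z where Z: "finite Z" "card Z \<le> 6" "Z \<subseteq> crit0" "\<And>z. z \<in> crit0 \<Longrightarrow> \<exists>B\<in>I_star. \<exists>w\<in>Z. z = B *v w"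
    by (rule crit0_reps) blast
  obtain T1 where T1: "T1 > 0" "\<And>t z. 0 < t \<Longrightarrow> t < T1 \<Longrightarrow> z \<in> S3 \<Longrightarrow> horiz c t z = 0 \<Longrightarrow> vert z = 0 \<Longrightarrow>
    \<exists>w\<in>crit0. (t, z) \<in> ball (0, w) (r w)"
    using near_crit0[OF c, of r] r(1) by blast
  \<comment> \<open>A pair of a group element and a point of \<open>Z\<close> that together produce
    \<open>z\<close>.\<close>
  define rep where "rep z = (SOME x. fst x \<in> I_star \<and> snd x \<in> Z \<and> z = fst x *v snd x)" for z
  have rep: "fst (rep z) \<in> I_star" "snd (rep z) \<in> Z" "z = fst (rep z) *v snd (rep z)" if "z \<in> crit0" for z
  proof -
    have "\<exists>x. fst x \<in> I_star \<and> snd x \<in> Z \<and> z = fst x *v snd x" using Z(4)[OF that] by auto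
    from someI_ex[OF this] show "fst (rep z) \<in> I_star" "snd (rep z) \<in> Z" "z = fst (rep z) *v snd (rep z)"
      unfolding rep_def by blast+
  qed
  \<comment> \<open>The radius is that of the representative: an isometry of the group carries the
    ball around \<open>w\<close> to the ball around the representative. The bound \<open>T1\<close>,
    with the radius of \<open>w\<close> itself, serves for nondegeneracy.\<close>
  obtain T2 where T2: "T2 > 0" "\<And>t z. 0 < t \<Longrightarrow> t < T2 \<Longrightarrow> z \<in> S3 \<Longrightarrow> horiz c t z = 0 \<Longrightarrow> vert z = 0 \<Longrightarrow>
    \<exists>w\<in>crit0. (t, z) \<in> ball (0, w) (r (snd (rep w)))"
  proof -
    have "r (snd (rep w)) > 0" if "w \<in> crit0" for w using r(1) rep(2)[OF that] Z(3) by blast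
    then have "\<exists>T>0. \<forall>t z. 0 < t \<longrightarrow> t < T \<longrightarrow> z \<in> S3 \<longrightarrow> horiz c t z = 0 \<longrightarrow> vert z = 0 \<longrightarrow>
      (\<exists>w\<in>crit0. (t, z) \<in> ball (0, w) (r (snd (rep w))))" by (rule near_crit0[OF c])
    then show ?thesis using that by blast
  qed
  show ?thesis
  proof (rule that[of "min T1 T2"])
    fix t f assume t: "0 < t" "t < min T1 T2" and f: "\<And>z. z \<in> S3 \<Longrightarrow> f (proj z) = family c t t t z"
    interpret polynomial_lift "family c t t t" f by (rule polynomial_lift_family[OF f])
    have crit: "z \<in> lifted_critical f \<longleftrightarrow> z \<in> S3 \<and> horiz c t z = 0 \<and> vert z = 0" for z
    proof -
      have "(\<forall>\<kappa>. Re (cnj \<kappa> * horiz c t z) = 0) \<longleftrightarrow> horiz c t z = 0"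
      proof
        assume "\<forall>\<kappa>. Re (cnj \<kappa> * horiz c t z) = 0"
        then have "Re (cnj (horiz c t z) * horiz c t z) = 0" by blast
        then show "horiz c t z = 0" by (simp add: complex_eq_iff)
      qed simp
      then show ?thesis unfolding lifted_critical_P family_along_hat family_along_fibre using t by auto
    qed
    have nondeg: "v = 0" if z: "z \<in> lifted_critical f" and v: "v \<in> tangent z" "\<And>w. w \<in> tangent z \<Longrightarrow> second_deriv (radial_lift f) z v w = 0" for z v
    proof -
      have zc: "z \<in> S3" "horiz c t z = 0" "vert z = 0" using z crit by auto
      obtain w where w: "w \<in> crit0" "(t, z) \<in> ball (0, w) (r w)" using T1(2)[OF t(1) _ zc] t(2) by auto
      define h' where "h' v = of_real (- 14 * c) * DA 5 z v + of_real t * DgradA z v" for v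
      have h': "(horiz c t has_derivative h') (at z)"
        unfolding horiz_def h'_def by (intro has_derivative_add has_derivative_mult_right DA DgradA)
      have "Re (cnj \<kappa> * h' v) = 0" for \<kappa>
      proof (rule field_derivative_zero[OF z frame_linear(2) frame_tangent(2) v])
        show "((\<lambda>y. DP y (hat \<kappa> y)) has_derivative (\<lambda>v. Re (cnj \<kappa> * h' v))) (at z)"
          unfolding family_along_hat by (intro has_derivative_Re has_derivative_mult_right h')
      qed
      from this[of "h' v"] have 1: "h' v = 0" by (simp add: complex_eq_iff)
      have "- t * Dvert z v = 0"
      proof (rule field_derivative_zero[OF z frame_linear(1) frame_tangent(1) v])
        show "((\<lambda>y. DP y (cscale \<i> y)) has_derivative (\<lambda>v. - t * Dvert z v)) (at z)"
          unfolding family_along_fibre by (intro has_derivative_mult_right DgradA)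
      qed
      then have "Dvert z v = 0" using t by simp
      moreover have "z \<bullet> v = 0" using v(1) by (simp add: tangent_def inner_commute)
      ultimately have "DPhi c (t, z) (0, v) = 0" using 1 by (simp add: DPhi_def h'_def zero_prod_def)
      then have "(0::real, v) = 0" using r(3)[OF w] by blast
      then show ?thesis by (simp add: zero_prod_def)
    qed
    have proj_fibre: "p = proj z \<and> z \<in> S3" if zp: "z \<in> fibre p" for z p
    proof -
      obtain w where w: "w \<in> S3" "p = proj w" using proj_surj by (metis UNIV_I imageE)
      obtain B where B: "B \<in> I_star" "z = B *v w"
        using zp unfolding w(2) fibre_proj[OF w(1)] orbit_def by blast
      then show ?thesis using w I_star_sphere[OF B(1) w(1)] proj_eq_iff by metis
    qed
    have morse: "morse f"
      unfolding morse_def nondegenerate_at_def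
    proof (intro conjI ballI impI smooth)
      fix p z v assume p: "p \<in> critical_points f" "z \<in> fibre p" "v \<in> tangent z"
        "\<forall>w\<in>tangent z. second_deriv (radial_lift f) z v w = 0"
      have "z \<in> lifted_critical f" using proj_fibre[OF p(2)] lifted_critical_iff[OF smooth] p(1) by blast
      then show "v = 0" using nondeg p by blast
    qed
    have "\<exists>w z. w \<in> Z \<and> z \<in> lifted_critical f \<and> p = proj z \<and> (t, z) \<in> ball (0, w) (r w)" if p: "p \<in> critical_points f" for p
    proof -
      obtain z where z: "z \<in> S3" "p = proj z" using proj_surj by (metis UNIV_I imageE)
      have zl: "z \<in> lifted_critical f" using lifted_critical_iff[OF smooth z(1)] p z(2) by blast
      then have zc: "z \<in> S3" "horiz c t z = 0" "vert z = 0" using crit by auto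
      obtain w where w: "w \<in> crit0" "(t, z) \<in> ball (0, w) (r (snd (rep w)))" using T2(2)[OF t(1) _ zc] t(2) by auto
      define B where "B = conj_transpose (fst (rep w))"
      have B: "B \<in> I_star" unfolding B_def using rep(1)[OF w(1)] by (rule I_star_adj)
      have Bw: "B *v w = snd (rep w)"
        using rep(1,3)[OF w(1)] unfolding B_def
        by (metis (no_types, lifting) I_star_def SU2_adj(2) matrix_vector_mul_assoc matrix_vector_mul_lid mem_Collect_eq)
      have "dist (B *v w) (B *v z) = dist w z"
        unfolding dist_norm matrix_vector_mult_diff_distrib[symmetric] by (rule rotation_isometry(1)[OF B])
      then have "dist (0, B *v w) (t, B *v z) = dist (0, w) (t, z)" by (simp only: dist_Pair_Pair)
      then have "(t, B *v z) \<in> ball (0, snd (rep w)) (r (snd (rep w)))" using w(2) Bw by simp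
      moreover have "proj (B *v z) = proj z" using proj_eq_iff[OF I_star_sphere[OF B z(1)] z(1)] B by blast
      moreover have "B *v z \<in> lifted_critical f"
        using lifted_critical_iff[OF smooth I_star_sphere[OF B z(1)]] calculation(2) p z(2) by simp
      ultimately show ?thesis using rep(2)[OF w(1)] z(2) by metis
    qed
    then obtain W L where WL: "\<And>p. p \<in> critical_points f \<Longrightarrow> W p \<in> Z \<and> L p \<in> lifted_critical f \<and> p = proj (L p) \<and> (t, L p) \<in> ball (0, W p) (r (W p))"
      by metis
    have inj: "inj_on W (critical_points f)"
    proof (rule inj_onI)
      fix p q assume pq: "p \<in> critical_points f" "q \<in> critical_points f" "W p = W q"
      have "Phi c (t, L p) = Phi c (t, L q)"
        using WL[OF pq(1)] WL[OF pq(2)] crit by (auto simp: Phi_def dot_square_norm)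
      moreover have "W p \<in> crit0" using WL[OF pq(1)] Z(3) by blast
      ultimately have "(t, L p) = (t, L q)"
        using r(2)[of "W p"] WL[OF pq(1)] WL[OF pq(2)] pq(3) unfolding inj_on_def by metis
      then show "p = q" using WL[OF pq(1)] WL[OF pq(2)] by (metis prod.inject)
    qed
    have WZ: "W ` critical_points f \<subseteq> Z" using WL by blast
    have fin: "finite (critical_points f)" using inj WZ Z(1) inj_on_finite by blast
    have "card (critical_points f) \<le> card Z" using inj WZ Z(1) card_inj_on_le by blast
    then have "card (critical_points f) = 6" using morse_at_least_six[OF morse fin] Z(2) by linarith
    then show "morse f \<and> finite (critical_points f) \<and> card (critical_points f) = 6" using morse fin by blast
  qed (use T1 T2 in simp)
qed

section \<open>Uniqueness of the seed\<close>

definition monom3 :: "complex \<times> nat \<times> nat \<times> nat \<Rightarrow> complex \<Rightarrow> complex \<Rightarrow> complex \<Rightarrow> complex" where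
  "monom3 m u v s = (case m of (c, a, b, k) \<Rightarrow> c * u ^ a * v ^ b * s ^ k)"

text \<open>A list may repeat monomials. It is evaluated and its terms are selected, but
  coefficients of two lists are never compared.\<close>

definition mpoly :: "(complex \<times> nat \<times> nat \<times> nat) list \<Rightarrow> complex \<Rightarrow> complex \<Rightarrow> complex \<Rightarrow> complex" where
  "mpoly L u v s = (\<Sum>m\<leftarrow>L. monom3 m u v s)"

definition mmult :: "complex \<times> nat \<times> nat \<times> nat \<Rightarrow> complex \<times> nat \<times> nat \<times> nat \<Rightarrow> complex \<times> nat \<times> nat \<times> nat" where
  "mmult m n = (case m of (c, a, b, k) \<Rightarrow> case n of (d, e, f, l) \<Rightarrow> (c * d, a + e, b + f, k + l))"

lemma monom3_mmult: "monom3 (mmult m n) u v s = monom3 m u v s * monom3 n u v s"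
  by (auto simp: monom3_def mmult_def power_add split: prod.split)

lemma mpoly_append: "mpoly (L @ L') u v s = mpoly L u v s + mpoly L' u v s"
  by (simp add: mpoly_def)

lemma mpoly_mult: "mpoly (concat (map (\<lambda>m. map (mmult m) L') L)) u v s = mpoly L u v s * mpoly L' u v s"
proof (induction L)
  case (Cons m L)
  have "(\<Sum>n\<leftarrow>L'. monom3 m u v s * monom3 n u v s) = monom3 m u v s * mpoly L' u v s"
    unfolding mpoly_def by (rule sum_list_const_mult)
  then show ?case using Cons by (simp add: mpoly_def comp_def monom3_mmult algebra_simps)
qed (simp add: mpoly_def)

definition cu :: "real^3 \<Rightarrow> complex" where "cu x = Complex (x $ 1) (x $ 2)"

lemma real_polynomial_mpoly:
  assumes "real_polynomial_function (P :: real^3 \<Rightarrow> real)"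
  shows "\<exists>L. \<forall>x. complex_of_real (P x) = mpoly L (cu x) (cnj (cu x)) (complex_of_real (x $ 3))"
  using assms
proof induction
  case (linear f)
  define a b c where "a = f (axis 1 1)" and "b = f (axis 2 1)" and "c = f (axis 3 1)"
  have f: "f x = a * x $ 1 + b * x $ 2 + c * x $ 3" for x
  proof -
    have x: "x = x $ 1 *\<^sub>R axis 1 1 + x $ 2 *\<^sub>R axis 2 1 + x $ 3 *\<^sub>R axis 3 1"
      by (simp add: vec_eq_iff forall_3 axis_def)
    have "f x = f (x $ 1 *\<^sub>R axis 1 1 + x $ 2 *\<^sub>R axis 2 1 + x $ 3 *\<^sub>R axis 3 1)" using x by simp
    also have "\<dots> = x $ 1 * a + x $ 2 * b + x $ 3 * c"
      using linear by (simp add: bounded_linear.linear linear_add linear_scale a_def b_def c_def)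
    finally show ?thesis by (simp add: mult.commute)
  qed
  define L :: "(complex \<times> nat \<times> nat \<times> nat) list"
    where "L = [(Complex (a / 2) (- b / 2), 1, 0, 0), (Complex (a / 2) (b / 2), 0, 1, 0), (complex_of_real c, 0, 0, 1)]"
  have "complex_of_real (f x) = mpoly L (cu x) (cnj (cu x)) (complex_of_real (x $ 3))" for x
    unfolding f by (simp add: L_def mpoly_def monom3_def cu_def complex_eq_iff field_simps)
  then show ?case by blast
next
  case (const c)
  show ?case by (rule exI[of _ "[(complex_of_real c, 0, 0, 0)]"]) (simp add: mpoly_def monom3_def)
next
  case (add f g)
  then obtain L L' where "\<forall>x. complex_of_real (f x) = mpoly L (cu x) (cnj (cu x)) (complex_of_real (x $ 3))"
    "\<forall>x. complex_of_real (g x) = mpoly L' (cu x) (cnj (cu x)) (complex_of_real (x $ 3))" by blast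
  then show ?case by (intro exI[of _ "L @ L'"]) (simp add: mpoly_append)
next
  case (mult f g)
  then obtain L L' where "\<forall>x. complex_of_real (f x) = mpoly L (cu x) (cnj (cu x)) (complex_of_real (x $ 3))"
    "\<forall>x. complex_of_real (g x) = mpoly L' (cu x) (cnj (cu x)) (complex_of_real (x $ 3))" by blast
  then show ?case
    by (intro exI[of _ "concat (map (\<lambda>m. map (mmult m) L') L)"]) (simp only: mpoly_mult of_real_mult, simp)
qed

definition mdeg :: "complex \<times> nat \<times> nat \<times> nat \<Rightarrow> nat" where
  "mdeg m = (case m of (c, a, b, k) \<Rightarrow> a + b + k)"

text \<open>Along a ray both sides are polynomials in \<open>t\<close> that agree at all real
  numbers, so their coefficients of degree \<open>d\<close> agree.\<close>

lemma mpoly_homogeneous_part: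
  assumes "\<And>t. mpoly L (of_real t * u) (of_real t * v) (of_real t * s) = of_real t ^ d * c"
  shows "c = mpoly (filter (\<lambda>m. mdeg m = d) L) u v s"
proof -
  define p where "p = (\<Sum>m\<leftarrow>L. monom (monom3 m u v s) (mdeg m))"
  have ev: "poly p (of_real t) = of_real t ^ d * c" for t
  proof -
    have m: "monom3 m (of_real t * u) (of_real t * v) (of_real t * s) = monom3 m u v s * of_real t ^ mdeg m" for m
      by (auto simp: monom3_def mdeg_def power_mult_distrib power_add split: prod.split)
    have "poly p (of_real t) = (\<Sum>m\<leftarrow>L. monom3 m u v s * of_real t ^ mdeg m)"
      unfolding p_def by (induction L) (auto simp: poly_monom)
    also have "\<dots> = mpoly L (of_real t * u) (of_real t * v) (of_real t * s)"
      unfolding mpoly_def m ..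
    finally show ?thesis using assms by simp
  qed
  have "p - monom c d = 0"
  proof (rule ccontr)
    assume "p - monom c d \<noteq> 0"
    then have "finite {z. poly (p - monom c d) z = 0}" by (rule poly_roots_finite)
    moreover have "range complex_of_real \<subseteq> {z. poly (p - monom c d) z = 0}"
      using ev by (auto simp: poly_monom)
    ultimately have "finite (range complex_of_real)" by (rule rev_finite_subset)
    then have "finite (UNIV :: real set)" by (rule finite_imageD) (simp add: inj_on_def)
    then show False using infinite_UNIV_char_0 by blast
  qed
  then have "coeff p d = c" by simp
  moreover have "coeff p d = mpoly (filter (\<lambda>m. mdeg m = d) L) u v s"
    unfolding p_def mpoly_def by (induction L) auto
  ultimately show ?thesis by simp
qed

lemma fifth_root_average:
  assumes "x ^ 5 = (1::complex)"
  shows "(\<Sum>k<5. x ^ k) = (if x = 1 then 5 else 0)"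
proof (cases "x = 1")
  case False
  then show ?thesis using assms geometric_sum[of x 5] by simp
qed simp

text \<open>In the coordinates \<open>u = x + \<i> y\<close>, \<open>v = x - \<i> y\<close>, \<open>s\<close> the rotation of order five is diagonal,
  so averaging over it selects monomials.\<close>
lemma mpoly_five_fold:
  "(\<Sum>k<5. mpoly L ((\<epsilon> ^ k)\<^sup>2 * u) ((\<epsilon> ^ k) ^ 8 * v) s) = 5 * mpoly (filter (\<lambda>(c, a, b, k). \<epsilon> ^ (2 * a + 8 * b) = 1) L) u v s"
proof (induction L)
  case (Cons m L)
  obtain c a b l where m: "m = (c, a, b, l)" by (cases m)
  define x where "x = \<epsilon> ^ (2 * a + 8 * b)"
  have x5: "x ^ 5 = 1" unfolding x_def by (rule eps_power)
  have "monom3 m ((\<epsilon> ^ k)\<^sup>2 * u) ((\<epsilon> ^ k) ^ 8 * v) s = x ^ k * monom3 m u v s" for k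
    unfolding m monom3_def x_def
    by (simp add: power_mult_distrib power_mult[symmetric] power_add[symmetric] algebra_simps)
  then have "(\<Sum>k<5. monom3 m ((\<epsilon> ^ k)\<^sup>2 * u) ((\<epsilon> ^ k) ^ 8 * v) s) = (if x = 1 then 5 else 0) * monom3 m u v s"
    by (simp add: sum_distrib_right[symmetric] fifth_root_average[OF x5])
  then show ?case using Cons by (simp add: mpoly_def sum.distrib m x_def algebra_simps)
qed (simp add: mpoly_def)

lemma eps_power_eq_1: "\<epsilon> ^ n = 1 \<longleftrightarrow> 5 dvd n"
proof -
  have "\<epsilon> ^ n = \<epsilon> ^ (n mod 5)"
  proof -
    have "\<epsilon> ^ n = (\<epsilon> ^ 5) ^ (n div 5) * \<epsilon> ^ (n mod 5)"
      by (simp only: power_mult[symmetric] power_add[symmetric]) simp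
    then show ?thesis by (simp add: eps_pow5)
  qed
  moreover have "n mod 5 < 5" by simp
  then consider "n mod 5 = 0" | "n mod 5 = 1" | "n mod 5 = 2" | "n mod 5 = 3" | "n mod 5 = 4" by linarith
  then have "\<epsilon> ^ (n mod 5) = 1 \<longleftrightarrow> n mod 5 = 0"
  proof cases
    case 4
    have "\<epsilon> ^ 3 \<noteq> 1" using eps_pow5 eps_neq_1 by algebra
    then show ?thesis using 4 by simp
  qed (use eps_neq_1 eps_powers_neq_1 in auto)
  ultimately show ?thesis by (simp add: dvd_eq_mod_eq_0)
qed

text \<open>The condition on \<open>\<epsilon>\<close> means that \<open>a\<close> and
  \<open>b\<close> agree modulo 5, which together with \<open>a + b + k = 6\<close> leaves six
  triples.\<close>

lemma five_fold_normal_form: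
  assumes "\<And>m. m \<in> set L \<Longrightarrow> mdeg m = 6 \<and> (case m of (c, a, b, k) \<Rightarrow> \<epsilon> ^ (2 * a + 8 * b) = 1)"
  shows "\<exists>c0 c1 c2 c3 d e. \<forall>u v s. mpoly L u v s = c0 * s ^ 6 + c1 * u * v * s ^ 4 + c2 * u ^ 2 * v ^ 2 * s ^ 2
    + c3 * u ^ 3 * v ^ 3 + d * u ^ 5 * s + e * v ^ 5 * s"
  using assms
proof (induction L)
  case Nil
  show ?case by (rule exI[of _ 0])+ (simp add: mpoly_def)
next
  case (Cons m L)
  have "\<exists>c0 c1 c2 c3 d e. \<forall>u v s. mpoly L u v s = c0 * s ^ 6 + c1 * u * v * s ^ 4 + c2 * u ^ 2 * v ^ 2 * s ^ 2
    + c3 * u ^ 3 * v ^ 3 + d * u ^ 5 * s + e * v ^ 5 * s" using Cons by simp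
  then obtain c0 c1 c2 c3 d e where IH: "\<And>u v s. mpoly L u v s = c0 * s ^ 6 + c1 * u * v * s ^ 4 + c2 * u ^ 2 * v ^ 2 * s ^ 2
    + c3 * u ^ 3 * v ^ 3 + d * u ^ 5 * s + e * v ^ 5 * s" by blast
  obtain c a b k where m: "m = (c, a, b, k)" by (cases m)
  have abk: "a + b + k = 6" "5 dvd 2 * a + 8 * b" using Cons.prems[of m] by (auto simp: m mdeg_def eps_power_eq_1)
  then have ab: "a \<le> 6" "b \<le> 6 - a" "k = 6 - a - b" by auto
  have "a \<in> {0, 1, 2, 3, 4, 5, 6}" using ab(1) by auto
  moreover have "b \<in> {0, 1, 2, 3, 4, 5, 6}" using ab(1,2) by auto
  ultimately have "(a, b, k) \<in> {(0,0,6), (1,1,4), (2,2,2), (3,3,0), (5,0,1), (0,5,1)}"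
    using abk(2) ab(2,3) by (elim insertE emptyE) simp_all
  then have "mpoly (m # L) u v s = (c0 + (if (a, b, k) = (0,0,6) then c else 0)) * s ^ 6
    + (c1 + (if (a, b, k) = (1,1,4) then c else 0)) * u * v * s ^ 4
    + (c2 + (if (a, b, k) = (2,2,2) then c else 0)) * u ^ 2 * v ^ 2 * s ^ 2
    + (c3 + (if (a, b, k) = (3,3,0) then c else 0)) * u ^ 3 * v ^ 3
    + (d + (if (a, b, k) = (5,0,1) then c else 0)) * u ^ 5 * s + (e + (if (a, b, k) = (0,5,1) then c else 0)) * v ^ 5 * s" for u v s
    using IH[of u v s] by (auto simp: mpoly_def m monom3_def algebra_simps)
  then show ?case by blast
qed

lemma hopf_onto:
  assumes x: "x \<in> sphere 0 1"
  obtains z where "z \<in> S3" "hopf z = x"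
proof -
  have n: "(x $ 1)\<^sup>2 + (x $ 2)\<^sup>2 + (x $ 3)\<^sup>2 = 1"
  proof -
    have "(norm x)\<^sup>2 = 1" using x by simp
    then show ?thesis unfolding power2_norm_eq_inner inner_vec_def sum_3 by (simp add: power2_eq_square)
  qed
  have hn: "hopf z $ 1 = 2 * Re (z $ 1 * cnj (z $ 2))" "hopf z $ 2 = 2 * Im (z $ 1 * cnj (z $ 2))"
    "hopf z $ 3 = (cmod (z $ 1))\<^sup>2 - (cmod (z $ 2))\<^sup>2" for z by (simp_all add: hopf_def)
  show ?thesis
  proof (cases "x $ 3 = - 1")
    case True
    then have "x $ 1 = 0" "x $ 2 = 0" using n by (simp_all add: sum_power2_eq_zero_iff)
    then have "hopf (vector [0, 1]) = x" using True by (simp add: vec_eq_iff forall_3 hn)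
    moreover have "vector [0, 1] \<in> S3" unfolding S3_iff by simp
    ultimately show ?thesis using that by blast
  next
    case False
    have "(x $ 3)\<^sup>2 \<le> 1" using n zero_le_power2[of "x $ 1"] zero_le_power2[of "x $ 2"] by linarith
    then have "\<bar>x $ 3\<bar> \<le> 1" by (simp only: abs_square_le_1)
    then have "x $ 3 > - 1" using False by linarith
    \<comment> \<open>A section of the Hopf map with positive first coordinate, away from the south
      pole.\<close>
    define r where "r = sqrt ((1 + x $ 3) / 2)"
    have r: "r > 0" "r\<^sup>2 = (1 + x $ 3) / 2" unfolding r_def using \<open>x $ 3 > - 1\<close> by auto
    define b where "b = Complex (x $ 1) (- x $ 2) / complex_of_real (2 * r)"
    define z :: "complex^2" where "z = vector [complex_of_real r, b]"
    have zn: "z $ 1 = complex_of_real r" "z $ 2 = b" by (simp_all add: z_def)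
    have "complex_of_real r * cnj b = Complex (x $ 1) (x $ 2) / 2"
      using r(1) by (simp add: b_def complex_eq_iff field_simps)
    then have u: "z $ 1 * cnj (z $ 2) = Complex (x $ 1) (x $ 2) / 2" by (simp add: zn)
    have "(cmod b)\<^sup>2 = ((x $ 1)\<^sup>2 + (x $ 2)\<^sup>2) / (4 * r\<^sup>2)"
      using r(1) unfolding b_def norm_divide power_divide by (simp add: cmod_power2 power_mult_distrib norm_mult)
    also have "(x $ 1)\<^sup>2 + (x $ 2)\<^sup>2 = (1 - x $ 3) * (1 + x $ 3)" using n by (simp add: algebra_simps power2_eq_square)
    also have "(1 - x $ 3) * (1 + x $ 3) / (4 * r\<^sup>2) = (1 - x $ 3) / 2"
      unfolding r(2) using \<open>x $ 3 > - 1\<close> by (simp add: field_simps)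
    finally have b: "(cmod b)\<^sup>2 = (1 - x $ 3) / 2" .
    have "z \<in> S3" unfolding S3_iff zn b by (simp add: r(2) field_simps)
    moreover have "hopf z = x" unfolding vec_eq_iff forall_3 hn u by (simp add: zn b r(2) field_simps)
    ultimately show ?thesis using that by blast
  qed
qed

text \<open>The icosahedral harmonic of degree 6. Its zonal part is 11 times the Legendre polynomial
  of degree 6 in \<open>s\<close>, made homogeneous by \<open>s\<^sup>2 + u * cnj u = 1\<close> on
  the unit sphere.\<close>

lemma A_fun_6_hopf:
  fixes z :: "complex^2"
  defines "u \<equiv> 2 * (z $ 1 * cnj (z $ 2))" and "s \<equiv> hopf z $ 3"
  shows "16 * A_fun 6 z = 11 * (16 * of_real s ^ 6 - 120 * (u * cnj u) * of_real s ^ 4 + 90 * (u * cnj u)\<^sup>2 * of_real s ^ 2 - 5 * (u * cnj u) ^ 3)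
    - 231 * of_real s * (u ^ 5 + cnj u ^ 5)"
proof -
  have s: "complex_of_real s = z $ 1 * cnj (z $ 1) - z $ 2 * cnj (z $ 2)"
    by (simp add: s_def hopf_def complex_norm_square[symmetric])
  show ?thesis unfolding A_fun_6 Let_def s u_def by simp algebra
qed

text \<open>Five-fold symmetry and \<open>rotJ\<close> leave the coefficients \<open>c0\<close>,
  \<open>c1\<close>, \<open>c2\<close>, \<open>c3\<close> and \<open>F\<close>; harmonicity
  expresses \<open>c1\<close>, \<open>c2\<close>, \<open>c3\<close> by \<open>c0\<close>, and
  invariance under \<open>rotT\<close>, tested at one vertex, determines \<open>F\<close>. The
  candidates thus form a line, which \<open>A_6\<close> spans.\<close>

theorem seed_unique:
  assumes Y: "spherical_harmonic 6 Y" "\<forall>R\<in>A5. \<forall>x\<in>sphere 0 1. Y (R *v x) = Y x" "\<exists>x\<in>sphere 0 1. Y x \<noteq> 0"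
  obtains c where "c \<noteq> 0" "\<And>z. z \<in> S3 \<Longrightarrow> Y (hopf z) = c * Re (A_fun 6 z)"
proof -
  obtain P where P: "real_polynomial_function P" "\<And>c x. P (c *\<^sub>R x) = c ^ 6 * P x" "\<And>x. laplacian P x = 0"
    "\<And>x. x \<in> sphere 0 1 \<Longrightarrow> Y x = P x" using Y(1) unfolding spherical_harmonic_def by blast
  have inv: "P (hopf (B *v z)) = P (hopf z)" if B: "B \<in> I_star" and z: "z \<in> S3" for B z
  proof -
    have "B \<in> SU2" using B by (simp add: I_star_def)
    then obtain R where R: "rotation_matrix R" "\<And>z. hopf (B *v z) = R *v hopf z"
      by (rule hopf_equivariant) blast
    then have "R \<in> A5" using B by (auto simp: A5_def)
    then have "Y (R *v hopf z) = Y (hopf z)" using Y(2) hopf_sphere[OF z] by blast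
    then show ?thesis using P(4) R(2) hopf_sphere[OF z] hopf_sphere[OF I_star_sphere[OF B z]] by metis
  qed
  obtain L where L: "\<And>x. complex_of_real (P x) = mpoly L (cu x) (cnj (cu x)) (complex_of_real (x $ 3))"
    using real_polynomial_mpoly[OF P(1)] by blast
  define L6 where "L6 = filter (\<lambda>m. mdeg m = 6) L"
  have L6: "complex_of_real (P x) = mpoly L6 (cu x) (cnj (cu x)) (complex_of_real (x $ 3))" for x
    unfolding L6_def
  proof (rule mpoly_homogeneous_part)
    fix t
    have "cu (t *\<^sub>R x) = of_real t * cu x" by (simp add: cu_def complex_eq_iff)
    then show "mpoly L (of_real t * cu x) (of_real t * cnj (cu x)) (of_real t * complex_of_real (x $ 3)) = of_real t ^ 6 * complex_of_real (P x)"
      using L[of "t *\<^sub>R x"] P(2)[of t x] by simp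
  qed
  define u where "u z = 2 * (z $ 1 * cnj (z $ 2))" for z :: "complex^2"
  define s where "s z = complex_of_real (hopf z $ 3)" for z
  have cuh: "cu (hopf z) = u z" for z by (simp add: cu_def u_def hopf_def complex_eq_iff)
  have sz: "s z = z $ 1 * cnj (z $ 1) - z $ 2 * cnj (z $ 2)" for z
    by (simp add: s_def hopf_def complex_norm_square[symmetric])
  define L5 where "L5 = filter (\<lambda>(c, a, b, k). \<epsilon> ^ (2 * a + 8 * b) = 1) L6"
  have L5: "complex_of_real (P (hopf z)) = mpoly L5 (u z) (cnj (u z)) (s z)" if z: "z \<in> S3" for z
  proof -
    have "mpoly L6 ((\<epsilon> ^ k)\<^sup>2 * u z) ((\<epsilon> ^ k) ^ 8 * cnj (u z)) (s z) = complex_of_real (P (hopf z))" for k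
    proof -
      define \<zeta> where "\<zeta> = \<epsilon> ^ k"
      have \<zeta>: "\<zeta> ^ 5 = 1" "\<zeta> ^ 10 = 1" using eps_power by (simp_all add: \<zeta>_def)
      note d = diag_I_star[OF \<zeta>(2)]
      have c4: "cnj \<zeta> = \<zeta> ^ 4" using \<zeta>(1) d(3) by algebra
      have uz: "u (mat2 \<zeta> 0 *v z) = \<zeta>\<^sup>2 * u z" unfolding u_def diag_apply by (simp add: power2_eq_square)
      have "(cnj \<zeta>)\<^sup>2 = \<zeta> ^ 8" by (simp add: c4 power_mult[symmetric])
      moreover have "s (mat2 \<zeta> 0 *v z) = s z" unfolding sz diag_apply using d(3) by simp algebra
      ultimately show ?thesis using L6[of "hopf (mat2 \<zeta> 0 *v z)"] inv[OF d(1) z]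
        unfolding cuh uz s_def[symmetric] \<zeta>_def[symmetric] by simp
    qed
    then have "(\<Sum>k<5. mpoly L6 ((\<epsilon> ^ k)\<^sup>2 * u z) ((\<epsilon> ^ k) ^ 8 * cnj (u z)) (s z)) = 5 * complex_of_real (P (hopf z))" by simp
    then show ?thesis unfolding mpoly_five_fold L5_def by simp
  qed
  have "\<exists>c0 c1 c2 c3 d e. \<forall>u v s. mpoly L5 u v s = c0 * s ^ 6 + c1 * u * v * s ^ 4 + c2 * u ^ 2 * v ^ 2 * s ^ 2
    + c3 * u ^ 3 * v ^ 3 + d * u ^ 5 * s + e * v ^ 5 * s"
    by (rule five_fold_normal_form) (auto simp: L5_def L6_def)
  then obtain c0 c1 c2 c3 d e where nf: "\<And>u v s. mpoly L5 u v s = c0 * s ^ 6 + c1 * u * v * s ^ 4 + c2 * u ^ 2 * v ^ 2 * s ^ 2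
    + c3 * u ^ 3 * v ^ 3 + d * u ^ 5 * s + e * v ^ 5 * s" by blast
  \<comment> \<open>Invariance under \<open>rotJ\<close> gives the same expression with
    \<open>d\<close> and \<open>e\<close> exchanged, so both may be replaced by their mean.\<close>
  define F where "F = (d + e) / 2"
  have Pz: "complex_of_real (P (hopf z)) = c0 * s z ^ 6 + c1 * (u z * cnj (u z)) * s z ^ 4 + c2 * (u z * cnj (u z))\<^sup>2 * s z ^ 2
    + c3 * (u z * cnj (u z)) ^ 3 + F * s z * (u z ^ 5 + cnj (u z) ^ 5)" if z: "z \<in> S3" for z
  proof -
    have uJ: "u (rotJ *v z) = - cnj (u z)" and sJ: "s (rotJ *v z) = - s z"
      unfolding u_def sz rotJ_apply by simp_all
    have 1: "complex_of_real (P (hopf z)) = c0 * s z ^ 6 + c1 * u z * cnj (u z) * s z ^ 4 + c2 * u z ^ 2 * cnj (u z) ^ 2 * s z ^ 2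
      + c3 * u z ^ 3 * cnj (u z) ^ 3 + d * u z ^ 5 * s z + e * cnj (u z) ^ 5 * s z"
      using L5[OF z] nf by simp
    have 2: "complex_of_real (P (hopf z)) = c0 * (- s z) ^ 6 + c1 * (- cnj (u z)) * (- u z) * (- s z) ^ 4 + c2 * (- cnj (u z)) ^ 2 * (- u z) ^ 2 * (- s z) ^ 2
      + c3 * (- cnj (u z)) ^ 3 * (- u z) ^ 3 + d * (- cnj (u z)) ^ 5 * (- s z) + e * (- u z) ^ 5 * (- s z)"
      using L5[OF I_star_sphere[OF rotJ_I_star z]] nf inv[OF rotJ_I_star z] unfolding uJ sJ by simp
    have "2 * F = d + e" by (simp add: F_def)
    then have "2 * complex_of_real (P (hopf z)) = 2 * (c0 * s z ^ 6 + c1 * (u z * cnj (u z)) * s z ^ 4 + c2 * (u z * cnj (u z))\<^sup>2 * s z ^ 2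
      + c3 * (u z * cnj (u z)) ^ 3 + F * s z * (u z ^ 5 + cnj (u z) ^ 5))" using 1 2 by algebra
    then show ?thesis by (simp only: mult_cancel_left) simp
  qed
  \<comment> \<open>The normal form in real coordinates. Homogeneity extends the equality from the
    sphere to the whole space, where the Laplacian can be computed.\<close>
  define q where "q x y t = Re c0 * t ^ 6 + Re c1 * (x\<^sup>2 + y\<^sup>2) * t ^ 4 + Re c2 * (x\<^sup>2 + y\<^sup>2)\<^sup>2 * t ^ 2
    + Re c3 * (x\<^sup>2 + y\<^sup>2) ^ 3 + 2 * Re F * t * (x ^ 5 - 10 * x ^ 3 * y ^ 2 + 5 * x * y ^ 4)" for x y t
  have Pq: "P x = q (x $ 1) (x $ 2) (x $ 3)" for x
  proof -
    have sphere: "P x = q (x $ 1) (x $ 2) (x $ 3)" if x: "x \<in> sphere 0 1" for x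
    proof -
      obtain z where z: "z \<in> S3" "hopf z = x" using hopf_onto[OF x] by blast
      define X V T where "X = x $ 1" and "V = x $ 2" and "T = x $ 3"
      have uz: "u z = Complex X V" using cuh[of z] z(2) by (simp add: cu_def X_def V_def)
      have uu: "u z * cnj (u z) = complex_of_real (X\<^sup>2 + V\<^sup>2)" unfolding uz by (simp add: complex_eq_iff power2_eq_square)
      have u5: "u z ^ 5 + cnj (u z) ^ 5 = complex_of_real (2 * (X ^ 5 - 10 * X ^ 3 * V ^ 2 + 5 * X * V ^ 4))"
        unfolding uz by (simp add: complex_eq_iff eval_nat_numeral algebra_simps)
      have "P x = Re (c0 * s z ^ 6 + c1 * (u z * cnj (u z)) * s z ^ 4 + c2 * (u z * cnj (u z))\<^sup>2 * s z ^ 2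
    + c3 * (u z * cnj (u z)) ^ 3 + F * s z * (u z ^ 5 + cnj (u z) ^ 5))"
        using arg_cong[OF Pz[OF z(1)], of Re] z(2) by simp
      also have "\<dots> = q X V T"
        unfolding uu u5 s_def z(2) T_def[symmetric] q_def of_real_power[symmetric] of_real_mult[symmetric]
        by (simp flip: of_real_power of_real_mult)
      finally show ?thesis by (simp add: X_def V_def T_def)
    qed
    show ?thesis
    proof (cases "x = 0")
      case True
      then show ?thesis using P(2)[of 0 0] by (simp add: q_def)
    next
      case False
      define r where "r = norm x"
      have r: "r \<noteq> 0" "x /\<^sub>R r \<in> sphere 0 1" using False by (simp_all add: r_def)
      have "P x = r ^ 6 * P (x /\<^sub>R r)" using P(2)[of r "x /\<^sub>R r"] r by simp
      also have "P (x /\<^sub>R r) = q (x $ 1 / r) (x $ 2 / r) (x $ 3 / r)" using sphere[OF r(2)] by (simp add: divide_inverse mult.commute)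
      also have "r ^ 6 * \<dots> = q (x $ 1) (x $ 2) (x $ 3)"
        using r(1) unfolding q_def by (simp add: power_divide field_simps eval_nat_numeral)
      finally show ?thesis .
    qed
  qed
  \<comment> \<open>The terms with \<open>F\<close> drop out because the real part of the fifth
    power, times the third coordinate, is harmonic.\<close>
  have lap: "0 = Re c0 * 30 * t ^ 4 + Re c1 * (4 * t ^ 4 + 12 * (x\<^sup>2 + y\<^sup>2) * t\<^sup>2) + Re c2 * (16 * (x\<^sup>2 + y\<^sup>2) * t\<^sup>2 + 2 * (x\<^sup>2 + y\<^sup>2)\<^sup>2)
     + Re c3 * 36 * (x\<^sup>2 + y\<^sup>2)\<^sup>2" for x y t
  proof -
    obtain k0 k1 k2 k3 kF where k: "Re c0 = k0" "Re c1 = k1" "Re c2 = k2" "Re c3 = k3" "Re F = kF" by blast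
    define X :: "real^3" where "X = vector [x, y, t]"
    have Xn: "X $ 1 = x" "X $ 2 = y" "X $ 3 = t" by (simp_all add: X_def)
    have C2P: "C2 UNIV P"
    proof
      show "Ck_on 2 UNIV P"
      proof (rule Ck_on_coinduct[of _ _ "Collect real_polynomial_function"])
        fix f :: "real^3 \<Rightarrow> real" assume "f \<in> Collect real_polynomial_function"
        then obtain D where "\<And>x. (f has_derivative D x) (at x)" "\<And>v. real_polynomial_function (\<lambda>x. D x v)"
          using real_polynomial_function_derivative[of f] by blast
        then show "\<exists>D. (\<forall>x\<in>UNIV. (f has_derivative D x) (at x)) \<and> (\<forall>v. \<exists>g\<in>Collect real_polynomial_function. \<forall>x\<in>UNIV. D x v = g x)"
          by (intro exI[of _ D] conjI ballI allI) auto
      qed (use P(1) in auto)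
    qed simp
    interpret C2 UNIV P by (rule C2P)
    have second: "H X b b = q2" if q1: "\<And>h. ((\<lambda>h. P (X + h *\<^sub>R b)) has_real_derivative q1 h) (at h)" and q2: "(q1 has_real_derivative q2) (at 0)" for b q1 q2
    proof -
      have "DU (X + h *\<^sub>R b) b = q1 h" for h
        using DERIV_unique[OF line_derivative(1) q1] by simp
      then have "(q1 has_real_derivative H (X + 0 *\<^sub>R b) b b) (at 0)"
        using line_derivative(2)[of X 0 b b] by simp
      then show ?thesis using DERIV_unique[OF _ q2] by simp
    qed
    have B: "(\<Sum>b\<in>(Basis::(real^3) set). g b) = g (axis 1 1) + g (axis 2 1) + g (axis 3 1)" for g :: "real^3 \<Rightarrow> real"
    proof -
      have B: "(Basis::(real^3) set) = {axis 1 1, axis 2 1, axis 3 1}"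
        unfolding Basis_vec_def UNIV_3 by auto
      show ?thesis unfolding B by (subst sum.insert; simp add: axis_eq_axis add_ac)+
    qed
    have line: "P (X + h *\<^sub>R axis 1 1) = q (x + h) y t" "P (X + h *\<^sub>R axis 2 1) = q x (y + h) t"
      "P (X + h *\<^sub>R axis 3 1) = q x y (t + h)" for h
      unfolding Pq by (simp_all add: Xn axis_def)
    have H1: "H X (axis 1 1) (axis 1 1) = k1 * 2 * t ^ 4 + k2 * (12 * x\<^sup>2 + 4 * y\<^sup>2) * t\<^sup>2
       + k3 * (6 * (x\<^sup>2 + y\<^sup>2)\<^sup>2 + 24 * x\<^sup>2 * (x\<^sup>2 + y\<^sup>2)) + 2 * kF * t * (20 * x ^ 3 - 60 * x * y\<^sup>2)"
      by (rule second[of _ "\<lambda>h. k1 * (2 * (x + h)) * t ^ 4 + k2 * (4 * (x + h) * ((x + h)\<^sup>2 + y\<^sup>2)) * t\<^sup>2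
         + k3 * (6 * (x + h) * ((x + h)\<^sup>2 + y\<^sup>2)\<^sup>2) + 2 * kF * t * (5 * (x + h) ^ 4 - 30 * (x + h)\<^sup>2 * y\<^sup>2 + 5 * y ^ 4)"])
         (simp_all only: line q_def k, (rule DERIV_cong, (rule derivative_intros)+, (simp; algebra))+)
    have H2: "H X (axis 2 1) (axis 2 1) = k1 * 2 * t ^ 4 + k2 * (12 * y\<^sup>2 + 4 * x\<^sup>2) * t\<^sup>2
       + k3 * (6 * (x\<^sup>2 + y\<^sup>2)\<^sup>2 + 24 * y\<^sup>2 * (x\<^sup>2 + y\<^sup>2)) + 2 * kF * t * (60 * x * y\<^sup>2 - 20 * x ^ 3)"
      by (rule second[of _ "\<lambda>h. k1 * (2 * (y + h)) * t ^ 4 + k2 * (4 * (y + h) * (x\<^sup>2 + (y + h)\<^sup>2)) * t\<^sup>2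
         + k3 * (6 * (y + h) * (x\<^sup>2 + (y + h)\<^sup>2)\<^sup>2) + 2 * kF * t * (20 * x * (y + h) ^ 3 - 20 * x ^ 3 * (y + h))"])
         (simp_all only: line q_def k, (rule DERIV_cong, (rule derivative_intros)+, (simp; algebra))+)
    have H3: "H X (axis 3 1) (axis 3 1) = k0 * 30 * t ^ 4 + k1 * (x\<^sup>2 + y\<^sup>2) * 12 * t\<^sup>2 + k2 * (x\<^sup>2 + y\<^sup>2)\<^sup>2 * 2"
      by (rule second[of _ "\<lambda>h. k0 * 6 * (t + h) ^ 5 + k1 * (x\<^sup>2 + y\<^sup>2) * 4 * (t + h) ^ 3 + k2 * (x\<^sup>2 + y\<^sup>2)\<^sup>2 * (2 * (t + h))
          + 2 * kF * (x ^ 5 - 10 * x ^ 3 * y ^ 2 + 5 * x * y ^ 4)"])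
         (simp_all only: line q_def k, (rule DERIV_cong, (rule derivative_intros)+, (simp; algebra))+)
    have "laplacian P X = 0" by (rule P(3))
    then show ?thesis unfolding laplacian_def B H1 H2 H3 k by (simp add: algebra_simps power2_eq_square)
  qed
  \<comment> \<open>Three evaluations give the ratios 16 : -120 : 90 : -5 of the zonal
    harmonic.\<close>
  have C1: "Re c1 = - 15 / 2 * Re c0" using lap[of 1 0 0] by simp
  have C3: "Re c3 = - Re c2 / 18" using lap[of 0 1 0] by simp
  have C2: "Re c2 = 45 / 8 * Re c0" using lap[of 1 1 0] C1 C3 by simp
  have PA: "P (hopf z) = Re c0 / 11 * Re (A_fun 6 z) + (Re F + 21 / 16 * Re c0) * Re (s z * (u z ^ 5 + cnj (u z) ^ 5))" if z: "z \<in> S3" for z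
  proof -
    define U S V where "U = (cmod (u z))\<^sup>2" and "S = hopf z $ 3" and "V = 2 * Re (u z ^ 5)"
    have r: "u z * cnj (u z) = complex_of_real U" "s z = complex_of_real S" "u z ^ 5 + cnj (u z) ^ 5 = complex_of_real V"
      unfolding U_def S_def V_def s_def complex_norm_square complex_cnj_power[symmetric] by (simp_all add: complex_eq_iff del: complex_cnj_power)
    have e1: "P (hopf z) = Re c0 * S ^ 6 + Re c1 * U * S ^ 4 + Re c2 * U\<^sup>2 * S ^ 2 + Re c3 * U ^ 3 + Re F * S * V"
      using arg_cong[OF Pz[OF z], of Re] unfolding r by (simp flip: of_real_power of_real_mult)
    have A: "16 * Re (A_fun 6 z) = 11 * (16 * S ^ 6 - 120 * U * S ^ 4 + 90 * U\<^sup>2 * S ^ 2 - 5 * U ^ 3) - 231 * S * V"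
      using arg_cong[OF A_fun_6_hopf[of z], of Re] unfolding u_def[symmetric] s_def[symmetric] r by (simp flip: of_real_power of_real_mult)
    have e2: "Re (s z * (u z ^ 5 + cnj (u z) ^ 5)) = S * V" unfolding r by simp
    have e3: "Re (A_fun 6 z) = (11 * (16 * S ^ 6 - 120 * U * S ^ 4 + 90 * U\<^sup>2 * S ^ 2 - 5 * U ^ 3) - 231 * S * V) / 16" using A by simp
    show ?thesis unfolding e1 e2 e3 C3 unfolding C2 C1 by (simp add: field_simps)
  qed
  \<comment> \<open>The second term of \<open>PA\<close> vanishes over the pole, where
    \<open>u = 0\<close>, but its factor does not vanish over the image of the pole under
    \<open>rotT\<close>. As \<open>P\<close> and \<open>A_6\<close> agree at both points, the
    coefficient is zero.\<close>
  have zT: "rotT *v zN \<in> S3" by (rule I_star_sphere[OF rotT_I_star base_S3(1)])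
  have "Re (s zN * (u zN ^ 5 + cnj (u zN) ^ 5)) = 0" by (simp add: u_def)
  moreover have "Re (s (rotT *v zN) * (u (rotT *v zN) ^ 5 + cnj (u (rotT *v zN)) ^ 5)) \<noteq> 0"
  proof -
    define w where "w = (cmod ct)\<^sup>2"
    have w: "w > 0" using gnorm(1) by (simp add: w_def ct)
    have cc: "ct * cnj ct = complex_of_real w" unfolding w_def complex_norm_square ..
    have uT: "u (rotT *v zN) = complex_of_real (- 2 * gold * w)"
      unfolding u_def rotT_apply using cc by simp
    have sT: "s (rotT *v zN) = complex_of_real (w * gold)"
    proof -
      have "s (rotT *v zN) = (ct * cnj ct) * (complex_of_real gold)\<^sup>2 - ct * cnj ct"
        unfolding sz rotT_apply by (simp add: power2_eq_square)
      then show ?thesis unfolding cc gold_sq_complex by (simp add: algebra_simps)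
    qed
    have "s (rotT *v zN) * (u (rotT *v zN) ^ 5 + cnj (u (rotT *v zN)) ^ 5) = complex_of_real (w * gold * (2 * (- 2 * gold * w) ^ 5))"
      unfolding uT sT by simp
    then show ?thesis using w gold_pos by simp
  qed
  moreover have "P (hopf (rotT *v zN)) = P (hopf zN)" by (rule inv[OF rotT_I_star base_S3(1)])
  moreover have "A_fun 6 (rotT *v zN) = A_fun 6 zN" by (rule A_fun_invariant[OF rotT_I_star])
  ultimately have "Re F + 21 / 16 * Re c0 = 0"
    using PA[OF zT] PA[OF base_S3(1)] by simp
  then have fin: "Y (hopf z) = Re c0 / 11 * Re (A_fun 6 z)" if z: "z \<in> S3" for z
    using PA[OF z] P(4)[OF hopf_sphere[OF z]] by simp
  obtain x where x: "x \<in> sphere 0 1" "Y x \<noteq> 0" using Y(3) by blast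
  obtain z where z: "z \<in> S3" "hopf z = x" by (rule hopf_onto[OF x(1)])
  have "Re c0 / 11 \<noteq> 0" using fin[OF z(1)] z(2) x(2) by auto
  then show ?thesis using that fin by blast
qed

section \<open>Minimal Morse lines near the seed\<close>

lemma not_morse_zero: "\<not> morse (\<lambda>p. 0)"
proof
  assume m: "morse (\<lambda>p. 0)"
  have r: "radial_lift (\<lambda>p. 0) = (\<lambda>x. 0)" by (simp add: radial_lift_def fun_eq_iff)
  have d: "frechet_derivative (\<lambda>x::complex^2. 0::real) (at z) = (\<lambda>v. 0)" for z
    by (rule frechet_derivative_at[symmetric]) simp
  have "zN \<in> fibre (proj zN)"
    unfolding fibre_proj[OF base_S3(1)] orbit_def using I_star_one by force
  moreover have "proj zN \<in> critical_points (\<lambda>p. 0)" unfolding critical_points_def r d by simp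
  moreover have "cscale \<i> zN \<in> tangent zN"
    by (simp add: tangent_def inner_vec_def sum_2 inner_complex_def)
  ultimately have "cscale \<i> zN = 0"
    using m unfolding morse_def nondegenerate_at_def second_deriv_def r d by simp
  then have "(cscale \<i> zN) $ 1 = 0" by simp
  then show False by simp
qed

theorem theorem14p1:
  fixes Y :: "real^3 \<Rightarrow> real"
  assumes "spherical_harmonic 6 Y"
    and "\<forall>R\<in>A5. \<forall>x\<in>sphere 0 1. Y (R *v x) = Y x"
    and "\<exists>x\<in>sphere 0 1. Y x \<noteq> 0"
  shows
    "(\<forall>\<delta>>0. \<exists>e2 e3 e5.
        e2 \<noteq> 0 \<and> e3 \<noteq> 0 \<and> e5 \<noteq> 0 \<and> \<bar>e2\<bar> < \<delta> \<and> \<bar>e3\<bar> < \<delta> \<and> \<bar>e5\<bar> < \<delta> \<and>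
        morse (Psi Y e2 e3 e5) \<and> card (critical_points (Psi Y e2 e3 e5)) = 6) \<and>
     (\<forall>e2 e3 e5.
        morse (Psi Y e2 e3 e5) \<and> card (critical_points (Psi Y e2 e3 e5)) = 6 \<longleftrightarrow>
        minimal_morse_line (line (Psi Y e2 e3 e5))) \<and>
     line (seed Y) \<in> topspace proj_E \<and>
     (\<forall>\<delta>>0. \<forall>U. openin proj_E U \<and> line (seed Y) \<in> U \<longrightarrow>
        (\<exists>e2 e3 e5.
           e2 \<noteq> 0 \<and> e3 \<noteq> 0 \<and> e5 \<noteq> 0 \<and> \<bar>e2\<bar> < \<delta> \<and> \<bar>e3\<bar> < \<delta> \<and> \<bar>e5\<bar> < \<delta> \<and>
           minimal_morse_line (line (Psi Y e2 e3 e5)) \<and> line (Psi Y e2 e3 e5) \<in> U))"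
proof -
  obtain c where c: "c \<noteq> 0" "\<And>z. z \<in> S3 \<Longrightarrow> Y (hopf z) = c * Re (A_fun 6 z)"
    using seed_unique[OF assms] by blast
  have Psi: "Psi Y e2 e3 e5 (proj z) = family c e2 e3 e5 z" if "z \<in> S3" for e2 e3 e5 z
    using that by (simp add: Psi_def family_def seed_proj[OF assms(2)] F_fun_proj c(2))
  have E: "Psi Y e2 e3 e5 \<in> E168" for e2 e3 e5 using Psi by (rule family_E168)
  have seed: "Psi Y 0 0 0 = seed Y" by (simp add: Psi_def fun_eq_iff)
  obtain T where T: "T > 0" "\<And>t. 0 < t \<Longrightarrow> t < T \<Longrightarrow>
      morse (Psi Y t t t) \<and> finite (critical_points (Psi Y t t t)) \<and> card (critical_points (Psi Y t t t)) = 6"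
    using perturbation[OF c(1)] Psi by metis
  \<comment> \<open>The perturbed seed with parameter \<open>T / 2\<close> attains the lower bound,
    so the minimum is six.\<close>
  have six: "minimal_morse f \<longleftrightarrow> morse f \<and> card (critical_points f) = 6" for f
  proof
    assume f: "minimal_morse f"
    let ?g = "Psi Y (T / 2) (T / 2) (T / 2)"
    have g: "morse ?g \<and> finite (critical_points ?g) \<and> card (critical_points ?g) = 6"
      by (rule T(2)) (use T(1) in auto)
    then have "card (critical_points f) \<le> card (critical_points ?g)"
      using f unfolding minimal_morse_def by blast
    also have "\<dots> = 6" using g by simp
    finally show "morse f \<and> card (critical_points f) = 6"
      using f morse_at_least_six[of f] unfolding minimal_morse_def by simp
  next
    assume f: "morse f \<and> card (critical_points f) = 6"
    then have "finite (critical_points f)" by (intro card_ge_0_finite) simp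
    then show "minimal_morse f" unfolding minimal_morse_def using f morse_at_least_six by simp
  qed
  have iff: "morse (Psi Y e2 e3 e5) \<and> card (critical_points (Psi Y e2 e3 e5)) = 6 \<longleftrightarrow>
    minimal_morse_line (line (Psi Y e2 e3 e5))" (is "?six \<longleftrightarrow> _") for e2 e3 e5
  proof
    assume ?six
    then show "minimal_morse_line (line (Psi Y e2 e3 e5))"
      unfolding minimal_morse_line_def using six E by blast
  next
    assume "minimal_morse_line (line (Psi Y e2 e3 e5))"
    then obtain f where f: "minimal_morse f" "line (Psi Y e2 e3 e5) = line f"
      unfolding minimal_morse_line_def by blast
    have "f \<in> line f" unfolding line_def by (rule image_eqI[of _ _ 1]) simp_all
    then have "f \<in> line (Psi Y e2 e3 e5)" by (simp only: f(2))
    \<comment> \<open>Two generators of a line differ by a factor, which is nonzero because the zero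
      function is not Morse; such factors preserve critical points and nondegeneracy.\<close>
    then obtain a where a: "f = (\<lambda>p. a * Psi Y e2 e3 e5 p)" unfolding line_def by blast
    have m: "morse f" "card (critical_points f) = 6" using f(1) six by simp_all
    then have "a \<noteq> 0" using not_morse_zero a by auto
    then have P: "Psi Y e2 e3 e5 = (\<lambda>p. inverse a * f p)" by (simp add: a mult.assoc[symmetric])
    have "smooth_M f" using m(1) by (simp add: morse_def)
    then show ?six
      unfolding P using morse_cmult[OF m(1)] critical_points_cmult(2)[of f "inverse a"] m(2) \<open>a \<noteq> 0\<close> by simp
  qed
  have "seed Y (proj zN) \<noteq> 0"
    using c(1) base_N unfolding seed_proj[OF assms(2) base_S3(1)] c(2)[OF base_S3(1)] by (simp add: A_fun_6 Let_def)
  then have seed_E: "seed Y \<in> nonzero_E" using E[of 0 0 0] unfolding seed nonzero_E_def by auto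
  have top: "topspace proj_E = line ` nonzero_E"
    using quotient_map_line by (simp add: quotient_map_def)
  have near: "\<exists>e2 e3 e5. e2 \<noteq> 0 \<and> e3 \<noteq> 0 \<and> e5 \<noteq> 0 \<and> \<bar>e2\<bar> < \<delta> \<and> \<bar>e3\<bar> < \<delta> \<and> \<bar>e5\<bar> < \<delta> \<and>
      minimal_morse_line (line (Psi Y e2 e3 e5)) \<and> line (Psi Y e2 e3 e5) \<in> U"
    if \<delta>: "\<delta> > 0" and U: "openin proj_E U" "line (seed Y) \<in> U" for \<delta> U
  proof -
    have "U \<subseteq> line ` nonzero_E" using openin_subset[OF U(1)] top by simp
    then have "openin (top_of_set nonzero_E) {f \<in> nonzero_E. line f \<in> U}"
      using quotient_map_line U(1) unfolding quotient_map_def top by simp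
    then obtain V where V: "open V" "{f \<in> nonzero_E. line f \<in> U} = nonzero_E \<inter> V"
      unfolding openin_open by blast
    \<comment> \<open>Functions carry the topology of pointwise convergence, so continuity in
      \<open>t\<close> is checked at each point of \<open>M\<close>.\<close>
    have "continuous_on UNIV (\<lambda>t. Psi Y t t t)"
      by (rule continuous_on_coordinatewise_then_product) (simp add: Psi_def, intro continuous_intros)
    then have "open ((\<lambda>t. Psi Y t t t) -` V)" using V(1) by (simp add: open_vimage)
    moreover have "0 \<in> (\<lambda>t. Psi Y t t t) -` V" using seed seed_E U(2) V(2) by auto
    ultimately obtain r where r: "r > 0" "ball 0 r \<subseteq> (\<lambda>t. Psi Y t t t) -` V"
      by (meson open_contains_ball)
    define t where "t = min r (min T \<delta>) / 2"
    have t: "0 < t" "t < r" "t < T" "t < \<delta>" using r(1) T(1) \<delta> by (auto simp: t_def min_def)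
    have m: "morse (Psi Y t t t)" "card (critical_points (Psi Y t t t)) = 6" using T(2) t by simp_all
    then have "Psi Y t t t \<in> nonzero_E" using E[of t t t] not_morse_zero unfolding nonzero_E_def by auto
    moreover have "Psi Y t t t \<in> V" using r(2) t by (auto simp: subset_iff dist_real_def)
    ultimately have "line (Psi Y t t t) \<in> U" using V(2) by blast
    moreover have "minimal_morse_line (line (Psi Y t t t))" using iff m by blast
    ultimately show ?thesis using t by (intro exI[of _ t]) simp
  qed
  have small: "\<exists>e2 e3 e5. e2 \<noteq> 0 \<and> e3 \<noteq> 0 \<and> e5 \<noteq> 0 \<and> \<bar>e2\<bar> < \<delta> \<and> \<bar>e3\<bar> < \<delta> \<and> \<bar>e5\<bar> < \<delta> \<and>
      morse (Psi Y e2 e3 e5) \<and> card (critical_points (Psi Y e2 e3 e5)) = 6" if \<delta>: "\<delta> > 0" for \<delta>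
    unfolding iff using near[OF \<delta> openin_topspace] seed_E unfolding top by blast
  show ?thesis using small iff near seed_E unfolding top by blast
qed

end
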